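(* Let $\Phi=\{\pm\alpha_1,\dots,\pm\alpha_J\}\subset\mathbf{R}^d$ with $\alpha_1,\dots,\alpha_J$ pairwise orthogonal nonzero vectors (direct product rank one case, $W\cong\mathbb Z_2^J$), let $\Phi_+=\{\alpha_1,\dots,\alpha_J\}$, and let $k:\Phi\to[0,\infty)$ be a $W$-invariant multiplicity function. Let $P^W$ and $N^W$ be the $W$-invariant Dunkl-Poisson kernel of the unit ball and the $W$-invariant Dunkl-Newton kernel. Then there are constants $0<C_1\le C_2$, depending only on $d$, $\Phi$ and $k$, such that: (1) for all $x\in B^+$ and $y\in S^+$, $$C_1\,\frac{1-|x|^2}{|x-y|^d\prod_{\alpha\in\Phi_+}|x-\sigma_\alpha y|^{2k(\alpha)}}\;\le\; P^W(x,y)\;\le\; C_2\,\frac{1-|x|^2}{|x-y|^d\prod_{\alpha\in\Phi_+}|x-\sigma_\alpha y|^{2k(\alpha)}};$$ (2) if $d\ge 3$, for all $x,y\in\overline{\mathfrak a^+}$ (with both sides equal to $+\infty$ when $x=y$), $$C_1\,\frac{1}{|x-y|^{d-2}\prod_{\alpha\in\Phi_+}|x-\sigma_\alpha y|^{2k(\alpha)}}\;\le\; N^W(x,y)\;\le\; C_2\,\frac{1}{|x-y|^{d-2}\prod_{\alpha\in\Phi_+}|x-\sigma_\alpha y|^{2k(\alpha)}}.$$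
   Context: $\mathbf{R}^d$ carries the usual scalar product $\langle\cdot,\cdot\rangle$ and norm $|\cdot|$; roots are normalized so that $|\alpha|\ge1$. $\sigma_\alpha$ is the reflection in the hyperplane orthogonal to $\alpha$, $W$ is the group generated by the $\sigma_\alpha$. The positive Weyl chamber is $\mathfrak a^+=\{x\in\mathbf{R}^d:\langle\alpha,x\rangle>0\ \forall\alpha\in\Phi_+\}$. $B$ is the open unit ball, $S=\partial B$, $B^+=B\cap\overline{\mathfrak a^+}$, $S^+=S\cap\overline{\mathfrak a^+}$. Put $\omega_k(x)=\prod_{\alpha\in\Phi_+}|\langle\alpha,x\rangle|^{2k(\alpha)}$ and $\gamma=\sum_{\alpha\in\Phi_+}k(\alpha)$. Radial Dunkl Laplacian: for $W$-invariant $f\in C^2$, $\Delta^Wf(x)=\Delta f(x)+2\sum_{\alpha\in\Phi_+}k(\alpha)\frac{\langle\nabla f(x),\alpha\rangle}{\langle\alpha,x\rangle}$. $P^W(x,y)$ is the (unique) continuous function on $B\times S$, $W$-invariant in each variable, such that for every $W$-invariant continuous $f$ on $S$ the function $u(x)=\int_S P^W(x,y)f(y)\,\omega_k(y)\,dy$ ($dy$ surface measure) is $W$-invariant, of class $C^2$ on $B$, satisfies $\Delta^Wu=0$ on $B$, and extends continuously to $\overline B$ with $u=f$ on $S$. Dunkl operators: $T_\xi f(x)=\partial_\xi f(x)+\sum_{\alpha\in\Phi_+}k(\alpha)\langle\alpha,\xi\rangle\frac{f(x)-f(\sigma_\alpha x)}{\langle\alpha,x\rangle}$. The intertwining operator $V_k$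 is the unique linear isomorphism of polynomials preserving homogeneity degree with $V_k1=1$ and $T_\xi V_k=V_k\partial_\xi$ for all $\xi$; it extends to smooth functions by $V_kf(x)=\int f\,d\mu^k_x$ with $\mu_x^k$ a probability measure on the convex hull of $W\cdot x$. The Dunkl kernel is $E_k(x,y)=V_k(e^{\langle\cdot,y\rangle})(x)$, the Dunkl heat kernel is $$p^k_t(x,y)=\frac{M_k}{t^{\gamma+d/2}}e^{-(|x|^2+|y|^2)/4t}E_k\Bigl(\frac{x}{\sqrt{2t}},\frac{y}{\sqrt{2t}}\Bigr),\qquad M_k=2^{-\gamma-d/2}\Bigl(\int_{\mathbf{R}^d}e^{-|x|^2/2}\omega_k(x)\,dx\Bigr)^{-1},$$ and $N^W(x,y)=\int_0^\infty\frac1{|W|}\sum_{w\in W}p^k_t(x,wy)\,dt$. *)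

theory Defs
  imports "HOL-Analysis.Analysis" "HOL-Probability.Probability_Measure"
begin

section \<open>Reflections and Weyl chambers\<close>

definition reflection :: "'a::euclidean_space \<Rightarrow> 'a \<Rightarrow> 'a" where
  "reflection \<alpha> x = x - (2 * (\<alpha> \<bullet> x) / (\<alpha> \<bullet> \<alpha>)) *\<^sub>R \<alpha>"

text \<open>The generators are involutions, so closure under composition already gives the group
  they generate. Since \<open>reflection (- \<alpha>) = reflection \<alpha>\<close>, a root system and its set of positive
  roots generate the same group; the operators and kernels below take the positive roots \<open>R\<close>.\<close>

inductive_set reflection_group :: "'a::euclidean_space set \<Rightarrow> ('a \<Rightarrow> 'a) set" for R where
  id: "id \<in> reflection_group R"
| step: "\<alpha> \<in> R \<Longrightarrow> w \<in> reflection_group R \<Longrightarrow> reflection \<alpha> \<circ> w \<in> reflection_group R"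

definition pos_chamber :: "'a::euclidean_space set \<Rightarrow> 'a set" where
  "pos_chamber R = {x. \<forall>\<alpha>\<in>R. \<alpha> \<bullet> x > 0}"

text \<open>Isabelle's \<open>0 powr 0 = 0\<close> differs from the usual convention only on root hyperplanes,
  which are null for Lebesgue measure and for the surface measure of the unit sphere;
  the weight occurs only under integrals.\<close>

definition dunkl_weight :: "'a::euclidean_space set \<Rightarrow> ('a \<Rightarrow> real) \<Rightarrow> 'a \<Rightarrow> real" where
  "dunkl_weight R k x = (\<Prod>\<alpha>\<in>R. \<bar>\<alpha> \<bullet> x\<bar> powr (2 * k \<alpha>))"

definition dunkl_gamma :: "'a::euclidean_space set \<Rightarrow> ('a \<Rightarrow> real) \<Rightarrow> real" where
  "dunkl_gamma R k = (\<Sum>\<alpha>\<in>R. k \<alpha>)"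

section \<open>Differential and difference operators\<close>

definition dir_deriv :: "'a::euclidean_space \<Rightarrow> ('a \<Rightarrow> real) \<Rightarrow> 'a \<Rightarrow> real" where
  "dir_deriv v f x = frechet_derivative f (at x) v"

definition grad :: "('a::euclidean_space \<Rightarrow> real) \<Rightarrow> 'a \<Rightarrow> 'a" where
  "grad f x = (\<Sum>b\<in>Basis. dir_deriv b f x *\<^sub>R b)"

definition laplacian :: "('a::euclidean_space \<Rightarrow> real) \<Rightarrow> 'a \<Rightarrow> real" where
  "laplacian f x = (\<Sum>b\<in>Basis. dir_deriv b (dir_deriv b f) x)"

text \<open>Meant for open \<open>S\<close>.\<close>

definition C2_on :: "'a::euclidean_space set \<Rightarrow> ('a \<Rightarrow> real) \<Rightarrow> bool" where
  "C2_on S f \<longleftrightarrow>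
     (\<forall>x\<in>S. f differentiable at x) \<and>
     (\<forall>v. \<forall>x\<in>S. dir_deriv v f differentiable at x) \<and>
     (\<forall>v w. continuous_on S (dir_deriv w (dir_deriv v f)))"

text \<open>The quotient \<open>\<langle>\<nabla>f(x), \<alpha>\<rangle> / \<langle>\<alpha>, x\<rangle>\<close>. For a \<open>C\<^sup>2\<close> function \<open>f\<close> invariant under \<open>reflection \<alpha>\<close>
  the numerator vanishes on the hyperplane orthogonal to \<open>\<alpha>\<close>, and the quotient extends
  continuously to it by the value \<open>\<partial>\<^sub>\<alpha>\<partial>\<^sub>\<alpha> f(x) / |\<alpha>|\<^sup>2\<close>.\<close>

definition radial_quotient :: "'a::euclidean_space \<Rightarrow> ('a \<Rightarrow> real) \<Rightarrow> 'a \<Rightarrow> real" where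
  "radial_quotient \<alpha> f x =
     (if \<alpha> \<bullet> x = 0 then dir_deriv \<alpha> (dir_deriv \<alpha> f) x / (norm \<alpha>)\<^sup>2
      else (grad f x \<bullet> \<alpha>) / (\<alpha> \<bullet> x))"

definition radial_dunkl_laplacian ::
    "'a::euclidean_space set \<Rightarrow> ('a \<Rightarrow> real) \<Rightarrow> ('a \<Rightarrow> real) \<Rightarrow> 'a \<Rightarrow> real" where
  "radial_dunkl_laplacian R k f x = laplacian f x + 2 * (\<Sum>\<alpha>\<in>R. k \<alpha> * radial_quotient \<alpha> f x)"

text \<open>The quotient \<open>(f(x) - f(\<sigma>\<^sub>\<alpha> x)) / \<langle>\<alpha>, x\<rangle>\<close>, which for a \<open>C\<^sup>1\<close> function \<open>f\<close> extends continuously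
  to the hyperplane orthogonal to \<open>\<alpha>\<close> by \<open>2 \<partial>\<^sub>\<alpha> f(x) / |\<alpha>|\<^sup>2\<close>.\<close>

definition reflection_quotient :: "'a::euclidean_space \<Rightarrow> ('a \<Rightarrow> real) \<Rightarrow> 'a \<Rightarrow> real" where
  "reflection_quotient \<alpha> f x =
     (if \<alpha> \<bullet> x = 0 then 2 * dir_deriv \<alpha> f x / (norm \<alpha>)\<^sup>2
      else (f x - f (reflection \<alpha> x)) / (\<alpha> \<bullet> x))"

definition dunkl_operator ::
    "'a::euclidean_space set \<Rightarrow> ('a \<Rightarrow> real) \<Rightarrow> 'a \<Rightarrow> ('a \<Rightarrow> real) \<Rightarrow> 'a \<Rightarrow> real" where
  "dunkl_operator R k \<xi> f x =
     dir_deriv \<xi> f x + (\<Sum>\<alpha>\<in>R. k \<alpha> * (\<alpha> \<bullet> \<xi>) * reflection_quotient \<alpha> f x)"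

section \<open>The Poisson kernel of the unit ball\<close>

text \<open>Surface measure on the unit sphere through polar coordinates: the measure of \<open>A\<close> is \<open>d\<close> times
  the volume of the cone \<open>{t y | 0 < t < 1, y \<in> A}\<close>. Its sigma algebra lives on the sphere, so that
  functions need to be measurable on the sphere only.\<close>

definition sphere_measure :: "'a::euclidean_space measure" where
  "sphere_measure = scale_measure (of_nat DIM('a))
     (distr (restrict_space lborel (ball 0 1 - {0})) (restrict_space borel (sphere 0 1))
        (\<lambda>x. x /\<^sub>R norm x))"

definition poisson_integral ::
    "'a::euclidean_space set \<Rightarrow> ('a \<Rightarrow> real) \<Rightarrow> ('a \<Rightarrow> 'a \<Rightarrow> real) \<Rightarrow> ('a \<Rightarrow> real) \<Rightarrow> 'a \<Rightarrow> real" where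
  "poisson_integral R k P f x = (LINT y|sphere_measure. P x y * f y * dunkl_weight R k y)"

definition invariant_on :: "('a \<Rightarrow> 'a) set \<Rightarrow> 'a set \<Rightarrow> ('a \<Rightarrow> real) \<Rightarrow> bool" where
  "invariant_on W S f \<longleftrightarrow> (\<forall>w\<in>W. \<forall>x\<in>S. f (w x) = f x)"

definition is_poisson_kernel_W ::
    "'a::euclidean_space set \<Rightarrow> ('a \<Rightarrow> real) \<Rightarrow> ('a \<Rightarrow> 'a \<Rightarrow> real) \<Rightarrow> bool" where
  "is_poisson_kernel_W R k P \<longleftrightarrow>
     continuous_on (ball 0 1 \<times> sphere 0 1) (\<lambda>(x, y). P x y) \<and>
     (\<forall>y\<in>sphere 0 1. invariant_on (reflection_group R) (ball 0 1) (\<lambda>x. P x y)) \<and>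
     (\<forall>x\<in>ball 0 1. invariant_on (reflection_group R) (sphere 0 1) (P x)) \<and>
     (\<forall>f. continuous_on (sphere 0 1) f \<and> invariant_on (reflection_group R) (sphere 0 1) f \<longrightarrow>
        (let u = poisson_integral R k P f in
           invariant_on (reflection_group R) (ball 0 1) u \<and>
           C2_on (ball 0 1) u \<and>
           (\<forall>x\<in>ball 0 1. radial_dunkl_laplacian R k u x = 0) \<and>
           continuous_on (cball 0 1) (\<lambda>x. if norm x < 1 then u x else f x)))"

text \<open>The kernel lives on \<open>ball 0 1 \<times> sphere 0 1\<close>; setting it to \<open>0\<close> elsewhere makes it
  unique as a total function.\<close>

definition poisson_kernel_W ::
    "'a::euclidean_space set \<Rightarrow> ('a \<Rightarrow> real) \<Rightarrow> 'a \<Rightarrow> 'a \<Rightarrow> real" where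
  "poisson_kernel_W R k =
     (THE P. is_poisson_kernel_W R k P \<and>
        (\<forall>x y. (x, y) \<notin> ball 0 1 \<times> sphere 0 1 \<longrightarrow> P x y = 0))"

section \<open>The intertwining operator, the Dunkl kernel and the Newton kernel\<close>

definition homogeneous_poly :: "nat \<Rightarrow> ('a::euclidean_space \<Rightarrow> real) \<Rightarrow> bool" where
  "homogeneous_poly n p \<longleftrightarrow> real_polynomial_function p \<and> (\<forall>c x. p (c *\<^sub>R x) = c ^ n * p x)"

definition is_intertwining ::
    "'a::euclidean_space set \<Rightarrow> ('a \<Rightarrow> real) \<Rightarrow> (('a \<Rightarrow> real) \<Rightarrow> 'a \<Rightarrow> real) \<Rightarrow> bool" where
  "is_intertwining R k V \<longleftrightarrow>
     bij_betw V (Collect real_polynomial_function) (Collect real_polynomial_function) \<and>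
     (\<forall>p q. real_polynomial_function p \<and> real_polynomial_function q \<longrightarrow>
        V (\<lambda>x. p x + q x) = (\<lambda>x. V p x + V q x)) \<and>
     (\<forall>c p. real_polynomial_function p \<longrightarrow> V (\<lambda>x. c * p x) = (\<lambda>x. c * V p x)) \<and>
     (\<forall>n p. homogeneous_poly n p \<longrightarrow> homogeneous_poly n (V p)) \<and>
     V (\<lambda>x. 1) = (\<lambda>x. 1) \<and>
     (\<forall>\<xi> p. real_polynomial_function p \<longrightarrow> dunkl_operator R k \<xi> (V p) = V (dir_deriv \<xi> p))"

definition intertwining_poly ::
    "'a::euclidean_space set \<Rightarrow> ('a \<Rightarrow> real) \<Rightarrow> ('a \<Rightarrow> real) \<Rightarrow> 'a \<Rightarrow> real" where
  "intertwining_poly R k =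
     (THE V. is_intertwining R k V \<and> V \<in> extensional (Collect real_polynomial_function))"

text \<open>A probability measure on a compact set is determined by its integrals of polynomials.\<close>

definition intertwining_measure ::
    "'a::euclidean_space set \<Rightarrow> ('a \<Rightarrow> real) \<Rightarrow> 'a \<Rightarrow> 'a measure" where
  "intertwining_measure R k x =
     (THE \<mu>. prob_space \<mu> \<and> sets \<mu> = sets borel \<and>
        emeasure \<mu> (convex hull ((\<lambda>w. w x) ` reflection_group R)) = 1 \<and>
        (\<forall>p. real_polynomial_function p \<longrightarrow> intertwining_poly R k p x = (LINT z|\<mu>. p z)))"

definition intertwining ::
    "'a::euclidean_space set \<Rightarrow> ('a \<Rightarrow> real) \<Rightarrow> ('a \<Rightarrow> real) \<Rightarrow> 'a \<Rightarrow> real" where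
  "intertwining R k f x = (LINT z|intertwining_measure R k x. f z)"

definition dunkl_kernel ::
    "'a::euclidean_space set \<Rightarrow> ('a \<Rightarrow> real) \<Rightarrow> 'a \<Rightarrow> 'a \<Rightarrow> real" where
  "dunkl_kernel R k x y = intertwining R k (\<lambda>z. exp (z \<bullet> y)) x"

definition dunkl_const :: "'a::euclidean_space set \<Rightarrow> ('a \<Rightarrow> real) \<Rightarrow> real" where
  "dunkl_const R k =
     2 powr (- dunkl_gamma R k - real DIM('a) / 2) *
     inverse (LINT x|lborel. exp (- (norm x)\<^sup>2 / 2) * dunkl_weight R k x)"

definition dunkl_heat_kernel ::
    "'a::euclidean_space set \<Rightarrow> ('a \<Rightarrow> real) \<Rightarrow> real \<Rightarrow> 'a \<Rightarrow> 'a \<Rightarrow> real" where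
  "dunkl_heat_kernel R k t x y =
     dunkl_const R k / t powr (dunkl_gamma R k + real DIM('a) / 2) *
     exp (- ((norm x)\<^sup>2 + (norm y)\<^sup>2) / (4 * t)) *
     dunkl_kernel R k (x /\<^sub>R sqrt (2 * t)) (y /\<^sub>R sqrt (2 * t))"

definition newton_kernel_W ::
    "'a::euclidean_space set \<Rightarrow> ('a \<Rightarrow> real) \<Rightarrow> 'a \<Rightarrow> 'a \<Rightarrow> ennreal" where
  "newton_kernel_W R k x y =
     (\<integral>\<^sup>+ t\<in>{0<..}. ennreal (1 / real (card (reflection_group R)) *
        (\<Sum>w\<in>reflection_group R. dunkl_heat_kernel R k t x (w y))) \<partial>lborel)"

end

theory Submission
  imports Defs "HOL-Probability.Probability"
begin

text \<open>For orthogonal roots everything is an average over independent random variables \<open>t\<^sub>\<beta>\<close> on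
  \<open>[-1, 1]\<close> with density proportional to \<open>(1 - t\<^sup>2)\<close> to the power \<open>k(\<beta>) - 1\<close>. Let \<open>t \<cdot> x\<close> denote \<open>x\<close> with
  its component along each \<open>\<beta>\<close> multiplied by \<open>t\<^sub>\<beta>\<close>. Then \<open>V\<^sub>k f(x) = E[\<Prod>(1 + t\<^sub>\<beta>) f(t \<cdot> x)]\<close>, and the mean over
  \<open>W\<close> removes the factor \<open>\<Prod>(1 + t\<^sub>\<beta>)\<close>. With \<open>\<lambda> = \<gamma> + d/2\<close> and
  \<open>A = |x - y|\<^sup>2 + 2 \<Sum> (1 - t\<^sub>\<beta>) \<langle>\<beta>, x\<rangle> \<langle>\<beta>, y\<rangle> / |\<beta>|\<^sup>2\<close>, the Newton kernel is a constant multiple of the mean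
  of \<open>A\<close> to the power \<open>1 - \<lambda>\<close>, and the Poisson kernel one of \<open>1 - |x|\<^sup>2\<close> times the mean of \<open>A\<close> to the
  power \<open>- \<lambda>\<close>. A Gamma integral turns the powers of \<open>A\<close> into exponentials, so both estimates reduce to
  the one-dimensional fact that \<open>E[exp (- (1 - t) s)]\<close> is comparable to \<open>1 + s\<close> to the power \<open>- k\<close>,
  together with \<open>|x - \<sigma>\<^sub>\<beta> y|\<^sup>2 = |x - y|\<^sup>2 + 4 \<langle>\<beta>, x\<rangle> \<langle>\<beta>, y\<rangle> / |\<beta>|\<^sup>2\<close>.

  The formula for the Poisson kernel is verified rather than derived: integration by parts in \<open>t\<close> shows
  that it is harmonic for \<open>\<Delta>\<^sup>W\<close>, a Green identity that its spherical means are constant, hence it is an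
  approximate identity at the boundary, and the maximum principle gives uniqueness.\<close>

text \<open>V_k, its representing measures and the Poisson kernel are given by definite
  descriptions, so an explicit formula counts only together with a uniqueness proof. For V_k and for
  the Poisson kernel uniqueness comes from a maximum principle, for the measures from density of the
  polynomials.

  The exact mean of the heat kernel over W is never computed. The factor
  \<open>\<Prod>(1 + t\<^sub>\<beta>)\<close> is at most 2 to the number of roots, which bounds
  every summand from above; for nonnegative pairings it can only increase the integral, so the
  summand of the identity alone bounds the mean from below.

  The exponent \<lambda> = \<gamma> + d/2 is forced. After integration by parts the trace of the
  Hessian and the radial terms of the Poisson integrand cancel for each t separately, and this
  cancellation amounts to d = 2\<lambda> - 2\<gamma>.

  Two singularities shape the technique: for k < 1 the beta density is unbounded at the end points,
  and the Poisson kernel is unbounded near the sphere. Hence integration by parts in t rests on the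
  weight of exponent k, which vanishes at the end points when k > 0, and the Green identity uses
  cut-offs supported in smaller balls.\<close>

lemma set_integrable_lborel_of_nonneg:
  fixes f :: "real \<Rightarrow> real"
  assumes "f integrable_on {a..b}" "\<And>x. x \<in> {a..b} \<Longrightarrow> 0 \<le> f x"
    and "(\<lambda>x. indicator {a..b} x *\<^sub>R f x) \<in> borel_measurable borel"
  shows "set_integrable lborel {a..b} f"
proof -
  have "set_integrable lebesgue {a..b} f"
    using nonnegative_absolutely_integrable_1[OF assms(1)] assms(2) by auto
  thus ?thesis unfolding set_integrable_def
    by (subst (asm) integrable_completion) (use assms(3) in auto)
qed

lemma has_bochner_integral_Gamma_scaled:
  fixes k a :: real
  assumes "k > 0" "a > 0"
  shows "has_bochner_integral lborel (\<lambda>u. indicator {0..} u * u powr (k - 1) / exp (a * u)) (Gamma k * a powr (- k))"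
proof (rule has_bochner_integral_nn_integral)
  show "(\<integral>\<^sup>+x. ennreal (indicator {0..} x * x powr (k - 1) / exp (a * x)) \<partial>lborel) = ennreal (Gamma k * a powr (- k))"
  proof -
    have "Gamma k = nn_integral lborel (\<lambda>t. ennreal (indicator {0..} t * t powr (k - 1) / exp t))"
      by (rule Gamma_conv_nn_integral_real) fact
    also have "\<dots> = ennreal \<bar>a\<bar> * (\<integral>\<^sup>+t. ennreal (indicator {0..} (0 + a * t) * (0 + a * t) powr (k - 1) / exp (0 + a * t)) \<partial>lborel)"
      using assms by (intro nn_integral_real_affine) auto
    also have "(\<integral>\<^sup>+t. ennreal (indicator {0..} (0 + a * t) * (0 + a * t) powr (k - 1) / exp (0 + a * t)) \<partial>lborel)
      = (\<integral>\<^sup>+t. ennreal (a powr (k - 1)) * ennreal (indicator {0..} t * t powr (k - 1) / exp (a * t)) \<partial>lborel)"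
      using assms by (intro nn_integral_cong) (auto simp: indicator_def zero_le_mult_iff powr_mult ennreal_mult'[symmetric])
    also have "\<dots> = ennreal (a powr (k - 1)) * (\<integral>\<^sup>+t. ennreal (indicator {0..} t * t powr (k - 1) / exp (a * t)) \<partial>lborel)"
      by (intro nn_integral_cmult) auto
    finally have "ennreal (a powr (-k)) * ennreal (Gamma k) = ennreal (a powr (-k)) * (ennreal \<bar>a\<bar> * (ennreal (a powr (k - 1)) * (\<integral>\<^sup>+t. ennreal (indicator {0..} t * t powr (k - 1) / exp (a * t)) \<partial>lborel)))"
      by simp
    also have "\<dots> = ennreal (a powr (-k) * (a * a powr (k - 1))) * (\<integral>\<^sup>+t. ennreal (indicator {0..} t * t powr (k - 1) / exp (a * t)) \<partial>lborel)"
      using assms by (simp add: ennreal_mult' mult.assoc)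
    also have "a powr (-k) * (a * a powr (k - 1)) = 1"
      using assms by (simp add: powr_diff powr_minus)
    finally show ?thesis
      using assms Gamma_real_pos[of k] by (simp add: ennreal_mult' mult.commute)
  qed
qed (use assms Gamma_real_pos[of k] in \<open>auto simp: indicator_def\<close>)

text \<open>The constant k^k exp(1 - k) is the value of (1 + s)^k exp(-s) at its critical point s =
  k - 1. The inequality itself is ln z \<le> z - 1 at z = (1 + s)/k.\<close>

lemma one_plus_powr_le_exp:
  fixes k s :: real
  assumes "k > 0" "s \<ge> (0::real)"
  shows "exp (- s) \<le> exp (1 - k + k * ln k) * (1 + s) powr (- k)"
proof -
  have "ln ((1 + s) / k) \<le> (1 + s) / k - 1" using assms by (intro ln_le_minus_one) auto
  hence "k * (ln (1 + s) - ln k) \<le> k * ((1 + s) / k - 1)" using assms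
    by (intro mult_left_mono) (auto simp: ln_div)
  also have "k * ((1 + s) / k - 1) = 1 + s - k" using assms by (simp add: field_simps)
  finally have "- s \<le> (1 - k + k * ln k) + (- k * ln (1 + s))"
    by (simp add: algebra_simps)
  hence "exp (- s) \<le> exp ((1 - k + k * ln k) + (- k * ln (1 + s)))" by simp
  thus ?thesis using assms by (subst (asm) exp_add) (simp add: powr_def)
qed

section \<open>The symmetric beta distribution\<close>

text \<open>The mass of the Gegenbauer weight, equal to the beta value B(1/2, k) when k > 0.\<close>

definition gegen_const :: "real \<Rightarrow> real" where
  "gegen_const k = (LINT t:{-1..1}|lborel. (1 - t\<^sup>2) powr (k - 1))"

text \<open>For \<open>k = 0\<close> this is the weak limit of the densities as \<open>k\<close> tends to \<open>0\<close>.\<close>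

definition gegen :: "real \<Rightarrow> real measure" where
  "gegen k = (if k > 0
     then density (restrict_space lborel {-1..1}) (\<lambda>t. ennreal ((1 - t\<^sup>2) powr (k - 1) / gegen_const k))
     else distr (uniform_count_measure {-1, 1}) (restrict_space borel {-1..1}) (\<lambda>t. t))"

text \<open>The measure lives on the interval and not on the line: membership in its space bounds
  the variable, and continuity on the interval is enough for measurability.\<close>

lemma sets_gegen [measurable_cong]: "sets (gegen k) = sets (restrict_space borel {-1..1})"
  by (auto simp: gegen_def sets_restrict_space)

lemma space_gegen [simp]: "space (gegen k) = {-1..1}"
  by (auto simp: gegen_def space_restrict_space)

lemma has_derivative_gegen_weight:
  fixes k :: real
  assumes "t \<in> {-1<..<1::real}"
  shows "((\<lambda>t. (1 - t\<^sup>2) powr k) has_real_derivative - 2 * k * t * (1 - t\<^sup>2) powr (k - 1)) (at t)"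
proof -
  have "1 - t\<^sup>2 > 0" using assms by (auto simp: abs_square_less_1 abs_less_iff)
  thus ?thesis by (auto intro!: derivative_eq_intros simp: powr_diff field_simps)
qed

lemma continuous_on_gegen_weight:
  fixes k :: real
  assumes "k > 0" shows "continuous_on {-1..1::real} (\<lambda>t. (1 - t\<^sup>2) powr k)"
  using assms by (intro continuous_on_powr' continuous_intros) (auto simp: abs_square_le_1 abs_le_iff)

lemma gegen_weight_split:
  fixes k :: real
  assumes "t \<in> {-1..1::real}"
  shows "(1 - t\<^sup>2) * (1 - t\<^sup>2) powr (k - 1) = (1 - t\<^sup>2) powr k"
proof (cases "t\<^sup>2 = 1")
  case False
  hence "1 - t\<^sup>2 > 0" using assms abs_square_le_1[of t] by (auto simp: abs_le_iff)
  thus ?thesis by (simp add: powr_diff)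
qed auto

text \<open>For k < 1 the weight w of exponent k - 1 is unbounded at the end points. With W = (1 -
  t^2)^k one has w = W + t^2 w and (t W)' = W - 2 k t^2 w, hence w = (1 + 1/(2k)) W - (t W)'/(2k), a
  continuous function minus a multiple of a derivative.\<close>

lemma gegen_weight_integrable:
  fixes k :: real
  assumes "k > 0" shows "set_integrable lborel {-1..1} (\<lambda>t. (1 - t\<^sup>2) powr (k - 1))"
proof -
  have 1: "((\<lambda>t. (1 - t\<^sup>2) powr k + t * (- 2 * k * t * (1 - t\<^sup>2) powr (k - 1))) has_integral
      (1 * (1 - 1\<^sup>2) powr k - (-1) * (1 - (-1)\<^sup>2) powr k)) {-1..1}"
  proof (rule fundamental_theorem_of_calculus_interior)
    show "continuous_on {-1..1} (\<lambda>t. t * (1 - t\<^sup>2) powr k)"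
      by (intro continuous_intros continuous_on_gegen_weight assms)
    fix t :: real assume "t \<in> {-1<..<1}"
    note D = has_derivative_gegen_weight[OF this, of k]
    show "((\<lambda>t. t * (1 - t\<^sup>2) powr k) has_vector_derivative
       (1 - t\<^sup>2) powr k + t * (- 2 * k * t * (1 - t\<^sup>2) powr (k - 1))) (at t)"
      unfolding has_real_derivative_iff_has_vector_derivative[symmetric]
      by (rule DERIV_cong[OF DERIV_mult[OF DERIV_ident D]]) simp
  qed simp
  have 2: "(\<lambda>t. (1 - t\<^sup>2) powr k) integrable_on {-1..1}"
    by (intro integrable_continuous_interval continuous_on_gegen_weight assms)
  have "(\<lambda>t. (1 + 1 / (2 * k)) *\<^sub>R (1 - t\<^sup>2) powr k - (1 / (2 * k)) *\<^sub>R ((1 - t\<^sup>2) powr k + t * (- 2 * k * t * (1 - t\<^sup>2) powr (k - 1)))) integrable_on {-1..1}"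
    using 1 2 by (intro integrable_diff integrable_cmul) (auto simp: integrable_on_def)
  also have "?this \<longleftrightarrow> (\<lambda>t. (1 - t\<^sup>2) powr (k - 1)) integrable_on {-1..1}"
  proof (rule integrable_cong)
    fix t :: real assume "t \<in> {-1..1}"
    hence eq: "(1 - t\<^sup>2) powr k = (1 - t\<^sup>2) powr (k - 1) - t * t * (1 - t\<^sup>2) powr (k - 1)"
      using gegen_weight_split[of t k] by (simp add: algebra_simps power2_eq_square)
    have "(1 + 1 / (2 * k)) * P - (1 / (2 * k)) * (P + t * (- 2 * k * t * w)) = P + t * t * w" for P w
      using assms by (simp add: field_simps)
    thus "(1 + 1 / (2 * k)) *\<^sub>R (1 - t\<^sup>2) powr k - (1 / (2 * k)) *\<^sub>R ((1 - t\<^sup>2) powr k + t * (- 2 * k * t * (1 - t\<^sup>2) powr (k - 1))) = (1 - t\<^sup>2) powr (k - 1)"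
      using eq by simp
  qed
  finally show ?thesis
    by (rule set_integrable_lborel_of_nonneg) auto
qed

lemma gegen_const_pos:
  assumes "k > 0" shows "gegen_const k > 0"
proof -
  have "gegen_const k \<noteq> 0"
  proof
    assume "gegen_const k = 0"
    hence "AE t in lborel. indicator {-1..1} t *\<^sub>R (1 - t\<^sup>2) powr (k - 1) = 0"
      using gegen_weight_integrable[OF assms] unfolding gegen_const_def set_lebesgue_integral_def set_integrable_def
      by (subst (asm) integral_nonneg_eq_0_iff_AE) (auto simp: indicator_def)
    hence "AE t in lborel. t \<notin> {-1<..<1::real}"
      \<comment> \<open>At the end points the base is 0 and \<open>0 powr (k - 1) = 0\<close>, so
        positivity of the weight is available in the open interval only.\<close>
      by eventually_elim (auto simp: indicator_def split: if_splits simp: power2_eq_1_iff)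
    hence "emeasure lborel {-1<..<1::real} = 0"
      by (subst (asm) AE_iff_measurable[OF _ refl]) (auto simp: greaterThanLessThan_def Int_def)
    thus False by simp
  qed
  moreover have "gegen_const k \<ge> 0" unfolding gegen_const_def set_lebesgue_integral_def
    by (intro integral_nonneg_AE) auto
  ultimately show ?thesis by simp
qed

lemma integral_gegen_pos:
  assumes k: "k > 0" and f: "(f :: real \<Rightarrow> real) \<in> borel_measurable (gegen k)"
  shows "(LINT t|gegen k. f t) = (LINT t:{-1..1}|lborel. (1 - t\<^sup>2) powr (k - 1) * f t) / gegen_const k"
proof -
  have f': "f \<in> borel_measurable (restrict_space lborel {-1..1})"
    using f by (subst (asm) measurable_cong_sets[OF sets_gegen refl])
       (subst measurable_cong_sets[where M'="restrict_space borel {-1..1}"], auto simp: sets_restrict_space)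
  have "(LINT t|gegen k. f t) = (LINT t|restrict_space lborel {-1..1}. ((1 - t\<^sup>2) powr (k - 1) / gegen_const k) *\<^sub>R f t)"
    using k gegen_const_pos[OF k] unfolding gegen_def if_P[OF k]
    by (intro integral_density f') (auto intro!: measurable_restrict_space1)
  also have "\<dots> = (LINT t|lborel. (indicator {-1..1} t *\<^sub>R ((1 - t\<^sup>2) powr (k - 1) * f t)) / gegen_const k)"
    by (subst integral_restrict_space) (auto intro!: Bochner_Integration.integral_cong)
  finally show ?thesis by (simp add: set_lebesgue_integral_def)
qed

lemma integral_gegen_0:
  assumes k: "k \<le> 0" and f: "(f :: real \<Rightarrow> real) \<in> borel_measurable (gegen k)"
  shows "(LINT t|gegen k. f t) = (f (-1) + f 1) / 2"
proof -
  have f': "f \<in> borel_measurable (restrict_space borel {-1..1})"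
    using f by (subst (asm) measurable_cong_sets[OF sets_gegen refl])
  have m: "(\<lambda>t. t) \<in> uniform_count_measure {-1, 1} \<rightarrow>\<^sub>M restrict_space borel {-1..1::real}"
    by (auto simp: measurable_def space_uniform_count_measure sets_uniform_count_measure space_restrict_space)
  have "(LINT t|gegen k. f t) = (LINT t|uniform_count_measure {-1, 1}. f t)"
    using k unfolding gegen_def by (simp add: integral_distr[OF m f'])
  also have "\<dots> = (f (-1) + f 1) / 2"
    by (subst integral_uniform_count_measure) auto
  finally show ?thesis .
qed

lemma prob_space_gegen: "prob_space (gegen k)"
proof (cases "k > 0")
  case True
  have "emeasure (gegen k) {-1..1} = (\<integral>\<^sup>+t. ennreal ((1 - t\<^sup>2) powr (k - 1) / gegen_const k) \<partial>restrict_space lborel {-1..1})"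
    unfolding gegen_def if_P[OF True]
    by (subst emeasure_density) (auto simp: sets_restrict_space intro!: nn_integral_cong measurable_restrict_space1 simp: space_restrict_space image_iff exI[of _ "{-1..1}"])
  also have "\<dots> = (\<integral>\<^sup>+t. ennreal (indicator {-1..1} t *\<^sub>R (1 - t\<^sup>2) powr (k - 1) / gegen_const k) \<partial>lborel)"
    by (subst nn_integral_restrict_space) (auto intro!: nn_integral_cong simp: indicator_def)
  also have "\<dots> = ennreal (LINT t|lborel. indicator {-1..1} t *\<^sub>R (1 - t\<^sup>2) powr (k - 1) / gegen_const k)"
    using gegen_weight_integrable[OF True] gegen_const_pos[OF True] unfolding set_integrable_def
    by (intro nn_integral_eq_integral integrable_divide) auto
  also have "\<dots> = 1"
    using gegen_const_pos[OF True] by (simp add: gegen_const_def set_lebesgue_integral_def)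
  finally show ?thesis by (intro prob_spaceI) simp
next
  case False
  interpret U: prob_space "uniform_count_measure {-1, 1::real}"
    by (rule prob_space_uniform_count_measure) auto
  show ?thesis using False unfolding gegen_def
    by (simp, intro U.prob_space_distr)
       (auto simp: measurable_def space_uniform_count_measure sets_uniform_count_measure space_restrict_space)
qed

lemma integrable_gegen_bounded:
  assumes "(f :: real \<Rightarrow> real) \<in> borel_measurable (gegen k)" "\<And>t. t \<in> {-1..1} \<Longrightarrow> \<bar>f t\<bar> \<le> B"
  shows "integrable (gegen k) f"
proof -
  interpret prob_space "gegen k" by (rule prob_space_gegen)
  show ?thesis by (rule integrable_const_bound[of _ B]) (use assms in \<open>auto intro!: AE_I2\<close>)
qed

lemma gegen_symmetric:
  assumes [measurable]: "(f :: real \<Rightarrow> real) \<in> borel_measurable (gegen k)"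
  shows "(LINT t|gegen k. f (- t)) = (LINT t|gegen k. f t)"
proof -
  have "uminus \<in> restrict_space borel {-1..1::real} \<rightarrow>\<^sub>M restrict_space borel {-1..1}"
    by (intro measurable_restrict_space3) auto
  hence [measurable]: "uminus \<in> gegen k \<rightarrow>\<^sub>M gegen k"
    by (subst measurable_cong_sets[OF sets_gegen sets_gegen])
  have m: "(\<lambda>t. f (- t)) \<in> borel_measurable (gegen k)" by measurable
  show ?thesis
  proof (cases "k > 0")
    case True
    have "(LINT t|lborel. indicator {-1..1} t *\<^sub>R ((1 - t\<^sup>2) powr (k - 1) * f t)) =
       (LINT t|lborel. indicator {-1..1} t *\<^sub>R ((1 - t\<^sup>2) powr (k - 1) * f (- t)))"
      by (subst lborel_integral_real_affine[where c="-1" and t=0])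
         (auto intro!: Bochner_Integration.integral_cong simp: indicator_def)
    thus ?thesis
      by (simp add: integral_gegen_pos[OF True m] integral_gegen_pos[OF True assms] set_lebesgue_integral_def)
  next
    case False
    thus ?thesis using integral_gegen_0[OF _ m] integral_gegen_0[OF _ assms] by simp
  qed
qed

text \<open>For k > 0, (1 - t^2) times the weight is (1 - t^2)^k, whose derivative is -2 k t times
  the weight and whose boundary values vanish. For k = 0 the law charges only the zeros of 1 - t^2,
  so both sides are 0. All later identities in the variables t come from this one.\<close>

lemma gegen_integration_by_parts:
  assumes k: "k \<ge> 0"
    and g: "\<And>t. t \<in> {-1..1} \<Longrightarrow> (g has_real_derivative g' t) (at t within {-1..1})"
    and m': "g' \<in> borel_measurable (gegen k)"
    and B': "\<And>t. t \<in> {-1..1} \<Longrightarrow> \<bar>g' t\<bar> \<le> B"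
  shows "(LINT t|gegen k. (1 - t\<^sup>2) * g' t) = 2 * k * (LINT t|gegen k. t * g t)"
proof -
  have cg: "continuous_on {-1..1} g" using g
    by (meson DERIV_continuous continuous_on_eq_continuous_within)
  have "g \<in> borel_measurable (restrict_space borel {-1..1})"
    using cg by (rule borel_measurable_continuous_on_restrict)
  hence m: "g \<in> borel_measurable (gegen k)" by (subst measurable_cong_sets[OF sets_gegen refl])
  have idm: "(\<lambda>t. t) \<in> borel_measurable (gegen k)"
    by (subst measurable_cong_sets[OF sets_gegen refl]) (auto intro!: measurable_restrict_space1)
  have m1: "(\<lambda>t. (1 - t\<^sup>2) * g' t) \<in> borel_measurable (gegen k)"
    and m2: "(\<lambda>t. t * g t) \<in> borel_measurable (gegen k)"
    using m m' idm by measurable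
  show ?thesis
  proof (cases "k > 0")
    case False
    hence "k = 0" using k by simp
    thus ?thesis using integral_gegen_0[OF _ m1] by simp
  next
    case True
    let ?w = "\<lambda>t. (1 - t\<^sup>2) powr (k - 1)"
    have HK: "((\<lambda>t. (1 - t\<^sup>2) powr k * g' t + (- 2 * k * t * ?w t) * g t) has_integral
      ((1 - 1\<^sup>2) powr k * g 1 - (1 - (-1)\<^sup>2) powr k * g (-1))) {-1..1}"
    proof (rule fundamental_theorem_of_calculus_interior)
      show "continuous_on {-1..1} (\<lambda>t. (1 - t\<^sup>2) powr k * g t)"
        by (intro continuous_intros continuous_on_gegen_weight True cg)
      fix t :: real assume t: "t \<in> {-1<..<1}"
      have "(g has_real_derivative g' t) (at t)"
        using g[of t] t at_within_interior[of t "{-1..1}"] by auto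
      from DERIV_mult[OF has_derivative_gegen_weight[OF t, of k] this]
      show "((\<lambda>t. (1 - t\<^sup>2) powr k * g t) has_vector_derivative
         (1 - t\<^sup>2) powr k * g' t + (- 2 * k * t * ?w t) * g t) (at t)"
        unfolding has_real_derivative_iff_has_vector_derivative[symmetric]
        by (rule DERIV_cong) simp
    qed simp
    have lift: "(\<lambda>t. indicator {-1..1} t *\<^sub>R h t) \<in> borel_measurable borel"
      if "h \<in> borel_measurable (gegen k)" for h :: "real \<Rightarrow> real"
      using that by (subst (asm) measurable_cong_sets[OF sets_gegen refl])
        (subst (asm) borel_measurable_restrict_space_iff, auto)
    \<comment> \<open>The weight may be unbounded, so integrability is inherited from it by bounded
      measurable factors.\<close>
    have wint: "set_integrable lborel {-1..1} (\<lambda>t. ?w t * h t)"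
      if "h \<in> borel_measurable (gegen k)" "\<And>t. t \<in> {-1..1} \<Longrightarrow> \<bar>h t\<bar> \<le> B" for h B
    proof -
      have [measurable]: "(\<lambda>t. indicator {-1..1} t *\<^sub>R h t) \<in> borel_measurable borel" by (rule lift) fact
      have eq: "indicator {-1..1} t *\<^sub>R (?w t * h t) = ?w t * (indicator {-1..1} t *\<^sub>R h t)" for t by auto
      show ?thesis
        unfolding set_integrable_def
      proof (rule Bochner_Integration.integrable_bound)
        show "integrable lborel (\<lambda>t. B * (indicator {-1..1} t *\<^sub>R ?w t))"
          using gegen_weight_integrable[OF True] unfolding set_integrable_def by (intro integrable_mult_right)
        show "(\<lambda>t. indicator {-1..1} t *\<^sub>R (?w t * h t)) \<in> borel_measurable lborel"
          unfolding eq by measurable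
        show "AE t in lborel. norm (indicator {-1..1} t *\<^sub>R (?w t * h t)) \<le> norm (B * (indicator {-1..1} t *\<^sub>R ?w t))"
        proof (rule AE_I2)
          fix t :: real
          have "?w t * \<bar>h t\<bar> \<le> ?w t * \<bar>B\<bar>" if "t \<in> {-1..1}"
            using that(1) \<open>\<And>t. t \<in> {-1..1} \<Longrightarrow> \<bar>h t\<bar> \<le> B\<close>[OF that]
            by (intro mult_left_mono) auto
          thus "norm (indicator {-1..1} t *\<^sub>R (?w t * h t)) \<le> norm (B * (indicator {-1..1} t *\<^sub>R ?w t))"
            by (auto simp: indicator_def abs_mult mult.commute)
        qed
      qed
    qed
    obtain Bg where Bg: "\<And>t. t \<in> {-1..1} \<Longrightarrow> \<bar>g t\<bar> \<le> Bg"
      using compact_imp_bounded[OF compact_continuous_image[OF cg]]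
      by (fastforce simp: bounded_iff)
    have "\<bar>t * g t\<bar> \<le> Bg" if "t \<in> {-1..1}" for t
    proof -
      have "\<bar>t\<bar> * \<bar>g t\<bar> \<le> 1 * \<bar>g t\<bar>" using that by (intro mult_right_mono) auto
      thus ?thesis using Bg[OF that] by (simp add: abs_mult)
    qed
    hence i2: "set_integrable lborel {-1..1} (\<lambda>t. ?w t * (t * g t))" by (intro wint[OF m2])
    have "\<bar>(1 - t\<^sup>2) * g' t\<bar> \<le> B" if "t \<in> {-1..1}" for t
    proof -
      have "\<bar>1 - t\<^sup>2\<bar> * \<bar>g' t\<bar> \<le> 1 * \<bar>g' t\<bar>"
        using that by (intro mult_right_mono) (auto simp: abs_square_le_1 abs_le_iff)
      thus ?thesis using B'[OF that] by (simp add: abs_mult)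
    qed
    hence i1: "set_integrable lborel {-1..1} (\<lambda>t. ?w t * ((1 - t\<^sup>2) * g' t))" by (intro wint[OF m1])
    have i2': "set_integrable lborel {-1..1} (\<lambda>t. 2 * k * (?w t * (t * g t)))" using i2 by simp
    have "((\<lambda>t. ?w t * ((1 - t\<^sup>2) * g' t) - 2 * k * (?w t * (t * g t))) has_integral 0) {-1..1}"
    proof -
      have "((\<lambda>t. (1 - t\<^sup>2) powr k * g' t + (- 2 * k * t * ?w t) * g t) has_integral 0) {-1..1}"
        using HK by simp
      also have "?this \<longleftrightarrow> ?thesis"
        by (rule has_integral_cong) (simp add: gegen_weight_split[of _ k, symmetric] algebra_simps)
      finally show ?thesis .
    qed
    note zero = this
    have "((\<lambda>t. ?w t * ((1 - t\<^sup>2) * g' t) - 2 * k * (?w t * (t * g t))) has_integral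
       ((LINT t:{-1..1}|lborel. ?w t * ((1 - t\<^sup>2) * g' t)) - (LINT t:{-1..1}|lborel. 2 * k * (?w t * (t * g t))))) {-1..1}"
      unfolding set_borel_integral_eq_integral(2)[OF i1] set_borel_integral_eq_integral(2)[OF i2']
      by (intro has_integral_diff integrable_integral set_borel_integral_eq_integral(1) i1 i2')
    from has_integral_unique[OF this zero]
    have "(LINT t:{-1..1}|lborel. ?w t * ((1 - t\<^sup>2) * g' t)) = (LINT t:{-1..1}|lborel. 2 * k * (?w t * (t * g t)))"
      by simp
    thus ?thesis using integral_gegen_pos[OF True m1] integral_gegen_pos[OF True m2] by simp
  qed
qed

section \<open>Laplace transform of the symmetric beta law\<close>

text \<open>For s > 0 a normalized modified Bessel function: exp(-s) I(s) divided by s^(k - 1/2), up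
  to a constant, with I of order k - 1/2. The factor exp(-s) removes the exponential growth.\<close>

definition gegen_laplace :: "real \<Rightarrow> real \<Rightarrow> real" where
  "gegen_laplace k s = (LINT t|gegen k. exp (- ((1 - t) * s)))"

lemma measurable_gegen_continuous:
  "continuous_on {-1..1} (f :: real \<Rightarrow> real) \<Longrightarrow> f \<in> borel_measurable (gegen k)"
  by (subst measurable_cong_sets[OF sets_gegen refl], rule borel_measurable_continuous_on_restrict)

lemma integrable_gegen_continuous:
  assumes "continuous_on {-1..1} (f :: real \<Rightarrow> real)"
  shows "integrable (gegen k) f"
proof -
  have "bounded (f ` {-1..1})"
    by (intro compact_imp_bounded compact_continuous_image assms compact_Icc)
  then obtain B where "\<forall>x\<in>f ` {-1..1}. norm x \<le> B" unfolding bounded_iff by blast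
  thus ?thesis by (intro integrable_gegen_bounded[of _ _ B] measurable_gegen_continuous assms) auto
qed

text \<open>In the variable u = 1 - t the weight is (u (2 - u))^(k - 1) on [0, 2], and only its
  behaviour u^(k - 1) at u = 0 matters. The part u \<le> 1/(1 + s) gives the lower bound; a Gamma
  integral on [0, 1] and exp(-s) on [1, 2] give the upper one. Writing 1 + s in place of s keeps the
  bounds uniform down to s = 0.\<close>

lemma gegen_laplace_bounds:
  assumes k: "k \<ge> 0"
  shows "\<exists>c C. 0 < c \<and> 0 < C \<and> (\<forall>s\<ge>0. c * (1 + s) powr (- k) \<le> gegen_laplace k s \<and> gegen_laplace k s \<le> C * (1 + s) powr (- k))"
proof (cases "k > 0")
  case False
  hence [simp]: "k = 0" using k by simp
  have "gegen_laplace k s = (exp (- (2 * s)) + 1) / 2" for s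
    unfolding gegen_laplace_def by (subst integral_gegen_0) (auto intro!: measurable_gegen_continuous continuous_intros)
  hence gl: "gegen_laplace k s = (exp (- (2 * s)) + 1) / 2" for s by blast
  have "1/2 * (1 + s) powr (- k) \<le> gegen_laplace k s \<and> gegen_laplace k s \<le> 1 * (1 + s) powr (- k)"
    if "s \<ge> 0" for s
  proof -
    have "(1 + s) powr (- k) = 1" using that by simp
    moreover have "0 < exp (- (2 * s))" "exp (- (2 * s)) \<le> 1" using that by auto
    ultimately show ?thesis unfolding gl by (intro conjI; simp)
  qed
  moreover have "(0::real) < 1/2" "(0::real) < 1" by auto
  ultimately show ?thesis by blast
next
  case True
  \<comment> \<open>Bounds for (2 - u)^(k - 1) on [0, 1]: there 2 - u runs through [1, 2], and
    taking min and max with 1 covers both signs of k - 1.\<close>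
  define m where "m = min 1 (2 powr (k - 1))"
  define M where "M = max 1 (2 powr (k - 1))"
  define Z where "Z = gegen_const k"
  define C' where "C' = exp (1 - k + k * ln k)"
  have mM: "m > 0" "M > 0" "Z > 0" "C' > 0"
    using gegen_const_pos[OF True] unfolding m_def M_def Z_def C'_def by (simp_all add: less_max_iff_disj)
  let ?w = "\<lambda>u. indicator {0..2} u * (u * (2 - u)) powr (k - 1)"
  have w: "has_bochner_integral lborel ?w Z"
  proof -
    have "has_bochner_integral lborel (\<lambda>t. indicator {-1..1} t *\<^sub>R (1 - t\<^sup>2) powr (k - 1)) Z"
      using gegen_weight_integrable[OF True] unfolding set_integrable_def Z_def gegen_const_def set_lebesgue_integral_def
      by (rule has_bochner_integral_integrable)
    from lborel_has_bochner_integral_real_affine_iff[of "-1" _ _ 1, THEN iffD1, OF _ this]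
    have "has_bochner_integral lborel (\<lambda>u. indicator {-1..1} (1 + -1 * u) *\<^sub>R (1 - (1 + -1 * u)\<^sup>2) powr (k - 1)) Z"
      by simp
    thus ?thesis
      by (rule subst[of _ _ "\<lambda>f. has_bochner_integral lborel f Z", rotated])
         (auto simp: indicator_def power2_eq_square algebra_simps fun_eq_iff)
  qed
  have gl: "gegen_laplace k s = (LINT u|lborel. exp (- (u * s)) * ?w u) / Z" for s
  proof -
    have "gegen_laplace k s = (LINT t:{-1..1}|lborel. (1 - t\<^sup>2) powr (k - 1) * exp (- ((1 - t) * s))) / Z"
      unfolding gegen_laplace_def Z_def
      by (rule integral_gegen_pos[OF True]) (auto intro!: measurable_gegen_continuous continuous_intros)
    also have "(LINT t:{-1..1}|lborel. (1 - t\<^sup>2) powr (k - 1) * exp (- ((1 - t) * s))) = (LINT u|lborel. exp (- (u * s)) * ?w u)"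
      unfolding set_lebesgue_integral_def
      by (subst lborel_integral_real_affine[where c="-1" and t=1])
         (auto intro!: Bochner_Integration.integral_cong simp: indicator_def power2_eq_square algebra_simps)
    finally show ?thesis .
  qed
  have int: "integrable lborel (\<lambda>u. exp (- (u * s)) * ?w u)" if "s \<ge> 0" for s
  proof (rule Bochner_Integration.integrable_bound)
    show "integrable lborel ?w" using w by (simp add: has_bochner_integral_iff)
    show "AE u in lborel. norm (exp (- (u * s)) * ?w u) \<le> norm (?w u)"
      using that by (intro AE_I2) (auto simp: indicator_def intro!: mult_left_le_one_le)
  qed measurable
  have pw: "m * u powr (k - 1) \<le> (u * (2 - u)) powr (k - 1) \<and> (u * (2 - u)) powr (k - 1) \<le> M * u powr (k - 1)"
    if "u \<in> {0..1}" for u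
  proof -
    have "m \<le> (2 - u) powr (k - 1) \<and> (2 - u) powr (k - 1) \<le> M"
    proof (cases "k \<ge> 1")
      case True
      have "1 powr (k - 1) \<le> (2 - u) powr (k - 1)" "(2 - u) powr (k - 1) \<le> 2 powr (k - 1)"
        using True that powr_mono2[of "k - 1" 1 "2 - u"] powr_mono2[of "k - 1" "2 - u" 2] by simp_all
      thus ?thesis by (auto simp: m_def M_def)
    next
      case False
      have "(2 - u) powr (k - 1) \<le> 1 powr (k - 1)" "2 powr (k - 1) \<le> (2 - u) powr (k - 1)"
        using False that powr_mono2'[of "k - 1" 1 "2 - u"] powr_mono2'[of "k - 1" "2 - u" 2] by simp_all
      thus ?thesis by (auto simp: m_def M_def)
    qed
    hence "m * u powr (k - 1) \<le> (2 - u) powr (k - 1) * u powr (k - 1) \<and>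
        (2 - u) powr (k - 1) * u powr (k - 1) \<le> M * u powr (k - 1)"
      by (auto intro!: mult_right_mono)
    thus ?thesis using that by (simp add: powr_mult mult.commute)
  qed
  show ?thesis
  proof (intro exI conjI allI impI)
    show "0 < exp (-1) * m / k / Z" "0 < (M * exp 1 * Gamma k + C' * Z) / Z"
      using mM True Gamma_real_pos[of k] by (auto intro!: add_pos_pos divide_pos_pos mult_pos_pos)
    fix s :: real assume s: "s \<ge> 0"
    \<comment> \<open>For u \<le> d the product u s is at most 1, so the exponential is at least
      exp(-1), while the integral of u^(k - 1) over [0, d] is already of order (1 + s)^(-k).\<close>
    define d where "d = 1 / (1 + s)"
    have d: "0 < d" "d \<le> 1" using s by (auto simp: d_def)
    have dk: "d powr k = (1 + s) powr (- k)" using s by (simp add: d_def powr_divide powr_minus field_simps)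
    have lower: "has_bochner_integral lborel (\<lambda>u. exp (-1) * m * (indicator {0..d} u * u powr (k - 1))) (exp (-1) * m * (d powr k / k))"
    proof (intro has_bochner_integral_mult_right)
      have hi: "((\<lambda>u. u powr (k - 1)) has_integral (d powr k / k)) {0..d}"
        using has_integral_powr_from_0[of "k - 1" d] True d by auto
      hence "set_integrable lborel {0..d} (\<lambda>u. u powr (k - 1))"
        by (intro set_integrable_lborel_of_nonneg) (auto simp: integrable_on_def)
      thus "has_bochner_integral lborel (\<lambda>u. indicator {0..d} u * u powr (k - 1)) (d powr k / k)"
        using set_borel_integral_eq_integral(2)[OF \<open>set_integrable lborel {0..d} (\<lambda>u. u powr (k - 1))\<close>] hi
        by (simp add: has_bochner_integral_iff set_integrable_def set_lebesgue_integral_def integral_unique)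
    qed
    have "exp (-1) * m * (d powr k / k) \<le> (LINT u|lborel. exp (- (u * s)) * ?w u)"
      unfolding has_bochner_integral_integral_eq[OF lower, symmetric]
    proof (rule integral_mono)
      show "integrable lborel (\<lambda>u. exp (-1) * m * (indicator {0..d} u * u powr (k - 1)))"
        using lower by (simp add: has_bochner_integral_iff)
      show "integrable lborel (\<lambda>u. exp (- (u * s)) * ?w u)" by (rule int) fact
      fix u :: real
      show "exp (-1) * m * (indicator {0..d} u * u powr (k - 1)) \<le> exp (- (u * s)) * ?w u"
      proof (cases "u \<in> {0..d}")
        case True
        have "u * s \<le> d * s" using True s by (intro mult_right_mono) auto
        also have "d * s \<le> 1" using s by (simp add: d_def)
        finally have "exp (-1) \<le> exp (- (u * s))" by simp
        moreover have "m * u powr (k - 1) \<le> (u * (2 - u)) powr (k - 1)" using pw[of u] True d by auto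
        ultimately have "exp (-1) * (m * u powr (k - 1)) \<le> exp (- (u * s)) * (u * (2 - u)) powr (k - 1)"
          using mM by (intro mult_mono) auto
        thus ?thesis using True d by (simp add: indicator_def)
      qed auto
    qed
    thus "exp (-1) * m / k / Z * (1 + s) powr - k \<le> gegen_laplace k s"
      unfolding gl dk[symmetric] using divide_right_mono[of "exp (-1) * m * (d powr k / k)" _ Z] mM by simp
    \<comment> \<open>The factor exp(1) is the price of replacing exp(-u s) by exp(-u (1 + s)) for u
      in [0, 1].\<close>
    have upper: "has_bochner_integral lborel (\<lambda>u. M * exp 1 * (indicator {0..} u * u powr (k - 1) / exp ((1 + s) * u)) + exp (- s) * ?w u)
      (M * exp 1 * (Gamma k * (1 + s) powr (- k)) + exp (- s) * Z)"
      using s True by (intro has_bochner_integral_add has_bochner_integral_mult_right has_bochner_integral_Gamma_scaled w) auto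
    have "(LINT u|lborel. exp (- (u * s)) * ?w u) \<le> M * exp 1 * (Gamma k * (1 + s) powr (- k)) + exp (- s) * Z"
      unfolding has_bochner_integral_integral_eq[OF upper, symmetric]
    proof (rule integral_mono)
      show "integrable lborel (\<lambda>u. M * exp 1 * (indicator {0..} u * u powr (k - 1) / exp ((1 + s) * u)) + exp (- s) * ?w u)"
        using upper by (simp add: has_bochner_integral_iff)
      show "integrable lborel (\<lambda>u. exp (- (u * s)) * ?w u)" by (rule int) fact
      fix u :: real
      consider "u \<in> {0..1}" | "u \<in> {1<..2}" | "u \<notin> {0..2}" by force
      thus "exp (- (u * s)) * ?w u \<le> M * exp 1 * (indicator {0..} u * u powr (k - 1) / exp ((1 + s) * u)) + exp (- s) * ?w u"
      proof cases
        case 1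
        have "exp (- (u * s)) = exp u / exp ((1 + s) * u)" by (simp add: exp_diff[symmetric] algebra_simps)
        also have "\<dots> \<le> exp 1 / exp ((1 + s) * u)" using 1 by (intro divide_right_mono) auto
        finally have "exp (- (u * s)) * (u * (2 - u)) powr (k - 1) \<le> (exp 1 / exp ((1 + s) * u)) * (M * u powr (k - 1))"
          using pw[OF 1] mM by (intro mult_mono) auto
        moreover have "0 \<le> exp (- s) * ?w u" by (auto simp: indicator_def)
        moreover have "exp (- (u * s)) * ?w u = exp (- (u * s)) * (u * (2 - u)) powr (k - 1)"
          and "M * exp 1 * (indicator {0..} u * u powr (k - 1) / exp ((1 + s) * u)) = (exp 1 / exp ((1 + s) * u)) * (M * u powr (k - 1))"
          using 1 by (simp_all add: indicator_def)
        ultimately show ?thesis by linarith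
      next
        case 2
        have "s * 1 \<le> s * u" using 2 s by (intro mult_left_mono) auto
        hence "exp (- (u * s)) * ?w u \<le> exp (- s) * ?w u"
          by (intro mult_right_mono) (auto simp: indicator_def mult_ac)
        moreover have "0 \<le> M * exp 1 * (indicator {0..} u * u powr (k - 1) / exp ((1 + s) * u))"
          using mM by (auto simp: indicator_def)
        ultimately show ?thesis by linarith
      qed (use mM in \<open>auto simp: indicator_def\<close>)
    qed
    also have "exp (- s) * Z \<le> C' * (1 + s) powr (- k) * Z"
      using one_plus_powr_le_exp[OF True s] mM by (intro mult_right_mono) (auto simp: C'_def)
    finally show "gegen_laplace k s \<le> (M * exp 1 * Gamma k + C' * Z) / Z * (1 + s) powr - k"
      unfolding gl using divide_right_mono[of _ "M * exp 1 * (Gamma k * (1 + s) powr (- k)) + C' * (1 + s) powr (- k) * Z" Z] mM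
      by (simp add: distrib_right mult.assoc mult.commute[of Z] add_divide_distrib)
  qed
qed

section \<open>Rescaling along orthogonal roots\<close>

definition rescale :: "'a::euclidean_space set \<Rightarrow> ('a \<Rightarrow> real) \<Rightarrow> 'a \<Rightarrow> 'a" where
  "rescale R t x = x + (\<Sum>\<beta>\<in>R. ((t \<beta> - 1) * (\<beta> \<bullet> x) / (\<beta> \<bullet> \<beta>)) *\<^sub>R \<beta>)"

text \<open>The contribution of the line spanned by \<beta> to the scalar product of x and
  y.\<close>

definition pairing :: "'a::euclidean_space \<Rightarrow> 'a \<Rightarrow> 'a \<Rightarrow> real" where
  "pairing \<beta> x y = (\<beta> \<bullet> x) * (\<beta> \<bullet> y) / (\<beta> \<bullet> \<beta>)"

locale orth_roots =
  fixes R :: "'a::euclidean_space set" and k :: "'a \<Rightarrow> real"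
  assumes finite_R [simp, intro]: "finite R"
    and root_nonzero: "\<And>\<beta>. \<beta> \<in> R \<Longrightarrow> \<beta> \<noteq> 0"
    and roots_orthogonal: "\<And>\<beta> \<gamma>. \<beta> \<in> R \<Longrightarrow> \<gamma> \<in> R \<Longrightarrow> \<beta> \<noteq> \<gamma> \<Longrightarrow> \<beta> \<bullet> \<gamma> = 0"
    and k_nonneg: "\<And>\<beta>. \<beta> \<in> R \<Longrightarrow> 0 \<le> k \<beta>"
begin

lemma rescale_cong: "(\<And>\<beta>. \<beta> \<in> R \<Longrightarrow> s \<beta> = t \<beta>) \<Longrightarrow> rescale R s x = rescale R t x"
  by (simp add: rescale_def)

lemma rescale_id: "(\<And>\<beta>. \<beta> \<in> R \<Longrightarrow> t \<beta> = 1) \<Longrightarrow> rescale R t x = x"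
  by (simp add: rescale_def)

lemma inner_rescale_root:
  assumes "\<beta> \<in> R" shows "\<beta> \<bullet> rescale R t x = t \<beta> * (\<beta> \<bullet> x)"
proof -
  have "\<beta> \<bullet> rescale R t x = \<beta> \<bullet> x + (\<Sum>\<gamma>\<in>R. if \<gamma> = \<beta> then (t \<gamma> - 1) * (\<gamma> \<bullet> x) else 0)"
    unfolding rescale_def inner_add_right inner_sum_right
    by (intro arg_cong[of _ _ "(+) (\<beta> \<bullet> x)"] sum.cong)
       (use assms roots_orthogonal root_nonzero in auto)
  also have "\<dots> = t \<beta> * (\<beta> \<bullet> x)" using assms by (simp add: algebra_simps)
  finally show ?thesis .
qed

lemma rescale_inner: "rescale R t x \<bullet> y = x \<bullet> y + (\<Sum>\<beta>\<in>R. (t \<beta> - 1) * pairing \<beta> x y)"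
  by (simp add: rescale_def inner_add_left inner_sum_left pairing_def mult.assoc)

lemma pairing_commute: "pairing \<beta> x y = pairing \<beta> y x"
  by (simp add: pairing_def mult.commute)

lemma rescale_inner_commute: "rescale R t x \<bullet> y = x \<bullet> rescale R t y"
  using rescale_inner[of t x y] rescale_inner[of t y x] by (simp add: inner_commute pairing_commute)

text \<open>Orthogonality decouples the coordinates along the roots, so rescalings compose by
  multiplying parameters. Sign vectors then form a copy of W, and self-adjointness lets every
  parameter be moved to either argument of a scalar product.\<close>

lemma rescale_rescale: "rescale R s (rescale R t x) = rescale R (\<lambda>\<beta>. s \<beta> * t \<beta>) x"
proof -
  have "rescale R s (rescale R t x) = rescale R t x + (\<Sum>\<beta>\<in>R. ((s \<beta> - 1) * (t \<beta> * (\<beta> \<bullet> x)) / (\<beta> \<bullet> \<beta>)) *\<^sub>R \<beta>)"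
    by (subst rescale_def) (simp add: inner_rescale_root)
  also have "\<dots> = rescale R (\<lambda>\<beta>. s \<beta> * t \<beta>) x"
    unfolding rescale_def add.assoc sum.distrib[symmetric] scaleR_left_distrib[symmetric] add_divide_distrib[symmetric]
    by (simp add: algebra_simps)
  finally show ?thesis .
qed

lemma linear_rescale: "linear (rescale R t)"
proof (rule linearI)
  show "rescale R t (x + y) = rescale R t x + rescale R t y" for x y
    by (simp add: rescale_def inner_add_right distrib_left add_divide_distrib scaleR_left_distrib sum.distrib)
  show "rescale R t (c *\<^sub>R x) = c *\<^sub>R rescale R t x" for c x
    by (simp add: rescale_def scaleR_add_right scaleR_sum_right mult.left_commute)
qed

text \<open>Self-adjointness and composition reduce the norm to a rescaling by the squares. The loss
  of length recorded here is the quantity that later cancels the radial terms of the Poisson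
  integrand.\<close>

lemma norm_rescale_sq: "(norm (rescale R t x))\<^sup>2 = (norm x)\<^sup>2 - (\<Sum>\<beta>\<in>R. (1 - (t \<beta>)\<^sup>2) * pairing \<beta> x x)"
proof -
  have "(norm (rescale R t x))\<^sup>2 = rescale R (\<lambda>\<beta>. t \<beta> * t \<beta>) x \<bullet> x"
    by (simp add: power2_norm_eq_inner rescale_inner_commute rescale_rescale)
  also have "\<dots> = x \<bullet> x + (\<Sum>\<beta>\<in>R. (t \<beta> * t \<beta> - 1) * pairing \<beta> x x)" by (rule rescale_inner)
  also have "(\<Sum>\<beta>\<in>R. (t \<beta> * t \<beta> - 1) * pairing \<beta> x x) = - (\<Sum>\<beta>\<in>R. (1 - (t \<beta>)\<^sup>2) * pairing \<beta> x x)"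
    unfolding sum_negf[symmetric] by (intro sum.cong) (auto simp: power2_eq_square algebra_simps)
  finally show ?thesis by (simp add: power2_norm_eq_inner)
qed

lemma pairing_self_nonneg: "pairing \<beta> x x \<ge> 0"
  by (simp add: pairing_def)

lemma norm_rescale_le:
  assumes "\<And>\<beta>. \<beta> \<in> R \<Longrightarrow> t \<beta> \<in> {-1..1}" shows "norm (rescale R t x) \<le> norm x"
proof -
  have "(\<Sum>\<beta>\<in>R. (1 - (t \<beta>)\<^sup>2) * pairing \<beta> x x) \<ge> 0"
    using assms by (intro sum_nonneg mult_nonneg_nonneg pairing_self_nonneg) (auto simp: abs_square_le_1 abs_le_iff)
  hence "(norm (rescale R t x))\<^sup>2 \<le> (norm x)\<^sup>2" unfolding norm_rescale_sq by simp
  thus ?thesis by (simp add: power2_le_iff_abs_le)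
qed

lemma norm_rescale_eq:
  assumes "\<And>\<beta>. \<beta> \<in> R \<Longrightarrow> t \<beta> \<in> {-1, 1}" shows "norm (rescale R t x) = norm x"
proof -
  have "(\<Sum>\<beta>\<in>R. (1 - (t \<beta>)\<^sup>2) * pairing \<beta> x x) = 0"
    using assms by (intro sum.neutral) fastforce
  hence "(norm (rescale R t x))\<^sup>2 = (norm x)\<^sup>2" unfolding norm_rescale_sq by simp
  thus ?thesis by simp
qed

text \<open>The rescaled point is affine in each single parameter, which is what makes
  differentiation in one coordinate of t explicit.\<close>

lemma rescale_upd:
  assumes "\<beta> \<in> R"
  shows "rescale R (t(\<beta> := s)) x = rescale R t x + ((s - t \<beta>) * (\<beta> \<bullet> x) / (\<beta> \<bullet> \<beta>)) *\<^sub>R \<beta>"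
proof -
  have "rescale R (t(\<beta> := s)) x = rescale R t x +
    (\<Sum>\<gamma>\<in>R. if \<gamma> = \<beta> then ((s - t \<gamma>) * (\<gamma> \<bullet> x) / (\<gamma> \<bullet> \<gamma>)) *\<^sub>R \<gamma> else 0)"
    unfolding rescale_def add.assoc sum.distrib[symmetric]
    by (intro arg_cong[of _ _ "(+) x"] sum.cong)
       (auto simp: scaleR_left_distrib[symmetric] add_divide_distrib[symmetric] algebra_simps)
  thus ?thesis using assms by simp
qed

lemma reflection_eq_rescale:
  assumes "\<beta> \<in> R" shows "reflection \<beta> = rescale R ((\<lambda>_. 1)(\<beta> := -1))"
  by (rule ext, subst rescale_upd[OF assms]) (simp add: rescale_id reflection_def)

lemma rescale_reflection:
  assumes "\<beta> \<in> R" shows "rescale R t (reflection \<beta> x) = rescale R (t(\<beta> := - t \<beta>)) x"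
  unfolding reflection_eq_rescale[OF assms] rescale_rescale by (intro rescale_cong) auto

lemma norm_reflection:
  assumes "\<beta> \<in> R" shows "norm (reflection \<beta> x) = norm x"
  unfolding reflection_eq_rescale[OF assms] by (rule norm_rescale_eq) auto

lemma reflection_group_rescale:
  assumes "w \<in> reflection_group R"
  shows "\<exists>F\<subseteq>R. w = rescale R (\<lambda>\<beta>. if \<beta> \<in> F then -1 else 1)"
  using assms
proof (induction rule: reflection_group.induct)
  case id
  show ?case by (intro exI[of _ "{}"]) (auto simp: rescale_id)
next
  case (step \<beta> w)
  then obtain F where F: "F \<subseteq> R" "w = rescale R (\<lambda>\<beta>. if \<beta> \<in> F then -1 else 1)" by blast
  \<comment> \<open>Composition with a reflection toggles the membership of \<beta> in the set of
    negative signs.\<close>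
  define F' where "F' = (if \<beta> \<in> F then F - {\<beta>} else insert \<beta> F)"
  have "reflection \<beta> \<circ> w = rescale R (\<lambda>\<gamma>. if \<gamma> \<in> F' then -1 else 1)"
    unfolding F(2) reflection_eq_rescale[OF step(1)] comp_def rescale_rescale
  proof (rule ext, rule rescale_cong)
    fix \<gamma> show "((\<lambda>_. 1)(\<beta> := - 1)) \<gamma> * (if \<gamma> \<in> F then - 1 else 1) = (if \<gamma> \<in> F' then - 1 else 1 :: real)"
      by (cases "\<gamma> = \<beta>"; cases "\<beta> \<in> F"; cases "\<gamma> \<in> F") (simp_all add: F'_def)
  qed
  moreover have "F' \<subseteq> R" using F(1) step(1) by (auto simp: F'_def)
  ultimately show ?case by blast
qed

lemma rescale_in_reflection_group:
  assumes "F \<subseteq> R" shows "rescale R (\<lambda>\<beta>. if \<beta> \<in> F then -1 else 1) \<in> reflection_group R"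
proof -
  have "finite F" using assms finite_subset by auto
  thus ?thesis using assms
  proof (induction F rule: finite_induct)
    case empty
    have "rescale R (\<lambda>\<beta>. if \<beta> \<in> {} then -1 else 1) = id" by (rule ext) (simp add: rescale_id)
    thus ?case using reflection_group.id by metis
  next
    case (insert \<beta> F)
    have "reflection \<beta> \<circ> rescale R (\<lambda>\<beta>. if \<beta> \<in> F then -1 else 1) \<in> reflection_group R"
      using insert by (intro reflection_group.step) auto
    also have "reflection \<beta> \<circ> rescale R (\<lambda>\<beta>. if \<beta> \<in> F then -1 else 1) = rescale R (\<lambda>\<gamma>. if \<gamma> \<in> insert \<beta> F then -1 else 1)"
    proof -
      have b: "\<beta> \<in> R" using insert by simp
      show ?thesis unfolding reflection_eq_rescale[OF b] comp_def rescale_rescale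
        by (rule ext, rule rescale_cong) (use insert in auto)
    qed
    finally show ?case .
  qed
qed

lemma rescale_signs_in_reflection_group:
  assumes "\<And>\<beta>. \<beta> \<in> R \<Longrightarrow> \<epsilon> \<beta> \<in> {-1, 1}" shows "rescale R \<epsilon> \<in> reflection_group R"
proof -
  have "rescale R \<epsilon> = rescale R (\<lambda>\<beta>. if \<beta> \<in> {\<beta>\<in>R. \<epsilon> \<beta> = -1} then -1 else 1)"
    using assms by (intro ext rescale_cong) auto
  thus ?thesis using rescale_in_reflection_group[of "{\<beta>\<in>R. \<epsilon> \<beta> = -1}"] by auto
qed

lemma finite_reflection_group: "finite (reflection_group R)"
proof (rule finite_subset)
  show "reflection_group R \<subseteq> (\<lambda>F. rescale R (\<lambda>\<beta>. if \<beta> \<in> F then -1 else 1)) ` Pow R"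
    using reflection_group_rescale by blast
qed auto

lemma norm_reflection_group: "w \<in> reflection_group R \<Longrightarrow> norm (w x) = norm x"
  using reflection_group_rescale[of w] by (auto intro!: norm_rescale_eq)

section \<open>The product of the symmetric beta distributions\<close>

abbreviation GM :: "('a \<Rightarrow> real) measure" where
  "GM \<equiv> PiM R (\<lambda>\<beta>. gegen (k \<beta>))"

sublocale P: product_sigma_finite "\<lambda>\<beta>. gegen (k \<beta>)"
  by (rule product_sigma_finite.intro) (rule prob_space_imp_sigma_finite[OF prob_space_gegen])

sublocale GM: prob_space GM
  by (rule prob_space_PiM) (rule prob_space_gegen)

lemma space_GM: "t \<in> space GM \<Longrightarrow> \<beta> \<in> R \<Longrightarrow> t \<beta> \<in> {-1..1}"
  by (auto simp: space_PiM PiE_def Pi_def)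

lemma measurable_GM_coord [measurable]: "\<beta> \<in> R \<Longrightarrow> (\<lambda>t. t \<beta>) \<in> borel_measurable GM"
proof -
  have "(\<lambda>t. t) \<in> borel_measurable (gegen (k \<beta>))"
    by (rule measurable_gegen_continuous) (intro continuous_intros)
  moreover assume "\<beta> \<in> R"
  ultimately show ?thesis
    using measurable_compose[OF measurable_component_singleton[of \<beta> R "\<lambda>\<beta>. gegen (k \<beta>)"]] by blast
qed

lemma measurable_rescale [measurable]: "(\<lambda>t. rescale R t x) \<in> borel_measurable GM"
  unfolding rescale_def by measurable

lemma norm_rescale_GM: "t \<in> space GM \<Longrightarrow> norm (rescale R t x) \<le> norm x"
  using space_GM by (intro norm_rescale_le) auto

lemma integrable_GM_bounded:
  fixes f :: "('a \<Rightarrow> real) \<Rightarrow> real"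
  assumes "f \<in> borel_measurable GM" "\<And>t. t \<in> space GM \<Longrightarrow> \<bar>f t\<bar> \<le> B"
  shows "integrable GM f"
  by (rule GM.integrable_const_bound[of _ B]) (use assms in auto)

lemma integral_GM_coord:
  fixes f :: "('a \<Rightarrow> real) \<Rightarrow> real"
  assumes "\<beta> \<in> R" "integrable GM f"
  shows "(LINT t|GM. f t) = (LINT t|PiM (R - {\<beta>}) (\<lambda>\<beta>. gegen (k \<beta>)). LINT s|gegen (k \<beta>). f (t(\<beta> := s)))"
  using P.product_integral_insert[of "R - {\<beta>}" \<beta> f] assms by (simp add: insert_absorb)

lemma measurable_GM_upd:
  fixes f :: "('a \<Rightarrow> real) \<Rightarrow> real"
  assumes "\<beta> \<in> R" "f \<in> borel_measurable GM" "t \<in> space (PiM (R - {\<beta>}) (\<lambda>\<beta>. gegen (k \<beta>)))"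
  shows "(\<lambda>s. f (t(\<beta> := s))) \<in> borel_measurable (gegen (k \<beta>))"
  using measurable_compose[OF measurable_component_update[OF assms(3)], of \<beta> f borel] assms
  by (simp add: insert_absorb)

lemma GM_upd_space:
  assumes "\<beta> \<in> R" "t \<in> space (PiM (R - {\<beta>}) (\<lambda>\<beta>. gegen (k \<beta>)))" "s \<in> {-1..1}"
  shows "t(\<beta> := s) \<in> space GM"
  using assms by (auto simp: space_PiM PiE_def Pi_def extensional_def)

lemma measurable_GM_flip:
  assumes "\<beta> \<in> R" shows "(\<lambda>t. t(\<beta> := - t \<beta>)) \<in> GM \<rightarrow>\<^sub>M GM"
proof (rule measurable_PiM_single')
  fix \<gamma> assume g: "\<gamma> \<in> R"
  have "(\<lambda>t. (t(\<beta> := - t \<beta>)) \<gamma>) \<in> GM \<rightarrow>\<^sub>M restrict_space borel {-1..1}"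
    using g assms by (intro measurable_restrict_space2) (auto simp: Pi_def dest: space_GM)
  thus "(\<lambda>t. (t(\<beta> := - t \<beta>)) \<gamma>) \<in> GM \<rightarrow>\<^sub>M gegen (k \<gamma>)"
    by (subst measurable_cong_sets[OF refl sets_gegen])
next
  show "(\<lambda>t. t(\<beta> := - t \<beta>)) \<in> space GM \<rightarrow> (\<Pi>\<^sub>E i\<in>R. space (gegen (k i)))"
    using assms by (auto simp: space_PiM PiE_def Pi_def extensional_def)
qed

text \<open>Symmetry of the one-dimensional law, transported by Fubini; the bound on
  \<open>f\<close> supplies the integrability.\<close>

lemma integral_GM_flip:
  fixes f :: "('a \<Rightarrow> real) \<Rightarrow> real"
  assumes b: "\<beta> \<in> R" and m: "f \<in> borel_measurable GM" and B: "\<And>t. t \<in> space GM \<Longrightarrow> \<bar>f t\<bar> \<le> B"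
  shows "(LINT t|GM. f (t(\<beta> := - t \<beta>))) = (LINT t|GM. f t)"
proof -
  let ?N = "PiM (R - {\<beta>}) (\<lambda>\<beta>. gegen (k \<beta>))"
  note fl = measurable_GM_flip[OF b]
  have "integrable GM (\<lambda>t. f (t(\<beta> := - t \<beta>)))"
    using measurable_compose[OF fl m] measurable_space[OF fl] by (intro integrable_GM_bounded[where B=B] B) auto
  hence "(LINT t|GM. f (t(\<beta> := - t \<beta>))) = (LINT t|?N. LINT s|gegen (k \<beta>). f (t(\<beta> := - s)))"
    by (subst integral_GM_coord[OF b]) (simp_all)
  also have "\<dots> = (LINT t|?N. LINT s|gegen (k \<beta>). f (t(\<beta> := s)))"
    by (intro Bochner_Integration.integral_cong refl gegen_symmetric measurable_GM_upd[OF b m])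
  also have "\<dots> = (LINT t|GM. f t)"
    by (intro integral_GM_coord[OF b, symmetric] integrable_GM_bounded[where B=B] m B)
  finally show ?thesis .
qed

text \<open>The one-dimensional identity on each fibre of the coordinate \<beta>, integrated over
  the remaining coordinates. The bounds make both sides integrable and the derivative bounded on
  every fibre.\<close>

lemma GM_integration_by_parts:
  fixes h h' :: "('a \<Rightarrow> real) \<Rightarrow> real"
  assumes b: "\<beta> \<in> R"
    and D: "\<And>t s. t \<in> space GM \<Longrightarrow> s \<in> {-1..1} \<Longrightarrow>
      ((\<lambda>s. h (t(\<beta> := s))) has_real_derivative h' (t(\<beta> := s))) (at s within {-1..1})"
    and m: "h \<in> borel_measurable GM" "h' \<in> borel_measurable GM"
    and B: "\<And>t. t \<in> space GM \<Longrightarrow> \<bar>h t\<bar> \<le> B" "\<And>t. t \<in> space GM \<Longrightarrow> \<bar>h' t\<bar> \<le> B'"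
  shows "(LINT t|GM. (1 - (t \<beta>)\<^sup>2) * h' t) = 2 * k \<beta> * (LINT t|GM. t \<beta> * h t)"
proof -
  let ?N = "PiM (R - {\<beta>}) (\<lambda>\<beta>. gegen (k \<beta>))"
  have sq: "\<bar>1 - (t \<beta>)\<^sup>2\<bar> \<le> 1" "\<bar>t \<beta>\<bar> \<le> 1" if "t \<in> space GM" for t
  proof -
    show "\<bar>t \<beta>\<bar> \<le> 1" using space_GM[OF that b] by auto
    hence "(t \<beta>)\<^sup>2 \<le> 1" by (simp add: abs_square_le_1)
    thus "\<bar>1 - (t \<beta>)\<^sup>2\<bar> \<le> 1" by auto
  qed
  have "(LINT t|GM. (1 - (t \<beta>)\<^sup>2) * h' t) = (LINT t|?N. LINT s|gegen (k \<beta>). (1 - s\<^sup>2) * h' (t(\<beta> := s)))"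
    using b m B(2) sq by (subst integral_GM_coord[OF b])
      (auto intro!: integrable_GM_bounded[where B="1 * B'"] mult_mono[where b=1 and d=B', simplified mult_1] simp: abs_mult simp del: mult_1)
  also have "\<dots> = (LINT t|?N. 2 * k \<beta> * (LINT s|gegen (k \<beta>). s * h (t(\<beta> := s))))"
  proof (rule Bochner_Integration.integral_cong[OF refl])
    fix t assume t: "t \<in> space ?N"
    show "(LINT s|gegen (k \<beta>). (1 - s\<^sup>2) * h' (t(\<beta> := s))) = 2 * k \<beta> * (LINT s|gegen (k \<beta>). s * h (t(\<beta> := s)))"
    proof (rule gegen_integration_by_parts[where B=B'])
      fix s :: real assume s: "s \<in> {-1..1}"
      show "((\<lambda>s. h (t(\<beta> := s))) has_real_derivative h' (t(\<beta> := s))) (at s within {-1..1})"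
        using D[OF GM_upd_space[OF b t, of 0] s] by simp
      show "\<bar>h' (t(\<beta> := s))\<bar> \<le> B'" by (intro B GM_upd_space b t s)
    qed (use b k_nonneg measurable_GM_upd[OF b m(2) t] in auto)
  qed
  also have "\<dots> = 2 * k \<beta> * (LINT t|?N. LINT s|gegen (k \<beta>). s * h (t(\<beta> := s)))" by simp
  also have "(LINT t|?N. LINT s|gegen (k \<beta>). s * h (t(\<beta> := s))) = (LINT t|GM. t \<beta> * h t)"
    using b m B(1) sq by (subst integral_GM_coord[OF b])
      (auto intro!: integrable_GM_bounded[where B="1 * B"] mult_mono[where b=1 and d=B, simplified mult_1] simp: abs_mult simp del: mult_1)
  finally show ?thesis .
qed

text \<open>A reflection of x only changes the sign of one parameter, and the product law does not
  see that sign. This is the W-invariance behind both kernels.\<close>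

lemma integral_GM_reflection_group:
  fixes f :: "'a \<Rightarrow> real"
  assumes "w \<in> reflection_group R" and m: "f \<in> borel_measurable borel"
    and B: "\<And>z. norm z \<le> norm x \<Longrightarrow> \<bar>f z\<bar> \<le> B"
  shows "(LINT t|GM. f (rescale R t (w x))) = (LINT t|GM. f (rescale R t x))"
  using assms(1)
proof (induction rule: reflection_group.induct)
  case (step \<beta> w)
  have [measurable]: "f \<in> borel_measurable borel" by fact
  have "(LINT t|GM. f (rescale R t ((reflection \<beta> \<circ> w) x))) = (LINT t|GM. f (rescale R (t(\<beta> := - t \<beta>)) (w x)))"
    by (simp add: rescale_reflection[OF step(1)])
  also have "\<dots> = (LINT t|GM. f (rescale R t (w x)))"
  proof (rule integral_GM_flip[OF step(1)])
    fix t assume "t \<in> space GM"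
    thus "\<bar>f (rescale R t (w x))\<bar> \<le> B"
      using norm_rescale_GM[of t "w x"] norm_reflection_group[OF step(2)] by (intro B) simp
  qed measurable
  finally show ?case using step by simp
qed simp

section \<open>Laplace transforms of the product law\<close>

lemma GM_laplace:
  "(LINT t|GM. exp (- (\<Sum>\<beta>\<in>R. (1 - t \<beta>) * s \<beta>))) = (\<Prod>\<beta>\<in>R. gegen_laplace (k \<beta>) (s \<beta>))"
proof -
  have "(LINT t|GM. exp (- (\<Sum>\<beta>\<in>R. (1 - t \<beta>) * s \<beta>))) = (LINT t|GM. (\<Prod>\<beta>\<in>R. exp (- ((1 - t \<beta>) * s \<beta>))))"
    by (simp add: exp_sum sum_negf[symmetric])
  also have "\<dots> = (\<Prod>\<beta>\<in>R. LINT t|gegen (k \<beta>). exp (- ((1 - t) * s \<beta>)))"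
  proof (rule P.product_integral_prod[where f="\<lambda>\<beta> t. exp (- ((1 - t) * s \<beta>))"])
    fix \<beta>
    show "integrable (gegen (k \<beta>)) (\<lambda>t. exp (- ((1 - t) * s \<beta>)))"
      by (intro integrable_gegen_continuous continuous_intros)
  qed auto
  finally show ?thesis by (simp add: gegen_laplace_def)
qed

text \<open>It suffices that E[t exp(-(1 - t) s)] is nonnegative. Averaging t and -t turns the
  integrand into t times the difference of two exponentials, and that difference has the sign of t
  for s \<ge> 0.\<close>

lemma gegen_laplace_le_weighted:
  assumes "s \<ge> 0"
  shows "gegen_laplace c s \<le> (LINT t|gegen c. (1 + t) * exp (- ((1 - t) * s)))"
proof -
  have "(LINT t|gegen c. (- t) * exp (- ((1 - (- t)) * s))) = (LINT t|gegen c. t * exp (- ((1 - t) * s)))"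
    by (rule gegen_symmetric[where f="\<lambda>t. t * exp (- ((1 - t) * s))"]) (intro measurable_gegen_continuous continuous_intros)
  hence "2 * (LINT t|gegen c. t * exp (- ((1 - t) * s))) = (LINT t|gegen c. t * exp (- ((1 - t) * s))) + (LINT t|gegen c. (- t) * exp (- ((1 - (- t)) * s)))"
    by simp
  also have "\<dots> = (LINT t|gegen c. t * exp (- ((1 - t) * s)) + (- t) * exp (- ((1 - (- t)) * s)))"
    by (intro Bochner_Integration.integral_add[symmetric] integrable_gegen_continuous continuous_intros)
  also have "\<dots> \<ge> 0"
  proof (rule Bochner_Integration.integral_nonneg)
    fix t :: real
    have "0 \<le> t * (exp (- ((1 - t) * s)) - exp (- ((1 + t) * s)))"
    proof (cases "t \<ge> 0")
      case True
      hence "(1 - t) * s \<le> (1 + t) * s" using assms by (intro mult_right_mono) auto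
      thus ?thesis using True by simp
    next
      case False
      hence "(1 + t) * s \<le> (1 - t) * s" using assms by (intro mult_right_mono) auto
      thus ?thesis using False by (intro mult_nonpos_nonpos) auto
    qed
    thus "0 \<le> t * exp (- ((1 - t) * s)) + (- t) * exp (- ((1 - (- t)) * s))" by (simp add: algebra_simps)
  qed
  finally have "0 \<le> (LINT t|gegen c. t * exp (- ((1 - t) * s)))" by simp
  moreover have "(LINT t|gegen c. (1 + t) * exp (- ((1 - t) * s))) = gegen_laplace c s + (LINT t|gegen c. t * exp (- ((1 - t) * s)))"
    unfolding gegen_laplace_def distrib_right mult_1
    by (intro Bochner_Integration.integral_add integrable_gegen_continuous continuous_intros)
  ultimately show ?thesis by simp
qed

lemma gegen_laplace_nonneg: "gegen_laplace c s \<ge> 0"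
  unfolding gegen_laplace_def by (intro Bochner_Integration.integral_nonneg) auto

text \<open>Gives the lower bound for the Dunkl kernel itself at points with nonnegative pairings,
  without averaging over W.\<close>

lemma GM_laplace_weighted_ge:
  assumes "\<And>\<beta>. \<beta> \<in> R \<Longrightarrow> s \<beta> \<ge> 0"
  shows "(\<Prod>\<beta>\<in>R. gegen_laplace (k \<beta>) (s \<beta>)) \<le>
    (LINT t|GM. (\<Prod>\<beta>\<in>R. 1 + t \<beta>) * exp (- (\<Sum>\<beta>\<in>R. (1 - t \<beta>) * s \<beta>)))"
proof -
  have "(LINT t|GM. (\<Prod>\<beta>\<in>R. 1 + t \<beta>) * exp (- (\<Sum>\<beta>\<in>R. (1 - t \<beta>) * s \<beta>))) =
     (LINT t|GM. (\<Prod>\<beta>\<in>R. (1 + t \<beta>) * exp (- ((1 - t \<beta>) * s \<beta>))))"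
    by (simp add: exp_sum sum_negf[symmetric] prod.distrib)
  also have "\<dots> = (\<Prod>\<beta>\<in>R. LINT t|gegen (k \<beta>). (1 + t) * exp (- ((1 - t) * s \<beta>)))"
  proof (rule P.product_integral_prod[where f="\<lambda>\<beta> t. (1 + t) * exp (- ((1 - t) * s \<beta>))"])
    fix \<beta>
    show "integrable (gegen (k \<beta>)) (\<lambda>t. (1 + t) * exp (- ((1 - t) * s \<beta>)))"
      by (intro integrable_gegen_continuous continuous_intros)
  qed auto
  finally show ?thesis
    using assms by (auto intro!: prod_mono gegen_laplace_nonneg gegen_laplace_le_weighted)
qed

declare measurable_GM_coord [measurable del]

end

section \<open>Gaussian subordination and two-sided bounds\<close>

text \<open>At 0 the exponential beats every power of v; at infinity the integrand is at most v^(g -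
  m - 1), integrable because g < m.\<close>

lemma nn_integral_powr_exp_finite:
  fixes m g :: real
  assumes "m > 0" "g < m"
  shows "(\<integral>\<^sup>+v. ennreal (indicator {0<..} v * (v powr (- m - 1) * exp (- (1 / (4 * v))) * max v 1 powr g)) \<partial>lborel) < \<infinity>"
proof -
  \<comment> \<open>\<open>one_plus_powr_le_exp\<close> with exponent m + 1 at s = 1/(4 v) bounds
    the exponential by C v^(m + 1), which cancels v^(-m - 1) exactly.\<close>
  define C where "C = exp (1 - (m + 1) + (m + 1) * ln (m + 1)) * 4 powr (m + 1)"
  have le: "indicator {0<..} v * (v powr (- m - 1) * exp (- (1 / (4 * v))) * max v 1 powr g)
     \<le> C * indicator {0..1} v + indicator {1..} v * v powr (g - m - 1)" for v :: real
  proof -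
    consider "v \<le> 0" | "0 < v" "v < 1" | "1 \<le> v" by linarith
    thus ?thesis
    proof cases
      case 2
      have "exp (- (1 / (4 * v))) \<le> exp (1 - (m + 1) + (m + 1) * ln (m + 1)) * (1 + 1 / (4 * v)) powr (- (m + 1))"
        using assms 2 by (intro one_plus_powr_le_exp) auto
      also have "(1 + 1 / (4 * v)) powr (- (m + 1)) \<le> (1 / (4 * v)) powr (- (m + 1))"
        using assms 2 by (intro powr_mono2') auto
      also have "(1 / (4 * v)) powr (- (m + 1)) = 4 powr (m + 1) * v powr (m + 1)"
        using 2 by (simp add: powr_def ln_div ln_mult exp_add[symmetric] algebra_simps)
      finally have "exp (- (1 / (4 * v))) \<le> C * v powr (m + 1)"
        by (simp add: C_def mult.assoc)
      hence "v powr (- m - 1) * exp (- (1 / (4 * v))) \<le> v powr (- m - 1) * (C * v powr (m + 1))"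
        by (intro mult_left_mono) auto
      also have "\<dots> = C * (v powr (- m - 1) * v powr (m + 1))" by simp
      also have "v powr (- m - 1) * v powr (m + 1) = 1" using 2 by (simp add: powr_add[symmetric])
      finally show ?thesis using 2 by simp
    next
      case 3
      have "v powr (- m - 1) * exp (- (1 / (4 * v))) * v powr g \<le> v powr (- m - 1) * 1 * v powr g"
        using 3 by (intro mult_right_mono mult_left_mono) auto
      also have "\<dots> = v powr (g - m - 1)"
        unfolding mult_1_right powr_add[symmetric] by (simp add: algebra_simps)
      finally show ?thesis using 3 by (auto simp: max_def indicator_def C_def intro: add_increasing)
    qed (auto simp: C_def indicator_def)
  qed
  have "((\<lambda>v. v powr (g - m - 1)) has_integral -(1 powr ((g - m - 1) + 1)) / ((g - m - 1) + 1)) {1..}"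
    using assms by (intro has_integral_powr_to_inf) auto
  hence "(\<integral>\<^sup>+v. ennreal (indicator {1..} v * v powr (g - m - 1)) \<partial>lborel) = ennreal (-(1 powr ((g - m - 1) + 1)) / ((g - m - 1) + 1))"
    using nn_integral_has_integral_lebesgue[of "{1..}" "\<lambda>v. v powr (g - m - 1)"] by simp
  hence *: "(\<integral>\<^sup>+v. ennreal (indicator {1..} v * v powr (g - m - 1)) \<partial>lborel) < \<infinity>" by simp
  have "(\<integral>\<^sup>+v. ennreal (indicator {0<..} v * (v powr (- m - 1) * exp (- (1 / (4 * v))) * max v 1 powr g)) \<partial>lborel)
     \<le> (\<integral>\<^sup>+v. ennreal C * indicator {0..1} v + ennreal (indicator {1..} v * v powr (g - m - 1)) \<partial>lborel)"
  proof (rule nn_integral_mono)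
    fix v :: real
    have "ennreal (indicator {0<..} v * (v powr (- m - 1) * exp (- (1 / (4 * v))) * max v 1 powr g))
      \<le> ennreal (C * indicator {0..1} v + indicator {1..} v * v powr (g - m - 1))"
      by (rule ennreal_leI[OF le])
    also have "\<dots> = ennreal C * indicator {0..1} v + ennreal (indicator {1..} v * v powr (g - m - 1))"
      by (subst ennreal_plus) (auto simp: C_def indicator_def)
    finally show "ennreal (indicator {0<..} v * (v powr (- m - 1) * exp (- (1 / (4 * v))) * max v 1 powr g))
      \<le> ennreal C * indicator {0..1} v + ennreal (indicator {1..} v * v powr (g - m - 1))" .
  qed
  also have "\<dots> = ennreal C * emeasure lborel {0..1::real} + (\<integral>\<^sup>+v. ennreal (indicator {1..} v * v powr (g - m - 1)) \<partial>lborel)"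
    by (subst nn_integral_add) (auto simp: nn_integral_cmult_indicator)
  also have "\<dots> < \<infinity>" using * by (simp add: ennreal_mult_less_top)
  finally show ?thesis .
qed

text \<open>For l > 0 the substitution w = 1/(4 v) identifies this number with
  \<open>4 powr l * Gamma l\<close>.\<close>

definition riesz_const :: "real \<Rightarrow> real" where
  "riesz_const l = enn2real (\<integral>\<^sup>+v. ennreal (indicator {0<..} v * (v powr (- l - 1) * exp (- (1 / (4 * v))))) \<partial>lborel)"

lemma riesz_const:
  assumes "l > 0"
  shows "(\<integral>\<^sup>+v. ennreal (indicator {0<..} v * (v powr (- l - 1) * exp (- (1 / (4 * v))))) \<partial>lborel) = ennreal (riesz_const l)"
    and "riesz_const l > 0"
proof -
  let ?I = "\<integral>\<^sup>+v. ennreal (indicator {0<..} v * (v powr (- l - 1) * exp (- (1 / (4 * v))))) \<partial>lborel"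
  have "max v 1 powr 0 = (1::real)" for v :: real by (simp add: max_def)
  hence "?I < \<infinity>" using nn_integral_powr_exp_finite[of l 0] assms by (simp del: powr_zero_eq_one powr_0)
  thus 1: "?I = ennreal (riesz_const l)" by (simp add: riesz_const_def)
  have "?I \<noteq> 0"
  proof
    assume "?I = 0"
    hence "AE v in lborel. ennreal (indicator {0<..} v * (v powr (- l - 1) * exp (- (1 / (4 * v))))) = 0"
      by (subst (asm) nn_integral_0_iff_AE) auto
    hence "AE v in lborel. v \<notin> {0<..<1::real}"
      by eventually_elim (auto simp: indicator_def ennreal_eq_0_iff mult_le_0_iff split: if_splits)
    hence "emeasure lborel {0<..<1::real} = 0"
      by (subst (asm) AE_iff_measurable[OF _ refl]) (auto simp: greaterThanLessThan_def Int_def)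
    thus False by simp
  qed
  thus "riesz_const l > 0" unfolding 1 by (simp add: ennreal_eq_0_iff)
qed

lemma nn_integral_scale_pos:
  fixes f :: "real \<Rightarrow> real"
  assumes [measurable]: "f \<in> borel_measurable borel" and a: "a > 0"
  shows "(\<integral>\<^sup>+u. ennreal (indicator {0<..} u * f u) \<partial>lborel) = ennreal a * (\<integral>\<^sup>+v. ennreal (indicator {0<..} v * f (a * v)) \<partial>lborel)"
  using a by (subst nn_integral_real_affine[where c=a and t=0])
    (auto intro!: arg_cong2[of _ _ _ _ "(*)"] nn_integral_cong simp: indicator_def zero_less_mult_iff)

text \<open>The substitution u = A v reduces to A = 1. In this form a power of A is a superposition
  of Gaussian factors exp(-A/(4u)), so u plays the role of the time of a heat kernel.\<close>

lemma riesz_identity: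
  assumes l: "l > 0" and A: "A > 0"
  shows "(\<integral>\<^sup>+u. ennreal (indicator {0<..} u * (u powr (- l - 1) * exp (- (A / (4 * u))))) \<partial>lborel) = ennreal (riesz_const l * A powr (- l))"
proof -
  have "(\<integral>\<^sup>+u. ennreal (indicator {0<..} u * (u powr (- l - 1) * exp (- (A / (4 * u))))) \<partial>lborel)
     = ennreal A * (\<integral>\<^sup>+v. ennreal (indicator {0<..} v * ((A * v) powr (- l - 1) * exp (- (A / (4 * (A * v)))))) \<partial>lborel)"
    using A by (intro nn_integral_scale_pos) auto
  also have "(\<integral>\<^sup>+v. ennreal (indicator {0<..} v * ((A * v) powr (- l - 1) * exp (- (A / (4 * (A * v)))))) \<partial>lborel)
     = (\<integral>\<^sup>+v. ennreal (A powr (- l - 1)) * ennreal (indicator {0<..} v * (v powr (- l - 1) * exp (- (1 / (4 * v))))) \<partial>lborel)"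
    using A by (intro nn_integral_cong) (auto simp: ennreal_mult'[symmetric] indicator_def powr_mult)
  also have "\<dots> = ennreal (A powr (- l - 1)) * ennreal (riesz_const l)"
    by (subst nn_integral_cmult) (auto simp: riesz_const(1)[OF l])
  also have "ennreal A * \<dots> = ennreal (A * A powr (- l - 1) * riesz_const l)"
    using A riesz_const(2)[OF l] by (simp add: ennreal_mult' mult.assoc)
  also have "A * A powr (- l - 1) = A powr (- l)" using A by (simp add: powr_diff)
  finally show ?thesis by (simp add: mult.commute)
qed

section \<open>Two-sided bounds for the time integrals\<close>

context orth_roots
begin

text \<open>D stands for |x - y| and s \<beta> for the pairing of x and y along \<beta>. For l =
  \<lambda> - 1 it is the time integral behind the Newton kernel, for l = \<lambda> the Gamma
  integral behind the Poisson kernel.\<close>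

definition heat_integral :: "real \<Rightarrow> real \<Rightarrow> ('a \<Rightarrow> real) \<Rightarrow> ennreal" where
  "heat_integral l D s = (\<integral>\<^sup>+u. ennreal (indicator {0<..} u *
     (u powr (- l - 1) * exp (- (D\<^sup>2 / (4 * u))) * (\<Prod>\<beta>\<in>R. gegen_laplace (k \<beta>) (s \<beta> / (2 * u))))) \<partial>lborel)"

text \<open>With D and s as in \<open>heat_integral\<close>, the base D^2 + 4 s \<beta> is the
  squared distance of x to the mirror image of y, and 2 (l - \<gamma>) is d - 2 or d. It is the
  right-hand side of the estimates to be proved.\<close>

definition comparison :: "real \<Rightarrow> real \<Rightarrow> ('a \<Rightarrow> real) \<Rightarrow> real" where
  "comparison l D s = D powr (- 2 * (l - dunkl_gamma R k)) * (\<Prod>\<beta>\<in>R. (D\<^sup>2 + 4 * s \<beta>) powr (- k \<beta>))"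

lemma gegen_laplace_measurable [measurable]: "gegen_laplace c \<in> borel_measurable borel"
proof -
  have *: "(\<lambda>t. t) \<in> borel_measurable (gegen c)"
    by (intro measurable_gegen_continuous continuous_intros)
  interpret prob_space "gegen c" by (rule prob_space_gegen)
  have [measurable]: "(\<lambda>p. snd p) \<in> borel_measurable ((borel :: real measure) \<Otimes>\<^sub>M gegen c)"
    by (rule measurable_compose[OF measurable_snd *])
  show ?thesis unfolding gegen_laplace_def[abs_def]
    by (intro borel_measurable_lebesgue_integral) measurable
qed

lemma prod_gegen_laplace_measurable':
  "(\<lambda>u. \<Prod>\<beta>\<in>R. gegen_laplace (k \<beta>) (s \<beta> / (2 * (c * u)))) \<in> borel_measurable borel"
proof (rule borel_measurable_prod)
  fix \<beta>
  have "(\<lambda>u. s \<beta> / (2 * (c * u))) \<in> borel_measurable borel" by simp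
  from measurable_compose[OF this gegen_laplace_measurable]
  show "(\<lambda>u. gegen_laplace (k \<beta>) (s \<beta> / (2 * (c * u)))) \<in> borel_measurable borel" .
qed

lemma prod_gegen_laplace_measurable:
  "(\<lambda>u. \<Prod>\<beta>\<in>R. gegen_laplace (k \<beta>) (s \<beta> / (2 * u))) \<in> borel_measurable borel"
  using prod_gegen_laplace_measurable'[of s 1] by simp

lemma prod_gegen_laplace_bounds:
  "\<exists>c C. 0 < c \<and> 0 < C \<and> (\<forall>s. (\<forall>\<beta>\<in>R. 0 \<le> s \<beta>) \<longrightarrow>
     c * (\<Prod>\<beta>\<in>R. (1 + s \<beta>) powr (- k \<beta>)) \<le> (\<Prod>\<beta>\<in>R. gegen_laplace (k \<beta>) (s \<beta>)) \<and>
     (\<Prod>\<beta>\<in>R. gegen_laplace (k \<beta>) (s \<beta>)) \<le> C * (\<Prod>\<beta>\<in>R. (1 + s \<beta>) powr (- k \<beta>)))"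
proof -
  obtain c C where cC: "\<And>\<beta>. \<beta> \<in> R \<Longrightarrow> 0 < c \<beta> \<and> 0 < C \<beta> \<and> (\<forall>s\<ge>0. c \<beta> * (1 + s) powr (- k \<beta>) \<le> gegen_laplace (k \<beta>) s \<and> gegen_laplace (k \<beta>) s \<le> C \<beta> * (1 + s) powr (- k \<beta>))"
    using gegen_laplace_bounds[OF k_nonneg] by metis
  show ?thesis
    by (rule exI[of _ "\<Prod>\<beta>\<in>R. c \<beta>"], rule exI[of _ "\<Prod>\<beta>\<in>R. C \<beta>"])
       (auto simp: prod.distrib[symmetric] intro!: prod_pos prod_mono mult_nonneg_nonneg gegen_laplace_nonneg dest: cC less_imp_le)
qed

lemma heat_integral_scaled:
  assumes "D > 0"
  shows "heat_integral l D s = (\<integral>\<^sup>+v. ennreal (D\<^sup>2 powr (- l) * (indicator {0<..} v *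
     (v powr (- l - 1) * exp (- (1 / (4 * v))) * (\<Prod>\<beta>\<in>R. gegen_laplace (k \<beta>) (s \<beta> / (2 * (D\<^sup>2 * v))))))) \<partial>lborel)"
proof -
  have "heat_integral l D s = ennreal (D\<^sup>2) * (\<integral>\<^sup>+v. ennreal (indicator {0<..} v *
     ((D\<^sup>2 * v) powr (- l - 1) * exp (- (D\<^sup>2 / (4 * (D\<^sup>2 * v)))) * (\<Prod>\<beta>\<in>R. gegen_laplace (k \<beta>) (s \<beta> / (2 * (D\<^sup>2 * v)))))) \<partial>lborel)"
    unfolding heat_integral_def using assms by (intro nn_integral_scale_pos borel_measurable_times prod_gegen_laplace_measurable) auto
  also have "\<dots> = (\<integral>\<^sup>+v. ennreal (D\<^sup>2) * ennreal (indicator {0<..} v *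
     ((D\<^sup>2 * v) powr (- l - 1) * exp (- (D\<^sup>2 / (4 * (D\<^sup>2 * v)))) * (\<Prod>\<beta>\<in>R. gegen_laplace (k \<beta>) (s \<beta> / (2 * (D\<^sup>2 * v)))))) \<partial>lborel)"
    using prod_gegen_laplace_measurable'[of s "D\<^sup>2"]
    by (intro nn_integral_cmult[symmetric] measurable_compose[OF _ measurable_ennreal] borel_measurable_times) auto
  also have "\<dots> = (\<integral>\<^sup>+v. ennreal (D\<^sup>2 powr (- l) * (indicator {0<..} v *
     (v powr (- l - 1) * exp (- (1 / (4 * v))) * (\<Prod>\<beta>\<in>R. gegen_laplace (k \<beta>) (s \<beta> / (2 * (D\<^sup>2 * v))))))) \<partial>lborel)"
  proof (rule nn_integral_cong)
    fix v :: real
    have "D\<^sup>2 * D\<^sup>2 powr (- l - 1) = D\<^sup>2 powr (- l)" using assms by (simp add: powr_diff)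
    thus "ennreal (D\<^sup>2) * ennreal (indicator {0<..} v *
     ((D\<^sup>2 * v) powr (- l - 1) * exp (- (D\<^sup>2 / (4 * (D\<^sup>2 * v)))) * (\<Prod>\<beta>\<in>R. gegen_laplace (k \<beta>) (s \<beta> / (2 * (D\<^sup>2 * v)))))) =
     ennreal (D\<^sup>2 powr (- l) * (indicator {0<..} v *
     (v powr (- l - 1) * exp (- (1 / (4 * v))) * (\<Prod>\<beta>\<in>R. gegen_laplace (k \<beta>) (s \<beta> / (2 * (D\<^sup>2 * v)))))))"
      using assms by (auto simp: ennreal_mult'[symmetric] indicator_def powr_mult mult.assoc[symmetric])
  qed
  finally show ?thesis .
qed

text \<open>The substitution u = D^2 v leaves an integral in v in which the product of Laplace
  transforms differs from that of (D^2/(D^2 + 4 s))^k by at most a power of max(v, 1), up to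
  constants. The condition \<gamma> < l makes the resulting majorant integrable at infinity; for the
  lower bound v in [1, 2] is enough.\<close>

lemma heat_integral_bounds:
  assumes l: "dunkl_gamma R k < l"
  shows "\<exists>c C. 0 < c \<and> 0 < C \<and> (\<forall>D s. 0 < D \<longrightarrow> (\<forall>\<beta>\<in>R. 0 \<le> s \<beta>) \<longrightarrow>
     ennreal (c * comparison l D s) \<le> heat_integral l D s \<and> heat_integral l D s \<le> ennreal (C * comparison l D s))"
proof -
  define g where "g = dunkl_gamma R k"
  have g0: "g \<ge> 0" unfolding g_def dunkl_gamma_def by (intro sum_nonneg k_nonneg)
  obtain c C where cC: "0 < c" "0 < C" "\<And>s. (\<forall>\<beta>\<in>R. 0 \<le> s \<beta>) \<Longrightarrow>
     c * (\<Prod>\<beta>\<in>R. (1 + s \<beta>) powr (- k \<beta>)) \<le> (\<Prod>\<beta>\<in>R. gegen_laplace (k \<beta>) (s \<beta>)) \<and>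
     (\<Prod>\<beta>\<in>R. gegen_laplace (k \<beta>) (s \<beta>)) \<le> C * (\<Prod>\<beta>\<in>R. (1 + s \<beta>) powr (- k \<beta>))"
    using prod_gegen_laplace_bounds by blast
  let ?J = "\<integral>\<^sup>+v. ennreal (indicator {0<..} v * (v powr (- l - 1) * exp (- (1 / (4 * v))) * max v 1 powr g)) \<partial>lborel"
  obtain J where J: "?J = ennreal J" "J \<ge> 0"
  proof -
    have "?J < \<infinity>" using nn_integral_powr_exp_finite[of l g] l g0 by (simp add: g_def)
    thus thesis using that by (cases ?J) auto
  qed
  define c' where "c' = c * (2 powr (- l - 1) * exp (- 1))"
  \<comment> \<open>The 8 makes D^2 + 4 s \<le> 8 max(v, 1) D^2 (1 + s/(2 D^2 v)) true: the second
    summand on the right is 4 s max(v, 1)/v.\<close>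
  define C' where "C' = C * 8 powr g"
  have comp: "comparison l D s = D\<^sup>2 powr (- l) * (D\<^sup>2 powr g * (\<Prod>\<beta>\<in>R. (D\<^sup>2 + 4 * s \<beta>) powr (- k \<beta>)))" if "D > 0" for D s
  proof -
    have "D\<^sup>2 powr (- l) * D\<^sup>2 powr g = (D powr 2) powr (- l + g)" using that by (subst powr_add) simp
    also have "\<dots> = D powr (- 2 * (l - g))" by (simp add: powr_powr algebra_simps)
    finally show ?thesis by (simp add: comparison_def g_def mult.assoc[symmetric])
  qed
  have prodg: "(\<Prod>\<beta>\<in>R. a powr k \<beta>) = a powr g" if "a > 0" for a :: real
    using that by (simp add: powr_sum[symmetric] g_def dunkl_gamma_def)
  show ?thesis
  proof (intro exI conjI allI impI)
    \<comment> \<open>J is only known to be nonnegative, so J + 1 keeps the constant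
      positive.\<close>
    show "0 < c'" "0 < C' * (J + 1)" using cC J(2) by (auto simp: c'_def C'_def)
    fix D :: real and s :: "'a \<Rightarrow> real" assume D: "D > 0" and s: "\<forall>\<beta>\<in>R. 0 \<le> s \<beta>"
    let ?G = "\<lambda>v. \<Prod>\<beta>\<in>R. gegen_laplace (k \<beta>) (s \<beta> / (2 * (D\<^sup>2 * v)))"
    let ?P = "D\<^sup>2 powr g * (\<Prod>\<beta>\<in>R. (D\<^sup>2 + 4 * s \<beta>) powr (- k \<beta>))"
    have P0: "?P \<ge> 0" by (auto intro!: mult_nonneg_nonneg prod_nonneg)
    have up: "?G v \<le> C' * max v 1 powr g * ?P" if v: "v > 0" for v
    proof -
      have "(\<Prod>\<beta>\<in>R. (1 + s \<beta> / (2 * (D\<^sup>2 * v))) powr (- k \<beta>)) \<le> (\<Prod>\<beta>\<in>R. (8 * max v 1 * D\<^sup>2) powr (k \<beta>) * (D\<^sup>2 + 4 * s \<beta>) powr (- k \<beta>))"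
      proof (rule prod_mono, rule conjI)
        fix \<beta> assume b: "\<beta> \<in> R"
        have sb: "s \<beta> \<ge> 0" using s b by auto
        define X where "X = max v 1"
        have X: "X > 0" by (auto simp: X_def)
        have "(D\<^sup>2 + 4 * s \<beta>) * v \<le> (1 + s \<beta> / (2 * (D\<^sup>2 * v))) * (8 * X * D\<^sup>2) * v"
        proof -
          have "1 * (D\<^sup>2 * v) \<le> (8 * X) * (D\<^sup>2 * v)" using v by (intro mult_right_mono) (auto simp: X_def)
          moreover have "4 * s \<beta> * v \<le> 4 * s \<beta> * X" using sb by (intro mult_left_mono) (auto simp: X_def)
          moreover have "(1 + s \<beta> / (2 * (D\<^sup>2 * v))) * (8 * X * D\<^sup>2) * v = (8 * X) * (D\<^sup>2 * v) + 4 * s \<beta> * X"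
            using D v by (simp add: distrib_right)
          ultimately show ?thesis by (simp add: distrib_right)
        qed
        hence "D\<^sup>2 + 4 * s \<beta> \<le> (1 + s \<beta> / (2 * (D\<^sup>2 * v))) * (8 * X * D\<^sup>2)" using v by simp
        hence "(D\<^sup>2 + 4 * s \<beta>) / (8 * max v 1 * D\<^sup>2) \<le> 1 + s \<beta> / (2 * (D\<^sup>2 * v))"
          using D X by (subst pos_divide_le_eq) (auto simp: X_def)
        hence "(1 + s \<beta> / (2 * (D\<^sup>2 * v))) powr (- k \<beta>) \<le> ((D\<^sup>2 + 4 * s \<beta>) / (8 * max v 1 * D\<^sup>2)) powr (- k \<beta>)"
          using D sb v b k_nonneg by (intro powr_mono2') (auto intro!: divide_pos_pos add_pos_nonneg)
        also have "\<dots> = (8 * max v 1 * D\<^sup>2) powr (k \<beta>) * (D\<^sup>2 + 4 * s \<beta>) powr (- k \<beta>)"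
          using D sb v by (subst powr_divide) (auto simp: powr_minus_divide)
        finally show "(1 + s \<beta> / (2 * (D\<^sup>2 * v))) powr (- k \<beta>) \<le> (8 * max v 1 * D\<^sup>2) powr (k \<beta>) * (D\<^sup>2 + 4 * s \<beta>) powr (- k \<beta>)" .
      qed simp
      also have "\<dots> = 8 powr g * max v 1 powr g * ?P"
        using D v by (simp add: prod.distrib prodg powr_mult)
      finally have "C * (\<Prod>\<beta>\<in>R. (1 + s \<beta> / (2 * (D\<^sup>2 * v))) powr (- k \<beta>)) \<le> C' * max v 1 powr g * ?P"
        using cC(2) by (simp add: C'_def mult.assoc mult_left_mono)
      moreover have "\<forall>\<beta>\<in>R. 0 \<le> s \<beta> / (2 * (D\<^sup>2 * v))" using s v by auto
      ultimately show ?thesis using cC(3)[of "\<lambda>\<beta>. s \<beta> / (2 * (D\<^sup>2 * v))"] by linarith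
    qed
    \<comment> \<open>For v \<ge> 1 one has s/(2 D^2 v) \<le> 4 s/D^2, so no power of v is
      lost.\<close>
    have low: "c * ?P \<le> ?G v" if v: "v \<in> {1..2}" for v
    proof -
      have "(\<Prod>\<beta>\<in>R. (D\<^sup>2) powr (k \<beta>) * (D\<^sup>2 + 4 * s \<beta>) powr (- k \<beta>)) \<le> (\<Prod>\<beta>\<in>R. (1 + s \<beta> / (2 * (D\<^sup>2 * v))) powr (- k \<beta>))"
      proof (rule prod_mono, rule conjI)
        fix \<beta> assume b: "\<beta> \<in> R"
        have sb: "s \<beta> \<ge> 0" using s b by auto
        have "s \<beta> / (2 * (D\<^sup>2 * v)) \<le> s \<beta> / (D\<^sup>2 / 4)"
          using v D sb by (intro divide_left_mono) (auto intro!: mult_pos_pos order_trans[of "D\<^sup>2 / 4" "2 * (D\<^sup>2 * 1)" "2 * (D\<^sup>2 * v)"])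
        hence "1 + s \<beta> / (2 * (D\<^sup>2 * v)) \<le> (D\<^sup>2 + 4 * s \<beta>) / D\<^sup>2" using D by (simp add: field_simps)
        hence "((D\<^sup>2 + 4 * s \<beta>) / D\<^sup>2) powr (- k \<beta>) \<le> (1 + s \<beta> / (2 * (D\<^sup>2 * v))) powr (- k \<beta>)"
          using D sb v b k_nonneg by (intro powr_mono2') (auto intro!: add_pos_nonneg)
        moreover have "((D\<^sup>2 + 4 * s \<beta>) / D\<^sup>2) powr (- k \<beta>) = (D\<^sup>2) powr (k \<beta>) * (D\<^sup>2 + 4 * s \<beta>) powr (- k \<beta>)"
          using D sb by (subst powr_divide) (auto simp: powr_minus_divide)
        ultimately show "(D\<^sup>2) powr (k \<beta>) * (D\<^sup>2 + 4 * s \<beta>) powr (- k \<beta>) \<le> (1 + s \<beta> / (2 * (D\<^sup>2 * v))) powr (- k \<beta>)"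
          by simp
      qed simp
      hence "?P \<le> (\<Prod>\<beta>\<in>R. (1 + s \<beta> / (2 * (D\<^sup>2 * v))) powr (- k \<beta>))"
        using D by (simp add: prod.distrib prodg)
      hence "c * ?P \<le> c * (\<Prod>\<beta>\<in>R. (1 + s \<beta> / (2 * (D\<^sup>2 * v))) powr (- k \<beta>))"
        using cC(1) by (intro mult_left_mono) auto
      moreover have "\<forall>\<beta>\<in>R. 0 \<le> s \<beta> / (2 * (D\<^sup>2 * v))" using s v by auto
      ultimately show ?thesis using cC(3)[of "\<lambda>\<beta>. s \<beta> / (2 * (D\<^sup>2 * v))"] by linarith
    qed
    have "heat_integral l D s \<le> (\<integral>\<^sup>+v. ennreal (C' * comparison l D s) * ennreal (indicator {0<..} v * (v powr (- l - 1) * exp (- (1 / (4 * v))) * max v 1 powr g)) \<partial>lborel)"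
      unfolding heat_integral_scaled[OF D]
    proof (rule nn_integral_mono)
      fix v :: real
      have "D\<^sup>2 powr (- l) * (indicator {0<..} v * (v powr (- l - 1) * exp (- (1 / (4 * v))) * ?G v))
         \<le> D\<^sup>2 powr (- l) * (indicator {0<..} v * (v powr (- l - 1) * exp (- (1 / (4 * v))) * (C' * max v 1 powr g * ?P)))"
        by (cases "v > 0") (auto intro!: mult_left_mono up)
      also have "\<dots> = (C' * comparison l D s) * (indicator {0<..} v * (v powr (- l - 1) * exp (- (1 / (4 * v))) * max v 1 powr g))"
        unfolding comp[OF D] by (simp add: mult_ac)
      finally show "ennreal (D\<^sup>2 powr (- l) * (indicator {0<..} v * (v powr (- l - 1) * exp (- (1 / (4 * v))) * ?G v)))
         \<le> ennreal (C' * comparison l D s) * ennreal (indicator {0<..} v * (v powr (- l - 1) * exp (- (1 / (4 * v))) * max v 1 powr g))"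
        by (subst ennreal_mult''[symmetric]) (auto simp: ennreal_leI)
    qed
    also have "\<dots> = ennreal (C' * comparison l D s) * ennreal J"
      by (subst nn_integral_cmult) (auto simp: J)
    also have "\<dots> = ennreal (C' * comparison l D s * J)" by (rule ennreal_mult''[symmetric]) fact
    also have "\<dots> \<le> ennreal (C' * (J + 1) * comparison l D s)"
    proof (rule ennreal_leI)
      have "0 \<le> C' * comparison l D s"
        using cC D by (auto simp: C'_def comparison_def intro!: mult_nonneg_nonneg prod_nonneg)
      thus "C' * comparison l D s * J \<le> C' * (J + 1) * comparison l D s" by (simp add: algebra_simps)
    qed
    finally show "heat_integral l D s \<le> ennreal (C' * (J + 1) * comparison l D s)" .
    have "ennreal (c' * comparison l D s) = (\<integral>\<^sup>+v. ennreal (c' * comparison l D s) * indicator {1..2::real} v \<partial>lborel)"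
      by (subst nn_integral_cmult_indicator) auto
    also have "\<dots> \<le> heat_integral l D s"
      unfolding heat_integral_scaled[OF D]
    proof (rule nn_integral_mono)
      fix v :: real
      show "ennreal (c' * comparison l D s) * indicator {1..2::real} v \<le> ennreal (D\<^sup>2 powr (- l) * (indicator {0<..} v * (v powr (- l - 1) * exp (- (1 / (4 * v))) * ?G v)))"
      proof (cases "v \<in> {1..2}")
        case True
        have "2 powr (- l - 1) \<le> v powr (- l - 1)" using True l g0 by (intro powr_mono2') (auto simp: g_def)
        moreover have "exp (- 1) \<le> exp (- (1 / (4 * v)))" using True by (auto simp: field_simps)
        ultimately have "(2 powr (- l - 1) * exp (- 1)) * (c * ?P) \<le> (v powr (- l - 1) * exp (- (1 / (4 * v)))) * ?G v"
          using low[OF True] cC(1) P0 by (intro mult_mono) auto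
        hence "D\<^sup>2 powr (- l) * ((2 powr (- l - 1) * exp (- 1)) * (c * ?P)) \<le> D\<^sup>2 powr (- l) * ((v powr (- l - 1) * exp (- (1 / (4 * v)))) * ?G v)"
          by (intro mult_left_mono) auto
        moreover have "D\<^sup>2 powr (- l) * ((2 powr (- l - 1) * exp (- 1)) * (c * ?P)) = c' * comparison l D s"
          unfolding comp[OF D] c'_def by (simp add: mult_ac)
        ultimately show ?thesis using True by (auto intro!: ennreal_leI)
      qed auto
    qed
    finally show "ennreal (c' * comparison l D s) \<le> heat_integral l D s" .
  qed
qed

text \<open>The integral at D = 0 dominates that at every D > 0, and the lower bounds there blow up
  like D to the power -2 (l - \<gamma>).\<close>

lemma heat_integral_zero:
  assumes l: "dunkl_gamma R k < l" and s: "\<forall>\<beta>\<in>R. 0 \<le> s \<beta>"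
  shows "heat_integral l 0 s = \<infinity>"
proof -
  obtain c where c: "0 < c" "\<And>D. 0 < D \<Longrightarrow> ennreal (c * comparison l D s) \<le> heat_integral l D s"
    using heat_integral_bounds[OF l] s by blast
  have mono: "heat_integral l D s \<le> heat_integral l 0 s" for D
    unfolding heat_integral_def
  proof (intro nn_integral_mono ennreal_leI)
    fix u :: real
    let ?G = "\<Prod>\<beta>\<in>R. gegen_laplace (k \<beta>) (s \<beta> / (2 * u))"
    show "indicator {0<..} u * (u powr (- l - 1) * exp (- (D\<^sup>2 / (4 * u))) * ?G) \<le>
      indicator {0<..} u * (u powr (- l - 1) * exp (- (0\<^sup>2 / (4 * u))) * ?G)"
      by (cases "u > 0") (auto intro!: mult_right_mono prod_nonneg gegen_laplace_nonneg mult_left_mono mult_left_le_one_le)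
  qed
  define q where "q = c * (\<Prod>\<beta>\<in>R. (1 + 4 * s \<beta>) powr (- k \<beta>))"
  have q: "q > 0" unfolding q_def using c s by (auto intro!: mult_pos_pos prod_pos simp: add_pos_nonneg less_imp_neq[symmetric])
  define e where "e = 2 * (l - dunkl_gamma R k)"
  have e: "e > 0" using l by (simp add: e_def)
  have "ennreal r \<le> heat_integral l 0 s" if r: "r > q" for r
  proof -
    \<comment> \<open>Chosen so that the lower bound equals r; r > q gives D \<le> 1, which allows
      D^2 + 4 s to be replaced by 1 + 4 s.\<close>
    define D where "D = (q / r) powr (1 / e)"
    have D: "0 < D" "D \<le> 1" using q r e by (auto simp: D_def intro!: powr_le1)
    have "(\<Prod>\<beta>\<in>R. (1 + 4 * s \<beta>) powr (- k \<beta>)) \<le> (\<Prod>\<beta>\<in>R. (D\<^sup>2 + 4 * s \<beta>) powr (- k \<beta>))"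
    proof (rule prod_mono, rule conjI)
      fix \<beta> assume "\<beta> \<in> R"
      thus "(1 + 4 * s \<beta>) powr (- k \<beta>) \<le> (D\<^sup>2 + 4 * s \<beta>) powr (- k \<beta>)"
        using D s k_nonneg by (intro powr_mono2') (auto intro!: add_pos_nonneg simp: power_le_one)
    qed auto
    hence "D powr (- e) * q \<le> c * comparison l D s"
      using c D by (simp add: q_def comparison_def e_def mult_left_mono mult_ac)
    moreover have "D powr (- e) * q = r"
      using q r e by (simp add: D_def powr_powr powr_minus_divide)
    ultimately have "ennreal r \<le> ennreal (c * comparison l D s)" by (simp add: ennreal_leI)
    also have "\<dots> \<le> heat_integral l D s" using c D by blast
    finally show ?thesis using mono order_trans by blast
  qed
  note le = this
  have "of_nat n \<le> heat_integral l 0 s" for n :: nat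
  proof -
    have "of_nat n \<le> ennreal (max (q + 1) (real n))" by (simp add: ennreal_of_nat_eq_real_of_nat ennreal_leI)
    also have "\<dots> \<le> heat_integral l 0 s" by (rule le) simp
    finally show ?thesis .
  qed
  thus ?thesis using ennreal_Ex_less_of_nat[of "heat_integral l 0 s"] by (metis infinity_ennreal_def leD less_top)
qed

text \<open>Each power of the affine form in t becomes an integral of exponentials by
  \<open>riesz_identity\<close>; after Tonelli the mean over t factors into one-dimensional Laplace
  transforms.\<close>

lemma GM_riesz:
  assumes l: "l > 0" and D: "D > 0" and s: "\<forall>\<beta>\<in>R. 0 \<le> s \<beta>"
  shows "ennreal (riesz_const l * (LINT t|GM. (D\<^sup>2 + 2 * (\<Sum>\<beta>\<in>R. (1 - t \<beta>) * s \<beta>)) powr (- l))) = heat_integral l D s"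
proof -
  let ?A = "\<lambda>t. D\<^sup>2 + 2 * (\<Sum>\<beta>\<in>R. (1 - t \<beta>) * s \<beta>)"
  let ?S = "\<lambda>t. \<Sum>\<beta>\<in>R. (1 - t \<beta>) * s \<beta>"
  interpret GL: pair_sigma_finite GM lborel ..
  note [measurable] = measurable_GM_coord
  have S0: "?S t \<ge> 0" if "t \<in> space GM" for t
    using s space_GM[OF that] by (intro sum_nonneg mult_nonneg_nonneg) auto
  have A: "?A t \<ge> D\<^sup>2" if "t \<in> space GM" for t using S0[OF that] by simp
  have i: "integrable GM (\<lambda>t. ?A t powr (- l))"
    using A D l by (intro integrable_GM_bounded[of _ "D\<^sup>2 powr (- l)"]) (measurable, auto intro!: powr_mono2')
  have "ennreal (riesz_const l * (LINT t|GM. ?A t powr (- l))) = ennreal (LINT t|GM. riesz_const l * ?A t powr (- l))"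
    by simp
  also have "\<dots> = (\<integral>\<^sup>+t. ennreal (riesz_const l * ?A t powr (- l)) \<partial>GM)"
    using i riesz_const(2)[OF l] by (intro nn_integral_eq_integral[symmetric]) auto
  also have "\<dots> = (\<integral>\<^sup>+t. \<integral>\<^sup>+u. ennreal (indicator {0<..} u * (u powr (- l - 1) * exp (- (?A t / (4 * u))))) \<partial>lborel \<partial>GM)"
  proof (rule nn_integral_cong)
    fix t assume "t \<in> space GM"
    hence "?A t > 0" using A[of t] D by (smt (verit) zero_less_power)
    thus "ennreal (riesz_const l * ?A t powr (- l)) = (\<integral>\<^sup>+u. ennreal (indicator {0<..} u * (u powr (- l - 1) * exp (- (?A t / (4 * u))))) \<partial>lborel)"
      by (simp add: riesz_identity[OF l])
  qed
  also have "\<dots> = (\<integral>\<^sup>+u. \<integral>\<^sup>+t. ennreal (indicator {0<..} u * (u powr (- l - 1) * exp (- (?A t / (4 * u))))) \<partial>GM \<partial>lborel)"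
    by (rule GL.Fubini'[symmetric]) measurable
  also have "\<dots> = heat_integral l D s"
    unfolding heat_integral_def
  proof (rule nn_integral_cong)
    fix u :: real
    show "(\<integral>\<^sup>+t. ennreal (indicator {0<..} u * (u powr (- l - 1) * exp (- (?A t / (4 * u))))) \<partial>GM) =
      ennreal (indicator {0<..} u * (u powr (- l - 1) * exp (- (D\<^sup>2 / (4 * u))) * (\<Prod>\<beta>\<in>R. gegen_laplace (k \<beta>) (s \<beta> / (2 * u)))))"
    proof (cases "u > 0")
      case True
      have eq: "exp (- (?A t / (4 * u))) = exp (- (D\<^sup>2 / (4 * u))) * exp (- (\<Sum>\<beta>\<in>R. (1 - t \<beta>) * (s \<beta> / (2 * u))))" for t
      proof -
        have "(\<Sum>\<beta>\<in>R. (1 - t \<beta>) * (s \<beta> / (2 * u))) = ?S t / (2 * u)" by (simp add: sum_divide_distrib)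
        thus ?thesis using True by (simp add: exp_add[symmetric] field_simps)
      qed
      have "(\<integral>\<^sup>+t. ennreal (indicator {0<..} u * (u powr (- l - 1) * exp (- (?A t / (4 * u))))) \<partial>GM)
        = (\<integral>\<^sup>+t. ennreal (u powr (- l - 1) * exp (- (D\<^sup>2 / (4 * u))) * exp (- (\<Sum>\<beta>\<in>R. (1 - t \<beta>) * (s \<beta> / (2 * u))))) \<partial>GM)"
        using True by (intro nn_integral_cong) (simp only: eq, simp add: mult.assoc)
      also have "\<dots> = ennreal (LINT t|GM. u powr (- l - 1) * exp (- (D\<^sup>2 / (4 * u))) * exp (- (\<Sum>\<beta>\<in>R. (1 - t \<beta>) * (s \<beta> / (2 * u)))))"
      proof (intro nn_integral_eq_integral integrable_mult_right AE_I2)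
        show "integrable GM (\<lambda>t. exp (- (\<Sum>\<beta>\<in>R. (1 - t \<beta>) * (s \<beta> / (2 * u)))))"
        proof (rule integrable_GM_bounded[of _ 1])
          fix t assume t: "t \<in> space GM"
          have "(\<Sum>\<beta>\<in>R. (1 - t \<beta>) * (s \<beta> / (2 * u))) = ?S t / (2 * u)" by (simp add: sum_divide_distrib)
          thus "\<bar>exp (- (\<Sum>\<beta>\<in>R. (1 - t \<beta>) * (s \<beta> / (2 * u))))\<bar> \<le> 1" using S0[OF t] True by simp
        qed measurable
      qed auto
      also have "\<dots> = ennreal (u powr (- l - 1) * exp (- (D\<^sup>2 / (4 * u))) * (\<Prod>\<beta>\<in>R. gegen_laplace (k \<beta>) (s \<beta> / (2 * u))))"
        by (simp only: integral_mult_right_zero GM_laplace)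
      finally show ?thesis using True by simp
    qed auto
  qed
  finally show ?thesis .
qed

lemma GM_riesz_bounds:
  assumes l: "dunkl_gamma R k < l"
  shows "\<exists>c C. 0 < c \<and> 0 < C \<and> (\<forall>D s. 0 < D \<longrightarrow> (\<forall>\<beta>\<in>R. 0 \<le> s \<beta>) \<longrightarrow>
     c * comparison l D s \<le> (LINT t|GM. (D\<^sup>2 + 2 * (\<Sum>\<beta>\<in>R. (1 - t \<beta>) * s \<beta>)) powr (- l)) \<and>
     (LINT t|GM. (D\<^sup>2 + 2 * (\<Sum>\<beta>\<in>R. (1 - t \<beta>) * s \<beta>)) powr (- l)) \<le> C * comparison l D s)"
proof -
  have "dunkl_gamma R k \<ge> 0" unfolding dunkl_gamma_def by (intro sum_nonneg k_nonneg)
  hence l0: "l > 0" using l by simp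
  note rc = riesz_const(2)[OF l0]
  obtain c C where cC: "0 < c" "0 < C" "\<And>D s. 0 < D \<Longrightarrow> (\<forall>\<beta>\<in>R. 0 \<le> s \<beta>) \<Longrightarrow>
     ennreal (c * comparison l D s) \<le> heat_integral l D s \<and> heat_integral l D s \<le> ennreal (C * comparison l D s)"
    using heat_integral_bounds[OF l] by blast
  have cnn: "comparison l D s \<ge> 0" for D s
    unfolding comparison_def by (auto intro!: mult_nonneg_nonneg prod_nonneg)
  have Inn: "(LINT t|GM. (D\<^sup>2 + 2 * (\<Sum>\<beta>\<in>R. (1 - t \<beta>) * s \<beta>)) powr (- l)) \<ge> 0" for D s
    by (intro Bochner_Integration.integral_nonneg) auto
  show ?thesis
  proof (rule exI[of _ "c / riesz_const l"], rule exI[of _ "C / riesz_const l"], intro conjI allI impI)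
    fix D :: real and s :: "'a \<Rightarrow> real" assume Ds: "0 < D" "\<forall>\<beta>\<in>R. 0 \<le> s \<beta>"
    note b = cC(3)[OF Ds, unfolded GM_riesz[OF l0 Ds, symmetric]]
    have "c * comparison l D s \<le> riesz_const l * (LINT t|GM. (D\<^sup>2 + 2 * (\<Sum>\<beta>\<in>R. (1 - t \<beta>) * s \<beta>)) powr (- l))"
      "riesz_const l * (LINT t|GM. (D\<^sup>2 + 2 * (\<Sum>\<beta>\<in>R. (1 - t \<beta>) * s \<beta>)) powr (- l)) \<le> C * comparison l D s"
      using b Inn[of D s] cnn[of D s] cC(1,2) rc by (auto simp: ennreal_le_iff)
    thus "c / riesz_const l * comparison l D s \<le> (LINT t|GM. (D\<^sup>2 + 2 * (\<Sum>\<beta>\<in>R. (1 - t \<beta>) * s \<beta>)) powr (- l))"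
      "(LINT t|GM. (D\<^sup>2 + 2 * (\<Sum>\<beta>\<in>R. (1 - t \<beta>) * s \<beta>)) powr (- l)) \<le> C / riesz_const l * comparison l D s"
      using rc by (auto simp: field_simps)
  qed (use cC rc in auto)
qed

end

section \<open>Integrals depending on a parameter\<close>

lemma measurable_compact_param:
  fixes f :: "'b::euclidean_space \<Rightarrow> real"
  assumes f: "continuous_on K f" and q: "q \<in> borel_measurable M" "\<And>p. p \<in> space M \<Longrightarrow> q p \<in> K"
  shows "(\<lambda>p. f (q p)) \<in> borel_measurable M"
proof -
  have "q \<in> M \<rightarrow>\<^sub>M restrict_space borel K" using q by (intro measurable_restrict_space2) auto
  from measurable_compose[OF this borel_measurable_continuous_on_restrict[OF f]] show ?thesis .
qed

lemma integrable_compact_param: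
  fixes f :: "'b::euclidean_space \<Rightarrow> real"
  assumes K: "compact K" and f: "continuous_on K f"
    and q: "q \<in> borel_measurable M" "\<And>p. p \<in> space M \<Longrightarrow> q p \<in> K" and w: "integrable M w"
  shows "integrable M (\<lambda>p. w p * f (q p))"
proof -
  have [measurable]: "(\<lambda>p. f (q p)) \<in> borel_measurable M" by (rule measurable_compact_param[OF f q])
  have "bounded (f ` K)" by (intro compact_imp_bounded compact_continuous_image f K)
  then obtain B where B: "\<forall>x\<in>f ` K. norm x \<le> B" unfolding bounded_iff by blast
  note [measurable] = borel_measurable_integrable[OF w]
  show ?thesis
  proof (rule Bochner_Integration.integrable_bound)
    show "integrable M (\<lambda>p. \<bar>w p\<bar> * B)" using w by simp
    show "AE p in M. norm (w p * f (q p)) \<le> norm (\<bar>w p\<bar> * B)"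
    proof (rule AE_I2)
      fix p assume "p \<in> space M"
      hence "\<bar>f (q p)\<bar> \<le> \<bar>B\<bar>" using B q(2) by fastforce
      thus "norm (w p * f (q p)) \<le> norm (\<bar>w p\<bar> * B)" by (simp add: abs_mult mult_left_mono)
    qed
  qed measurable
qed

text \<open>Compactness of the parameter set replaces a dominating function: by the tube lemma the
  integrand converges uniformly in the parameter as the point moves.\<close>

lemma continuous_on_param_integral:
  fixes F :: "'a::metric_space \<Rightarrow> 'b::euclidean_space \<Rightarrow> real"
  assumes K: "compact K" and F: "continuous_on (U \<times> K) (\<lambda>z. F (fst z) (snd z))"
    and q: "q \<in> borel_measurable M" "\<And>p. p \<in> space M \<Longrightarrow> q p \<in> K" and w: "integrable M w"
  shows "continuous_on U (\<lambda>x. LINT p|M. w p * F x (q p))"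
proof -
  have Fx: "continuous_on K (F x)" if "x \<in> U" for x
    using continuous_on_compose2[OF F continuous_on_Pair[OF continuous_on_const continuous_on_id], of x K] that by auto
  note int = integrable_compact_param[OF K Fx q w]
  show ?thesis unfolding continuous_on_iff
  proof (intro ballI allI impI)
    fix x and e :: real assume x: "x \<in> U" and e: "e > 0"
    define W where "W = (LINT p|M. \<bar>w p\<bar>)"
    have W: "W \<ge> 0" unfolding W_def by (intro Bochner_Integration.integral_nonneg) auto
    \<comment> \<open>The summand 1 allows for a weight of total mass 0.\<close>
    have "e / (2 * (W + 1)) > 0" using e W by auto
    from continuous_on_prod_compactE[OF F K x this] obtain X0 where
      X0: "x \<in> X0" "open X0" and le: "\<And>y t. y \<in> X0 \<inter> U \<Longrightarrow> t \<in> K \<Longrightarrow> dist (F y t) (F x t) \<le> e / (2 * (W + 1))"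
      by (metis fst_conv snd_conv)
    obtain d where d: "d > 0" "ball x d \<subseteq> X0" using X0 openE by blast
    show "\<exists>d>0. \<forall>y\<in>U. dist y x < d \<longrightarrow> dist (LINT p|M. w p * F y (q p)) (LINT p|M. w p * F x (q p)) < e"
    proof (intro exI[of _ d] conjI ballI impI d(1))
      fix y assume y: "y \<in> U" "dist y x < d"
      hence y0: "y \<in> X0 \<inter> U" using d(2) by (auto simp: dist_commute)
      have "dist (LINT p|M. w p * F y (q p)) (LINT p|M. w p * F x (q p)) = \<bar>LINT p|M. w p * F y (q p) - w p * F x (q p)\<bar>"
        using int[OF y(1)] int[OF x] by (simp add: dist_real_def)
      also have "\<dots> \<le> (LINT p|M. \<bar>w p * F y (q p) - w p * F x (q p)\<bar>)" by (rule integral_abs_bound)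
      also have "\<dots> \<le> (LINT p|M. \<bar>w p\<bar> * (e / (2 * (W + 1))))"
      proof (rule integral_mono)
        fix p assume "p \<in> space M"
        hence "dist (F y (q p)) (F x (q p)) \<le> e / (2 * (W + 1))" by (intro le y0 q)
        hence "\<bar>w p\<bar> * \<bar>F y (q p) - F x (q p)\<bar> \<le> \<bar>w p\<bar> * (e / (2 * (W + 1)))"
          by (intro mult_left_mono) (auto simp: dist_real_def)
        thus "\<bar>w p * F y (q p) - w p * F x (q p)\<bar> \<le> \<bar>w p\<bar> * (e / (2 * (W + 1)))"
          by (simp add: abs_mult[symmetric] right_diff_distrib)
      qed (use int[OF y(1)] int[OF x] w in auto)
      also have "\<dots> = W * (e / (2 * (W + 1)))" unfolding W_def by simp
      also have "\<dots> < e" using W e by (simp add: field_simps add_nonneg_pos)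
      finally show "dist (LINT p|M. w p * F y (q p)) (LINT p|M. w p * F x (q p)) < e" .
    qed
  qed
qed

text \<open>The remainder of the linear approximation is o(|y - x|) uniformly in the parameter,
  because the gradients are uniformly close on a small ball. Integrating it against w preserves the
  estimate.\<close>

lemma has_derivative_param_integral:
  fixes F :: "'a::euclidean_space \<Rightarrow> 'b::euclidean_space \<Rightarrow> real"
  assumes U: "open U" and K: "compact K" and G: "continuous_on (U \<times> K) (\<lambda>z. G (fst z) (snd z))"
    and D: "\<And>x t. x \<in> U \<Longrightarrow> t \<in> K \<Longrightarrow> ((\<lambda>x. F x t) has_derivative (\<lambda>h. G x t \<bullet> h)) (at x)"
    and F: "\<And>x. x \<in> U \<Longrightarrow> continuous_on K (F x)"
    and q: "q \<in> borel_measurable M" "\<And>p. p \<in> space M \<Longrightarrow> q p \<in> K" and w: "integrable M w" and x: "x \<in> U"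
  shows "((\<lambda>x. LINT p|M. w p * F x (q p)) has_derivative (\<lambda>h. LINT p|M. w p * (G x (q p) \<bullet> h))) (at x)"
  unfolding has_derivative_at_alt
proof (intro conjI allI impI)
  have Gx: "continuous_on K (\<lambda>t. G x t \<bullet> h)" for h
    using continuous_on_compose2[OF G continuous_on_Pair[OF continuous_on_const continuous_on_id], of x K] x
    by (auto intro!: continuous_intros)
  note intG = integrable_compact_param[OF K Gx q w]
  note intF = integrable_compact_param[OF K F q w]
  show "bounded_linear (\<lambda>h. LINT p|M. w p * (G x (q p) \<bullet> h))"
    unfolding linear_conv_bounded_linear[symmetric]
    by (rule linearI) (simp_all add: inner_add_right distrib_left intG mult.left_commute[of _ "_::real"])
  fix e :: real assume e: "e > 0"
  define W where "W = (LINT p|M. \<bar>w p\<bar>)"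
  have W: "W \<ge> 0" unfolding W_def by (intro Bochner_Integration.integral_nonneg) auto
  define e' where "e' = e / (W + 1)"
  have e': "e' > 0" using e W by (auto simp: e'_def)
  from continuous_on_prod_compactE[OF G K x this] obtain X0 where
    X0: "x \<in> X0" "open X0" and le: "\<And>y t. y \<in> X0 \<inter> U \<Longrightarrow> t \<in> K \<Longrightarrow> dist (G y t) (G x t) \<le> e'"
    by (metis fst_conv snd_conv)
  have "open (X0 \<inter> U)" "x \<in> X0 \<inter> U" using X0 U x by auto
  then obtain d where d: "d > 0" "ball x d \<subseteq> X0 \<inter> U" by (meson openE)
  show "\<exists>d>0. \<forall>y. norm (y - x) < d \<longrightarrow> norm ((LINT p|M. w p * F y (q p)) - (LINT p|M. w p * F x (q p)) -
     (LINT p|M. w p * (G x (q p) \<bullet> (y - x)))) \<le> e * norm (y - x)"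
  proof (intro exI[of _ d] conjI allI impI d(1))
    fix y assume y: "norm (y - x) < d"
    hence yb: "y \<in> ball x d" by (simp add: dist_norm norm_minus_commute)
    hence yU: "y \<in> U" using d by auto
    \<comment> \<open>Once the linear map with gradient G x t is subtracted, the derivative on the
      ball has norm at most e', and the mean value inequality applies.\<close>
    have mv: "\<bar>F y t - F x t - G x t \<bullet> (y - x)\<bar> \<le> e' * norm (y - x)" if t: "t \<in> K" for t
    proof -
      have "norm ((F y t - G x t \<bullet> y) - (F x t - G x t \<bullet> x)) \<le> e' * norm (y - x)"
      proof (rule differentiable_bound[where S="ball x d"])
        fix z assume z: "z \<in> ball x d"
        show "((\<lambda>y. F y t - G x t \<bullet> y) has_derivative (\<lambda>h. G z t \<bullet> h - G x t \<bullet> h)) (at z within ball x d)"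
          using z d(2) t
          by (intro has_derivative_diff has_derivative_inner_right has_derivative_ident has_derivative_at_withinI[OF D]) auto
        show "onorm (\<lambda>h. G z t \<bullet> h - G x t \<bullet> h) \<le> e'"
        proof (rule onorm_bound)
          fix h
          have "z \<in> X0 \<inter> U" using z d(2) by blast
          hence le': "norm (G z t - G x t) \<le> e'" using le[of z t] t by (simp add: dist_norm)
          have "\<bar>(G z t - G x t) \<bullet> h\<bar> \<le> norm (G z t - G x t) * norm h" by (rule Cauchy_Schwarz_ineq2)
          also have "\<dots> \<le> e' * norm h" using le' by (intro mult_right_mono) auto
          finally show "norm (G z t \<bullet> h - G x t \<bullet> h) \<le> e' * norm h" by (simp add: inner_diff_left)
        qed (use e' in simp)
      qed (use yb d in auto)
      thus ?thesis by (simp add: inner_diff_right algebra_simps)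
    qed
    have "(LINT p|M. w p * F y (q p)) - (LINT p|M. w p * F x (q p)) - (LINT p|M. w p * (G x (q p) \<bullet> (y - x)))
      = (LINT p|M. w p * F y (q p) - w p * F x (q p) - w p * (G x (q p) \<bullet> (y - x)))"
      using intF[OF yU] intF[OF x] intG by simp
    also have "\<bar>\<dots>\<bar> \<le> (LINT p|M. \<bar>w p * F y (q p) - w p * F x (q p) - w p * (G x (q p) \<bullet> (y - x))\<bar>)"
      by (rule integral_abs_bound)
    also have "\<dots> \<le> (LINT p|M. \<bar>w p\<bar> * (e' * norm (y - x)))"
    proof (rule integral_mono)
      fix p assume "p \<in> space M"
      hence "\<bar>F y (q p) - F x (q p) - G x (q p) \<bullet> (y - x)\<bar> \<le> e' * norm (y - x)" by (intro mv q)
      hence "\<bar>w p\<bar> * \<bar>F y (q p) - F x (q p) - G x (q p) \<bullet> (y - x)\<bar> \<le> \<bar>w p\<bar> * (e' * norm (y - x))"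
        by (intro mult_left_mono) auto
      thus "\<bar>w p * F y (q p) - w p * F x (q p) - w p * (G x (q p) \<bullet> (y - x))\<bar> \<le> \<bar>w p\<bar> * (e' * norm (y - x))"
        by (simp add: abs_mult[symmetric] right_diff_distrib)
    qed (use intF[OF yU] intF[OF x] intG w in auto)
    also have "\<dots> = W * (e' * norm (y - x))" unfolding W_def by simp
    also have "\<dots> = (W * e') * norm (y - x)" by simp
    also have "\<dots> \<le> e * norm (y - x)" using W e by (intro mult_right_mono) (auto simp: e'_def field_simps)
    finally show "norm ((LINT p|M. w p * F y (q p)) - (LINT p|M. w p * F x (q p)) -
     (LINT p|M. w p * (G x (q p) \<bullet> (y - x)))) \<le> e * norm (y - x)" by simp
  qed
qed

lemma dir_deriv_eq: "(f has_derivative f') (at x) \<Longrightarrow> dir_deriv v f x = f' v"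
  unfolding dir_deriv_def by (simp add: frechet_derivative_at[symmetric])

context orth_roots
begin

text \<open>A point of the box \<open>[-1, 1]\<^sup>R\<close> is encoded as a vector, so that integrals over the box become
  integrals depending on a parameter in a compact subset of the ambient space.\<close>

definition encode :: "('a \<Rightarrow> real) \<Rightarrow> 'a" where
  "encode t = (\<Sum>\<beta>\<in>R. t \<beta> *\<^sub>R \<beta>)"

definition decode :: "'a \<Rightarrow> 'a \<Rightarrow> real" where
  "decode \<tau> \<beta> = (\<tau> \<bullet> \<beta>) / (\<beta> \<bullet> \<beta>)"

text \<open>The coordinates bound a vector only within the span of the roots; intersecting with a
  ball makes the set compact, and the chosen radius leaves room for every encoded point.\<close>

definition code_box :: "'a set" where
  "code_box = {\<tau> \<in> cball 0 (\<Sum>\<beta>\<in>R. norm \<beta>). \<forall>\<beta>\<in>R. \<bar>decode \<tau> \<beta>\<bar> \<le> 1}"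

lemma decode_encode:
  assumes "\<beta> \<in> R" shows "decode (encode t) \<beta> = t \<beta>"
proof -
  have "encode t \<bullet> \<beta> = (\<Sum>\<gamma>\<in>R. if \<gamma> = \<beta> then t \<gamma> * (\<gamma> \<bullet> \<gamma>) else 0)"
    unfolding encode_def inner_sum_left using assms roots_orthogonal by (intro sum.cong) auto
  thus ?thesis using assms root_nonzero by (simp add: decode_def)
qed

lemma rescale_decode_encode: "rescale R (decode (encode t)) = rescale R t"
  by (rule ext, rule rescale_cong) (simp add: decode_encode)

lemma compact_code_box: "compact code_box"
proof -
  have "code_box = cball 0 (\<Sum>\<beta>\<in>R. norm \<beta>) \<inter> (\<Inter>\<beta>\<in>R. {\<tau>. \<bar>decode \<tau> \<beta>\<bar> \<le> 1})"
    by (auto simp: code_box_def)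
  also have "compact \<dots>"
    by (intro compact_Int_closed compact_cball closed_INT ballI closed_Collect_le)
       (auto simp: decode_def divide_inverse intro!: continuous_intros)
  finally show ?thesis .
qed

lemma encode_in_box:
  assumes "t \<in> space GM" shows "encode t \<in> code_box"
proof -
  have "norm (encode t) \<le> (\<Sum>\<beta>\<in>R. norm (t \<beta> *\<^sub>R \<beta>))" unfolding encode_def by (rule norm_sum)
  also have "\<dots> \<le> (\<Sum>\<beta>\<in>R. norm \<beta>)"
  proof (rule sum_mono)
    fix \<beta> assume b: "\<beta> \<in> R"
    have "\<bar>t \<beta>\<bar> \<le> 1" using space_GM[OF assms b] by auto
    hence "\<bar>t \<beta>\<bar> * norm \<beta> \<le> 1 * norm \<beta>" by (intro mult_right_mono) auto
    thus "norm (t \<beta> *\<^sub>R \<beta>) \<le> norm \<beta>" by simp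
  qed
  moreover have "\<bar>decode (encode t) \<beta>\<bar> \<le> 1" if "\<beta> \<in> R" for \<beta>
    using space_GM[OF assms that] by (simp add: decode_encode[OF that] abs_le_iff)
  ultimately show ?thesis by (simp add: code_box_def)
qed

lemma measurable_encode: "encode \<in> borel_measurable GM"
  unfolding encode_def[abs_def]
  by (intro borel_measurable_sum borel_measurable_scaleR measurable_GM_coord) auto

lemma norm_rescale_decode: "\<tau> \<in> code_box \<Longrightarrow> norm (rescale R (decode \<tau>) x) \<le> norm x"
  by (intro norm_rescale_le) (auto simp: code_box_def abs_le_iff minus_le_iff)

lemma continuous_on_rescale_decode [continuous_intros]:
  assumes "continuous_on S f" "continuous_on S g"
  shows "continuous_on S (\<lambda>z. rescale R (decode (f z)) (g z))"
  unfolding rescale_def decode_def divide_inverse by (intro continuous_intros assms)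

end

section \<open>The intertwining operator\<close>

text \<open>Produces the derivative as scalar product with a vector field, the form in which
  derivatives under the integral are taken, and keeps the components polynomial for the induction on
  degree.\<close>

lemma real_polynomial_function_gradient:
  assumes "real_polynomial_function (p :: 'a::euclidean_space \<Rightarrow> real)"
  shows "\<exists>G. (\<forall>x. (p has_derivative (\<lambda>h. G x \<bullet> h)) (at x)) \<and> (\<forall>v. real_polynomial_function (\<lambda>x. G x \<bullet> v))"
  using assms
proof (induction rule: real_polynomial_function.induct)
  case (linear f)
  have "f h = (\<Sum>b\<in>Basis. f b *\<^sub>R b) \<bullet> h" for h
  proof -
    interpret f: bounded_linear f by (rule linear)
    have "f h = f (\<Sum>b\<in>Basis. (h \<bullet> b) *\<^sub>R b)" by (simp add: euclidean_representation)
    also have "\<dots> = (\<Sum>b\<in>Basis. (h \<bullet> b) * f b)" by (simp add: f.sum f.scaleR)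
    finally have "f h = (\<Sum>b\<in>Basis. (h \<bullet> b) * f b)" .
    thus ?thesis by (simp add: inner_sum_left inner_commute[of h] mult.commute)
  qed
  hence eq: "f = (\<lambda>h. (\<Sum>b\<in>Basis. f b *\<^sub>R b) \<bullet> h)" by blast
  have "(f has_derivative (\<lambda>h. (\<Sum>b\<in>Basis. f b *\<^sub>R b) \<bullet> h)) (at x)" for x
    using bounded_linear_imp_has_derivative[OF linear] eq by metis
  thus ?case by (intro exI[of _ "\<lambda>_. \<Sum>b\<in>Basis. f b *\<^sub>R b"]) (auto intro: real_polynomial_function.intros(2))
next
  case (const c)
  show ?case by (intro exI[of _ "\<lambda>_. 0"]) (auto intro: real_polynomial_function.intros(2))
next
  case (add f g)
  then obtain Gf Gg where
    G: "\<And>x. (f has_derivative (\<lambda>h. Gf x \<bullet> h)) (at x)" "\<And>v. real_polynomial_function (\<lambda>x. Gf x \<bullet> v)"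
       "\<And>x. (g has_derivative (\<lambda>h. Gg x \<bullet> h)) (at x)" "\<And>v. real_polynomial_function (\<lambda>x. Gg x \<bullet> v)"
    by blast
  show ?case
    by (rule exI[of _ "\<lambda>x. Gf x + Gg x"])
       (auto simp: inner_add_left intro!: has_derivative_add G real_polynomial_function.intros(3))
next
  case (mult f g)
  then obtain Gf Gg where
    G: "\<And>x. (f has_derivative (\<lambda>h. Gf x \<bullet> h)) (at x)" "\<And>v. real_polynomial_function (\<lambda>x. Gf x \<bullet> v)"
       "\<And>x. (g has_derivative (\<lambda>h. Gg x \<bullet> h)) (at x)" "\<And>v. real_polynomial_function (\<lambda>x. Gg x \<bullet> v)"
    by blast
  have "((\<lambda>x. f x * g x) has_derivative (\<lambda>h. (f x *\<^sub>R Gg x + g x *\<^sub>R Gf x) \<bullet> h)) (at x)" for x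
    using has_derivative_mult[OF G(1)[of x] G(3)[of x]]
    by (simp add: inner_add_left mult.commute[of "_ \<bullet> _" "g x"])
  moreover have "real_polynomial_function (\<lambda>x. (f x *\<^sub>R Gg x + g x *\<^sub>R Gf x) \<bullet> v)" for v
    unfolding inner_add_left inner_scaleR_left
    by (intro real_polynomial_function.intros(3,4) mult.hyps G)
  ultimately show ?case by (intro exI[of _ "\<lambda>x. f x *\<^sub>R Gg x + g x *\<^sub>R Gf x"]) blast
qed

lemma real_polynomial_function_dir_deriv:
  assumes "real_polynomial_function p" shows "real_polynomial_function (dir_deriv v p)"
proof -
  obtain G where "\<And>x. (p has_derivative (\<lambda>h. G x \<bullet> h)) (at x)" and G: "\<And>v. real_polynomial_function (\<lambda>x. G x \<bullet> v)"
    using real_polynomial_function_gradient[OF assms] by blast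
  hence "dir_deriv v p = (\<lambda>x. G x \<bullet> v)" by (auto simp: fun_eq_iff dest: dir_deriv_eq)
  thus ?thesis using G by simp
qed

lemma real_polynomial_function_differentiable:
  "real_polynomial_function p \<Longrightarrow> (p has_derivative (\<lambda>h. dir_deriv h p x)) (at x)"
  using real_polynomial_function_gradient[of p] by (metis (no_types, lifting) dir_deriv_eq ext)

lemma continuous_on_real_polynomial_function:
  "real_polynomial_function (p :: 'a::euclidean_space \<Rightarrow> real) \<Longrightarrow> continuous_on S p"
  by (intro continuous_at_imp_continuous_on ballI)
     (rule has_derivative_continuous[OF real_polynomial_function_differentiable])

section \<open>Nilpotent differentiation and monomials in an orthogonal basis\<close>

text \<open>Stands in for the degree: after n derivatives in arbitrary directions the function is 0.
  It supports an induction whose step passes to derivatives, which is how an intertwining operator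
  acts.\<close>

primrec deriv_nilpotent :: "nat \<Rightarrow> ('a::euclidean_space \<Rightarrow> real) \<Rightarrow> bool" where
  "deriv_nilpotent 0 p \<longleftrightarrow> p = (\<lambda>_. 0)"
| "deriv_nilpotent (Suc n) p \<longleftrightarrow> (\<forall>\<xi>. deriv_nilpotent n (dir_deriv \<xi> p))"

lemma dir_deriv_const [simp]: "dir_deriv \<xi> (\<lambda>_. c) = (\<lambda>_. 0)"
  by (rule ext, rule dir_deriv_eq) simp

lemma deriv_nilpotent_zero: "deriv_nilpotent n (\<lambda>_. 0)"
  by (induction n) auto

lemma dir_deriv_add:
  assumes "\<And>x. f differentiable at x" "\<And>x. g differentiable at x"
  shows "dir_deriv \<xi> (\<lambda>x. f x + g x) = (\<lambda>x. dir_deriv \<xi> f x + dir_deriv \<xi> g x)"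
proof (rule ext)
  fix x
  from assms[of x] have "(f has_derivative frechet_derivative f (at x)) (at x)" "(g has_derivative frechet_derivative g (at x)) (at x)"
    by (simp_all add: frechet_derivative_works)
  from dir_deriv_eq[OF has_derivative_add[OF this]]
  show "dir_deriv \<xi> (\<lambda>x. f x + g x) x = dir_deriv \<xi> f x + dir_deriv \<xi> g x" by (simp add: dir_deriv_def)
qed

lemma dir_deriv_mult:
  assumes "\<And>x. f differentiable at x" "\<And>x. g differentiable at x"
  shows "dir_deriv \<xi> (\<lambda>x. f x * g x) = (\<lambda>x. f x * dir_deriv \<xi> g x + dir_deriv \<xi> f x * g x)"
proof (rule ext)
  fix x
  from assms[of x] have "(f has_derivative frechet_derivative f (at x)) (at x)" "(g has_derivative frechet_derivative g (at x)) (at x)"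
    by (simp_all add: frechet_derivative_works)
  from dir_deriv_eq[OF has_derivative_mult[OF this]]
  show "dir_deriv \<xi> (\<lambda>x. f x * g x) x = f x * dir_deriv \<xi> g x + dir_deriv \<xi> f x * g x" by (simp add: dir_deriv_def)
qed

lemma differentiable_rpf: "real_polynomial_function (p :: 'a::euclidean_space \<Rightarrow> real) \<Longrightarrow> p differentiable at x"
  by (rule differentiableI, rule real_polynomial_function_differentiable)

lemma deriv_nilpotent_Suc: "deriv_nilpotent n p \<Longrightarrow> deriv_nilpotent (Suc n) p"
proof (induction n arbitrary: p)
  case (Suc n)
  have "deriv_nilpotent (Suc n) (dir_deriv \<xi> p)" for \<xi>
    using Suc.prems by (intro Suc.IH) simp
  thus ?case unfolding deriv_nilpotent.simps(2)[of "Suc n"] by blast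
qed auto

lemma deriv_nilpotent_mono:
  assumes "deriv_nilpotent n p" "n \<le> m" shows "deriv_nilpotent m p"
  using assms(2) by (induction m rule: dec_induct) (auto intro: assms(1) deriv_nilpotent_Suc simp del: deriv_nilpotent.simps)

lemma deriv_nilpotent_add:
  assumes "real_polynomial_function p" "real_polynomial_function q" "deriv_nilpotent n p" "deriv_nilpotent n q"
  shows "deriv_nilpotent n (\<lambda>x. p x + q x)"
  using assms
  by (induction n arbitrary: p q) (auto simp: dir_deriv_add differentiable_rpf real_polynomial_function_dir_deriv)

text \<open>By the Leibniz rule each derivative lowers the order of one of the two factors, so the
  induction is on the sum of the orders.\<close>

lemma deriv_nilpotent_mult:
  assumes "real_polynomial_function p" "real_polynomial_function q" "deriv_nilpotent n p" "deriv_nilpotent m q"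
  shows "deriv_nilpotent (n + m) (\<lambda>x. p x * q x)"
  using assms
proof (induction "n + m" arbitrary: n m p q)
  case 0
  thus ?case by simp
next
  case (Suc l)
  show ?case
  proof (cases "n = 0 \<or> m = 0")
    case True
    hence "(\<lambda>x. p x * q x) = (\<lambda>_. 0)" using Suc.prems by (auto simp: fun_eq_iff)
    thus ?thesis using deriv_nilpotent_zero by metis
  next
    case False
    then obtain n' m' where nm: "n = Suc n'" "m = Suc m'" by (meson not0_implies_Suc)
    have "deriv_nilpotent l (\<lambda>x. p x * dir_deriv \<xi> q x + dir_deriv \<xi> p x * q x)" for \<xi>
    proof (rule deriv_nilpotent_add)
      have "deriv_nilpotent (n + m') (\<lambda>x. p x * dir_deriv \<xi> q x)"
        using Suc nm by (intro Suc(1)) (auto intro: real_polynomial_function_dir_deriv)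
      thus "deriv_nilpotent l (\<lambda>x. p x * dir_deriv \<xi> q x)" using Suc(2) nm by simp
      have "deriv_nilpotent (n' + m) (\<lambda>x. dir_deriv \<xi> p x * q x)"
        using Suc nm by (intro Suc(1)) (auto intro: real_polynomial_function_dir_deriv)
      thus "deriv_nilpotent l (\<lambda>x. dir_deriv \<xi> p x * q x)" using Suc(2) nm by simp
    qed (use Suc in \<open>auto intro!: real_polynomial_function.intros(4) real_polynomial_function_dir_deriv\<close>)
    thus ?thesis
      using Suc.prems unfolding Suc(2)[symmetric] by (simp add: dir_deriv_mult differentiable_rpf)
  qed
qed

lemma real_polynomial_function_deriv_nilpotent:
  assumes "real_polynomial_function (p :: 'a::euclidean_space \<Rightarrow> real)" shows "\<exists>n. deriv_nilpotent n p"
  using assms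
proof (induction rule: real_polynomial_function.induct)
  case (linear f)
  have "dir_deriv \<xi> f = (\<lambda>_. f \<xi>)" for \<xi>
    by (rule ext, rule dir_deriv_eq, rule bounded_linear_imp_has_derivative[OF linear])
  hence "deriv_nilpotent (Suc (Suc 0)) f" by simp
  thus ?case by blast
next
  case (const c)
  have "deriv_nilpotent (Suc 0) (\<lambda>_::'a. c)" by simp
  thus ?case by blast
next
  case (add f g)
  then obtain n m where "deriv_nilpotent n f" "deriv_nilpotent m g" by blast
  hence "deriv_nilpotent (max n m) (\<lambda>x. f x + g x)"
    using add by (intro deriv_nilpotent_add) (auto intro: deriv_nilpotent_mono)
  thus ?case by blast
next
  case (mult f g)
  thus ?case using deriv_nilpotent_mult by blast
qed

text \<open>Monomials in the coordinates of an orthogonal basis that contains the roots; on these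
  the explicit intertwining operator is diagonal.\<close>

inductive monomial_span :: "'a::euclidean_space set \<Rightarrow> ('a \<Rightarrow> real) \<Rightarrow> bool" for B where
  mono: "monomial_span B (\<lambda>x. c * (\<Prod>e\<in>B. (e \<bullet> x) ^ n e))"
| add: "monomial_span B p \<Longrightarrow> monomial_span B q \<Longrightarrow> monomial_span B (\<lambda>x. p x + q x)"

lemma monomial_span_mult:
  assumes "monomial_span B p" "monomial_span B q" shows "monomial_span B (\<lambda>x. p x * q x)"
  using assms
proof (induction arbitrary: q rule: monomial_span.induct)
  case (mono c n)
  from mono show ?case
  proof (induction rule: monomial_span.induct)
    case (mono d m)
    have "(\<lambda>x. c * (\<Prod>e\<in>B. (e \<bullet> x) ^ n e) * (d * (\<Prod>e\<in>B. (e \<bullet> x) ^ m e))) = (\<lambda>x. (c * d) * (\<Prod>e\<in>B. (e \<bullet> x) ^ (n e + m e)))"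
      by (simp add: power_add prod.distrib mult_ac)
    thus ?case using monomial_span.mono by metis
  next
    case (add p q)
    thus ?case by (simp add: distrib_left monomial_span.add)
  qed
next
  case (add p q')
  thus ?case by (simp add: distrib_right monomial_span.add)
qed

lemma monomial_span_sum:
  assumes "finite A" "\<And>a. a \<in> A \<Longrightarrow> monomial_span B (f a)" shows "monomial_span B (\<lambda>x. \<Sum>a\<in>A. f a x)"
  using assms
proof (induction A rule: finite_induct)
  case empty
  show ?case using monomial_span.mono[of B 0] by simp
qed (auto intro: monomial_span.add)

lemma monomial_span_imp_polynomial:
  assumes "monomial_span B p" "finite B" shows "real_polynomial_function p"
  using assms
proof (induction rule: monomial_span.induct)
  case (mono c n)
  have "real_polynomial_function (\<lambda>x. e \<bullet> x)" for e :: 'a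
    by (rule real_polynomial_function.intros(1)) (rule bounded_linear_inner_right)
  thus ?case using mono
    by (intro real_polynomial_function.intros(4) real_polynomial_function.intros(2) real_polynomial_function_prod real_polynomial_function_power) auto
qed (auto intro: real_polynomial_function.intros(3))

lemma polynomial_imp_monomial_span:
  assumes B: "finite B" "\<And>x. (\<Sum>e\<in>B. ((e \<bullet> x) / (e \<bullet> e)) *\<^sub>R e) = x"
    and "real_polynomial_function (p :: 'a::euclidean_space \<Rightarrow> real)"
  shows "monomial_span B p"
  using assms(3)
proof (induction rule: real_polynomial_function.induct)
  case (linear f)
  interpret f: bounded_linear f by fact
  have "f x = (\<Sum>e\<in>B. (f e / (e \<bullet> e)) * (\<Prod>e'\<in>B. (e' \<bullet> x) ^ (if e' = e then 1 else 0)))" for x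
  proof -
    have "f x = f (\<Sum>e\<in>B. ((e \<bullet> x) / (e \<bullet> e)) *\<^sub>R e)" using B(2) by simp
    also have "\<dots> = (\<Sum>e\<in>B. ((e \<bullet> x) / (e \<bullet> e)) * f e)" by (simp add: f.sum f.scaleR)
    also have "\<dots> = (\<Sum>e\<in>B. (f e / (e \<bullet> e)) * (\<Prod>e'\<in>B. (e' \<bullet> x) ^ (if e' = e then 1 else 0)))"
    proof (rule sum.cong[OF refl])
      fix e assume "e \<in> B"
      hence "(\<Prod>e'\<in>B. (e' \<bullet> x) ^ (if e' = e then 1 else 0)) = e \<bullet> x"
        using B(1) by (simp add: if_distrib cong: if_cong)
      thus "((e \<bullet> x) / (e \<bullet> e)) * f e = (f e / (e \<bullet> e)) * (\<Prod>e'\<in>B. (e' \<bullet> x) ^ (if e' = e then 1 else 0))"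
        by simp
    qed
    finally show ?thesis .
  qed
  hence "f = (\<lambda>x. \<Sum>e\<in>B. (f e / (e \<bullet> e)) * (\<Prod>e'\<in>B. (e' \<bullet> x) ^ (if e' = e then 1 else 0)))" by blast
  moreover have "monomial_span B (\<lambda>x. \<Sum>e\<in>B. (f e / (e \<bullet> e)) * (\<Prod>e'\<in>B. (e' \<bullet> x) ^ (if e' = e then 1 else 0)))"
    by (intro monomial_span_sum B(1) monomial_span.mono)
  ultimately show ?case by metis
next
  case (const c)
  show ?case using monomial_span.mono[of B c "\<lambda>_. 0"] by simp
qed (auto intro: monomial_span.add monomial_span_mult)

lemma homogeneous_dir_deriv:
  assumes "homogeneous_poly (Suc n) p" shows "homogeneous_poly n (dir_deriv \<xi> p)"
proof -
  have p: "real_polynomial_function p" "\<And>c x. p (c *\<^sub>R x) = c ^ Suc n * p x"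
    using assms unfolding homogeneous_poly_def by auto
  have d: "real_polynomial_function (dir_deriv \<xi> p)" using p(1) by (rule real_polynomial_function_dir_deriv)
  have ne: "dir_deriv \<xi> p (c *\<^sub>R x) = c ^ n * dir_deriv \<xi> p x" if "c \<noteq> 0" for c x
  proof -
    have "((\<lambda>x. p (c *\<^sub>R x)) has_derivative (\<lambda>h. dir_deriv (c *\<^sub>R h) p (c *\<^sub>R x))) (at x)"
      by (rule has_derivative_compose[OF _ real_polynomial_function_differentiable[OF p(1)], of "\<lambda>x. c *\<^sub>R x" "\<lambda>h. c *\<^sub>R h"])
         (auto intro!: derivative_eq_intros)
    hence "dir_deriv \<xi> (\<lambda>x. p (c *\<^sub>R x)) x = dir_deriv (c *\<^sub>R \<xi>) p (c *\<^sub>R x)" by (rule dir_deriv_eq)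
    also have "\<dots> = c * dir_deriv \<xi> p (c *\<^sub>R x)"
      by (subst linear_cmul[OF has_derivative_linear[OF real_polynomial_function_differentiable[OF p(1)]]]) simp
    finally have 1: "dir_deriv \<xi> (\<lambda>x. p (c *\<^sub>R x)) x = c * dir_deriv \<xi> p (c *\<^sub>R x)" .
    have "((\<lambda>x. c ^ Suc n * p x) has_derivative (\<lambda>h. c ^ Suc n * dir_deriv h p x)) (at x)"
      by (intro has_derivative_mult_right real_polynomial_function_differentiable p(1))
    hence "dir_deriv \<xi> (\<lambda>x. c ^ Suc n * p x) x = c ^ Suc n * dir_deriv \<xi> p x" by (rule dir_deriv_eq)
    hence "c * dir_deriv \<xi> p (c *\<^sub>R x) = c ^ Suc n * dir_deriv \<xi> p x" using 1[unfolded p(2)] by linarith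
    hence "c * dir_deriv \<xi> p (c *\<^sub>R x) = c * (c ^ n * dir_deriv \<xi> p x)" by (simp only: power_Suc mult.assoc)
    thus ?thesis using mult_left_cancel[OF that] by blast
  qed
  have "dir_deriv \<xi> p (c *\<^sub>R x) = c ^ n * dir_deriv \<xi> p x" for c x
  proof (cases "c = 0")
    case True
    \<comment> \<open>The chain rule gives the identity times c, which says nothing at c = 0; there
      the value is recovered by continuity, with \<open>0 ^ n\<close> correct also for n =
      0.\<close>
    have 1: "((\<lambda>c. dir_deriv \<xi> p (c *\<^sub>R x)) \<longlongrightarrow> dir_deriv \<xi> p (0 *\<^sub>R x)) (at (0::real))"
      by (rule isCont_tendsto_compose[of _ "dir_deriv \<xi> p"])
         (use continuous_on_real_polynomial_function[OF d, of UNIV] in \<open>auto intro!: tendsto_eq_intros simp: continuous_on_eq_continuous_at\<close>)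
    have 2: "((\<lambda>c. c ^ n * dir_deriv \<xi> p x) \<longlongrightarrow> 0 ^ n * dir_deriv \<xi> p x) (at (0::real))"
      by (intro tendsto_intros)
    have "\<forall>\<^sub>F c in at (0::real). dir_deriv \<xi> p (c *\<^sub>R x) = c ^ n * dir_deriv \<xi> p x"
      using ne by (auto simp: eventually_at_filter)
    from tendsto_cong[OF this, THEN iffD1, OF 1]
    have "dir_deriv \<xi> p (0 *\<^sub>R x) = 0 ^ n * dir_deriv \<xi> p x" using 2 by (rule LIM_unique)
    thus ?thesis using True by simp
  qed (rule ne)
  thus ?thesis using d by (simp add: homogeneous_poly_def)
qed

section \<open>The explicit intertwining operator\<close>

context orth_roots
begin

definition root_weight :: "('a \<Rightarrow> real) \<Rightarrow> real" where
  "root_weight t = (\<Prod>\<beta>\<in>R. 1 + t \<beta>)"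

definition dunkl_average :: "('a \<Rightarrow> real) \<Rightarrow> 'a \<Rightarrow> real" where
  "dunkl_average p x = (LINT t|GM. root_weight t * p (rescale R t x))"

lemma root_weight_bounds:
  assumes "t \<in> space GM" shows "0 \<le> root_weight t" "root_weight t \<le> 2 ^ card R"
proof -
  have "0 \<le> 1 + t \<beta> \<and> 1 + t \<beta> \<le> 2" if "\<beta> \<in> R" for \<beta> using space_GM[OF assms that] by auto
  thus "0 \<le> root_weight t" "root_weight t \<le> 2 ^ card R"
    using prod_mono[of R "\<lambda>\<beta>. 1 + t \<beta>" "\<lambda>_. 2"] by (auto simp: root_weight_def intro!: prod_nonneg)
qed

lemma measurable_prod_GM: "A \<subseteq> R \<Longrightarrow> (\<lambda>t. \<Prod>\<beta>\<in>A. 1 + t \<beta>) \<in> borel_measurable GM"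
  by (intro borel_measurable_prod borel_measurable_add measurable_GM_coord) auto

lemma integrable_root_weight: "integrable GM root_weight"
  using root_weight_bounds measurable_prod_GM[of R]
  by (intro integrable_GM_bounded[of _ "2 ^ card R"]) (auto simp: root_weight_def[abs_def])

lemma integrable_GM_rescale:
  fixes f :: "'a \<Rightarrow> real"
  assumes "continuous_on UNIV f" "integrable GM w"
  shows "integrable GM (\<lambda>t. w t * f (rescale R t x))"
  using assms by (intro integrable_compact_param[of "cball 0 (norm x)"])
    (auto intro: continuous_on_subset measurable_rescale norm_rescale_GM)

lemma bounded_GM_rescale:
  fixes f :: "'a \<Rightarrow> real"
  assumes "continuous_on UNIV f"
  obtains B where "B \<ge> 0" "\<And>t. t \<in> space GM \<Longrightarrow> \<bar>f (rescale R t x)\<bar> \<le> B"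
proof -
  have "bounded (f ` cball 0 (norm x))"
    by (intro compact_imp_bounded compact_continuous_image continuous_on_subset[OF assms]) auto
  then obtain B where "\<forall>y\<in>f ` cball 0 (norm x). norm y \<le> B" unfolding bounded_iff by blast
  hence "norm (f (rescale R t x)) \<le> B" if "t \<in> space GM" for t
    using norm_rescale_GM[OF that, of x] by (simp add: mem_cball_0)
  hence "\<bar>f (rescale R t x)\<bar> \<le> \<bar>B\<bar>" if "t \<in> space GM" for t
    using that by (metis abs_ge_self order_trans real_norm_def)
  thus ?thesis using that[of "\<bar>B\<bar>"] by auto
qed

lemma has_derivative_dunkl_average:
  assumes D: "\<And>x. (p has_derivative (\<lambda>h. G x \<bullet> h)) (at x)" and G: "continuous_on UNIV G"
  shows "(dunkl_average p has_derivative (\<lambda>h. LINT t|GM. root_weight t * (G (rescale R t x) \<bullet> rescale R t h))) (at x)"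
proof -
  have cp: "continuous_on UNIV p"
    using D by (intro continuous_at_imp_continuous_on ballI) (rule has_derivative_continuous)
  have "((\<lambda>x. LINT t|GM. root_weight t * p (rescale R (decode (encode t)) x)) has_derivative
     (\<lambda>h. LINT t|GM. root_weight t * (rescale R (decode (encode t)) (G (rescale R (decode (encode t)) x)) \<bullet> h))) (at x)"
  proof (rule has_derivative_param_integral[where U=UNIV and K=code_box])
    show "continuous_on (UNIV \<times> code_box) (\<lambda>z. rescale R (decode (snd z)) (G (rescale R (decode (snd z)) (fst z))))"
      by (intro continuous_intros continuous_on_compose2[OF G]) auto
    fix x \<tau>
    have "((\<lambda>x. p (rescale R (decode \<tau>) x)) has_derivative (\<lambda>h. G (rescale R (decode \<tau>) x) \<bullet> rescale R (decode \<tau>) h)) (at x)"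
      by (rule has_derivative_compose[OF linear_imp_has_derivative[OF linear_rescale] D])
    thus "((\<lambda>x. p (rescale R (decode \<tau>) x)) has_derivative (\<lambda>h. rescale R (decode \<tau>) (G (rescale R (decode \<tau>) x)) \<bullet> h)) (at x)"
      by (simp add: rescale_inner_commute)
    show "continuous_on code_box (\<lambda>\<tau>. p (rescale R (decode \<tau>) x))"
      by (intro continuous_intros continuous_on_compose2[OF cp]) auto
  qed (auto intro: compact_code_box measurable_encode encode_in_box integrable_root_weight)
  thus ?thesis by (simp add: rescale_decode_encode rescale_inner_commute dunkl_average_def[abs_def])
qed

lemma rescale_upd_derivative:
  assumes b: "\<beta> \<in> R" and D: "\<And>x. (p has_derivative (\<lambda>h. G x \<bullet> h)) (at x)"
  shows "((\<lambda>s. p (rescale R (t(\<beta> := s)) x)) has_real_derivative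
     (G (rescale R (t(\<beta> := s)) x) \<bullet> \<beta>) * ((\<beta> \<bullet> x) / (\<beta> \<bullet> \<beta>))) (at s within S)"
proof -
  have *: "((\<lambda>s. rescale R (t(\<beta> := s)) x) has_derivative (\<lambda>h. (h * ((\<beta> \<bullet> x) / (\<beta> \<bullet> \<beta>))) *\<^sub>R \<beta>)) (at s within S)"
    unfolding rescale_upd[OF b] by (auto intro!: derivative_eq_intros simp: divide_inverse mult.assoc)
  have "((\<lambda>s. p (rescale R (t(\<beta> := s)) x)) has_derivative
     (\<lambda>h. G (rescale R (t(\<beta> := s)) x) \<bullet> ((h * ((\<beta> \<bullet> x) / (\<beta> \<bullet> \<beta>))) *\<^sub>R \<beta>))) (at s within S)"
    by (rule has_derivative_compose[OF * D])
  thus ?thesis unfolding has_field_derivative_def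
    by (rule has_derivative_eq_rhs) (auto simp: fun_eq_iff)
qed

lemma root_weight_remove: "\<beta> \<in> R \<Longrightarrow> root_weight t = (1 + t \<beta>) * (\<Prod>\<gamma>\<in>R-{\<beta>}. 1 + t \<gamma>)"
  unfolding root_weight_def by (subst prod.remove[of R \<beta>]) auto

lemma root_weight_remove_bound:
  assumes "t \<in> space GM" shows "\<bar>\<Prod>\<gamma>\<in>R-{\<beta>}. 1 + t \<gamma>\<bar> \<le> 2 ^ card R"
proof -
  have "0 \<le> 1 + t \<gamma> \<and> 1 + t \<gamma> \<le> 2" if "\<gamma> \<in> R" for \<gamma> using space_GM[OF assms that] by auto
  hence "0 \<le> (\<Prod>\<gamma>\<in>R-{\<beta>}. 1 + t \<gamma>)" "(\<Prod>\<gamma>\<in>R-{\<beta>}. 1 + t \<gamma>) \<le> 2 ^ card (R - {\<beta>})"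
    using prod_mono[of "R-{\<beta>}" "\<lambda>\<beta>. 1 + t \<beta>" "\<lambda>_. 2"] by (auto intro!: prod_nonneg)
  moreover have "(2::real) ^ card (R - {\<beta>}) \<le> 2 ^ card R"
    by (intro power_increasing card_mono) auto
  ultimately show ?thesis by linarith
qed

lemma reflection_quotient_dunkl_average:
  assumes b: "\<beta> \<in> R" and D: "\<And>x. (p has_derivative (\<lambda>h. G x \<bullet> h)) (at x)" and G: "continuous_on UNIV G"
  shows "k \<beta> * reflection_quotient \<beta> (dunkl_average p) x =
    (LINT t|GM. root_weight t * ((1 - t \<beta>) * (G (rescale R t x) \<bullet> \<beta>))) / (\<beta> \<bullet> \<beta>)"
proof -
  let ?z = "\<lambda>t. rescale R t x"
  let ?w = "\<lambda>t. \<Prod>\<gamma>\<in>R-{\<beta>}. 1 + t \<gamma>"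
  have bb: "\<beta> \<bullet> \<beta> > 0" using root_nonzero[OF b] by simp
  have cp: "continuous_on UNIV p"
    using D by (intro continuous_at_imp_continuous_on ballI) (rule has_derivative_continuous)
  have cG: "continuous_on UNIV (\<lambda>x. G x \<bullet> v)" for v by (intro continuous_intros G)
  have wu: "?w (t(\<beta> := s)) = ?w t" for t s by (intro prod.cong) auto
  have mw: "?w \<in> borel_measurable GM" by (rule measurable_prod_GM) auto
  note mb = measurable_GM_coord[OF b]
  have mf: "(\<lambda>t. f (?z t)) \<in> borel_measurable GM" if "continuous_on UNIV f" for f :: "'a \<Rightarrow> real"
    using measurable_compose[OF measurable_rescale borel_measurable_continuous_onI[OF that]] .
  have tb: "\<bar>t \<beta>\<bar> \<le> 1" if "t \<in> space GM" for t using space_GM[OF that b] by auto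
  obtain Bp where Bp: "Bp \<ge> 0" "\<And>t. t \<in> space GM \<Longrightarrow> \<bar>p (?z t)\<bar> \<le> Bp" using bounded_GM_rescale[OF cp] by blast
  obtain BG where BG: "BG \<ge> 0" "\<And>t. t \<in> space GM \<Longrightarrow> \<bar>G (?z t) \<bullet> \<beta>\<bar> \<le> BG" using bounded_GM_rescale[OF cG] by blast
  have split: "root_weight t * ((1 - t \<beta>) * a) = (1 - (t \<beta>)\<^sup>2) * (?w t * a)" for t a
    unfolding root_weight_remove[OF b] by (simp add: power2_eq_square algebra_simps)
  have wB: "\<bar>?w t * a\<bar> \<le> 2 ^ card R * B" if "t \<in> space GM" "\<bar>a\<bar> \<le> B" for t a B
    unfolding abs_mult using root_weight_remove_bound[OF that(1), of \<beta>] that(2) by (intro mult_mono) auto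
  show ?thesis
  proof (cases "\<beta> \<bullet> x = 0")
    case False
    define c where "c = (\<beta> \<bullet> x) / (\<beta> \<bullet> \<beta>)"
    \<comment> \<open>Integration by parts in the coordinate of \<beta>: differentiating p at the
      rescaled point brings down the factor c = (\<beta> \<bullet> x)/(\<beta> \<bullet> \<beta>),
      the one needed to cancel the denominator of the quotient.\<close>
    have ibp: "(LINT t|GM. (1 - (t \<beta>)\<^sup>2) * (?w t * ((G (?z t) \<bullet> \<beta>) * c))) = 2 * k \<beta> * (LINT t|GM. t \<beta> * (?w t * p (?z t)))"
    proof (rule GM_integration_by_parts[OF b])
      fix t s
      show "((\<lambda>s. ?w (t(\<beta> := s)) * p (?z (t(\<beta> := s)))) has_real_derivative
         ?w (t(\<beta> := s)) * ((G (?z (t(\<beta> := s))) \<bullet> \<beta>) * c)) (at s within {-1..1})"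
        unfolding wu c_def by (intro DERIV_cmult rescale_upd_derivative[OF b D])
    next
      fix t assume t: "t \<in> space GM"
      show "\<bar>?w t * p (?z t)\<bar> \<le> 2 ^ card R * Bp" by (intro wB t Bp)
      have "\<bar>(G (?z t) \<bullet> \<beta>) * c\<bar> \<le> BG * \<bar>c\<bar>" unfolding abs_mult using BG(2)[OF t] by (intro mult_right_mono) auto
      thus "\<bar>?w t * ((G (?z t) \<bullet> \<beta>) * c)\<bar> \<le> 2 ^ card R * (BG * \<bar>c\<bar>)" by (intro wB t)
    qed (intro borel_measurable_times mw mf cp cG; simp)+
    \<comment> \<open>Reflecting x flips one parameter; moving the flip to the weight turns 1 + t
      into 1 - t, so the difference of the two averages is twice the mean with factor t.\<close>
    have "dunkl_average p (reflection \<beta> x) = (LINT t|GM. (1 + t \<beta>) * (?w t * p (?z (t(\<beta> := - t \<beta>)))))"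
      unfolding dunkl_average_def rescale_reflection[OF b] root_weight_remove[OF b] by (simp add: mult.assoc)
    also have "\<dots> = (LINT t|GM. (\<lambda>t. (1 - t \<beta>) * (?w t * p (?z t))) (t(\<beta> := - t \<beta>)))"
      by (simp add: wu)
    also have "\<dots> = (LINT t|GM. (1 - t \<beta>) * (?w t * p (?z t)))"
    proof (rule integral_GM_flip[OF b])
      fix t assume t: "t \<in> space GM"
      have "\<bar>1 - t \<beta>\<bar> \<le> 2" using tb[OF t] by linarith
      thus "\<bar>(1 - t \<beta>) * (?w t * p (?z t))\<bar> \<le> 2 * (2 ^ card R * Bp)"
        unfolding abs_mult[of "1 - t \<beta>"] using wB[OF t Bp(2)[OF t]] by (intro mult_mono) auto
    qed (intro borel_measurable_times borel_measurable_diff mw mf cp mb borel_measurable_const)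
    finally have refl: "dunkl_average p (reflection \<beta> x) = (LINT t|GM. (1 - t \<beta>) * (?w t * p (?z t)))" .
    have intw: "integrable GM (\<lambda>t. ?w t * p (?z t))"
      using wB Bp by (intro integrable_GM_bounded[of _ "2 ^ card R * Bp"] borel_measurable_times mw mf cp) auto
    have intt: "integrable GM (\<lambda>t. t \<beta> * (?w t * p (?z t)))"
    proof (rule integrable_GM_bounded)
      fix t assume t: "t \<in> space GM"
      show "\<bar>t \<beta> * (?w t * p (?z t))\<bar> \<le> 1 * (2 ^ card R * Bp)"
        unfolding abs_mult[of "t \<beta>"] using wB[OF t Bp(2)[OF t]] tb[OF t] by (intro mult_mono) auto
    qed (intro borel_measurable_times mw mf cp mb)
    have "dunkl_average p x = (LINT t|GM. ?w t * p (?z t) + t \<beta> * (?w t * p (?z t)))"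
      unfolding dunkl_average_def root_weight_remove[OF b] by (simp add: algebra_simps)
    also have "\<dots> = (LINT t|GM. ?w t * p (?z t)) + (LINT t|GM. t \<beta> * (?w t * p (?z t)))"
      by (rule Bochner_Integration.integral_add[OF intw intt])
    finally have V: "dunkl_average p x = (LINT t|GM. ?w t * p (?z t)) + (LINT t|GM. t \<beta> * (?w t * p (?z t)))" .
    have "dunkl_average p (reflection \<beta> x) = (LINT t|GM. ?w t * p (?z t) - t \<beta> * (?w t * p (?z t)))"
      unfolding refl by (simp add: algebra_simps)
    also have "\<dots> = (LINT t|GM. ?w t * p (?z t)) - (LINT t|GM. t \<beta> * (?w t * p (?z t)))"
      by (rule Bochner_Integration.integral_diff[OF intw intt])
    finally have diff: "dunkl_average p x - dunkl_average p (reflection \<beta> x) = 2 * (LINT t|GM. t \<beta> * (?w t * p (?z t)))" using V by simp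
    have "k \<beta> * (dunkl_average p x - dunkl_average p (reflection \<beta> x)) = (LINT t|GM. (1 - (t \<beta>)\<^sup>2) * (?w t * (G (?z t) \<bullet> \<beta>))) * c"
      unfolding diff using ibp by (simp add: mult.assoc[symmetric])
    thus ?thesis
      unfolding reflection_quotient_def split using False bb by (simp add: c_def field_simps)
  next
    case True
    have inv: "?z (t(\<beta> := s)) = ?z t" for t s using True by (simp add: rescale_upd[OF b])
    \<comment> \<open>Here the rescaled point does not depend on the coordinate of \<beta>, so the
      primitive is taken in the weight: 1 + t has derivative 1.\<close>
    have ibp: "(LINT t|GM. (1 - (t \<beta>)\<^sup>2) * (?w t * (G (?z t) \<bullet> \<beta>))) = 2 * k \<beta> * (LINT t|GM. t \<beta> * ((1 + t \<beta>) * (?w t * (G (?z t) \<bullet> \<beta>))))"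
    proof (rule GM_integration_by_parts[OF b])
      fix t s
      show "((\<lambda>s. (1 + (t(\<beta> := s)) \<beta>) * (?w (t(\<beta> := s)) * (G (?z (t(\<beta> := s))) \<bullet> \<beta>))) has_real_derivative
         ?w (t(\<beta> := s)) * (G (?z (t(\<beta> := s))) \<bullet> \<beta>)) (at s within {-1..1})"
        unfolding wu inv by (auto intro!: derivative_eq_intros)
    next
      fix t assume t: "t \<in> space GM"
      show "\<bar>?w t * (G (?z t) \<bullet> \<beta>)\<bar> \<le> 2 ^ card R * BG" by (intro wB t BG)
      have "\<bar>1 + t \<beta>\<bar> \<le> 2" using tb[OF t] by linarith
      thus "\<bar>(1 + t \<beta>) * (?w t * (G (?z t) \<bullet> \<beta>))\<bar> \<le> 2 * (2 ^ card R * BG)"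
        unfolding abs_mult[of "1 + t \<beta>"] using wB[OF t BG(2)[OF t]] by (intro mult_mono) auto
    qed (intro borel_measurable_times borel_measurable_add borel_measurable_const mb mw mf cG; simp)+
    have rb: "rescale R t \<beta> = t \<beta> *\<^sub>R \<beta>" for t
    proof -
      have "rescale R t \<beta> = \<beta> + (\<Sum>\<gamma>\<in>R. if \<gamma> = \<beta> then (t \<beta> - 1) *\<^sub>R \<beta> else 0)"
        unfolding rescale_def using b bb roots_orthogonal by (intro arg_cong[of _ _ "(+) \<beta>"] sum.cong) auto
      thus ?thesis using b by (simp add: algebra_simps)
    qed
    have "k \<beta> * dir_deriv \<beta> (dunkl_average p) x * 2 = 2 * k \<beta> * (LINT t|GM. t \<beta> * ((1 + t \<beta>) * (?w t * (G (?z t) \<bullet> \<beta>))))"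
      unfolding dir_deriv_eq[OF has_derivative_dunkl_average[OF D G]] rb root_weight_remove[OF b] by (simp add: mult_ac)
    also have "\<dots> = (LINT t|GM. root_weight t * ((1 - t \<beta>) * (G (?z t) \<bullet> \<beta>)))" unfolding split ibp ..
    finally show ?thesis using True by (simp add: reflection_quotient_def power2_norm_eq_inner field_simps)
  qed
qed

text \<open>Differentiation under the integral yields the gradient applied to the rescaled
  direction; the difference terms supply exactly what separates it from the direction
  itself.\<close>

lemma dunkl_operator_dunkl_average:
  assumes D: "\<And>x. (p has_derivative (\<lambda>h. G x \<bullet> h)) (at x)" and G: "continuous_on UNIV G"
  shows "dunkl_operator R k \<xi> (dunkl_average p) = dunkl_average (dir_deriv \<xi> p)"
proof (rule ext)
  fix x
  let ?z = "\<lambda>t. rescale R t x"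
  have cG: "continuous_on UNIV (\<lambda>x. G x \<bullet> v)" for v by (intro continuous_intros G)
  note param = integrable_compact_param[OF compact_code_box _ measurable_encode encode_in_box integrable_root_weight]
  have int: "integrable GM (\<lambda>t. root_weight t * (G (?z t) \<bullet> rescale R t v))" for v
  proof -
    have "continuous_on code_box (\<lambda>\<tau>. G (rescale R (decode \<tau>) x) \<bullet> rescale R (decode \<tau>) v)"
      by (intro continuous_intros continuous_on_compose2[OF G]) auto
    from param[OF this] show ?thesis by (simp add: rescale_decode_encode)
  qed
  have int2: "integrable GM (\<lambda>t. root_weight t * ((1 - t \<beta>) * (G (?z t) \<bullet> \<beta>)))" if "\<beta> \<in> R" for \<beta>
  proof -
    have "continuous_on code_box (\<lambda>\<tau>. (1 - decode \<tau> \<beta>) * (G (rescale R (decode \<tau>) x) \<bullet> \<beta>))"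
      unfolding decode_def[of _ \<beta>] divide_inverse
      by (intro continuous_intros continuous_on_compose2[OF G]) auto
    from param[OF this] show ?thesis by (simp add: rescale_decode_encode decode_encode[OF that])
  qed
  have "dunkl_operator R k \<xi> (dunkl_average p) x = (LINT t|GM. root_weight t * (G (?z t) \<bullet> rescale R t \<xi>)) +
     (\<Sum>\<beta>\<in>R. (\<beta> \<bullet> \<xi>) * (k \<beta> * reflection_quotient \<beta> (dunkl_average p) x))"
    unfolding dunkl_operator_def dir_deriv_eq[OF has_derivative_dunkl_average[OF D G]] by (simp add: mult_ac)
  also have "\<dots> = (LINT t|GM. root_weight t * (G (?z t) \<bullet> rescale R t \<xi>)) +
     (\<Sum>\<beta>\<in>R. LINT t|GM. (\<beta> \<bullet> \<xi>) / (\<beta> \<bullet> \<beta>) * (root_weight t * ((1 - t \<beta>) * (G (?z t) \<bullet> \<beta>))))"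
    by (intro arg_cong2[of _ _ _ _ "(+)"] sum.cong refl) (simp add: reflection_quotient_dunkl_average[OF _ D G])
  also have "\<dots> = (LINT t|GM. root_weight t * (G (?z t) \<bullet> rescale R t \<xi>) +
     (\<Sum>\<beta>\<in>R. (\<beta> \<bullet> \<xi>) / (\<beta> \<bullet> \<beta>) * (root_weight t * ((1 - t \<beta>) * (G (?z t) \<bullet> \<beta>)))))"
    using int int2 by (simp add: Bochner_Integration.integral_sum)
  also have "\<dots> = (LINT t|GM. root_weight t * (G (?z t) \<bullet> \<xi>))"
  proof (rule Bochner_Integration.integral_cong[OF refl])
    fix t
    have "G (?z t) \<bullet> rescale R t \<xi> + (\<Sum>\<beta>\<in>R. (\<beta> \<bullet> \<xi>) / (\<beta> \<bullet> \<beta>) * ((1 - t \<beta>) * (G (?z t) \<bullet> \<beta>)))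
      = G (?z t) \<bullet> \<xi> + (\<Sum>\<beta>\<in>R. (t \<beta> - 1) * (\<beta> \<bullet> \<xi>) / (\<beta> \<bullet> \<beta>) * (G (?z t) \<bullet> \<beta>) + (\<beta> \<bullet> \<xi>) / (\<beta> \<bullet> \<beta>) * ((1 - t \<beta>) * (G (?z t) \<bullet> \<beta>)))"
      unfolding rescale_def inner_add_right inner_sum_right inner_scaleR_right sum.distrib by simp
    \<comment> \<open>The coefficients t - 1 from the rescaled direction and 1 - t from the
      difference term cancel root by root.\<close>
    also have "(\<Sum>\<beta>\<in>R. (t \<beta> - 1) * (\<beta> \<bullet> \<xi>) / (\<beta> \<bullet> \<beta>) * (G (?z t) \<bullet> \<beta>) + (\<beta> \<bullet> \<xi>) / (\<beta> \<bullet> \<beta>) * ((1 - t \<beta>) * (G (?z t) \<bullet> \<beta>))) = 0"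
      by (rule sum.neutral) (simp add: algebra_simps diff_divide_distrib)
    finally have "G (?z t) \<bullet> rescale R t \<xi> + (\<Sum>\<beta>\<in>R. (\<beta> \<bullet> \<xi>) / (\<beta> \<bullet> \<beta>) * ((1 - t \<beta>) * (G (?z t) \<bullet> \<beta>))) = G (?z t) \<bullet> \<xi>"
      by simp
    from arg_cong[OF this, of "\<lambda>r. root_weight t * r"]
    show "root_weight t * (G (?z t) \<bullet> rescale R t \<xi>) +
     (\<Sum>\<beta>\<in>R. (\<beta> \<bullet> \<xi>) / (\<beta> \<bullet> \<beta>) * (root_weight t * ((1 - t \<beta>) * (G (?z t) \<bullet> \<beta>)))) = root_weight t * (G (?z t) \<bullet> \<xi>)"
      by (simp add: distrib_left sum_distrib_left mult_ac)
  qed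
  also have "\<dots> = dunkl_average (dir_deriv \<xi> p) x"
    unfolding dunkl_average_def by (simp add: dir_deriv_eq[OF D])
  finally show "dunkl_operator R k \<xi> (dunkl_average p) x = dunkl_average (dir_deriv \<xi> p) x" .
qed

lemma real_polynomial_gradient_continuous:
  assumes "real_polynomial_function (p :: 'a \<Rightarrow> real)"
  obtains G where "\<And>x. (p has_derivative (\<lambda>h. G x \<bullet> h)) (at x)" "continuous_on UNIV G"
proof -
  obtain G where G: "\<And>x. (p has_derivative (\<lambda>h. G x \<bullet> h)) (at x)" "\<And>v. real_polynomial_function (\<lambda>x. G x \<bullet> v)"
    using real_polynomial_function_gradient[OF assms] by blast
  have "continuous_on UNIV G"
    by (subst continuous_on_componentwise) (use G(2) in \<open>auto intro: continuous_on_real_polynomial_function\<close>)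
  thus ?thesis using that G by blast
qed

lemma dunkl_operator_dunkl_average_polynomial:
  assumes "real_polynomial_function p"
  shows "dunkl_operator R k \<xi> (dunkl_average p) = dunkl_average (dir_deriv \<xi> p)"
  using real_polynomial_gradient_continuous[OF assms] dunkl_operator_dunkl_average by metis

section \<open>Bijectivity of the average on polynomials\<close>

text \<open>The roots themselves are kept in the basis, so it is orthogonal without being
  normalized; this accounts for the denominators in the expansion.\<close>

lemma orthogonal_basis_extension:
  obtains B where "R \<subseteq> B" "finite B" "\<And>e f. e \<in> B \<Longrightarrow> f \<in> B \<Longrightarrow> e \<noteq> f \<Longrightarrow> e \<bullet> f = 0"
    "0 \<notin> B" "\<And>x. (\<Sum>e\<in>B. ((e \<bullet> x) / (e \<bullet> e)) *\<^sub>R e) = x"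
proof -
  have po: "pairwise orthogonal R"
    using roots_orthogonal by (auto simp: pairwise_def orthogonal_def)
  obtain U where U: "U \<inter> (insert 0 R) = {}" "pairwise orthogonal (R \<union> U)" "span (R \<union> U) = span (R \<union> UNIV)"
    using orthogonal_extension_strong[OF po] by metis
  define B where "B = R \<union> U"
  have 0: "0 \<notin> B" using U(1) root_nonzero by (auto simp: B_def)
  have fin: "finite B" using pairwise_orthogonal_independent[OF U(2)] 0 independent_imp_finite by (auto simp: B_def)
  have orth: "e \<bullet> f = 0" if "e \<in> B" "f \<in> B" "e \<noteq> f" for e f
    using U(2) that by (auto simp: B_def pairwise_def orthogonal_def)
  have "(\<Sum>e\<in>B. ((e \<bullet> x) / (e \<bullet> e)) *\<^sub>R e) = x" for x
  proof -
    define y where "y = x - (\<Sum>e\<in>B. ((e \<bullet> x) / (e \<bullet> e)) *\<^sub>R e)"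
    have "orthogonal y f" if f: "f \<in> B" for f
    proof -
      have "(\<Sum>e\<in>B. ((e \<bullet> x) / (e \<bullet> e)) *\<^sub>R e) \<bullet> f = (\<Sum>e\<in>B. if e = f then f \<bullet> x else 0)"
        unfolding inner_sum_left using orth f 0 by (intro sum.cong) auto
      thus ?thesis using f fin by (simp add: y_def orthogonal_def inner_diff_left inner_commute[of x f])
    qed
    moreover have "y \<in> span B" using U(3) by (simp add: B_def)
    ultimately have "orthogonal y y" by (rule orthogonal_to_span[rotated])
    thus ?thesis by (simp add: y_def orthogonal_def)
  qed
  thus ?thesis using that[of B] 0 fin orth by (auto simp: B_def)
qed

lemma integral_root_weight: "(LINT t|GM. root_weight t) = 1"
proof -
  have "(LINT t|gegen c. t) = 0" for c
    using gegen_symmetric[of "\<lambda>t. t" c] measurable_gegen_continuous[of "\<lambda>t. t" c] by (simp add: continuous_on_id)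
  moreover have "(LINT t|gegen c. 1 + t) = (LINT t|gegen c. 1) + (LINT t|gegen c. t)" for c
    by (intro Bochner_Integration.integral_add integrable_gegen_continuous continuous_intros)
  moreover have "(LINT t|gegen c. 1) = (1::real)" for c
    using prob_space.prob_space[OF prob_space_gegen, of c] by simp
  ultimately have "(LINT t|gegen c. 1 + t) = 1" for c by simp
  moreover have "(LINT t|GM. root_weight t) = (\<Prod>\<beta>\<in>R. LINT t|gegen (k \<beta>). 1 + t)"
    unfolding root_weight_def
    by (rule P.product_integral_prod) (auto intro!: integrable_gegen_continuous continuous_intros)
  ultimately show ?thesis by simp
qed

lemma dunkl_average_const: "dunkl_average (\<lambda>_. c) = (\<lambda>_. c)"
  by (auto simp: dunkl_average_def integral_root_weight)

lemma dunkl_average_add: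
  assumes "continuous_on UNIV p" "continuous_on UNIV q"
  shows "dunkl_average (\<lambda>x. p x + q x) = (\<lambda>x. dunkl_average p x + dunkl_average q x)"
  unfolding dunkl_average_def distrib_left
  by (rule ext, intro Bochner_Integration.integral_add integrable_GM_rescale assms integrable_root_weight)

lemma dunkl_average_cmult: "dunkl_average (\<lambda>x. c * p x) = (\<lambda>x. c * dunkl_average p x)"
  unfolding dunkl_average_def by (simp add: mult.left_commute[of _ c])

text \<open>Rescaling multiplies a coordinate along a root by its parameter and leaves the other
  coordinates alone, so a monomial is an eigenvector; the eigenvalue v is the weighted moment of the
  parameters and does not depend on c.\<close>

lemma dunkl_average_mono:
  assumes B: "R \<subseteq> B" "finite B" "\<And>e f. e \<in> B \<Longrightarrow> f \<in> B \<Longrightarrow> e \<noteq> f \<Longrightarrow> e \<bullet> f = 0"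
  shows "\<exists>v. \<forall>c. dunkl_average (\<lambda>x. c * (\<Prod>e\<in>B. (e \<bullet> x) ^ n e)) = (\<lambda>x. v * (c * (\<Prod>e\<in>B. (e \<bullet> x) ^ n e)))"
proof (intro exI[of _ "LINT t|GM. root_weight t * (\<Prod>\<beta>\<in>R. t \<beta> ^ n \<beta>)"] allI ext)
  fix c x
  have "(\<Prod>e\<in>B. (e \<bullet> rescale R t x) ^ n e) = (\<Prod>\<beta>\<in>R. t \<beta> ^ n \<beta>) * (\<Prod>e\<in>B. (e \<bullet> x) ^ n e)" for t
  proof -
    have "e \<bullet> rescale R t x = (if e \<in> R then t e else 1) * (e \<bullet> x)" if "e \<in> B" for e
    proof (cases "e \<in> R")
      case False
      have "e \<bullet> \<beta> = 0" if "\<beta> \<in> R" for \<beta> using B False \<open>e \<in> B\<close> that by blast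
      hence "(\<Sum>\<beta>\<in>R. e \<bullet> (((t \<beta> - 1) * (\<beta> \<bullet> x) / (\<beta> \<bullet> \<beta>)) *\<^sub>R \<beta>)) = 0" by (intro sum.neutral) simp
      thus ?thesis using False by (simp add: rescale_def inner_add_right inner_sum_right)
    qed (simp add: inner_rescale_root)
    hence "(\<Prod>e\<in>B. (e \<bullet> rescale R t x) ^ n e) = (\<Prod>e\<in>B. (if e \<in> R then t e ^ n e else 1) * (e \<bullet> x) ^ n e)"
      by (intro prod.cong) (auto simp: power_mult_distrib)
    also have "\<dots> = (\<Prod>e\<in>B. (if e \<in> R then t e ^ n e else 1)) * (\<Prod>e\<in>B. (e \<bullet> x) ^ n e)" by (rule prod.distrib)
    also have "(\<Prod>e\<in>B. (if e \<in> R then t e ^ n e else 1)) = (\<Prod>\<beta>\<in>R. t \<beta> ^ n \<beta>)"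
      using B by (subst prod.inter_restrict[symmetric]) (auto simp: Int_absorb1)
    finally show ?thesis .
  qed
  hence "root_weight t * (c * (\<Prod>e\<in>B. (e \<bullet> rescale R t x) ^ n e)) = (root_weight t * (\<Prod>\<beta>\<in>R. t \<beta> ^ n \<beta>)) * (c * (\<Prod>e\<in>B. (e \<bullet> x) ^ n e))" for t
    by simp
  thus "dunkl_average (\<lambda>x. c * (\<Prod>e\<in>B. (e \<bullet> x) ^ n e)) x = (LINT t|GM. root_weight t * (\<Prod>\<beta>\<in>R. t \<beta> ^ n \<beta>)) * (c * (\<Prod>e\<in>B. (e \<bullet> x) ^ n e))"
    unfolding dunkl_average_def by (simp only: integral_mult_left_zero)
qed

text \<open>The intertwining relation puts every derivative of p into the kernel as well. By
  induction all derivatives vanish, and constants are fixed by the average.\<close>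

lemma dunkl_average_injective:
  assumes "real_polynomial_function p" "dunkl_average p = (\<lambda>_. 0)" shows "p = (\<lambda>_. 0)"
proof -
  obtain n where "deriv_nilpotent n p" using real_polynomial_function_deriv_nilpotent[OF assms(1)] by blast
  thus ?thesis using assms
  proof (induction n arbitrary: p)
    case (Suc n)
    have d0: "dir_deriv \<xi> p = (\<lambda>_. 0)" for \<xi>
    proof (rule Suc.IH)
      have "reflection_quotient \<beta> (\<lambda>_. 0) x = 0" for \<beta> x :: 'a
        by (simp add: reflection_quotient_def)
      hence "(\<lambda>_. 0) = dunkl_operator R k \<xi> (\<lambda>_. 0)"
        by (intro ext) (simp add: dunkl_operator_def)
      thus "dunkl_average (dir_deriv \<xi> p) = (\<lambda>_. 0)"
        using dunkl_operator_dunkl_average_polynomial[OF Suc.prems(2), of \<xi>] Suc.prems(3) by simp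
    qed (use Suc in \<open>auto intro: real_polynomial_function_dir_deriv\<close>)
    have "(p has_derivative (\<lambda>h. 0)) (at x)" for x
      using real_polynomial_function_differentiable[OF Suc.prems(2), of x] d0 by simp
    then obtain c where "p = (\<lambda>_. c)"
      using has_derivative_zero_constant[of UNIV p] by (auto simp: fun_eq_iff)
    thus ?case using Suc.prems(3) dunkl_average_const[of c] by metis
  qed simp
qed

lemma dunkl_average_polynomial:
  assumes "real_polynomial_function p" shows "real_polynomial_function (dunkl_average p)"
proof -
  obtain B where B: "R \<subseteq> B" "finite B" "\<And>e f. e \<in> B \<Longrightarrow> f \<in> B \<Longrightarrow> e \<noteq> f \<Longrightarrow> e \<bullet> f = 0"
    "0 \<notin> B" "\<And>x. (\<Sum>e\<in>B. ((e \<bullet> x) / (e \<bullet> e)) *\<^sub>R e) = x" by (rule orthogonal_basis_extension) blast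
  have "monomial_span B p" by (rule polynomial_imp_monomial_span[OF B(2) B(5) assms])
  hence "monomial_span B (dunkl_average p)"
  proof (induction rule: monomial_span.induct)
    case (mono c n)
    obtain v where "dunkl_average (\<lambda>x. c * (\<Prod>e\<in>B. (e \<bullet> x) ^ n e)) = (\<lambda>x. v * (c * (\<Prod>e\<in>B. (e \<bullet> x) ^ n e)))"
      using dunkl_average_mono[OF B(1-3)] by blast
    thus ?case using monomial_span.mono[of B "v * c" n] by (simp add: mult.assoc)
  next
    case (add p q)
    thus ?case
      using monomial_span_imp_polynomial[OF _ B(2)]
      by (subst dunkl_average_add) (auto intro: monomial_span.add continuous_on_real_polynomial_function)
  qed
  thus ?thesis using B(2) by (rule monomial_span_imp_polynomial)
qed

text \<open>Monomials are eigenvectors, and injectivity already excludes the eigenvalue 0, so no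
  moment has to be evaluated.\<close>

lemma dunkl_average_surjective:
  assumes "real_polynomial_function q" shows "\<exists>p. real_polynomial_function p \<and> dunkl_average p = q"
proof -
  obtain B where B: "R \<subseteq> B" "finite B" "\<And>e f. e \<in> B \<Longrightarrow> f \<in> B \<Longrightarrow> e \<noteq> f \<Longrightarrow> e \<bullet> f = 0"
    "0 \<notin> B" "\<And>x. (\<Sum>e\<in>B. ((e \<bullet> x) / (e \<bullet> e)) *\<^sub>R e) = x" by (rule orthogonal_basis_extension) blast
  have "monomial_span B q" by (rule polynomial_imp_monomial_span[OF B(2) B(5) assms])
  thus ?thesis
  proof (induction rule: monomial_span.induct)
    case (mono c n)
    let ?m = "\<lambda>c x. c * (\<Prod>e\<in>B. (e \<bullet> x) ^ n e)"
    have pm: "real_polynomial_function (?m c)" for c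
      by (rule monomial_span_imp_polynomial[OF monomial_span.mono B(2)])
    obtain v where v: "\<And>c. dunkl_average (?m c) = (\<lambda>x. v * ?m c x)"
      using dunkl_average_mono[OF B(1-3)] by blast
    have "v \<noteq> 0"
    proof
      assume "v = 0"
      hence "dunkl_average (?m 1) = (\<lambda>_. 0)" unfolding v by simp
      hence "?m 1 = (\<lambda>_. 0)" by (rule dunkl_average_injective[OF pm])
      \<comment> \<open>At the sum of the basis vectors every coordinate is positive, which
        contradicts the vanishing of the monomial.\<close>
      hence z: "(\<Prod>e\<in>B. (e \<bullet> (\<Sum>f\<in>B. f)) ^ n e) = 0" by (metis mult_1)
      have "e \<bullet> (\<Sum>f\<in>B. f) > 0" if "e \<in> B" for e
      proof -
        have "e \<bullet> (\<Sum>f\<in>B. f) = (\<Sum>f\<in>B. if f = e then e \<bullet> e else 0)"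
          unfolding inner_sum_right using B(3) that by (intro sum.cong) auto
        thus ?thesis using that B(2,4) by auto
      qed
      hence "(\<Prod>e\<in>B. (e \<bullet> (\<Sum>f\<in>B. f)) ^ n e) > 0" by (intro prod_pos) auto
      thus False using z by simp
    qed
    hence "dunkl_average (?m (c / v)) = ?m c" unfolding v by simp
    thus ?case using pm by blast
  next
    case (add p q)
    then obtain p' q' where "real_polynomial_function p'" "dunkl_average p' = p" "real_polynomial_function q'" "dunkl_average q' = q" by blast
    thus ?case
      by (intro exI[of _ "\<lambda>x. p' x + q' x"]) (auto simp: dunkl_average_add continuous_on_real_polynomial_function)
  qed
qed

lemma homogeneous_dunkl_average:
  assumes "homogeneous_poly n p" shows "homogeneous_poly n (dunkl_average p)"
proof -
  have p: "real_polynomial_function p" "\<And>c x. p (c *\<^sub>R x) = c ^ n * p x"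
    using assms unfolding homogeneous_poly_def by auto
  have "dunkl_average p (c *\<^sub>R x) = c ^ n * dunkl_average p x" for c x
    unfolding dunkl_average_def by (simp add: linear_cmul[OF linear_rescale] p(2) mult.left_commute[of _ "c ^ n"])
  thus ?thesis using dunkl_average_polynomial[OF p(1)] by (simp add: homogeneous_poly_def)
qed

lemma is_intertwining_dunkl_average: "is_intertwining R k (restrict dunkl_average (Collect real_polynomial_function))"
  unfolding is_intertwining_def
proof (intro conjI allI impI)
  let ?P = "Collect real_polynomial_function :: ('a \<Rightarrow> real) set"
  show "bij_betw (restrict dunkl_average ?P) ?P ?P"
    unfolding bij_betw_def
  proof
    show "inj_on (restrict dunkl_average ?P) ?P"
    proof (rule inj_onI)
      fix p q assume pq: "p \<in> ?P" "q \<in> ?P" "restrict dunkl_average ?P p = restrict dunkl_average ?P q"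
      hence "dunkl_average (\<lambda>x. p x + (- 1) * q x) = (\<lambda>x. dunkl_average p x + dunkl_average (\<lambda>x. (- 1) * q x) x)"
        by (intro dunkl_average_add continuous_intros continuous_on_real_polynomial_function) auto
      also have "\<dots> = (\<lambda>x. dunkl_average p x + (- 1) * dunkl_average q x)" unfolding dunkl_average_cmult ..
      also have "\<dots> = (\<lambda>_. 0)" using pq by simp
      finally have z: "dunkl_average (\<lambda>x. p x + (- 1) * q x) = (\<lambda>_. 0)" .
      have "real_polynomial_function (\<lambda>x. p x + (- 1) * q x)"
        using pq by (intro real_polynomial_function.intros(2,3,4)) simp_all
      from dunkl_average_injective[OF this z] show "p = q" by (auto simp: fun_eq_iff)
    qed
    have "restrict dunkl_average ?P ` ?P = dunkl_average ` ?P" by simp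
    also have "\<dots> = ?P" using dunkl_average_polynomial dunkl_average_surjective by blast
    finally show "restrict dunkl_average ?P ` ?P = ?P" .
  qed
next
  fix p q :: "'a \<Rightarrow> real" assume "real_polynomial_function p \<and> real_polynomial_function q"
  thus "restrict dunkl_average (Collect real_polynomial_function) (\<lambda>x. p x + q x) =
     (\<lambda>x. restrict dunkl_average (Collect real_polynomial_function) p x + restrict dunkl_average (Collect real_polynomial_function) q x)"
    by (simp add: real_polynomial_function.intros(3) dunkl_average_add continuous_on_real_polynomial_function)
next
  fix c and p :: "'a \<Rightarrow> real" assume "real_polynomial_function p"
  thus "restrict dunkl_average (Collect real_polynomial_function) (\<lambda>x. c * p x) = (\<lambda>x. c * restrict dunkl_average (Collect real_polynomial_function) p x)"
    by (simp add: real_polynomial_function.intros(2,4) dunkl_average_cmult)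
next
  fix n and p :: "'a \<Rightarrow> real" assume h: "homogeneous_poly n p"
  hence "real_polynomial_function p" by (simp add: homogeneous_poly_def)
  thus "homogeneous_poly n (restrict dunkl_average (Collect real_polynomial_function) p)"
    using homogeneous_dunkl_average[OF h] by simp
next
  show "restrict dunkl_average (Collect real_polynomial_function) (\<lambda>x. 1) = (\<lambda>x. 1)"
    by (simp add: real_polynomial_function.intros(2) dunkl_average_const)
next
  fix \<xi> and p :: "'a \<Rightarrow> real" assume "real_polynomial_function p"
  thus "dunkl_operator R k \<xi> (restrict dunkl_average (Collect real_polynomial_function) p) =
    restrict dunkl_average (Collect real_polynomial_function) (dir_deriv \<xi> p)"
    by (simp add: dunkl_operator_dunkl_average_polynomial real_polynomial_function_dir_deriv)
qed

section \<open>Uniqueness of the intertwining operator\<close>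

text \<open>Euler's identity turns \<open>T\<^sub>x q(x) = 0\<close> into a relation that contradicts a positive maximum
  of \<open>q\<close> on the sphere, because all difference terms are nonnegative there.\<close>

lemma homogeneous_dunkl_kernel_trivial:
  assumes h: "homogeneous_poly (Suc n) q" and T: "\<And>\<xi>. dunkl_operator R k \<xi> q = (\<lambda>_. 0)"
  shows "q x \<le> 0"
proof -
  have q: "real_polynomial_function q" "\<And>c x. q (c *\<^sub>R x) = c ^ Suc n * q x"
    using h unfolding homogeneous_poly_def by auto
  have euler: "dir_deriv x q x = Suc n * q x" for x
  proof -
    have "((\<lambda>c. q (c *\<^sub>R x)) has_derivative (\<lambda>h. dir_deriv (h *\<^sub>R x) q (1 *\<^sub>R x))) (at (1::real))"
      by (rule has_derivative_compose[OF _ real_polynomial_function_differentiable[OF q(1)], of "\<lambda>c. c *\<^sub>R x" "\<lambda>h. h *\<^sub>R x"])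
         (auto intro!: derivative_eq_intros)
    moreover have "((\<lambda>c. c ^ Suc n * q x) has_derivative (\<lambda>h. h * (Suc n * q x))) (at (1::real))"
      by (rule has_derivative_eq_rhs, (rule derivative_intros)+) (auto simp: fun_eq_iff algebra_simps)
    ultimately have "(\<lambda>h. dir_deriv (h *\<^sub>R x) q (1 *\<^sub>R x)) = (\<lambda>h. h * (Suc n * q x))"
      unfolding q(2) by (rule has_derivative_unique)
    from fun_cong[OF this, of 1] show ?thesis by simp
  qed
  \<comment> \<open>The direction is the point itself, so the factor \<beta> \<bullet> x cancels the
    denominator of the difference quotient; on the hyperplane both sides of that term are 0.\<close>
  have rel: "Suc n * q x + (\<Sum>\<beta>\<in>R. k \<beta> * (q x - q (reflection \<beta> x))) = 0" for x
  proof -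
    have "0 = dunkl_operator R k x q x" by (simp add: T)
    also have "\<dots> = dir_deriv x q x + (\<Sum>\<beta>\<in>R. k \<beta> * (q x - q (reflection \<beta> x)))"
      unfolding dunkl_operator_def
      by (intro arg_cong[of _ _ "(+) (dir_deriv x q x)"] sum.cong) (auto simp: reflection_quotient_def reflection_def)
    finally show ?thesis by (simp add: euler)
  qed
  obtain m where m: "m \<in> sphere 0 1" "\<And>y. y \<in> sphere 0 1 \<Longrightarrow> q y \<le> q m"
    using continuous_attains_sup[of "sphere (0::'a) 1" q] continuous_on_real_polynomial_function[OF q(1)] by auto
  have "q m \<le> 0"
  proof (rule ccontr)
    assume "\<not> q m \<le> 0"
    moreover have "(\<Sum>\<beta>\<in>R. k \<beta> * (q m - q (reflection \<beta> m))) \<ge> 0"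
      using m by (intro sum_nonneg mult_nonneg_nonneg k_nonneg) (auto simp: norm_reflection)
    ultimately have "Suc n * q m + (\<Sum>\<beta>\<in>R. k \<beta> * (q m - q (reflection \<beta> m))) > 0"
      by (intro add_pos_nonneg mult_pos_pos) auto
    thus False using rel[of m] by simp
  qed
  show ?thesis
  proof (cases "x = 0")
    case True
    thus ?thesis using q(2)[of 0 x] by simp
  next
    case False
    have "q x = norm x ^ Suc n * q (x /\<^sub>R norm x)" using q(2)[of "norm x" "x /\<^sub>R norm x"] False by simp
    also have "q (x /\<^sub>R norm x) \<le> 0" using m(2)[of "x /\<^sub>R norm x"] False \<open>q m \<le> 0\<close> by simp
    hence "norm x ^ Suc n * q (x /\<^sub>R norm x) \<le> 0" by (intro mult_nonneg_nonpos) auto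
    finally show ?thesis .
  qed
qed

lemma dunkl_operator_diff:
  assumes "real_polynomial_function p" "real_polynomial_function q"
  shows "dunkl_operator R k \<xi> (\<lambda>x. p x - q x) = (\<lambda>x. dunkl_operator R k \<xi> p x - dunkl_operator R k \<xi> q x)"
proof (rule ext)
  fix x
  have d: "dir_deriv v (\<lambda>x. p x - q x) x = dir_deriv v p x - dir_deriv v q x" for v
    by (rule dir_deriv_eq) (intro has_derivative_diff real_polynomial_function_differentiable assms)
  have "reflection_quotient \<beta> (\<lambda>x. p x - q x) x = reflection_quotient \<beta> p x - reflection_quotient \<beta> q x" for \<beta>
    by (simp add: reflection_quotient_def d diff_divide_distrib right_diff_distrib)
  thus "dunkl_operator R k \<xi> (\<lambda>x. p x - q x) x = dunkl_operator R k \<xi> p x - dunkl_operator R k \<xi> q x"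
    by (simp add: dunkl_operator_def d right_diff_distrib sum_subtractf)
qed

text \<open>By induction on the degree, V p and the average of p have the same image under all Dunkl
  operators. Their difference is homogeneous of positive degree and annihilated by them, so it is at
  most 0, and so is its negative. Linearity extends this from monomials to all polynomials.\<close>

lemma intertwining_unique:
  assumes V: "is_intertwining R k V" and p: "real_polynomial_function p"
  shows "V p = dunkl_average p"
proof -
  note c = V[unfolded is_intertwining_def, THEN conjunct2]
  note add = c[THEN conjunct1, rule_format, OF conjI]
  note c = c[THEN conjunct2]
  note cmult = c[THEN conjunct1, rule_format]
  note c = c[THEN conjunct2]
  note hom = c[THEN conjunct1, rule_format]
  note c = c[THEN conjunct2]
  note one = c[THEN conjunct1] and T = c[THEN conjunct2, rule_format]
  have homog: "V p = dunkl_average p" if "homogeneous_poly n p" for n p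
    using that
  proof (induction n arbitrary: p)
    case 0
    \<comment> \<open>Degree 0: with the scalar 0 and \<open>0 ^ 0 = 1\<close> homogeneity says that
      p is constant.\<close>
    hence "p (0 *\<^sub>R x) = 0 ^ 0 * p x" for x unfolding homogeneous_poly_def by blast
    hence "p x = p 0 * 1" for x by (metis mult_1 mult_1_right power_0 scaleR_zero_left)
    hence eq: "p = (\<lambda>x. p 0 * 1)" by (rule ext)
    have "V (\<lambda>x. p 0 * 1) = (\<lambda>x. p 0 * 1)"
      by (subst cmult) (auto simp: one intro: real_polynomial_function.intros)
    moreover have "dunkl_average (\<lambda>x. p 0 * 1) = (\<lambda>x. p 0 * 1)" by (rule dunkl_average_const)
    ultimately show ?case using eq by simp
  next
    case (Suc n)
    have p: "real_polynomial_function p" using Suc.prems by (simp add: homogeneous_poly_def)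
    have h: "homogeneous_poly (Suc n) (V p)" "homogeneous_poly (Suc n) (dunkl_average p)"
      using hom homogeneous_dunkl_average Suc.prems by auto
    have hd: "homogeneous_poly (Suc n) (\<lambda>x. a x - b x)" if "homogeneous_poly (Suc n) a" "homogeneous_poly (Suc n) b" for a b :: "'a \<Rightarrow> real"
      using that unfolding homogeneous_poly_def by (metis real_polynomial_function_diff right_diff_distrib)
    \<comment> \<open>Both operators exchange the Dunkl operator with the derivative, and the
      derivative of p falls under the induction hypothesis.\<close>
    have TT: "dunkl_operator R k \<xi> (V p) = dunkl_operator R k \<xi> (dunkl_average p)" for \<xi>
      using Suc.IH[OF homogeneous_dir_deriv[OF Suc.prems]] T[OF p] dunkl_operator_dunkl_average_polynomial[OF p] by metis
    have pp: "real_polynomial_function (V p)" "real_polynomial_function (dunkl_average p)"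
      using h by (simp_all add: homogeneous_poly_def)
    have "V p x - dunkl_average p x \<le> 0" for x
      by (rule homogeneous_dunkl_kernel_trivial[OF hd[OF h]]) (simp add: dunkl_operator_diff pp TT)
    moreover have "dunkl_average p x - V p x \<le> 0" for x
      by (rule homogeneous_dunkl_kernel_trivial[OF hd[OF h(2,1)]]) (simp add: dunkl_operator_diff pp TT)
    ultimately have "V p x = dunkl_average p x" for x by (meson diff_le_0_iff_le order_antisym)
    thus ?case by blast
  qed
  obtain B where B: "R \<subseteq> B" "finite B" "\<And>e f. e \<in> B \<Longrightarrow> f \<in> B \<Longrightarrow> e \<noteq> f \<Longrightarrow> e \<bullet> f = 0"
    "0 \<notin> B" "\<And>x. (\<Sum>e\<in>B. ((e \<bullet> x) / (e \<bullet> e)) *\<^sub>R e) = x" by (rule orthogonal_basis_extension) blast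
  have "monomial_span B p" by (rule polynomial_imp_monomial_span[OF B(2) B(5) p])
  thus ?thesis
  proof (induction rule: monomial_span.induct)
    case (mono c n)
    have "homogeneous_poly (\<Sum>e\<in>B. n e) (\<lambda>x. c * (\<Prod>e\<in>B. (e \<bullet> x) ^ n e))"
      unfolding homogeneous_poly_def using monomial_span_imp_polynomial[OF monomial_span.mono B(2)]
      by (auto simp: power_mult_distrib prod.distrib power_sum)
    thus ?case by (rule homog)
  next
    case add': (add p q)
    have "real_polynomial_function p" "real_polynomial_function q"
      using add' monomial_span_imp_polynomial B(2) by auto
    thus ?case using add' by (simp add: add dunkl_average_add continuous_on_real_polynomial_function)
  qed
qed

lemma intertwining_poly_eq:
  assumes "real_polynomial_function p" shows "intertwining_poly R k p = dunkl_average p"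
proof -
  have "intertwining_poly R k = restrict dunkl_average (Collect real_polynomial_function)"
    unfolding intertwining_poly_def
  proof (rule the_equality)
    show "is_intertwining R k (restrict dunkl_average (Collect real_polynomial_function)) \<and>
      restrict dunkl_average (Collect real_polynomial_function) \<in> extensional (Collect real_polynomial_function)"
      using is_intertwining_dunkl_average by simp
    fix V assume V: "is_intertwining R k V \<and> V \<in> extensional (Collect real_polynomial_function)"
    show "V = restrict dunkl_average (Collect real_polynomial_function)"
    proof (rule extensionalityI[of _ "Collect real_polynomial_function"])
      fix p :: "'a \<Rightarrow> real" assume "p \<in> Collect real_polynomial_function"
      thus "V p = restrict dunkl_average (Collect real_polynomial_function) p"
        using V intertwining_unique[of V p] by simp
    qed (use V in auto)
  qed
  thus ?thesis using assms by simp
qed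

end

section \<open>The representing measures and the Newton kernel\<close>

text \<open>Stone-Weierstrass on the compact carrier passes from polynomials to continuous
  functions; these decrease to indicators of closed sets, which generate the Borel sets and are
  stable under intersection.\<close>

lemma measure_eqI_polynomials:
  fixes \<mu> \<nu> :: "'a::euclidean_space measure"
  assumes "prob_space \<mu>" "prob_space \<nu>" and sets: "sets \<mu> = sets borel" "sets \<nu> = sets borel"
    and K: "compact K" "emeasure \<mu> K = 1" "emeasure \<nu> K = 1"
    and eq: "\<And>p. real_polynomial_function p \<Longrightarrow> (LINT z|\<mu>. p z) = (LINT z|\<nu>. p z)"
  shows "\<mu> = \<nu>"
proof -
  interpret M: prob_space \<mu> by fact
  interpret N: prob_space \<nu> by fact
  note [measurable_cong] = sets
  have cont_eq: "(LINT z|\<mu>. g z) = (LINT z|\<nu>. g z)" if g: "continuous_on UNIV g" for g :: "'a \<Rightarrow> real"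
  proof (rule ccontr)
    assume ne: "(LINT z|\<mu>. g z) \<noteq> (LINT z|\<nu>. g z)"
    \<comment> \<open>A third of the gap: two approximation errors of size e bound the gap by 2 e,
      which is less than 3 e.\<close>
    define e where "e = \<bar>(LINT z|\<mu>. g z) - (LINT z|\<nu>. g z)\<bar> / 3"
    have e: "e > 0" using ne by (simp add: e_def)
    obtain p where p: "real_polynomial_function p" "\<And>x. x \<in> K \<Longrightarrow> \<bar>g x - p x\<bar> < e"
      using Stone_Weierstrass_real_polynomial_function[OF K(1) continuous_on_subset[OF g subset_UNIV] e] by blast
    have approx: "\<bar>(LINT z|\<rho>. g z) - (LINT z|\<rho>. p z)\<bar> \<le> e"
      if "prob_space \<rho>" and s[measurable_cong]: "sets \<rho> = sets borel" and r: "emeasure \<rho> K = 1" for \<rho>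
    proof -
      interpret prob_space \<rho> by fact
      have "K \<in> sets \<rho>" using K(1) s by (simp add: borel_compact)
      moreover have "prob K = 1" using r by (simp add: measure_def)
      ultimately have AE: "AE z in \<rho>. z \<in> K" by (simp add: AE_in_set_eq_1)
      have int: "integrable \<rho> h" if h: "continuous_on UNIV h" for h :: "'a \<Rightarrow> real"
      proof -
        have [measurable]: "h \<in> borel_measurable borel" using h by (rule borel_measurable_continuous_onI)
        have "bounded (h ` K)" by (intro compact_imp_bounded compact_continuous_image K continuous_on_subset[OF h]) auto
        then obtain B where B: "\<forall>y\<in>h ` K. norm y \<le> B" unfolding bounded_iff by blast
        from AE have "AE z in \<rho>. norm (h z) \<le> B" by eventually_elim (use B in auto)
        thus ?thesis by (rule integrable_const_bound) measurable
      qed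
      have cp: "continuous_on UNIV p" by (rule continuous_on_real_polynomial_function) fact
      have "\<bar>(LINT z|\<rho>. g z) - (LINT z|\<rho>. p z)\<bar> = \<bar>LINT z|\<rho>. g z - p z\<bar>"
        using int[OF g] int[OF cp] by simp
      also have "\<dots> \<le> (LINT z|\<rho>. \<bar>g z - p z\<bar>)" by (rule integral_abs_bound)
      also have "\<dots> \<le> (LINT z|\<rho>. e)"
      proof (rule integral_mono_AE)
        show "AE z in \<rho>. \<bar>g z - p z\<bar> \<le> e" using AE by eventually_elim (use p(2) in \<open>auto intro: less_imp_le\<close>)
      qed (use int[OF g] int[OF cp] in auto)
      also have "\<dots> = e" using prob_space by simp
      finally show ?thesis .
    qed
    have "\<bar>(LINT z|\<mu>. g z) - (LINT z|\<nu>. g z)\<bar> \<le> 2 * e"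
      using approx[OF assms(1) sets(1) K(2)] approx[OF assms(2) sets(2) K(3)] eq[OF p(1)] by linarith
    thus False using e by (simp add: e_def)
  qed
  have closed_eq: "emeasure \<mu> C = emeasure \<nu> C" if C: "closed C" for C
  proof (cases "C = {}")
    case False
    \<comment> \<open>Truncated distance functions that equal 1 on C and converge to 0 off C because
      C is closed.\<close>
    define f where "f n z = max 0 (1 - real n * infdist z C)" for n z
    have fc: "continuous_on UNIV (f n)" for n unfolding f_def by (intro continuous_intros)
    have lim: "(\<lambda>n. f n z) \<longlonglongrightarrow> indicator C z" for z
    proof (cases "z \<in> C")
      case True thus ?thesis by (simp add: f_def)
    next
      case F: False
      hence pos: "infdist z C > 0" using C False by (simp add: infdist_pos_not_in_closed)
      have "eventually (\<lambda>n. f n z = 0) sequentially"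
      proof (rule eventually_sequentiallyI)
        fix n assume "n \<ge> nat \<lceil>1 / infdist z C\<rceil>"
        hence "real n \<ge> 1 / infdist z C" by linarith
        hence "real n * infdist z C \<ge> 1" using pos by (simp add: field_simps)
        thus "f n z = 0" by (simp add: f_def)
      qed
      thus ?thesis using F by (simp add: tendsto_eventually)
    qed
    have conv: "(\<lambda>n. LINT z|\<rho>. f n z) \<longlonglongrightarrow> measure \<rho> C"
      if "prob_space \<rho>" and s[measurable_cong]: "sets \<rho> = sets borel" for \<rho>
    proof -
      interpret prob_space \<rho> by fact
      have Cm: "C \<in> sets \<rho>" using C s by simp
      have "(\<lambda>n. LINT z|\<rho>. f n z) \<longlonglongrightarrow> (LINT z|\<rho>. indicator C z)"
      proof (rule integral_dominated_convergence[where w="\<lambda>_. 1"])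
        show "f n \<in> borel_measurable \<rho>" for n
          using borel_measurable_continuous_onI[OF fc[of n]] by measurable
        show "AE z in \<rho>. norm (f n z) \<le> 1" for n
          by (intro AE_I2) (auto simp: f_def infdist_nonneg)
      qed (use Cm lim in auto)
      thus ?thesis using Cm by simp
    qed
    have "(\<lambda>n. LINT z|\<mu>. f n z) = (\<lambda>n. LINT z|\<nu>. f n z)" using cont_eq fc by blast
    hence "measure \<mu> C = measure \<nu> C"
      using conv[OF assms(1) sets(1)] conv[OF assms(2) sets(2)] LIMSEQ_unique by metis
    thus ?thesis by (simp add: M.emeasure_eq_measure N.emeasure_eq_measure)
  qed simp
  show ?thesis
  proof (rule measure_eqI_generator_eq[where E="Collect closed" and \<Omega>=UNIV and A="\<lambda>_. UNIV"])
    show "Int_stable (Collect closed :: 'a set set)" by (auto simp: Int_stable_def)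
    show "sets \<mu> = sigma_sets UNIV (Collect closed)" "sets \<nu> = sigma_sets UNIV (Collect closed)"
      using sets by (simp_all add: borel_eq_closed)
  qed (use closed_eq in auto)
qed

context orth_roots
begin

text \<open>Induction on the number of parameters that are not signs: a parameter in [-1, 1] is a
  convex combination of 1 and -1, and the rescaled point is affine in it. Pure sign vectors give
  points of the orbit.\<close>

lemma rescale_in_hull:
  assumes "\<And>\<beta>. \<beta> \<in> R \<Longrightarrow> t \<beta> \<in> {-1..1}"
  shows "rescale R t x \<in> convex hull ((\<lambda>w. w x) ` reflection_group R)"
proof -
  have "rescale R t x \<in> convex hull ((\<lambda>w. w x) ` reflection_group R)"
    if "finite F" "F \<subseteq> R" "\<And>\<beta>. \<beta> \<in> F \<Longrightarrow> t \<beta> \<in> {-1..1}" "\<And>\<beta>. \<beta> \<in> R - F \<Longrightarrow> t \<beta> \<in> {-1, 1}" for F t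
    using that
  proof (induction F arbitrary: t rule: finite_induct)
    case empty
    hence "rescale R t \<in> reflection_group R" by (intro rescale_signs_in_reflection_group) auto
    thus ?case by (intro hull_inc) auto
  next
    case (insert \<beta> F)
    have b: "\<beta> \<in> R" using insert by auto
    have "rescale R (t(\<beta> := s)) x \<in> convex hull ((\<lambda>w. w x) ` reflection_group R)" if "s \<in> {-1, 1}" for s
      using insert that by (intro insert.IH) auto
    hence "((1 + t \<beta>) / 2) *\<^sub>R rescale R (t(\<beta> := 1)) x + ((1 - t \<beta>) / 2) *\<^sub>R rescale R (t(\<beta> := -1)) x
       \<in> convex hull ((\<lambda>w. w x) ` reflection_group R)"
      using insert.prems(2)[of \<beta>] by (intro convexD[OF convex_convex_hull]) (auto simp: field_simps)
    also have "((1 + t \<beta>) / 2) *\<^sub>R rescale R (t(\<beta> := 1)) x + ((1 - t \<beta>) / 2) *\<^sub>R rescale R (t(\<beta> := -1)) x = rescale R t x"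
    proof -
      define v where "v = ((\<beta> \<bullet> x) / (\<beta> \<bullet> \<beta>)) *\<^sub>R \<beta>"
      have "rescale R (t(\<beta> := s)) x = rescale R t x + (s - t \<beta>) *\<^sub>R v" for s
        by (simp add: rescale_upd[OF b] v_def)
      hence "((1 + t \<beta>) / 2) *\<^sub>R rescale R (t(\<beta> := 1)) x + ((1 - t \<beta>) / 2) *\<^sub>R rescale R (t(\<beta> := -1)) x =
         ((1 + t \<beta>) / 2 + (1 - t \<beta>) / 2) *\<^sub>R rescale R t x + ((1 + t \<beta>) / 2 * (1 - t \<beta>) + (1 - t \<beta>) / 2 * (- 1 - t \<beta>)) *\<^sub>R v"
        by (simp only: scaleR_add_right scaleR_add_left scaleR_scaleR add_ac)
      also have "(1 + t \<beta>) / 2 + (1 - t \<beta>) / 2 = 1" by (simp add: field_simps)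
      also have "(1 + t \<beta>) / 2 * (1 - t \<beta>) + (1 - t \<beta>) / 2 * (- 1 - t \<beta>) = 0" by (simp add: field_simps)
      finally show ?thesis by (simp only: scaleR_one scaleR_zero_left add_0_right)
    qed
    finally show ?case .
  qed
  from this[of R t] show ?thesis using assms by auto
qed

definition representing_measure :: "'a \<Rightarrow> 'a measure" where
  "representing_measure x = distr (density GM (\<lambda>t. ennreal (root_weight t))) borel (\<lambda>t. rescale R t x)"

lemma measurable_root_weight: "root_weight \<in> borel_measurable GM"
  using integrable_root_weight by (rule borel_measurable_integrable)

lemma integral_representing_measure:
  fixes f :: "'a \<Rightarrow> real"
  assumes [measurable]: "f \<in> borel_measurable borel"
  shows "(LINT z|representing_measure x. f z) = (LINT t|GM. root_weight t * f (rescale R t x))"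
proof -
  note [measurable] = measurable_root_weight measurable_rescale
  have "(LINT z|representing_measure x. f z) = (LINT t|density GM (\<lambda>t. ennreal (root_weight t)). f (rescale R t x))"
    unfolding representing_measure_def by (subst integral_distr) auto
  also have "\<dots> = (LINT t|GM. root_weight t *\<^sub>R f (rescale R t x))"
    using root_weight_bounds(1) by (intro integral_density) (auto intro!: AE_I2)
  finally show ?thesis by simp
qed

lemma emeasure_representing_measure:
  assumes "A \<in> sets borel" "\<And>t. t \<in> space GM \<Longrightarrow> rescale R t x \<in> A"
  shows "emeasure (representing_measure x) A = 1"
proof -
  note [measurable] = measurable_root_weight measurable_rescale
  have "emeasure (representing_measure x) A = emeasure (density GM (\<lambda>t. ennreal (root_weight t))) ((\<lambda>t. rescale R t x) -` A \<inter> space GM)"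
    unfolding representing_measure_def using assms(1) by (subst emeasure_distr) auto
  also have "(\<lambda>t. rescale R t x) -` A \<inter> space GM = space GM" using assms(2) by auto
  also have "emeasure (density GM (\<lambda>t. ennreal (root_weight t))) (space GM) = (\<integral>\<^sup>+t. ennreal (root_weight t) \<partial>GM)"
    by (subst emeasure_density) (auto intro!: nn_integral_cong)
  also have "\<dots> = ennreal (LINT t|GM. root_weight t)"
    using root_weight_bounds(1) by (intro nn_integral_eq_integral integrable_root_weight) (auto intro!: AE_I2)
  finally show ?thesis by (simp add: integral_root_weight)
qed

text \<open>Existence comes from the explicit operator and the hull property, uniqueness from
  \<open>measure_eqI_polynomials\<close> on the hull of the finite orbit, which is compact.\<close>

lemma intertwining_measure_eq: "intertwining_measure R k x = representing_measure x"
  unfolding intertwining_measure_def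
proof (rule the_equality)
  let ?H = "convex hull ((\<lambda>w. w x) ` reflection_group R)"
  have H: "compact ?H" by (intro finite_imp_compact_convex_hull finite_imageI finite_reflection_group)
  have sb: "sets (representing_measure x) = sets borel" by (simp add: representing_measure_def)
  have pr: "prob_space (representing_measure x)"
    by (rule prob_spaceI) (use emeasure_representing_measure[of UNIV x] in \<open>simp add: representing_measure_def\<close>)
  have eH: "emeasure (representing_measure x) ?H = 1"
    using space_GM by (intro emeasure_representing_measure borel_compact H rescale_in_hull) auto
  have I: "intertwining_poly R k p x = (LINT z|representing_measure x. p z)" if "real_polynomial_function p" for p
    using that by (simp add: intertwining_poly_eq dunkl_average_def integral_representing_measure
       borel_measurable_continuous_onI continuous_on_real_polynomial_function)
  show "prob_space (representing_measure x) \<and> sets (representing_measure x) = sets borel \<and>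
    emeasure (representing_measure x) ?H = 1 \<and>
    (\<forall>p. real_polynomial_function p \<longrightarrow> intertwining_poly R k p x = (LINT z|representing_measure x. p z))"
    using pr sb eH I by blast
  fix \<mu> assume m: "prob_space \<mu> \<and> sets \<mu> = sets borel \<and> emeasure \<mu> ?H = 1 \<and>
    (\<forall>p. real_polynomial_function p \<longrightarrow> intertwining_poly R k p x = (LINT z|\<mu>. p z))"
  show "\<mu> = representing_measure x"
    by (rule measure_eqI_polynomials[where K="?H"]) (use m pr sb eH H I in auto)
qed

section \<open>Bounds for the Dunkl kernel\<close>

lemma dunkl_kernel_eq: "dunkl_kernel R k x y = (LINT t|GM. root_weight t * exp (rescale R t x \<bullet> y))"
  unfolding dunkl_kernel_def intertwining_def intertwining_measure_eq
  by (rule integral_representing_measure) (intro borel_measurable_continuous_onI continuous_intros)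

lemma exp_rescale_inner: "exp (x \<bullet> rescale R t y) = exp (x \<bullet> y) * exp (- (\<Sum>\<beta>\<in>R. (1 - t \<beta>) * pairing \<beta> x y))"
proof -
  have "x \<bullet> rescale R t y = x \<bullet> y + (\<Sum>\<beta>\<in>R. (t \<beta> - 1) * pairing \<beta> x y)"
    using rescale_inner[of t x y] rescale_inner_commute[of t x y] by simp
  also have "(\<Sum>\<beta>\<in>R. (t \<beta> - 1) * pairing \<beta> x y) = - (\<Sum>\<beta>\<in>R. (1 - t \<beta>) * pairing \<beta> x y)"
    unfolding sum_negf[symmetric] by (intro sum.cong) (auto simp: algebra_simps)
  finally show ?thesis by (simp add: exp_add[symmetric])
qed

lemma dunkl_kernel_nonneg: "dunkl_kernel R k x y \<ge> 0"
  unfolding dunkl_kernel_eq by (intro integral_nonneg_AE AE_I2) (simp add: root_weight_bounds)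

text \<open>After the weight has been replaced by its maximum the integral over the parameters is
  W-invariant, so w disappears from the bound.\<close>

lemma dunkl_kernel_upper:
  assumes w: "w \<in> reflection_group R"
  shows "dunkl_kernel R k x (w y) \<le> 2 ^ card R * (exp (x \<bullet> y) * (\<Prod>\<beta>\<in>R. gegen_laplace (k \<beta>) (pairing \<beta> x y)))"
proof -
  have c: "continuous_on UNIV (\<lambda>z. exp (x \<bullet> z))" by (intro continuous_intros)
  have i: "integrable GM (\<lambda>t. u t * exp (x \<bullet> rescale R t z))" if "integrable GM u" for u z
    using integrable_GM_rescale[OF c that] .
  have "dunkl_kernel R k x (w y) = (LINT t|GM. root_weight t * exp (x \<bullet> rescale R t (w y)))"
    by (simp add: dunkl_kernel_eq rescale_inner_commute)
  also have "\<dots> \<le> (LINT t|GM. 2 ^ card R * exp (x \<bullet> rescale R t (w y)))"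
    by (intro integral_mono i integrable_root_weight GM.integrable_const mult_right_mono root_weight_bounds) auto
  also have "\<dots> = 2 ^ card R * (LINT t|GM. exp (x \<bullet> rescale R t (w y)))" by simp
  also have "(LINT t|GM. exp (x \<bullet> rescale R t (w y))) = (LINT t|GM. exp (x \<bullet> rescale R t y))"
  proof (rule integral_GM_reflection_group[OF w borel_measurable_continuous_onI[OF c]])
    fix z :: 'a assume z: "norm z \<le> norm y"
    have "x \<bullet> z \<le> norm x * norm z" by (rule norm_cauchy_schwarz)
    also have "\<dots> \<le> norm x * norm y" using z by (intro mult_left_mono) auto
    finally show "\<bar>exp (x \<bullet> z)\<bar> \<le> exp (norm x * norm y)" by simp
  qed
  also have "\<dots> = exp (x \<bullet> y) * (\<Prod>\<beta>\<in>R. gegen_laplace (k \<beta>) (pairing \<beta> x y))"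
    unfolding exp_rescale_inner by (simp only: integral_mult_right_zero GM_laplace)
  finally show ?thesis .
qed

lemma dunkl_kernel_lower:
  assumes "\<And>\<beta>. \<beta> \<in> R \<Longrightarrow> pairing \<beta> x y \<ge> 0"
  shows "exp (x \<bullet> y) * (\<Prod>\<beta>\<in>R. gegen_laplace (k \<beta>) (pairing \<beta> x y)) \<le> dunkl_kernel R k x y"
proof -
  have "dunkl_kernel R k x y = exp (x \<bullet> y) * (LINT t|GM. (\<Prod>\<beta>\<in>R. 1 + t \<beta>) * exp (- (\<Sum>\<beta>\<in>R. (1 - t \<beta>) * pairing \<beta> x y)))"
    unfolding dunkl_kernel_eq rescale_inner_commute exp_rescale_inner root_weight_def
    by (simp only: integral_mult_right_zero[symmetric] mult.left_commute)
  thus ?thesis using GM_laplace_weighted_ge[OF assms] by (simp add: mult_left_mono)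
qed

lemma norm_diff_reflection:
  assumes "\<beta> \<in> R" shows "(norm (x - reflection \<beta> y))\<^sup>2 = (norm (x - y))\<^sup>2 + 4 * pairing \<beta> x y"
proof -
  define c where "c = (\<beta> \<bullet> y) / (\<beta> \<bullet> \<beta>)"
  have cb: "c * (\<beta> \<bullet> \<beta>) = \<beta> \<bullet> y" using root_nonzero[OF assms] by (simp add: c_def)
  have r: "reflection \<beta> y = y - (2 * c) *\<^sub>R \<beta>" by (simp add: reflection_def c_def)
  have "(norm (x - reflection \<beta> y))\<^sup>2 = (norm (x - y))\<^sup>2 + 4 * c * (\<beta> \<bullet> (x - y)) + 4 * c * (c * (\<beta> \<bullet> \<beta>))"
    unfolding r power2_norm_eq_inner
    by (simp add: inner_diff_left inner_diff_right inner_commute algebra_simps)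
  also have "\<dots> = (norm (x - y))\<^sup>2 + 4 * c * (\<beta> \<bullet> x)" unfolding cb by (simp add: inner_diff_right algebra_simps)
  also have "4 * c * (\<beta> \<bullet> x) = 4 * pairing \<beta> x y" by (simp add: c_def pairing_def)
  finally show ?thesis .
qed

lemma closure_chamber_pairing_nonneg:
  assumes "x \<in> closure (pos_chamber R)" "y \<in> closure (pos_chamber R)" "\<beta> \<in> R"
  shows "pairing \<beta> x y \<ge> 0"
proof -
  have "closure (pos_chamber R) \<subseteq> {x. \<beta> \<bullet> x \<ge> 0}"
    using assms(3) by (intro closure_minimal closed_Collect_le continuous_intros) (auto simp: pos_chamber_def intro: less_imp_le)
  thus ?thesis using assms(1,2) unfolding pairing_def
    by (intro divide_nonneg_nonneg mult_nonneg_nonneg) auto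
qed

text \<open>The estimates are stated with distances to mirror images;
  \<open>norm_diff_reflection\<close> provides their squares, and l enters through the exponent m,
  which is d - 2 or d.\<close>

lemma comparison_eq:
  assumes "\<And>\<beta>. \<beta> \<in> R \<Longrightarrow> pairing \<beta> x y \<ge> 0" "x \<noteq> y"
    and l: "2 * (l - dunkl_gamma R k) = real m"
  shows "comparison l (norm (x - y)) (\<lambda>\<beta>. pairing \<beta> x y) =
    1 / (norm (x - y) ^ m * (\<Prod>\<beta>\<in>R. norm (x - reflection \<beta> y) powr (2 * k \<beta>)))"
proof -
  have pos: "norm (x - y) > 0" using assms(2) by simp
  have "((norm (x - y))\<^sup>2 + 4 * pairing \<beta> x y) powr (- k \<beta>) = inverse (norm (x - reflection \<beta> y) powr (2 * k \<beta>))" if b: "\<beta> \<in> R" for \<beta>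
  proof -
    have "(norm (x - reflection \<beta> y))\<^sup>2 > 0"
      unfolding norm_diff_reflection[OF b] using assms(1)[OF b] pos by (intro add_pos_nonneg) auto
    hence p: "norm (x - reflection \<beta> y) > 0" by simp
    have "(norm (x - reflection \<beta> y))\<^sup>2 = norm (x - reflection \<beta> y) powr 2" using p by simp
    thus ?thesis unfolding norm_diff_reflection[OF b, symmetric] by (simp only: powr_powr powr_minus[symmetric]) simp
  qed
  hence "(\<Prod>\<beta>\<in>R. ((norm (x - y))\<^sup>2 + 4 * pairing \<beta> x y) powr (- k \<beta>)) = inverse (\<Prod>\<beta>\<in>R. norm (x - reflection \<beta> y) powr (2 * k \<beta>))"
    by (simp add: prod_inversef[symmetric] comp_def)
  moreover have "norm (x - y) powr (- 2 * (l - dunkl_gamma R k)) = inverse (norm (x - y) ^ m)"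
    using pos l by (simp add: powr_minus powr_realpow[symmetric])
  ultimately show ?thesis by (simp add: comparison_def field_simps)
qed

section \<open>The Newton kernel\<close>

text \<open>From above all summands of the mean over W obey the same bound, so the group order
  cancels. From below only the summand of the identity is kept, whence the factor one over the order
  of W. Positivity of the heat kernel constant is a hypothesis here because its proof uses polar
  coordinates.\<close>

lemma newton_kernel_bounds:
  assumes x: "\<And>\<beta>. \<beta> \<in> R \<Longrightarrow> pairing \<beta> x y \<ge> 0" and M: "dunkl_const R k > 0"
  defines "l \<equiv> dunkl_gamma R k + real DIM('a) / 2 - 1"
  shows "ennreal (dunkl_const R k / real (card (reflection_group R))) * heat_integral l (norm (x - y)) (\<lambda>\<beta>. pairing \<beta> x y) \<le> newton_kernel_W R k x y"
    and "newton_kernel_W R k x y \<le> ennreal (dunkl_const R k * 2 ^ card R) * heat_integral l (norm (x - y)) (\<lambda>\<beta>. pairing \<beta> x y)"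
proof -
  let ?W = "reflection_group R"
  let ?M = "dunkl_const R k"
  have cW: "card ?W > 0" using finite_reflection_group reflection_group.id[of R] by (auto simp: card_gt_0_iff)
  define h where "h u = indicator {0<..} u * (u powr (- l - 1) * exp (- ((norm (x - y))\<^sup>2 / (4 * u))) * (\<Prod>\<beta>\<in>R. gegen_laplace (k \<beta>) (pairing \<beta> x y / (2 * u))))" for u
  have hm: "h \<in> borel_measurable borel"
    unfolding h_def using prod_gegen_laplace_measurable by (intro borel_measurable_times) auto
  have h0: "h u \<ge> 0" for u unfolding h_def by (auto intro!: mult_nonneg_nonneg prod_nonneg gegen_laplace_nonneg simp: indicator_def)
  have hi: "heat_integral l (norm (x - y)) (\<lambda>\<beta>. pairing \<beta> x y) = (\<integral>\<^sup>+u. ennreal (h u) \<partial>lborel)"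
    by (simp add: heat_integral_def h_def)
  have pr: "pairing \<beta> (x /\<^sub>R sqrt (2 * t)) (y /\<^sub>R sqrt (2 * t)) = pairing \<beta> x y / (2 * t)" if "t > 0" for \<beta> t
    using that by (simp add: pairing_def field_simps)
  have ip: "(x /\<^sub>R sqrt (2 * t)) \<bullet> (y /\<^sub>R sqrt (2 * t)) = (x \<bullet> y) / (2 * t)" if "t > 0" for t
    using that by (simp add: field_simps)
  \<comment> \<open>The two exponentials combine to that of -|x - y|^2/(4t), and the power of t in
    the heat kernel is -l - 1.\<close>
  have pre: "?M / t powr (dunkl_gamma R k + real DIM('a) / 2) * exp (- ((norm x)\<^sup>2 + (norm y)\<^sup>2) / (4 * t)) *
      (exp ((x \<bullet> y) / (2 * t)) * (\<Prod>\<beta>\<in>R. gegen_laplace (k \<beta>) (pairing \<beta> x y / (2 * t)))) = ?M * h t" if t: "t > 0" for t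
  proof -
    have "exp (- ((norm x)\<^sup>2 + (norm y)\<^sup>2) / (4 * t)) * exp ((x \<bullet> y) / (2 * t)) = exp (- ((norm (x - y))\<^sup>2 / (4 * t)))"
      using t unfolding exp_add[symmetric]
      by (simp add: power2_norm_eq_inner inner_diff_left inner_diff_right inner_commute field_simps)
    moreover have "?M / t powr (dunkl_gamma R k + real DIM('a) / 2) = ?M * t powr (- l - 1)"
    proof -
      have "- l - 1 = - (dunkl_gamma R k + real DIM('a) / 2)" by (simp add: l_def)
      thus ?thesis by (simp only: powr_minus_divide) simp
    qed
    ultimately show ?thesis using t by (simp add: h_def mult_ac)
  qed
  have wlin: "(w y) /\<^sub>R c = w (y /\<^sub>R c)" if "w \<in> ?W" for w c
    using reflection_group_rescale[OF that] linear_cmul[OF linear_rescale] by metis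
  have up: "dunkl_heat_kernel R k t x (w y) \<le> ?M * 2 ^ card R * h t" if t: "t > 0" and w: "w \<in> ?W" for t w
  proof -
    have "dunkl_heat_kernel R k t x (w y) \<le> ?M / t powr (dunkl_gamma R k + real DIM('a) / 2) * exp (- ((norm x)\<^sup>2 + (norm y)\<^sup>2) / (4 * t)) *
      (2 ^ card R * (exp ((x \<bullet> y) / (2 * t)) * (\<Prod>\<beta>\<in>R. gegen_laplace (k \<beta>) (pairing \<beta> x y / (2 * t)))))"
      unfolding dunkl_heat_kernel_def wlin[OF w] norm_reflection_group[OF w]
      using dunkl_kernel_upper[OF w, of "x /\<^sub>R sqrt (2 * t)" "y /\<^sub>R sqrt (2 * t)"] M
      unfolding pr[OF t] ip[OF t] by (intro mult_left_mono) auto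
    also have "\<dots> = 2 ^ card R * (?M * h t)" unfolding pre[OF t, symmetric] by simp
    finally show ?thesis by (simp add: mult_ac)
  qed
  have low: "?M * h t \<le> dunkl_heat_kernel R k t x y" if t: "t > 0" for t
    unfolding dunkl_heat_kernel_def pre[OF t, symmetric]
    using dunkl_kernel_lower[of "x /\<^sub>R sqrt (2 * t)" "y /\<^sub>R sqrt (2 * t)"] M x t
    unfolding pr[OF t] ip[OF t] by (intro mult_left_mono) auto
  have nn: "0 \<le> dunkl_heat_kernel R k t x z" if "t > 0" for t z
    unfolding dunkl_heat_kernel_def using M that by (intro mult_nonneg_nonneg dunkl_kernel_nonneg) auto
  let ?A = "\<lambda>t. 1 / real (card ?W) * (\<Sum>w\<in>?W. dunkl_heat_kernel R k t x (w y))"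
  have A_up: "?A t \<le> ?M * 2 ^ card R * h t" if t: "t > 0" for t
  proof -
    have "(\<Sum>w\<in>?W. dunkl_heat_kernel R k t x (w y)) \<le> of_nat (card ?W) * (?M * 2 ^ card R * h t)"
      by (rule sum_bounded_above) (rule up[OF t])
    thus ?thesis using cW by (simp add: field_simps)
  qed
  have A_low: "?M / real (card ?W) * h t \<le> ?A t" if t: "t > 0" for t
  proof -
    have "dunkl_heat_kernel R k t x (id y) \<le> (\<Sum>w\<in>?W. dunkl_heat_kernel R k t x (w y))"
      by (rule member_le_sum[OF reflection_group.id]) (use nn[OF t] finite_reflection_group in auto)
    thus ?thesis using low[OF t] cW by (simp add: field_simps)
  qed
  have N: "newton_kernel_W R k x y = (\<integral>\<^sup>+t. ennreal (?A t) * indicator {0<..} t \<partial>lborel)"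
    by (simp add: newton_kernel_W_def)
  have "newton_kernel_W R k x y \<le> (\<integral>\<^sup>+t. ennreal (?M * 2 ^ card R) * ennreal (h t) \<partial>lborel)"
    unfolding N
  proof (rule nn_integral_mono)
    fix t :: real
    show "ennreal (?A t) * indicator {0<..} t \<le> ennreal (?M * 2 ^ card R) * ennreal (h t)"
    proof (cases "t > 0")
      case True
      have "ennreal (?A t) \<le> ennreal (?M * 2 ^ card R * h t)" by (rule ennreal_leI) (rule A_up[OF True])
      thus ?thesis using True h0[of t] by (simp add: ennreal_mult'')
    qed auto
  qed
  also have "\<dots> = ennreal (?M * 2 ^ card R) * (\<integral>\<^sup>+t. ennreal (h t) \<partial>lborel)"
    using hm by (intro nn_integral_cmult) auto
  finally show "newton_kernel_W R k x y \<le> ennreal (?M * 2 ^ card R) * heat_integral l (norm (x - y)) (\<lambda>\<beta>. pairing \<beta> x y)"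
    by (simp add: hi)
  have "ennreal (?M / real (card ?W)) * (\<integral>\<^sup>+t. ennreal (h t) \<partial>lborel) = (\<integral>\<^sup>+t. ennreal (?M / real (card ?W)) * ennreal (h t) \<partial>lborel)"
    using hm by (intro nn_integral_cmult[symmetric]) auto
  also have "\<dots> \<le> newton_kernel_W R k x y"
    unfolding N
  proof (rule nn_integral_mono)
    fix t :: real
    show "ennreal (?M / real (card ?W)) * ennreal (h t) \<le> ennreal (?A t) * indicator {0<..} t"
    proof (cases "t > 0")
      case True
      have "ennreal (?M / real (card ?W)) * ennreal (h t) = ennreal (?M / real (card ?W) * h t)"
        by (rule ennreal_mult''[symmetric]) (rule h0)
      also have "\<dots> \<le> ennreal (?A t)" by (rule ennreal_leI) (rule A_low[OF True])
      also have "\<dots> = ennreal (?A t) * indicator {0<..} t" using True by simp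
      finally show ?thesis .
    qed (auto simp: h_def)
  qed
  finally show "ennreal (?M / real (card ?W)) * heat_integral l (norm (x - y)) (\<lambda>\<beta>. pairing \<beta> x y) \<le> newton_kernel_W R k x y"
    by (simp add: hi)
qed

text \<open>Dimension at least 3 is what makes l = \<lambda> - 1 exceed \<gamma>, the condition for
  the time integral to converge off the diagonal and to diverge on it.\<close>

lemma newton_kernel_two_sided:
  assumes M: "dunkl_const R k > 0" and d: "3 \<le> DIM('a)"
  shows "\<exists>c C. 0 < c \<and> 0 < C \<and> (\<forall>x \<in> closure (pos_chamber R). \<forall>y \<in> closure (pos_chamber R).
       ennreal c * (1 / ennreal
         (norm (x - y) ^ (DIM('a) - 2) * (\<Prod>\<beta>\<in>R. norm (x - reflection \<beta> y) powr (2 * k \<beta>))))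
         \<le> newton_kernel_W R k x y \<and>
       newton_kernel_W R k x y \<le>
       ennreal C * (1 / ennreal
         (norm (x - y) ^ (DIM('a) - 2) * (\<Prod>\<beta>\<in>R. norm (x - reflection \<beta> y) powr (2 * k \<beta>)))))"
proof -
  define l where "l = dunkl_gamma R k + real DIM('a) / 2 - 1"
  have l: "dunkl_gamma R k < l" and lm: "2 * (l - dunkl_gamma R k) = real (DIM('a) - 2)"
    using d by (auto simp: l_def of_nat_diff)
  obtain c C where cC: "0 < c" "0 < C" "\<And>D s. 0 < D \<Longrightarrow> (\<forall>\<beta>\<in>R. 0 \<le> s \<beta>) \<Longrightarrow>
     ennreal (c * comparison l D s) \<le> heat_integral l D s \<and> heat_integral l D s \<le> ennreal (C * comparison l D s)"
    using heat_integral_bounds[OF l] by blast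
  let ?W = "reflection_group R"
  let ?M = "dunkl_const R k"
  have cW: "card ?W > 0" using finite_reflection_group reflection_group.id[of R] by (auto simp: card_gt_0_iff)
  define c' where "c' = ?M / real (card ?W) * c"
  define C' where "C' = ?M * 2 ^ card R * C"
  have pos: "0 < c'" "0 < C'" using cC M cW by (auto simp: c'_def C'_def)
  show ?thesis
  proof (rule exI[of _ c'], rule exI[of _ C'], intro conjI ballI pos)
    fix x y assume xy: "x \<in> closure (pos_chamber R)" "y \<in> closure (pos_chamber R)"
    let ?P = "norm (x - y) ^ (DIM('a) - 2) * (\<Prod>\<beta>\<in>R. norm (x - reflection \<beta> y) powr (2 * k \<beta>))"
    have s: "\<And>\<beta>. \<beta> \<in> R \<Longrightarrow> pairing \<beta> x y \<ge> 0" using closure_chamber_pairing_nonneg xy by blast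
    note nb = newton_kernel_bounds[OF s M, folded l_def]
    show "ennreal c' * (1 / ennreal ?P) \<le> newton_kernel_W R k x y"
      and "newton_kernel_W R k x y \<le> ennreal C' * (1 / ennreal ?P)"
    proof -
      have "ennreal c' * (1 / ennreal ?P) \<le> newton_kernel_W R k x y \<and> newton_kernel_W R k x y \<le> ennreal C' * (1 / ennreal ?P)"
      proof (cases "x = y")
        case True
        \<comment> \<open>The exponent d - 2 is positive, so the product is 0 at x = y and its
          reciprocal in \<open>ennreal\<close> is infinite, like the kernel.\<close>
        have z: "?P = 0" using d True by simp
        have "heat_integral l (norm (x - y)) (\<lambda>\<beta>. pairing \<beta> x y) = \<infinity>"
          using heat_integral_zero[OF l] s True by simp
        hence "newton_kernel_W R k x y = \<infinity>"
          using nb(1) M cW by (simp add: ennreal_mult_top top_unique)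
        moreover have "ennreal C' * (1 / ennreal ?P) = \<infinity>" unfolding z using pos by (simp add: ennreal_mult_top)
        ultimately show ?thesis by simp
      next
        case False
        hence D: "norm (x - y) > 0" by simp
        note hb = cC(3)[OF D, of "\<lambda>\<beta>. pairing \<beta> x y"]
        have ce: "comparison l (norm (x - y)) (\<lambda>\<beta>. pairing \<beta> x y) = 1 / ?P" by (rule comparison_eq[OF s False lm])
        have sn: "\<forall>\<beta>\<in>R. 0 \<le> pairing \<beta> x y" using s by blast
        have P: "?P > 0"
        proof (intro mult_pos_pos prod_pos ballI)
          fix \<beta> assume b: "\<beta> \<in> R"
          have "(norm (x - reflection \<beta> y))\<^sup>2 > 0"
            unfolding norm_diff_reflection[OF b] using s[OF b] D by (intro add_pos_nonneg) auto
          thus "0 < norm (x - reflection \<beta> y) powr (2 * k \<beta>)" by simp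
        qed (use D in auto)
        have e: "1 / ennreal ?P = ennreal (1 / ?P)" using P by (simp add: divide_ennreal[symmetric])
        have "ennreal c' * (1 / ennreal ?P) = ennreal (?M / real (card ?W)) * ennreal (c * (1 / ?P))"
          unfolding e c'_def using M cC P by (simp add: ennreal_mult'[symmetric] mult_ac)
        also have "\<dots> \<le> ennreal (?M / real (card ?W)) * heat_integral l (norm (x - y)) (\<lambda>\<beta>. pairing \<beta> x y)"
          using hb sn by (intro mult_left_mono) (auto simp: ce)
        also note nb(1)
        finally have 1: "ennreal c' * (1 / ennreal ?P) \<le> newton_kernel_W R k x y" .
        note nb(2)
        also have "ennreal (?M * 2 ^ card R) * heat_integral l (norm (x - y)) (\<lambda>\<beta>. pairing \<beta> x y) \<le> ennreal (?M * 2 ^ card R) * ennreal (C * (1 / ?P))"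
          using hb sn by (intro mult_left_mono) (auto simp: ce)
        also have "\<dots> = ennreal C' * (1 / ennreal ?P)"
          unfolding e C'_def using M cC P by (simp add: ennreal_mult'[symmetric] mult_ac)
        finally show ?thesis using 1 by blast
      qed
      thus "ennreal c' * (1 / ennreal ?P) \<le> newton_kernel_W R k x y" "newton_kernel_W R k x y \<le> ennreal C' * (1 / ennreal ?P)" by auto
    qed
  qed
qed

end

section \<open>Polar coordinates\<close>

lemma sets_sphere_measure [measurable_cong]: "sets (sphere_measure :: 'a::euclidean_space measure) = sets (restrict_space borel (sphere 0 1))"
  by (simp add: sphere_measure_def)

lemma space_sphere_measure [simp]: "space (sphere_measure :: 'a::euclidean_space measure) = sphere 0 1"
  by (simp add: sphere_measure_def space_scale_measure space_restrict_space)

lemma measurable_sphere_ident: "(\<lambda>y. y) \<in> borel_measurable (sphere_measure :: 'a::euclidean_space measure)"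
  by (subst measurable_cong_sets[OF sets_sphere_measure refl]) (auto intro: measurable_restrict_space1)

lemma measurable_sphere_continuous:
  fixes f :: "'a::euclidean_space \<Rightarrow> 'b::topological_space"
  assumes "continuous_on (sphere 0 1) f" shows "f \<in> borel_measurable sphere_measure"
  by (subst measurable_cong_sets[OF sets_sphere_measure refl]) (rule borel_measurable_continuous_on_restrict[OF assms])

lemma measurable_sphere_projection:
  "(\<lambda>x. x /\<^sub>R norm x) \<in> restrict_space lborel (ball 0 1 - {0::'a::euclidean_space}) \<rightarrow>\<^sub>M restrict_space borel (sphere 0 1)"
proof (rule measurable_restrict_space2)
  have "(\<lambda>x::'a. x /\<^sub>R norm x) \<in> borel_measurable borel" by measurable
  thus "(\<lambda>x. x /\<^sub>R norm x) \<in> restrict_space lborel (ball 0 1 - {0::'a}) \<rightarrow>\<^sub>M borel"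
    by (intro measurable_restrict_space1) simp
qed (auto simp: space_restrict_space)

lemma nn_integral_sphere_measure:
  fixes f :: "'a::euclidean_space \<Rightarrow> ennreal"
  assumes f: "f \<in> borel_measurable sphere_measure"
  shows "(\<integral>\<^sup>+y. f y \<partial>sphere_measure) = of_nat DIM('a) * (\<integral>\<^sup>+x. f (x /\<^sub>R norm x) * indicator (ball 0 1 - {0}) x \<partial>lborel)"
proof -
  let ?D = "distr (restrict_space lborel (ball 0 1 - {0::'a})) (restrict_space borel (sphere 0 1)) (\<lambda>x. x /\<^sub>R norm x)"
  have f': "f \<in> borel_measurable (restrict_space borel (sphere 0 1))"
    using f by (subst (asm) measurable_cong_sets[OF sets_sphere_measure refl])
  hence "f \<in> borel_measurable ?D" by simp
  hence "(\<integral>\<^sup>+y. f y \<partial>sphere_measure) = of_nat DIM('a) * (\<integral>\<^sup>+y. f y \<partial>?D)"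
    unfolding sphere_measure_def by (rule nn_integral_scale_measure)
  also have "(\<integral>\<^sup>+y. f y \<partial>?D) = (\<integral>\<^sup>+x. f (x /\<^sub>R norm x) \<partial>restrict_space lborel (ball 0 1 - {0}))"
    using f' by (intro nn_integral_distr[OF measurable_sphere_projection]) simp
  also have "\<dots> = (\<integral>\<^sup>+x. f (x /\<^sub>R norm x) * indicator (ball 0 1 - {0}) x \<partial>lborel)"
    by (rule nn_integral_restrict_space) auto
  finally show ?thesis .
qed

lemma finite_sphere_measure: "finite_measure (sphere_measure :: 'a::euclidean_space measure)"
proof
  have "emeasure sphere_measure (space (sphere_measure :: 'a measure)) = (\<integral>\<^sup>+y. 1 \<partial>(sphere_measure :: 'a measure))"
    by simp
  also have "\<dots> = of_nat DIM('a) * (\<integral>\<^sup>+x. indicator (ball 0 1 - {0::'a}) x \<partial>lborel)"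
    by (subst nn_integral_sphere_measure) auto
  also have "(\<integral>\<^sup>+x. indicator (ball 0 1 - {0::'a}) x \<partial>lborel) = emeasure lborel (ball 0 1 - {0::'a})"
    by (rule nn_integral_indicator) auto
  finally have eq: "emeasure sphere_measure (space (sphere_measure :: 'a measure)) = of_nat DIM('a) * emeasure lborel (ball 0 1 - {0::'a})" .
  have "emeasure lborel (ball 0 1 - {0::'a}) \<le> emeasure lborel (ball 0 (1::real) :: 'a set)" by (intro emeasure_mono) auto
  also have "\<dots> < \<infinity>" by (rule emeasure_lborel_ball_finite)
  finally show "emeasure sphere_measure (space (sphere_measure :: 'a measure)) \<noteq> \<infinity>"
    unfolding eq by (auto simp: ennreal_mult_eq_top_iff)
qed

text \<open>Null sets of the sphere are those whose cones are null, by the definition of surface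
  measure through cones.\<close>

lemma AE_sphere_measure:
  assumes "{y\<in>sphere 0 1. P y} \<in> sets (sphere_measure :: 'a::euclidean_space measure)"
  shows "(AE y in (sphere_measure :: 'a measure). P y) \<longleftrightarrow> (AE x in lborel. x \<in> ball 0 1 - {0::'a} \<longrightarrow> P (x /\<^sub>R norm x))"
proof -
  have eq: "{y\<in>space sphere_measure. \<not> P y} = space sphere_measure - {y\<in>sphere 0 1. P y}" by auto
  have m: "{y\<in>space sphere_measure. \<not> P y} \<in> sets (sphere_measure :: 'a measure)"
    unfolding eq using assms by (rule sets.compl_sets)
  have mi: "(indicator {y\<in>space sphere_measure. \<not> P y} :: 'a \<Rightarrow> ennreal) \<in> borel_measurable sphere_measure"
    using m by simp
  have "(AE y in sphere_measure. P y) \<longleftrightarrow> emeasure sphere_measure {y\<in>space sphere_measure. \<not> P y} = 0"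
    by (rule AE_iff_measurable[OF m refl])
  also have "emeasure sphere_measure {y\<in>space sphere_measure. \<not> P y} = (\<integral>\<^sup>+y. indicator {y\<in>space sphere_measure. \<not> P y} y \<partial>sphere_measure)"
    using m by simp
  also have "\<dots> = of_nat DIM('a) * (\<integral>\<^sup>+x. indicator {y\<in>space sphere_measure. \<not> P y} (x /\<^sub>R norm x) * indicator (ball 0 1 - {0}) x \<partial>lborel)"
    by (rule nn_integral_sphere_measure[OF mi])
  also have "\<dots> = 0 \<longleftrightarrow> (\<integral>\<^sup>+x. indicator {y\<in>space sphere_measure. \<not> P y} (x /\<^sub>R norm x) * indicator (ball 0 1 - {0}) x \<partial>lborel) = 0"
    by simp
  also have "\<dots> \<longleftrightarrow> (AE x in lborel. indicator {y\<in>space sphere_measure. \<not> P y} (x /\<^sub>R norm x) * indicator (ball 0 1 - {0}) x = (0::ennreal))"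
  proof (rule nn_integral_0_iff_AE)
    have "(indicator {y\<in>space sphere_measure. \<not> P y} :: 'a \<Rightarrow> ennreal) \<in> borel_measurable (restrict_space borel (sphere 0 1))"
      using mi by (subst (asm) measurable_cong_sets[OF sets_sphere_measure refl])
    from measurable_compose[OF measurable_sphere_projection this]
    show "(\<lambda>x. indicator {y\<in>space sphere_measure. \<not> P y} (x /\<^sub>R norm x) * indicator (ball 0 1 - {0}) x :: ennreal) \<in> borel_measurable lborel"
      by (subst (asm) borel_measurable_restrict_space_iff_ennreal) auto
  qed
  also have "\<dots> \<longleftrightarrow> (AE x in lborel. x \<in> ball 0 1 - {0::'a} \<longrightarrow> P (x /\<^sub>R norm x))"
    by (intro AE_cong) (auto simp: indicator_def)
  finally show ?thesis .
qed

lemma nn_integral_lborel_scale: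
  fixes f :: "'a::euclidean_space \<Rightarrow> ennreal"
  assumes [measurable]: "f \<in> borel_measurable borel" and s: "s > 0"
  shows "(\<integral>\<^sup>+x. f (s *\<^sub>R x) \<partial>lborel) = ennreal (1 / s ^ DIM('a)) * (\<integral>\<^sup>+x. f x \<partial>lborel)"
proof -
  have "(\<integral>\<^sup>+x. f x \<partial>lborel) = ennreal (s ^ DIM('a)) * (\<integral>\<^sup>+x. f (s *\<^sub>R x) \<partial>lborel)"
    using s by (subst lborel_affine[of s 0]) (simp_all add: nn_integral_density nn_integral_distr nn_integral_cmult)
  hence "ennreal (1 / s ^ DIM('a)) * (\<integral>\<^sup>+x. f x \<partial>lborel) = (ennreal (1 / s ^ DIM('a)) * ennreal (s ^ DIM('a))) * (\<integral>\<^sup>+x. f (s *\<^sub>R x) \<partial>lborel)"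
    by (simp add: mult.assoc)
  also have "ennreal (1 / s ^ DIM('a)) * ennreal (s ^ DIM('a)) = 1"
    using s by (simp add: ennreal_mult[symmetric])
  finally show ?thesis by simp
qed

text \<open>The radial integral that remains at the end of the polar formula, with n the dimension
  and a the norm of the point.\<close>

lemma nn_integral_tail:
  assumes "a > (0::real)" "n > 0"
  shows "(\<integral>\<^sup>+s. ennreal ((if a < s then 1 else 0) * (real n * s powr (- real n - 1))) \<partial>lborel) = ennreal (a powr (- real n))"
proof -
  have "((\<lambda>s. s powr (- real n - 1)) has_integral -(a powr ((- real n - 1) + 1)) / ((- real n - 1) + 1)) {a..}"
    using assms by (intro has_integral_powr_to_inf) auto
  hence "((\<lambda>s. real n * s powr (- real n - 1)) has_integral real n * (-(a powr ((- real n - 1) + 1)) / ((- real n - 1) + 1))) {a..}"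
    by (rule has_integral_mult_right)
  moreover have "real n * (-(a powr ((- real n - 1) + 1)) / ((- real n - 1) + 1)) = a powr (- real n)"
    using assms by simp
  ultimately have "(\<integral>\<^sup>+s. ennreal (indicator {a..} s * (real n * s powr (- real n - 1))) \<partial>lborel) = ennreal (a powr (- real n))"
    using nn_integral_has_integral_lebesgue[of "{a..}" "\<lambda>s. real n * s powr (- real n - 1)"] by simp
  moreover have "(\<integral>\<^sup>+s. ennreal ((if a < s then 1 else 0) * (real n * s powr (- real n - 1))) \<partial>lborel) = (\<integral>\<^sup>+s. ennreal (indicator {a..} s * (real n * s powr (- real n - 1))) \<partial>lborel)"
    by (rule nn_integral_cong_AE) (use AE_lborel_singleton[of a] in \<open>eventually_elim, auto simp: indicator_def\<close>)
  ultimately show ?thesis by simp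
qed

text \<open>Surface measure is itself an integral over the ball, so the right-hand side is a double
  integral in r and x. Two substitutions and an exchange of integrals reduce the inner integral to
  \<open>nn_integral_tail\<close>, and everything but G cancels.\<close>

lemma nn_integral_polar:
  fixes G :: "'a::euclidean_space \<Rightarrow> ennreal"
  assumes [measurable]: "G \<in> borel_measurable borel"
  shows "(\<integral>\<^sup>+x. G x \<partial>lborel) = (\<integral>\<^sup>+r. ennreal (indicator {0<..} r * r ^ (DIM('a) - 1)) * (\<integral>\<^sup>+y. G (r *\<^sub>R y) \<partial>sphere_measure) \<partial>lborel)"
proof -
  let ?d = "DIM('a)"
  have d: "?d > 0" by simp
  let ?B = "indicator (ball 0 1 - {0}) :: 'a \<Rightarrow> ennreal"
  have [measurable]: "?B \<in> borel_measurable borel" by (rule borel_measurable_indicator) auto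
  have sphere: "(\<integral>\<^sup>+y. G (r *\<^sub>R y) \<partial>sphere_measure) = of_nat ?d * (\<integral>\<^sup>+x. G (r *\<^sub>R (x /\<^sub>R norm x)) * ?B x \<partial>lborel)" for r
  proof (rule nn_integral_sphere_measure)
    have "(\<lambda>y. G (r *\<^sub>R y)) \<in> borel_measurable borel" by measurable
    from measurable_compose[OF measurable_sphere_ident this] show "(\<lambda>y. G (r *\<^sub>R y)) \<in> borel_measurable sphere_measure" .
  qed
  have "(\<integral>\<^sup>+r. ennreal (indicator {0<..} r * r ^ (?d - 1)) * (\<integral>\<^sup>+y. G (r *\<^sub>R y) \<partial>sphere_measure) \<partial>lborel)
     = (\<integral>\<^sup>+r. \<integral>\<^sup>+x. ennreal (real ?d * (indicator {0<..} r * r ^ (?d - 1))) * (G (r *\<^sub>R (x /\<^sub>R norm x)) * ?B x) \<partial>lborel \<partial>lborel)"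
  proof (rule nn_integral_cong)
    fix r :: real
    have "ennreal (real ?d * (indicator {0<..} r * r ^ (?d - 1))) = ennreal (indicator {0<..} r * r ^ (?d - 1)) * of_nat ?d"
      by (subst ennreal_mult) (auto simp: indicator_def ennreal_of_nat_eq_real_of_nat mult.commute)
    moreover have "(\<integral>\<^sup>+x. ennreal (real ?d * (indicator {0<..} r * r ^ (?d - 1))) * (G (r *\<^sub>R (x /\<^sub>R norm x)) * ?B x) \<partial>lborel)
       = ennreal (real ?d * (indicator {0<..} r * r ^ (?d - 1))) * (\<integral>\<^sup>+x. G (r *\<^sub>R (x /\<^sub>R norm x)) * ?B x \<partial>lborel)"
      by (rule nn_integral_cmult) measurable
    ultimately show "ennreal (indicator {0<..} r * r ^ (?d - 1)) * (\<integral>\<^sup>+y. G (r *\<^sub>R y) \<partial>sphere_measure) =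
      (\<integral>\<^sup>+x. ennreal (real ?d * (indicator {0<..} r * r ^ (?d - 1))) * (G (r *\<^sub>R (x /\<^sub>R norm x)) * ?B x) \<partial>lborel)"
      unfolding sphere by (simp only: mult.assoc)
  qed
  also have "\<dots> = (\<integral>\<^sup>+x. \<integral>\<^sup>+r. ennreal (real ?d * (indicator {0<..} r * r ^ (?d - 1))) * (G (r *\<^sub>R (x /\<^sub>R norm x)) * ?B x) \<partial>lborel \<partial>lborel)"
    by (rule lborel_pair.Fubini'[symmetric]) measurable
  \<comment> \<open>For fixed x the substitution r = |x| s turns r x/|x| into s x and r^(d-1) dr
    into |x|^d s^(d-1) ds.\<close>
  also have "\<dots> = (\<integral>\<^sup>+x. \<integral>\<^sup>+s. ennreal (real ?d * (indicator {0<..} s * (s ^ (?d - 1)))) * (ennreal (norm x ^ ?d) * G (s *\<^sub>R x) * ?B x) \<partial>lborel \<partial>lborel)"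
  proof (rule nn_integral_cong)
    fix x :: 'a
    show "(\<integral>\<^sup>+r. ennreal (real ?d * (indicator {0<..} r * r ^ (?d - 1))) * (G (r *\<^sub>R (x /\<^sub>R norm x)) * ?B x) \<partial>lborel) =
      (\<integral>\<^sup>+s. ennreal (real ?d * (indicator {0<..} s * (s ^ (?d - 1)))) * (ennreal (norm x ^ ?d) * G (s *\<^sub>R x) * ?B x) \<partial>lborel)"
    proof (cases "x = 0")
      case False
      hence nx: "norm x > 0" by simp
      have "(\<integral>\<^sup>+r. ennreal (real ?d * (indicator {0<..} r * r ^ (?d - 1))) * (G (r *\<^sub>R (x /\<^sub>R norm x)) * ?B x) \<partial>lborel)
        = ennreal \<bar>norm x\<bar> * (\<integral>\<^sup>+s. ennreal (real ?d * (indicator {0<..} (0 + norm x * s) * (0 + norm x * s) ^ (?d - 1))) * (G ((0 + norm x * s) *\<^sub>R (x /\<^sub>R norm x)) * ?B x) \<partial>lborel)"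
        using nx by (intro nn_integral_real_affine) auto
      also have "\<dots> = (\<integral>\<^sup>+s. ennreal \<bar>norm x\<bar> * (ennreal (real ?d * (indicator {0<..} (0 + norm x * s) * (0 + norm x * s) ^ (?d - 1))) * (G ((0 + norm x * s) *\<^sub>R (x /\<^sub>R norm x)) * ?B x)) \<partial>lborel)"
        by (rule nn_integral_cmult[symmetric]) measurable
      also have "\<dots> = (\<integral>\<^sup>+s. ennreal (real ?d * (indicator {0<..} s * (s ^ (?d - 1)))) * (ennreal (norm x ^ ?d) * G (s *\<^sub>R x) * ?B x) \<partial>lborel)"
      proof (rule nn_integral_cong)
        fix s :: real
        have e: "norm x * norm x ^ (?d - 1) = norm x ^ ?d" by (metis Suc_diff_1 d power_Suc)
        have "ennreal \<bar>norm x\<bar> * ennreal (real ?d * (indicator {0<..} (norm x * s) * (norm x * s) ^ (?d - 1)))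
          = ennreal (real ?d * (indicator {0<..} s * (s ^ (?d - 1)))) * ennreal (norm x ^ ?d)"
          using nx by (auto simp: ennreal_mult[symmetric] indicator_def zero_less_mult_iff power_mult_distrib e[symmetric] mult_ac)
        moreover have "(norm x * s) *\<^sub>R (x /\<^sub>R norm x) = s *\<^sub>R x" using nx by simp
        ultimately show "ennreal \<bar>norm x\<bar> * (ennreal (real ?d * (indicator {0<..} (0 + norm x * s) * (0 + norm x * s) ^ (?d - 1))) * (G ((0 + norm x * s) *\<^sub>R (x /\<^sub>R norm x)) * ?B x))
          = ennreal (real ?d * (indicator {0<..} s * (s ^ (?d - 1)))) * (ennreal (norm x ^ ?d) * G (s *\<^sub>R x) * ?B x)"
          by (simp only: add_0_left mult.assoc[symmetric])
      qed
      finally show ?thesis .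
    qed simp
  qed
  also have "\<dots> = (\<integral>\<^sup>+s. \<integral>\<^sup>+x. ennreal (real ?d * (indicator {0<..} s * (s ^ (?d - 1)))) * (ennreal (norm x ^ ?d) * G (s *\<^sub>R x) * ?B x) \<partial>lborel \<partial>lborel)"
    by (rule lborel_pair.Fubini') measurable
  \<comment> \<open>For fixed s the substitution z = s x: the unit ball becomes |z| < s, and the
    powers of s combine to s^(-d-1).\<close>
  also have "\<dots> = (\<integral>\<^sup>+s. \<integral>\<^sup>+z. ennreal (norm z ^ ?d * ((if norm z < s then 1 else 0) * (real ?d * s powr (- real ?d - 1)))) * (G z * indicator (- {0}) z) \<partial>lborel \<partial>lborel)"
  proof (rule nn_integral_cong)
    fix s :: real
    show "(\<integral>\<^sup>+x. ennreal (real ?d * (indicator {0<..} s * (s ^ (?d - 1)))) * (ennreal (norm x ^ ?d) * G (s *\<^sub>R x) * ?B x) \<partial>lborel) =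
       (\<integral>\<^sup>+z. ennreal (norm z ^ ?d * ((if norm z < s then 1 else 0) * (real ?d * s powr (- real ?d - 1)))) * (G z * indicator (- {0}) z) \<partial>lborel)"
    proof (cases "s > 0")
      case True
      define f where "f z = ennreal (real ?d * s ^ (?d - 1)) * (ennreal (norm z ^ ?d / s ^ ?d) * G z * indicator {z. norm z < s \<and> z \<noteq> 0} z)" for z :: 'a
      have fm: "f \<in> borel_measurable borel" unfolding f_def by measurable
      have "(\<integral>\<^sup>+x. ennreal (real ?d * (indicator {0<..} s * (s ^ (?d - 1)))) * (ennreal (norm x ^ ?d) * G (s *\<^sub>R x) * ?B x) \<partial>lborel) = (\<integral>\<^sup>+x. f (s *\<^sub>R x) \<partial>lborel)"
      proof (rule nn_integral_cong)
        fix x :: 'a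
        have "indicator {z. norm z < s \<and> z \<noteq> 0} (s *\<^sub>R x) = ?B x" using True by (auto simp: indicator_def)
        moreover have "norm (s *\<^sub>R x) ^ ?d / s ^ ?d = norm x ^ ?d" using True by (simp add: power_mult_distrib)
        ultimately show "ennreal (real ?d * (indicator {0<..} s * (s ^ (?d - 1)))) * (ennreal (norm x ^ ?d) * G (s *\<^sub>R x) * ?B x) = f (s *\<^sub>R x)"
          using True by (simp add: f_def)
      qed
      also have "\<dots> = ennreal (1 / s ^ ?d) * (\<integral>\<^sup>+z. f z \<partial>lborel)" by (rule nn_integral_lborel_scale[OF fm True])
      also have "\<dots> = (\<integral>\<^sup>+z. ennreal (1 / s ^ ?d) * f z \<partial>lborel)" using fm by (intro nn_integral_cmult[symmetric]) simp
      also have "\<dots> = (\<integral>\<^sup>+z. ennreal (norm z ^ ?d * ((if norm z < s then 1 else 0) * (real ?d * s powr (- real ?d - 1)))) * (G z * indicator (- {0}) z) \<partial>lborel)"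
      proof (rule nn_integral_cong)
        fix z :: 'a
        have "s ^ ?d = s * s ^ (?d - 1)" by (metis Suc_diff_1 d power_Suc)
        hence p: "1 / s ^ ?d * (s ^ (?d - 1) * (1 / s ^ ?d)) = s powr (- real ?d - 1)"
          using True by (simp add: powr_diff powr_minus powr_realpow field_simps)
        have "ennreal (1 / s ^ ?d) * (ennreal (real ?d * s ^ (?d - 1)) * ennreal (norm z ^ ?d / s ^ ?d)) = ennreal (norm z ^ ?d * (real ?d * s powr (- real ?d - 1)))"
          unfolding p[symmetric] using True by (simp add: ennreal_mult[symmetric] mult_ac)
        thus "ennreal (1 / s ^ ?d) * f z = ennreal (norm z ^ ?d * ((if norm z < s then 1 else 0) * (real ?d * s powr (- real ?d - 1)))) * (G z * indicator (- {0}) z)"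
          by (auto simp: f_def indicator_def mult.assoc[symmetric])
      qed
      finally show ?thesis .
    next
      case False
      hence "\<not> norm z < s" for z :: 'a using norm_ge_zero[of z] by linarith
      thus ?thesis using False by simp
    qed
  qed
  \<comment> \<open>Exchanged back, the integral over s > |z| is |z|^(-d) and cancels the remaining
    factor |z|^d.\<close>
  also have "\<dots> = (\<integral>\<^sup>+z. \<integral>\<^sup>+s. ennreal (norm z ^ ?d * ((if norm z < s then 1 else 0) * (real ?d * s powr (- real ?d - 1)))) * (G z * indicator (- {0}) z) \<partial>lborel \<partial>lborel)"
    by (rule lborel_pair.Fubini'[symmetric]) measurable
  also have "\<dots> = (\<integral>\<^sup>+z. G z \<partial>lborel)"
  proof (rule nn_integral_cong_AE)
    show "AE z in lborel. (\<integral>\<^sup>+s. ennreal (norm z ^ ?d * ((if norm z < s then 1 else 0) * (real ?d * s powr (- real ?d - 1)))) * (G z * indicator (- {0}) z) \<partial>lborel) = G z"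
      using AE_lborel_singleton[of "0::'a"]
    proof eventually_elim
      fix z :: 'a assume z: "z \<noteq> 0"
      hence nz: "norm z > 0" by simp
      have "(\<integral>\<^sup>+s. ennreal (norm z ^ ?d * ((if norm z < s then 1 else 0) * (real ?d * s powr (- real ?d - 1)))) * (G z * indicator (- {0}) z) \<partial>lborel)
        = (\<integral>\<^sup>+s. ennreal (norm z ^ ?d) * ennreal ((if norm z < s then 1 else 0) * (real ?d * s powr (- real ?d - 1))) * G z \<partial>lborel)"
        using z by (intro nn_integral_cong) (simp add: ennreal_mult)
      also have "\<dots> = ennreal (norm z ^ ?d) * (\<integral>\<^sup>+s. ennreal ((if norm z < s then 1 else 0) * (real ?d * s powr (- real ?d - 1))) \<partial>lborel) * G z"
        by (subst nn_integral_multc, measurable, subst nn_integral_cmult) auto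
      also have "\<dots> = ennreal (norm z ^ ?d) * ennreal (norm z powr (- real ?d)) * G z"
        by (subst nn_integral_tail[OF nz d]) simp
      also have "ennreal (norm z ^ ?d) * ennreal (norm z powr (- real ?d)) = 1"
        using nz by (simp add: ennreal_mult[symmetric] powr_minus powr_realpow)
      finally show "(\<integral>\<^sup>+s. ennreal (norm z ^ ?d * ((if norm z < s then 1 else 0) * (real ?d * s powr (- real ?d - 1)))) * (G z * indicator (- {0}) z) \<partial>lborel) = G z"
        by simp
    qed
  qed
  finally show ?thesis by simp
qed

definition radial_measure :: "nat \<Rightarrow> real measure" where
  "radial_measure d = density lborel (\<lambda>r. ennreal (indicator {0<..} r * r ^ (d - 1)))"

lemma sigma_finite_radial_measure: "sigma_finite_measure (radial_measure d)"
  unfolding radial_measure_def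
  by (subst sigma_finite_measure.sigma_finite_iff_density_finite[OF sigma_finite_lborel]) auto

lemma measurable_polar_map:
  "(\<lambda>(r, y). r *\<^sub>R y) \<in> radial_measure DIM('a) \<Otimes>\<^sub>M (sphere_measure :: 'a::euclidean_space measure) \<rightarrow>\<^sub>M borel"
proof -
  have 1: "(\<lambda>p. snd p) \<in> borel_measurable (radial_measure DIM('a) \<Otimes>\<^sub>M (sphere_measure :: 'a measure))"
    by (rule measurable_compose[OF measurable_snd measurable_sphere_ident])
  have 2: "fst \<in> borel_measurable (radial_measure DIM('a) \<Otimes>\<^sub>M (sphere_measure :: 'a measure))"
    using measurable_fst[of "radial_measure DIM('a)" "sphere_measure :: 'a measure"]
    by (simp add: radial_measure_def measurable_def)
  show ?thesis unfolding split_beta using 1 2 by (intro borel_measurable_scaleR) auto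
qed

text \<open>As an image measure the polar formula passes to signed integrable functions through
  Fubini.\<close>

lemma lborel_polar:
  "(lborel :: 'a::euclidean_space measure) = distr (radial_measure DIM('a) \<Otimes>\<^sub>M sphere_measure) borel (\<lambda>(r, y). r *\<^sub>R y)"
proof (rule measure_eqI)
  interpret S: finite_measure "sphere_measure :: 'a measure" by (rule finite_sphere_measure)
  fix A :: "'a set" assume "A \<in> sets lborel"
  hence A [measurable]: "A \<in> sets borel" by simp
  note m = measurable_polar_map[where 'a='a]
  have "emeasure (distr (radial_measure DIM('a) \<Otimes>\<^sub>M sphere_measure) borel (\<lambda>(r, y). r *\<^sub>R y)) A
    = (\<integral>\<^sup>+x. indicator A x \<partial>distr (radial_measure DIM('a) \<Otimes>\<^sub>M sphere_measure) borel (\<lambda>(r, y). r *\<^sub>R y))"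
    by (subst nn_integral_indicator) auto
  also have "\<dots> = (\<integral>\<^sup>+p. indicator A (case p of (r, y) \<Rightarrow> r *\<^sub>R y) \<partial>(radial_measure DIM('a) \<Otimes>\<^sub>M sphere_measure))"
    by (rule nn_integral_distr[OF m]) auto
  also have "\<dots> = (\<integral>\<^sup>+r. \<integral>\<^sup>+y. indicator A (r *\<^sub>R y) \<partial>sphere_measure \<partial>radial_measure DIM('a))"
    using measurable_compose[OF m, of "indicator A :: 'a \<Rightarrow> ennreal" borel]
    by (subst S.nn_integral_fst[symmetric]) auto
  also have "\<dots> = (\<integral>\<^sup>+r. ennreal (indicator {0<..} r * r ^ (DIM('a) - 1)) * (\<integral>\<^sup>+y. indicator A (r *\<^sub>R y) \<partial>sphere_measure) \<partial>lborel)"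
    unfolding radial_measure_def
  proof (rule nn_integral_density)
    have "(\<lambda>(r, y). r *\<^sub>R y) \<in> (borel :: real measure) \<Otimes>\<^sub>M (sphere_measure :: 'a measure) \<rightarrow>\<^sub>M borel"
      using m by (subst measurable_cong_sets[OF sets_pair_measure_cong[OF _ refl] refl]) (auto simp: radial_measure_def)
    from measurable_compose[OF this, of "indicator A :: 'a \<Rightarrow> ennreal" borel]
    have "(\<lambda>(r, y). indicator A (r *\<^sub>R y) :: ennreal) \<in> borel_measurable ((borel :: real measure) \<Otimes>\<^sub>M (sphere_measure :: 'a measure))"
      by (simp add: split_beta)
    from S.borel_measurable_nn_integral[OF this]
    show "(\<lambda>r. \<integral>\<^sup>+y. indicator A (r *\<^sub>R y) \<partial>(sphere_measure :: 'a measure)) \<in> borel_measurable lborel" by simp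
  qed auto
  also have "\<dots> = (\<integral>\<^sup>+x. indicator A x \<partial>lborel)" by (rule nn_integral_polar[symmetric]) auto
  also have "\<dots> = emeasure lborel A" by simp
  finally show "emeasure lborel A = emeasure (distr (radial_measure DIM('a) \<Otimes>\<^sub>M sphere_measure) borel (\<lambda>(r, y). r *\<^sub>R y)) A" by simp
qed auto

lemma polar_coordinates:
  fixes G :: "'a::euclidean_space \<Rightarrow> real"
  assumes G: "integrable lborel G"
  shows "integrable lborel (\<lambda>r. (indicator {0<..} r * r ^ (DIM('a) - 1)) * (LINT y|sphere_measure. G (r *\<^sub>R y)))"
    "(LINT x|lborel. G x) = (LINT r|lborel. (indicator {0<..} r * r ^ (DIM('a) - 1)) * (LINT y|sphere_measure. G (r *\<^sub>R y)))"
proof -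
  interpret S: finite_measure "sphere_measure :: 'a measure" by (rule finite_sphere_measure)
  interpret Rm: sigma_finite_measure "radial_measure DIM('a)" by (rule sigma_finite_radial_measure)
  interpret pair_sigma_finite "radial_measure DIM('a)" "sphere_measure :: 'a measure" ..
  note m = measurable_polar_map[where 'a='a]
  have Gm: "G \<in> borel_measurable borel" using G by auto
  have int: "integrable (radial_measure DIM('a) \<Otimes>\<^sub>M sphere_measure) (\<lambda>p. G (case p of (r, y) \<Rightarrow> r *\<^sub>R y))"
    using G by (subst (asm) lborel_polar) (subst (asm) integrable_distr_eq[OF m Gm])
  have "(\<lambda>(r, y). r *\<^sub>R y) \<in> (borel :: real measure) \<Otimes>\<^sub>M (sphere_measure :: 'a measure) \<rightarrow>\<^sub>M borel"
    using m by (subst measurable_cong_sets[OF sets_pair_measure_cong[OF _ refl] refl]) (auto simp: radial_measure_def)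
  from measurable_compose[OF this Gm]
  have "(\<lambda>(r, y). G (r *\<^sub>R y)) \<in> borel_measurable ((borel :: real measure) \<Otimes>\<^sub>M (sphere_measure :: 'a measure))"
    by (simp add: split_beta)
  from S.borel_measurable_lebesgue_integral[OF this]
  have mm: "(\<lambda>r. LINT y|sphere_measure. G (r *\<^sub>R y)) \<in> borel_measurable lborel" by simp
  have "integrable (radial_measure DIM('a)) (\<lambda>r. LINT y|sphere_measure. G (r *\<^sub>R y))"
    using integrable_fst'[OF int] by simp
  thus "integrable lborel (\<lambda>r. (indicator {0<..} r * r ^ (DIM('a) - 1)) * (LINT y|sphere_measure. G (r *\<^sub>R y)))"
    unfolding radial_measure_def by (subst (asm) integrable_density[OF mm]) (auto simp: indicator_def)
  have "(LINT x|lborel. G x) = (LINT p|(radial_measure DIM('a) \<Otimes>\<^sub>M sphere_measure). G (case p of (r, y) \<Rightarrow> r *\<^sub>R y))"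
    by (subst lborel_polar) (rule integral_distr[OF m Gm])
  also have "\<dots> = (LINT r|radial_measure DIM('a). LINT y|sphere_measure. G (r *\<^sub>R y))"
    using integral_fst'[OF int] by simp
  also have "\<dots> = (LINT r|lborel. (indicator {0<..} r * r ^ (DIM('a) - 1)) *\<^sub>R (LINT y|sphere_measure. G (r *\<^sub>R y)))"
    unfolding radial_measure_def by (rule integral_density[OF mm]) (auto simp: indicator_def)
  finally show "(LINT x|lborel. G x) = (LINT r|lborel. (indicator {0<..} r * r ^ (DIM('a) - 1)) * (LINT y|sphere_measure. G (r *\<^sub>R y)))"
    by simp
qed

text \<open>Used to pass from almost everywhere to everywhere for continuous functions: the set
  where such a function does not vanish is open.\<close>

lemma open_AE_empty:
  assumes "open (S :: 'a::euclidean_space set)" "AE x in lborel. x \<notin> S" shows "S = {}"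
proof (rule ccontr)
  assume "S \<noteq> {}"
  hence "\<not> negligible S" using open_not_negligible assms(1) by blast
  moreover have "emeasure lborel S = 0"
    using assms by (subst (asm) AE_iff_measurable[OF _ refl]) auto
  hence "S \<in> null_sets lborel" using assms(1) by (auto simp: null_sets_def)
  hence "negligible S" unfolding negligible_iff_null_sets by (rule null_sets_completionI)
  ultimately show False by blast
qed

section \<open>The weight on the sphere and the Gaussian constant\<close>

context orth_roots
begin

lemma dunkl_weight_measurable [measurable]: "dunkl_weight R k \<in> borel_measurable borel"
  unfolding dunkl_weight_def[abs_def] by measurable

lemma dunkl_weight_nonneg: "dunkl_weight R k x \<ge> 0"
  unfolding dunkl_weight_def by (intro prod_nonneg) auto

lemma dunkl_weight_pos: "(\<And>\<beta>. \<beta> \<in> R \<Longrightarrow> \<beta> \<bullet> x \<noteq> 0) \<Longrightarrow> dunkl_weight R k x > 0"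
  unfolding dunkl_weight_def by (intro prod_pos) auto

lemma dunkl_weight_scale:
  assumes "r > 0" shows "dunkl_weight R k (r *\<^sub>R x) = r powr (2 * dunkl_gamma R k) * dunkl_weight R k x"
proof -
  have "dunkl_weight R k (r *\<^sub>R x) = (\<Prod>\<beta>\<in>R. r powr (2 * k \<beta>)) * dunkl_weight R k x"
    unfolding dunkl_weight_def using assms by (simp add: abs_mult powr_mult prod.distrib)
  also have "(\<Prod>\<beta>\<in>R. r powr (2 * k \<beta>)) = r powr (2 * dunkl_gamma R k)"
    using assms by (simp add: powr_sum[symmetric] dunkl_gamma_def sum_distrib_left)
  finally show ?thesis .
qed

lemma dunkl_weight_le:
  assumes "norm x \<le> 1" shows "dunkl_weight R k x \<le> (\<Prod>\<beta>\<in>R. norm \<beta> powr (2 * k \<beta>))"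
  unfolding dunkl_weight_def
proof (rule prod_mono, rule conjI)
  fix \<beta> assume b: "\<beta> \<in> R"
  have "\<bar>\<beta> \<bullet> x\<bar> \<le> norm \<beta> * norm x" by (rule Cauchy_Schwarz_ineq2)
  also have "\<dots> \<le> norm \<beta> * 1" using assms by (intro mult_left_mono) auto
  finally show "\<bar>\<beta> \<bullet> x\<bar> powr (2 * k \<beta>) \<le> norm \<beta> powr (2 * k \<beta>)" using k_nonneg[OF b] by (intro powr_mono2) auto
qed auto

lemma AE_roots_nonzero: "AE x in lborel. \<forall>\<beta>\<in>R. \<beta> \<bullet> x \<noteq> 0"
proof (rule AE_finite_allI[OF finite_R])
  fix \<beta> assume b: "\<beta> \<in> R"
  have "negligible {x. \<beta> \<bullet> x = 0}" using root_nonzero[OF b] by (intro negligible_hyperplane) auto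
  hence "{x. \<beta> \<bullet> x = 0} \<in> null_sets lborel"
    unfolding negligible_iff_null_sets by (subst (asm) null_sets_completion_iff) auto
  from AE_not_in[OF this] show "AE x in lborel. \<beta> \<bullet> x \<noteq> 0" by simp
qed

lemma AE_sphere_roots_nonzero: "AE y in sphere_measure. \<forall>\<beta>\<in>R. \<beta> \<bullet> y \<noteq> 0"
proof (subst AE_sphere_measure)
  have "(\<lambda>y::'a. y) \<in> borel_measurable sphere_measure" by (rule measurable_sphere_ident)
  moreover have "{y::'a. \<forall>\<beta>\<in>R. \<beta> \<bullet> y \<noteq> 0} \<in> sets borel" by measurable
  ultimately have "(\<lambda>y::'a. y) -` {y. \<forall>\<beta>\<in>R. \<beta> \<bullet> y \<noteq> 0} \<inter> space sphere_measure \<in> sets sphere_measure" by (rule measurable_sets)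
  also have "(\<lambda>y::'a. y) -` {y. \<forall>\<beta>\<in>R. \<beta> \<bullet> y \<noteq> 0} \<inter> space sphere_measure = {y\<in>sphere 0 1. \<forall>\<beta>\<in>R. \<beta> \<bullet> y \<noteq> 0}" by auto
  finally show "{y\<in>sphere 0 1. \<forall>\<beta>\<in>R. \<beta> \<bullet> y \<noteq> 0} \<in> sets (sphere_measure :: 'a measure)" .
  show "AE x in lborel. x \<in> ball 0 1 - {0} \<longrightarrow> (\<forall>\<beta>\<in>R. \<beta> \<bullet> (x /\<^sub>R norm x) \<noteq> 0)"
    using AE_roots_nonzero by eventually_elim auto
qed

lemma measurable_sphere_weight: "dunkl_weight R k \<in> borel_measurable sphere_measure"
  using measurable_compose[OF measurable_sphere_ident dunkl_weight_measurable] .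

lemma integrable_sphere_weight: "integrable sphere_measure (dunkl_weight R k)"
proof -
  interpret finite_measure "sphere_measure :: 'a measure" by (rule finite_sphere_measure)
  show ?thesis
    by (rule integrable_const_bound[OF AE_I2 measurable_sphere_weight, of "\<Prod>\<beta>\<in>R. norm \<beta> powr (2 * k \<beta>)"])
       (use dunkl_weight_nonneg dunkl_weight_le in auto)
qed

text \<open>The weight is positive off the root hyperplanes, which are null, so f vanishes almost
  everywhere on the sphere; continuity removes the exception.\<close>

lemma integral_sphere_weight_zero:
  assumes c: "continuous_on (sphere 0 1) f" and nn: "\<And>y. y \<in> sphere 0 1 \<Longrightarrow> f y \<ge> 0"
    and int: "integrable sphere_measure (\<lambda>y. f y * dunkl_weight R k y)"
    and z: "(LINT y|sphere_measure. f y * dunkl_weight R k y) = 0"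
  shows "\<forall>y\<in>sphere 0 1. f y = 0"
proof -
  have fm: "f \<in> borel_measurable sphere_measure" by (rule measurable_sphere_continuous[OF c])
  have "AE y in sphere_measure. f y * dunkl_weight R k y = 0"
    using z nn dunkl_weight_nonneg by (subst (asm) integral_nonneg_eq_0_iff_AE[OF int]) (auto intro!: AE_I2)
  with AE_sphere_roots_nonzero have "AE y in sphere_measure. f y = 0"
    by eventually_elim (metis dunkl_weight_pos less_irrefl mult_eq_0_iff)
  hence "AE x in lborel. x \<in> ball 0 1 - {0::'a} \<longrightarrow> f (x /\<^sub>R norm x) = 0"
  proof (subst (asm) AE_sphere_measure)
    have "f -` {0} \<inter> space sphere_measure \<in> sets sphere_measure" by (rule measurable_sets[OF fm]) auto
    also have "f -` {0} \<inter> space sphere_measure = {y\<in>sphere 0 1. f y = 0}" by auto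
    finally show "{y\<in>sphere 0 1. f y = 0} \<in> sets (sphere_measure :: 'a measure)" .
  qed
  \<comment> \<open>The nonvanishing set of the radial extension of f is open in the ambient space
    and null, so no statement about relatively open subsets of the sphere is required.\<close>
  define U where "U = {x \<in> ball 0 1 - {0::'a}. f (x /\<^sub>R norm x) \<in> - {0}}"
  have "continuous_on (ball 0 1 - {0}) (\<lambda>x. f (x /\<^sub>R norm x))"
    by (rule continuous_on_compose2[OF c]) (auto intro!: continuous_intros, metis left_inverse norm_eq_zero)
  from continuous_open_preimage[OF this _ open_Compl[OF closed_singleton[of 0]]]
  have "open ((ball 0 1 - {0}) \<inter> (\<lambda>x. f (x /\<^sub>R norm x)) -` (- {0}))" by auto
  also have "(ball 0 1 - {0}) \<inter> (\<lambda>x. f (x /\<^sub>R norm x)) -` (- {0}) = U" by (auto simp: U_def)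
  finally have "open U" .
  moreover have "AE x in lborel. x \<notin> U"
    using \<open>AE x in lborel. x \<in> ball 0 1 - {0::'a} \<longrightarrow> f (x /\<^sub>R norm x) = 0\<close> by eventually_elim (auto simp: U_def)
  ultimately have U: "U = {}" by (rule open_AE_empty)
  show ?thesis
  proof
    fix y :: 'a assume y: "y \<in> sphere 0 1"
    hence "(1/2) *\<^sub>R y \<in> ball 0 1 - {0}" by auto
    hence "f (((1/2) *\<^sub>R y) /\<^sub>R norm ((1/2) *\<^sub>R y)) = 0" using U unfolding U_def by blast
    thus "f y = 0" using y by simp
  qed
qed

lemma integral_sphere_weight_pos: "(LINT y|sphere_measure. dunkl_weight R k y) > 0"
proof -
  have "(LINT y|sphere_measure. dunkl_weight R k y) \<noteq> 0"
  proof
    assume "(LINT y|sphere_measure. dunkl_weight R k y) = 0"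
    hence "\<forall>y\<in>sphere (0::'a) 1. (1::real) = 0"
      using integrable_sphere_weight by (intro integral_sphere_weight_zero) auto
    moreover obtain b :: 'a where "b \<in> Basis" using nonempty_Basis by blast
    hence "b \<in> sphere 0 1" by simp
    ultimately show False by auto
  qed
  moreover have "(LINT y|sphere_measure. dunkl_weight R k y) \<ge> 0"
    by (intro Bochner_Integration.integral_nonneg dunkl_weight_nonneg)
  ultimately show ?thesis by simp
qed

text \<open>In polar coordinates homogeneity of degree 2\<gamma> leaves a one-dimensional integral
  with the power d + 2\<gamma> - 1 of the radius, dominated by a Gamma integral.\<close>

lemma integrable_gaussian_weight: "integrable lborel (\<lambda>x. exp (- (norm x)\<^sup>2 / 2) * dunkl_weight R k x)"
proof (rule integrableI_nonneg)
  define B where "B = (\<Prod>\<beta>\<in>R. norm \<beta> powr (2 * k \<beta>))"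
  define m where "m = real DIM('a) + 2 * dunkl_gamma R k"
  have g0: "dunkl_gamma R k \<ge> 0" unfolding dunkl_gamma_def by (intro sum_nonneg k_nonneg)
  have B0: "B \<ge> 0" unfolding B_def by (intro prod_nonneg) auto
  have m: "m > 0" using g0 by (simp add: m_def add_pos_nonneg)
  interpret S: finite_measure "sphere_measure :: 'a measure" by (rule finite_sphere_measure)
  define s where "s = measure (sphere_measure :: 'a measure) (sphere 0 1)"
  have s: "emeasure (sphere_measure :: 'a measure) (sphere 0 1) = ennreal s" by (simp add: s_def S.emeasure_eq_measure)
  have "(\<integral>\<^sup>+x. ennreal (exp (- (norm x)\<^sup>2 / 2) * dunkl_weight R k x) \<partial>lborel)
    = (\<integral>\<^sup>+r. ennreal (indicator {0<..} r * r ^ (DIM('a) - 1)) * (\<integral>\<^sup>+y. ennreal (exp (- (norm (r *\<^sub>R y))\<^sup>2 / 2) * dunkl_weight R k (r *\<^sub>R y)) \<partial>sphere_measure) \<partial>lborel)"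
    by (rule nn_integral_polar) measurable
  also have "\<dots> \<le> (\<integral>\<^sup>+r. ennreal (exp (1/2) * B * s) * ennreal (indicator {0..} r * r powr (m - 1) / exp (1 * r)) \<partial>lborel)"
  proof (rule nn_integral_mono)
    fix r :: real
    show "ennreal (indicator {0<..} r * r ^ (DIM('a) - 1)) * (\<integral>\<^sup>+y. ennreal (exp (- (norm (r *\<^sub>R y))\<^sup>2 / 2) * dunkl_weight R k (r *\<^sub>R y)) \<partial>sphere_measure)
      \<le> ennreal (exp (1/2) * B * s) * ennreal (indicator {0..} r * r powr (m - 1) / exp (1 * r))"
    proof (cases "r > 0")
      case True
      have "(\<integral>\<^sup>+y. ennreal (exp (- (norm (r *\<^sub>R y))\<^sup>2 / 2) * dunkl_weight R k (r *\<^sub>R y)) \<partial>sphere_measure) \<le> (\<integral>\<^sup>+y. ennreal (exp (1/2) / exp r * (r powr (2 * dunkl_gamma R k) * B)) \<partial>(sphere_measure :: 'a measure))"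
      proof (rule nn_integral_mono, rule ennreal_leI)
        fix y :: 'a assume "y \<in> space sphere_measure"
        hence y: "norm y = 1" by simp
        \<comment> \<open>Completing the square bounds exp(-r^2/2) by exp(1/2) exp(-r), which turns
          the Gaussian into the integrand of a Gamma integral.\<close>
        have "0 \<le> (r - 1)\<^sup>2" by simp
        hence "- r\<^sup>2 / 2 \<le> 1 / 2 - r" by (simp add: power2_eq_square algebra_simps)
        hence "exp (- r\<^sup>2 / 2) \<le> exp (1/2) / exp r" by (simp add: exp_diff[symmetric])
        moreover have "dunkl_weight R k y \<le> B" unfolding B_def using y by (intro dunkl_weight_le) simp
        ultimately show "exp (- (norm (r *\<^sub>R y))\<^sup>2 / 2) * dunkl_weight R k (r *\<^sub>R y) \<le> exp (1/2) / exp r * (r powr (2 * dunkl_gamma R k) * B)"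
          using True y B0 by (simp only: dunkl_weight_scale[OF True]) (intro mult_mono, auto simp: dunkl_weight_nonneg intro!: mult_left_mono mult_nonneg_nonneg)
      qed
      also have "\<dots> = ennreal (exp (1/2) / exp r * (r powr (2 * dunkl_gamma R k) * B)) * ennreal s" by (simp add: s)
      also have "\<dots> = ennreal (exp (1/2) / exp r * (r powr (2 * dunkl_gamma R k) * B) * s)"
        using B0 by (intro ennreal_mult[symmetric]) (auto simp: s_def)
      finally have "ennreal (indicator {0<..} r * r ^ (DIM('a) - 1)) * (\<integral>\<^sup>+y. ennreal (exp (- (norm (r *\<^sub>R y))\<^sup>2 / 2) * dunkl_weight R k (r *\<^sub>R y)) \<partial>sphere_measure)
        \<le> ennreal (r ^ (DIM('a) - 1)) * ennreal (exp (1/2) / exp r * (r powr (2 * dunkl_gamma R k) * B) * s)"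
        using True by (simp add: mult_left_mono)
      also have "\<dots> = ennreal (r ^ (DIM('a) - 1) * (exp (1/2) / exp r * (r powr (2 * dunkl_gamma R k) * B) * s))"
        using True B0 by (intro ennreal_mult[symmetric]) (auto simp: s_def)
      also have "r ^ (DIM('a) - 1) * (exp (1/2) / exp r * (r powr (2 * dunkl_gamma R k) * B) * s) = (exp (1/2) * B * s) * (r powr (m - 1) / exp r)"
      proof -
        have "m - 1 = real (DIM('a) - 1) + 2 * dunkl_gamma R k" using DIM_positive[where 'a='a] by (simp add: m_def of_nat_diff Suc_leI)
        hence "r powr (m - 1) = r powr real (DIM('a) - 1) * r powr (2 * dunkl_gamma R k)"
          by (simp only: powr_add)
        also have "r powr real (DIM('a) - 1) = r ^ (DIM('a) - 1)" by (rule powr_realpow[OF True])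
        finally have "r powr (m - 1) = r ^ (DIM('a) - 1) * r powr (2 * dunkl_gamma R k)" .
        thus ?thesis by simp
      qed
      also have "ennreal \<dots> = ennreal (exp (1/2) * B * s) * ennreal (r powr (m - 1) / exp r)"
        using B0 by (intro ennreal_mult) (auto simp: s_def)
      finally show ?thesis using True by simp
    qed auto
  qed
  also have "\<dots> = ennreal (exp (1/2) * B * s) * (\<integral>\<^sup>+r. ennreal (indicator {0..} r * r powr (m - 1) / exp (1 * r)) \<partial>lborel)"
    by (rule nn_integral_cmult) measurable
  also have "(\<integral>\<^sup>+r. ennreal (indicator {0..} r * r powr (m - 1) / exp (1 * r)) \<partial>lborel) = ennreal (Gamma m * 1 powr (- m))"
    using has_bochner_integral_Gamma_scaled[OF m, of 1] unfolding has_bochner_integral_iff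
    by (subst nn_integral_eq_integral) auto
  also have "ennreal (exp (1/2) * B * s) * \<dots> < \<infinity>" by (simp add: ennreal_mult_less_top)
  finally show "(\<integral>\<^sup>+x. ennreal (exp (- (norm x)\<^sup>2 / 2) * dunkl_weight R k x) \<partial>lborel) < \<infinity>" .
qed (auto simp: dunkl_weight_nonneg)

lemma dunkl_const_pos: "dunkl_const R k > 0"
proof -
  let ?f = "\<lambda>x. exp (- (norm x)\<^sup>2 / 2) * dunkl_weight R k x"
  have "(LINT x|lborel. ?f x) \<noteq> 0"
  proof
    assume "(LINT x|lborel. ?f x) = 0"
    hence "AE x in lborel. ?f x = 0"
      using dunkl_weight_nonneg by (subst (asm) integral_nonneg_eq_0_iff_AE[OF integrable_gaussian_weight]) auto
    with AE_roots_nonzero have "AE x in lborel. (x::'a) \<notin> UNIV"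
      by eventually_elim (metis dunkl_weight_pos less_irrefl mult_eq_0_iff exp_not_eq_zero)
    hence "(UNIV :: 'a set) = {}" by (intro open_AE_empty) auto
    thus False by simp
  qed
  moreover have "(LINT x|lborel. ?f x) \<ge> 0" using dunkl_weight_nonneg by (intro Bochner_Integration.integral_nonneg) auto
  ultimately show ?thesis by (simp add: dunkl_const_def)
qed

end

section \<open>Twice differentiable integrals\<close>

lemma grad_inner:
  assumes "f differentiable at x" shows "grad f x \<bullet> v = dir_deriv v f x"
proof -
  interpret l: linear "frechet_derivative f (at x)" using assms by (rule linear_frechet_derivative)
  have "grad f x \<bullet> v = (\<Sum>b\<in>Basis. (v \<bullet> b) * frechet_derivative f (at x) b)"
    unfolding grad_def inner_sum_left by (simp add: dir_deriv_def inner_commute mult.commute)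
  also have "\<dots> = frechet_derivative f (at x) (\<Sum>b\<in>Basis. (v \<bullet> b) *\<^sub>R b)"
    by (simp add: l.sum l.scale)
  also have "\<dots> = dir_deriv v f x" by (simp add: euclidean_representation dir_deriv_def)
  finally show ?thesis .
qed

lemma C2_onI:
  assumes U: "open U"
    and D: "\<And>x. x \<in> U \<Longrightarrow> (f has_derivative (\<lambda>h. g x \<bullet> h)) (at x)"
    and D2: "\<And>x v. x \<in> U \<Longrightarrow> ((\<lambda>x. g x \<bullet> v) has_derivative (\<lambda>h. H v x \<bullet> h)) (at x)"
    and c: "\<And>v. continuous_on U (H v)"
  shows "C2_on U f" "\<And>x v. x \<in> U \<Longrightarrow> dir_deriv v f x = g x \<bullet> v"
    "\<And>x v w. x \<in> U \<Longrightarrow> dir_deriv w (dir_deriv v f) x = H v x \<bullet> w"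
proof -
  show d1: "dir_deriv v f x = g x \<bullet> v" if "x \<in> U" for x v using dir_deriv_eq[OF D[OF that]] .
  have D2': "(dir_deriv v f has_derivative (\<lambda>h. H v x \<bullet> h)) (at x)" if "x \<in> U" for x v
    by (rule has_derivative_transform_within_open[OF D2[OF that] U that]) (simp add: d1)
  show d2: "dir_deriv w (dir_deriv v f) x = H v x \<bullet> w" if "x \<in> U" for x v w
    by (rule dir_deriv_eq[OF D2'[OF that]])
  have "continuous_on U (dir_deriv w (dir_deriv v f))" for v w
    using c[of v] by (subst continuous_on_cong[OF refl d2]) (auto intro!: continuous_intros)
  thus "C2_on U f" unfolding C2_on_def using D D2' by (blast intro: differentiableI)
qed

text \<open>Integration by components, so that gradients and Hessian columns reduce to the parameter
  lemmas for real-valued integrands.\<close>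

definition vec_integral :: "'p measure \<Rightarrow> ('p \<Rightarrow> real) \<Rightarrow> ('p \<Rightarrow> 'b) \<Rightarrow> ('a::euclidean_space \<Rightarrow> 'b \<Rightarrow> 'a) \<Rightarrow> 'a \<Rightarrow> 'a" where
  "vec_integral M w q F x = (\<Sum>b\<in>Basis. (LINT p|M. w p * (F x (q p) \<bullet> b)) *\<^sub>R b)"

locale compact_parameter =
  fixes M :: "'p measure" and w :: "'p \<Rightarrow> real" and q :: "'p \<Rightarrow> 'b::euclidean_space" and K :: "'b set"
  assumes K: "compact K" and q: "q \<in> borel_measurable M" "\<And>p. p \<in> space M \<Longrightarrow> q p \<in> K" and w: "integrable M w"
begin

lemma section_continuous:
  fixes F :: "'a::euclidean_space \<Rightarrow> 'b \<Rightarrow> 'c::metric_space"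
  assumes "continuous_on (U \<times> K) (\<lambda>z. F (fst z) (snd z))" "x \<in> U"
  shows "continuous_on K (F x)"
  using continuous_on_compose2[OF assms(1) continuous_on_Pair[OF continuous_on_const continuous_on_id], of x K] assms(2) by auto

lemma integrable_section:
  fixes F :: "'a::euclidean_space \<Rightarrow> 'b \<Rightarrow> 'a"
  assumes "continuous_on (U \<times> K) (\<lambda>z. F (fst z) (snd z))" "x \<in> U"
  shows "integrable M (\<lambda>p. w p * (F x (q p) \<bullet> v))"
  using section_continuous[OF assms] by (intro integrable_compact_param[OF K _ q w] continuous_intros)

lemma vec_integral_inner:
  fixes F :: "'a::euclidean_space \<Rightarrow> 'b \<Rightarrow> 'a"
  assumes "continuous_on (U \<times> K) (\<lambda>z. F (fst z) (snd z))" "x \<in> U"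
  shows "vec_integral M w q F x \<bullet> v = (LINT p|M. w p * (F x (q p) \<bullet> v))"
proof -
  note i = integrable_section[OF assms]
  have "vec_integral M w q F x \<bullet> v = (\<Sum>b\<in>Basis. LINT p|M. (v \<bullet> b) * (w p * (F x (q p) \<bullet> b)))"
    unfolding vec_integral_def inner_sum_left by (simp add: inner_commute mult.commute)
  also have "\<dots> = (LINT p|M. (\<Sum>b\<in>Basis. (v \<bullet> b) * (w p * (F x (q p) \<bullet> b))))"
    by (rule Bochner_Integration.integral_sum[symmetric]) (intro integrable_mult_right i)
  also have "\<dots> = (LINT p|M. w p * (F x (q p) \<bullet> v))"
    by (intro Bochner_Integration.integral_cong refl)
       (simp add: euclidean_inner[of "F x (q _)" v] sum_distrib_left mult_ac)
  finally show ?thesis .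
qed

lemma continuous_on_vec_integral:
  fixes F :: "'a::euclidean_space \<Rightarrow> 'b \<Rightarrow> 'a"
  assumes "continuous_on (U \<times> K) (\<lambda>z. F (fst z) (snd z))"
  shows "continuous_on U (vec_integral M w q F)"
  unfolding vec_integral_def
  by (intro continuous_on_sum continuous_on_scaleR continuous_on_const continuous_on_param_integral[OF K _ q w] continuous_on_inner assms)

text \<open>Differentiates twice under the integral and returns gradient and Hessian columns as
  integrals again, the form in which the radial operator is evaluated.\<close>

lemma C2_on_param_integral:
  fixes F :: "'a::euclidean_space \<Rightarrow> 'b \<Rightarrow> real"
  assumes U: "open U"
    and cF: "\<And>x. x \<in> U \<Longrightarrow> continuous_on K (F x)"
    and cG: "continuous_on (U \<times> K) (\<lambda>z. G (fst z) (snd z))"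
    and cH: "\<And>v. continuous_on (U \<times> K) (\<lambda>z. H v (fst z) (snd z))"
    and D: "\<And>x t. x \<in> U \<Longrightarrow> t \<in> K \<Longrightarrow> ((\<lambda>x. F x t) has_derivative (\<lambda>h. G x t \<bullet> h)) (at x)"
    and D2: "\<And>x t v. x \<in> U \<Longrightarrow> t \<in> K \<Longrightarrow> ((\<lambda>x. G x t \<bullet> v) has_derivative (\<lambda>h. H v x t \<bullet> h)) (at x)"
  defines "f \<equiv> (\<lambda>x. LINT p|M. w p * F x (q p))"
  shows "\<And>x. x \<in> U \<Longrightarrow> (f has_derivative (\<lambda>h. vec_integral M w q G x \<bullet> h)) (at x)"
    "\<And>x v. x \<in> U \<Longrightarrow> ((\<lambda>x. vec_integral M w q G x \<bullet> v) has_derivative (\<lambda>h. vec_integral M w q (H v) x \<bullet> h)) (at x)"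
    "\<And>v. continuous_on U (vec_integral M w q (H v))"
proof -
  fix x v assume x: "x \<in> U"
  show "(f has_derivative (\<lambda>h. vec_integral M w q G x \<bullet> h)) (at x)"
    unfolding f_def vec_integral_inner[OF cG x]
    by (rule has_derivative_param_integral[OF U K cG D cF q w x])
  have "((\<lambda>x. LINT p|M. w p * (G x (q p) \<bullet> v)) has_derivative (\<lambda>h. vec_integral M w q (H v) x \<bullet> h)) (at x)"
    unfolding vec_integral_inner[OF cH x]
  proof (rule has_derivative_param_integral[OF U K cH _ _ q w x])
    fix x t assume "x \<in> U" "t \<in> K"
    thus "((\<lambda>x. G x t \<bullet> v) has_derivative (\<lambda>h. H v x t \<bullet> h)) (at x)" by (rule D2)
  next
    fix x assume "x \<in> U"
    thus "continuous_on K (\<lambda>t. G x t \<bullet> v)" by (intro continuous_intros section_continuous[OF cG])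
  qed
  thus "((\<lambda>x. vec_integral M w q G x \<bullet> v) has_derivative (\<lambda>h. vec_integral M w q (H v) x \<bullet> h)) (at x)"
    by (rule has_derivative_transform_within_open[OF _ U x]) (simp add: vec_integral_inner[OF cG])
next
  show "continuous_on U (vec_integral M w q (H v))" for v by (rule continuous_on_vec_integral[OF cH])
qed

end

text \<open>The expression \<open>\<Delta>\<^sup>W f(x)\<close> in terms of the gradient \<open>g\<close> and the Hessian columns \<open>H b\<close> at \<open>x\<close>.\<close>

definition radial_symbol :: "'a::euclidean_space set \<Rightarrow> ('a \<Rightarrow> real) \<Rightarrow> 'a \<Rightarrow> 'a \<Rightarrow> ('a \<Rightarrow> 'a) \<Rightarrow> real" where
  "radial_symbol R k x g H = (\<Sum>b\<in>Basis. H b \<bullet> b) +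
     2 * (\<Sum>\<alpha>\<in>R. k \<alpha> * (if \<alpha> \<bullet> x = 0 then (H \<alpha> \<bullet> \<alpha>) / (norm \<alpha>)\<^sup>2 else (g \<bullet> \<alpha>) / (\<alpha> \<bullet> x)))"

lemma radial_dunkl_laplacian_eq:
  assumes U: "open U" "x \<in> U"
    and D: "\<And>x. x \<in> U \<Longrightarrow> (f has_derivative (\<lambda>h. g x \<bullet> h)) (at x)"
    and D2: "\<And>x v. x \<in> U \<Longrightarrow> ((\<lambda>x. g x \<bullet> v) has_derivative (\<lambda>h. H v x \<bullet> h)) (at x)"
    and c: "\<And>v. continuous_on U (H v)"
  shows "radial_dunkl_laplacian R k f x = radial_symbol R k x (g x) (\<lambda>v. H v x)"
proof -
  note d = C2_onI(2,3)[OF U(1) D D2 c U(2)]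
  have "f differentiable at x" using D[OF U(2)] by (rule differentiableI)
  thus ?thesis
    by (simp add: radial_dunkl_laplacian_def laplacian_def radial_symbol_def radial_quotient_def d grad_inner cong: if_cong)
qed

context compact_parameter
begin

text \<open>The symbol is linear in gradient and Hessian at a fixed point, also where it switches to
  the second derivative on a hyperplane, so it commutes with the integral. Harmonicity of the
  integral thus follows from harmonicity of the kernel.\<close>

lemma radial_symbol_integral:
  fixes G :: "'a::euclidean_space \<Rightarrow> 'b \<Rightarrow> 'a"
  assumes x: "x \<in> U" and cG: "continuous_on (U \<times> K) (\<lambda>z. G (fst z) (snd z))"
    and cH: "\<And>v. continuous_on (U \<times> K) (\<lambda>z. H v (fst z) (snd z))"
  shows "radial_symbol R k x (vec_integral M w q G x) (\<lambda>v. vec_integral M w q (H v) x) =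
    (LINT p|M. w p * radial_symbol R k x (G x (q p)) (\<lambda>v. H v x (q p)))"
proof -
  note iG = integrable_section[OF cG x] and iH = integrable_section[OF cH x]
  let ?r = "\<lambda>\<alpha> g H. if \<alpha> \<bullet> x = 0 then (H \<alpha> \<bullet> \<alpha>) / (norm \<alpha>)\<^sup>2 else (g \<bullet> \<alpha>) / (\<alpha> \<bullet> x)"
  have r_int: "integrable M (\<lambda>p. k \<alpha> * (w p * ?r \<alpha> (G x (q p)) (\<lambda>v. H v x (q p))))" for \<alpha>
    using iG iH by (cases "\<alpha> \<bullet> x = 0") (auto simp: times_divide_eq_right)
  have r: "k \<alpha> * ?r \<alpha> (vec_integral M w q G x) (\<lambda>v. vec_integral M w q (H v) x) = (LINT p|M. k \<alpha> * (w p * ?r \<alpha> (G x (q p)) (\<lambda>v. H v x (q p))))" for \<alpha>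
    unfolding vec_integral_inner[OF cG x] vec_integral_inner[OF cH x] by (auto simp: times_divide_eq_right)
  have s1: "(\<Sum>b\<in>Basis. vec_integral M w q (H b) x \<bullet> b) = (LINT p|M. (\<Sum>b\<in>Basis. w p * (H b x (q p) \<bullet> b)))"
    unfolding vec_integral_inner[OF cH x] by (rule Bochner_Integration.integral_sum[symmetric]) (rule iH)
  have s2: "(\<Sum>\<alpha>\<in>R. k \<alpha> * ?r \<alpha> (vec_integral M w q G x) (\<lambda>v. vec_integral M w q (H v) x)) =
     (LINT p|M. (\<Sum>\<alpha>\<in>R. k \<alpha> * (w p * ?r \<alpha> (G x (q p)) (\<lambda>v. H v x (q p)))))"
    unfolding r by (rule Bochner_Integration.integral_sum[symmetric]) (rule r_int)
  have "radial_symbol R k x (vec_integral M w q G x) (\<lambda>v. vec_integral M w q (H v) x)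
    = (LINT p|M. (\<Sum>b\<in>Basis. w p * (H b x (q p) \<bullet> b))) + 2 * (LINT p|M. (\<Sum>\<alpha>\<in>R. k \<alpha> * (w p * ?r \<alpha> (G x (q p)) (\<lambda>v. H v x (q p)))))"
    unfolding radial_symbol_def s1 s2 ..
  also have "\<dots> = (LINT p|M. (\<Sum>b\<in>Basis. w p * (H b x (q p) \<bullet> b)) + 2 * (\<Sum>\<alpha>\<in>R. k \<alpha> * (w p * ?r \<alpha> (G x (q p)) (\<lambda>v. H v x (q p)))))"
    by (subst Bochner_Integration.integral_add)
       (intro Bochner_Integration.integrable_sum iH integrable_mult_right r_int, simp)+
  also have "\<dots> = (LINT p|M. w p * radial_symbol R k x (G x (q p)) (\<lambda>v. H v x (q p)))"
    unfolding radial_symbol_def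
    by (intro Bochner_Integration.integral_cong refl) (simp add: distrib_left sum_distrib_left mult.left_commute cong: if_cong)
  finally show ?thesis .
qed

end

section \<open>The Poisson kernel\<close>

text \<open>Equals the squared distance of x and q when q is a unit vector. For the shorter vectors
  q = t \<cdot> y the summand 1 remains the squared norm of y, which is what makes this the form
  A.\<close>

definition pk_dist :: "'a::real_inner \<Rightarrow> 'a \<Rightarrow> real" where
  "pk_dist x q = 1 + x \<bullet> x - 2 * (x \<bullet> q)"

text \<open>For l = d/2 and unit q this is the classical Poisson kernel times the area of the
  sphere.\<close>

definition pk_fun :: "real \<Rightarrow> 'a::real_inner \<Rightarrow> 'a \<Rightarrow> real" where
  "pk_fun l x q = (1 - x \<bullet> x) * pk_dist x q powr (- l)"

definition pk_grad :: "real \<Rightarrow> 'a::real_inner \<Rightarrow> 'a \<Rightarrow> 'a" where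
  "pk_grad l x q = (- 2 * pk_dist x q powr (- l)) *\<^sub>R x - (2 * l * (1 - x \<bullet> x) * pk_dist x q powr (- l - 1)) *\<^sub>R (x - q)"

definition pk_hess :: "real \<Rightarrow> 'a::real_inner \<Rightarrow> 'a \<Rightarrow> 'a \<Rightarrow> 'a" where
  "pk_hess l v x q = (- 2 * pk_dist x q powr (- l)) *\<^sub>R v
     + (4 * l * pk_dist x q powr (- l - 1)) *\<^sub>R ((v \<bullet> x) *\<^sub>R (x - q) + (v \<bullet> (x - q)) *\<^sub>R x)
     + (1 - x \<bullet> x) *\<^sub>R ((4 * l * (l + 1) * pk_dist x q powr (- l - 2) * (v \<bullet> (x - q))) *\<^sub>R (x - q)
        - (2 * l * pk_dist x q powr (- l - 1)) *\<^sub>R v)"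

lemma pk_dist_ge:
  assumes "norm q \<le> 1" shows "(1 - norm x)\<^sup>2 \<le> pk_dist x q"
proof -
  have "x \<bullet> q \<le> norm x * norm q" by (rule norm_cauchy_schwarz)
  also have "\<dots> \<le> norm x * 1" using assms by (intro mult_left_mono) auto
  finally show ?thesis by (simp add: pk_dist_def power2_norm_eq_inner[symmetric] power2_eq_square algebra_simps)
qed

lemma pk_dist_pos: "norm x < 1 \<Longrightarrow> norm q \<le> 1 \<Longrightarrow> 0 < pk_dist x q"
  using pk_dist_ge[of q x] zero_less_power[of "1 - norm x" 2] by linarith

lemma has_derivative_pk_dist_powr:
  fixes x :: "'a::euclidean_space"
  assumes "0 < pk_dist x q"
  shows "((\<lambda>x. pk_dist x q powr e) has_derivative (\<lambda>h. (2 * e * pk_dist x q powr (e - 1)) * ((x - q) \<bullet> h))) (at x)"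
proof -
  have 1: "((\<lambda>x. pk_dist x q) has_derivative (\<lambda>h. 2 * ((x - q) \<bullet> h))) (at x)"
    unfolding pk_dist_def by (auto intro!: derivative_eq_intros simp: inner_diff_left inner_commute algebra_simps)
  have "((\<lambda>y. y powr e) has_real_derivative e * pk_dist x q powr (e - 1)) (at (pk_dist x q))"
    using has_real_derivative_powr[OF assms] .
  from DERIV_compose_FDERIV[OF this 1] show ?thesis
    by (rule has_derivative_eq_rhs) (simp add: fun_eq_iff)
qed

lemma has_derivative_pk_fun:
  fixes x :: "'a::euclidean_space"
  assumes "0 < pk_dist x q"
  shows "((\<lambda>x. pk_fun l x q) has_derivative (\<lambda>h. pk_grad l x q \<bullet> h)) (at x)"
proof -
  have 1: "((\<lambda>x. 1 - x \<bullet> x) has_derivative (\<lambda>h. - 2 * (x \<bullet> h))) (at x)"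
    by (auto intro!: derivative_eq_intros simp: inner_commute)
  show ?thesis unfolding pk_fun_def
    by (rule has_derivative_eq_rhs[OF has_derivative_mult[OF 1 has_derivative_pk_dist_powr[OF assms]]])
       (simp add: fun_eq_iff pk_grad_def inner_diff_left algebra_simps)
qed

lemma has_derivative_pk_grad:
  fixes x :: "'a::euclidean_space"
  assumes "0 < pk_dist x q"
  shows "((\<lambda>x. pk_grad l x q \<bullet> v) has_derivative (\<lambda>h. pk_hess l v x q \<bullet> h)) (at x)"
proof -
  define a where "a = pk_dist x q powr (- l)"
  define b where "b = pk_dist x q powr (- l - 1)"
  define c where "c = pk_dist x q powr (- l - 2)"
  have A: "((\<lambda>x. pk_dist x q powr (- l)) has_derivative (\<lambda>h. (- 2 * l * b) * ((x - q) \<bullet> h))) (at x)"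
    using has_derivative_pk_dist_powr[OF assms, of "- l"] by (simp add: b_def)
  have e: "- l - 1 - 1 = - l - 2" by simp
  have B: "((\<lambda>x. pk_dist x q powr (- l - 1)) has_derivative (\<lambda>h. (2 * (- l - 1) * c) * ((x - q) \<bullet> h))) (at x)"
    using has_derivative_pk_dist_powr[OF assms, of "- l - 1"] unfolding e by (simp add: c_def)
  have 1: "((\<lambda>x. 1 - x \<bullet> x) has_derivative (\<lambda>h. - 2 * (x \<bullet> h))) (at x)"
    by (auto intro!: derivative_eq_intros simp: inner_commute)
  have 2: "((\<lambda>x. x \<bullet> v) has_derivative (\<lambda>h. h \<bullet> v)) (at x)" "((\<lambda>x. (x - q) \<bullet> v) has_derivative (\<lambda>h. h \<bullet> v)) (at x)"
    by (auto intro!: derivative_eq_intros)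
  have eq: "pk_grad l x q \<bullet> v = - 2 * (pk_dist x q powr (- l) * (x \<bullet> v)) - 2 * l * ((1 - x \<bullet> x) * pk_dist x q powr (- l - 1) * ((x - q) \<bullet> v))" for x
    by (simp add: pk_grad_def inner_diff_left)
  show ?thesis unfolding eq
    by (rule has_derivative_eq_rhs[OF has_derivative_diff[OF
          has_derivative_mult_right[OF has_derivative_mult[OF A 2(1)]]
          has_derivative_mult_right[OF has_derivative_mult[OF has_derivative_mult[OF 1 B] 2(2)]]]])
       (simp add: fun_eq_iff pk_hess_def a_def[symmetric] b_def[symmetric] c_def[symmetric]
          inner_add_left inner_diff_left inner_diff_right inner_commute algebra_simps)
qed

lemma continuous_on_pk [continuous_intros]:
  fixes f g :: "'z::topological_space \<Rightarrow> 'a::euclidean_space"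
  assumes f: "continuous_on S f" and g: "continuous_on S g"
    and S: "\<And>z. z \<in> S \<Longrightarrow> norm (f z) < 1" "\<And>z. z \<in> S \<Longrightarrow> norm (g z) \<le> 1"
  shows "continuous_on S (\<lambda>z. pk_dist (f z) (g z) powr e)"
    "continuous_on S (\<lambda>z. pk_fun l (f z) (g z))"
    "continuous_on S (\<lambda>z. pk_grad l (f z) (g z))"
    "continuous_on S (\<lambda>z. pk_hess l v (f z) (g z))"
proof -
  show c: "continuous_on S (\<lambda>z. pk_dist (f z) (g z) powr e)" for e
  proof (rule continuous_on_powr)
    show "continuous_on S (\<lambda>z. pk_dist (f z) (g z))" unfolding pk_dist_def by (intro continuous_intros f g)
  qed (use pk_dist_pos[OF S] in \<open>auto intro: less_imp_neq[THEN not_sym] simp: less_le\<close>)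
  show "continuous_on S (\<lambda>z. pk_fun l (f z) (g z))" "continuous_on S (\<lambda>z. pk_grad l (f z) (g z))"
    "continuous_on S (\<lambda>z. pk_hess l v (f z) (g z))"
    unfolding pk_fun_def pk_grad_def pk_hess_def
    by (intro continuous_on_add continuous_on_diff continuous_on_scaleR continuous_on_mult continuous_on_inner continuous_on_const c f g)+
qed

section \<open>The averaged kernel and its harmonicity\<close>

context orth_roots
begin

definition lam :: real where "lam = dunkl_gamma R k + real DIM('a) / 2"

definition ball_kernel :: "'a \<Rightarrow> 'a \<Rightarrow> real" where
  "ball_kernel x y = (LINT t|GM. pk_fun lam x (rescale R t y))"

definition kernel_grad :: "'a \<Rightarrow> 'a \<Rightarrow> 'a" where
  "kernel_grad x y = vec_integral GM (\<lambda>_. 1) (\<lambda>t. rescale R t y) (pk_grad lam) x"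

definition kernel_hess :: "'a \<Rightarrow> 'a \<Rightarrow> 'a \<Rightarrow> 'a" where
  "kernel_hess v x y = vec_integral GM (\<lambda>_. 1) (\<lambda>t. rescale R t y) (pk_hess lam v) x"

lemma lam_pos: "lam > 0"
  unfolding lam_def dunkl_gamma_def by (intro add_nonneg_pos sum_nonneg k_nonneg) auto

lemma compact_parameter_rescale: "norm y \<le> 1 \<Longrightarrow> compact_parameter GM (\<lambda>_. 1) (\<lambda>t. rescale R t y) (cball 0 1)"
  by unfold_locales (auto intro: measurable_rescale order_trans[OF norm_rescale_GM])

lemma pk_continuous_sections:
  "continuous_on (ball 0 1 \<times> cball 0 1) (\<lambda>z. pk_grad lam (fst z) (snd z :: 'a))"
  "continuous_on (ball 0 1 \<times> cball 0 1) (\<lambda>z. pk_hess lam v (fst z) (snd z :: 'a))"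
  by (intro continuous_on_pk continuous_intros; force)+

lemma ball_kernel_derivatives:
  assumes "norm y \<le> 1"
  shows "\<And>x. x \<in> ball 0 1 \<Longrightarrow> ((\<lambda>x. ball_kernel x y) has_derivative (\<lambda>h. kernel_grad x y \<bullet> h)) (at x)"
    "\<And>x v. x \<in> ball 0 1 \<Longrightarrow> ((\<lambda>x. kernel_grad x y \<bullet> v) has_derivative (\<lambda>h. kernel_hess v x y \<bullet> h)) (at x)"
    "\<And>v. continuous_on (ball 0 1) (\<lambda>x. kernel_hess v x y)"
proof -
  interpret compact_parameter GM "\<lambda>_. 1" "\<lambda>t. rescale R t y" "cball 0 1"
    by (rule compact_parameter_rescale) fact
  have pos: "0 < pk_dist x t" if "x \<in> ball 0 1" "t \<in> cball 0 1" for x t :: 'a using that by (intro pk_dist_pos) auto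
  have cF: "continuous_on (cball 0 1) (pk_fun lam x)" if "x \<in> ball 0 1" for x :: 'a
    using that by (intro continuous_on_pk continuous_intros) auto
  have D: "((\<lambda>x. pk_fun lam x t) has_derivative (\<lambda>h. pk_grad lam x t \<bullet> h)) (at x)" if "x \<in> ball 0 1" "t \<in> cball 0 1" for x t :: 'a
    by (rule has_derivative_pk_fun[OF pos[OF that]])
  have D2: "((\<lambda>x. pk_grad lam x t \<bullet> v) has_derivative (\<lambda>h. pk_hess lam v x t \<bullet> h)) (at x)" if "x \<in> ball 0 1" "t \<in> cball 0 1" for x t v :: 'a
    by (rule has_derivative_pk_grad[OF pos[OF that]])
  note C = C2_on_param_integral[where F="pk_fun lam" and G="pk_grad lam" and H="pk_hess lam" and U="ball 0 1",
     OF open_ball cF pk_continuous_sections D D2]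
  show "((\<lambda>x. ball_kernel x y) has_derivative (\<lambda>h. kernel_grad x y \<bullet> h)) (at x)" if "x \<in> ball 0 1" for x
    using C(1) that by (simp add: ball_kernel_def kernel_grad_def)
  show "((\<lambda>x. kernel_grad x y \<bullet> v) has_derivative (\<lambda>h. kernel_hess v x y \<bullet> h)) (at x)" if "x \<in> ball 0 1" for x v
    using C(2) that by (simp add: kernel_grad_def kernel_hess_def)
  show "continuous_on (ball 0 1) (\<lambda>x. kernel_hess v x y)" for v
    using C(3) by (simp add: kernel_hess_def)
qed

text \<open>Joint continuity in both arguments: the pair is the point, and the box of parameters in
  its encoded form is the compact parameter set.\<close>

lemma continuous_on_GM_integral:
  assumes F: "continuous_on (ball 0 1 \<times> cball 0 1) (\<lambda>z. F (fst z) (snd z) :: real)"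
  shows "continuous_on (ball 0 1 \<times> sphere 0 1) (\<lambda>z. LINT t|GM. F (fst z) (rescale R t (snd z)))"
proof -
  have "continuous_on (ball 0 1 \<times> sphere 0 1) (\<lambda>z. LINT t|GM. 1 * F (fst z) (rescale R (decode (encode t)) (snd z)))"
  proof (rule continuous_on_param_integral[OF compact_code_box, where q=encode and F="\<lambda>z \<tau>. F (fst z) (rescale R (decode \<tau>) (snd z))"])
    show "continuous_on ((ball 0 1 \<times> sphere 0 1) \<times> code_box) (\<lambda>z. F (fst (fst z)) (rescale R (decode (snd z)) (snd (fst z))))"
    proof (rule continuous_on_compose2[OF F, of _ "\<lambda>z. (fst (fst z), rescale R (decode (snd z)) (snd (fst z)))", simplified])
      show "continuous_on ((ball 0 1 \<times> sphere 0 1) \<times> code_box) (\<lambda>z. (fst (fst z), rescale R (decode (snd z)) (snd (fst z))))"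
        by (intro continuous_intros)
      show "(\<lambda>z. (fst (fst z), rescale R (decode (snd z)) (snd (fst z)))) ` ((ball 0 1 \<times> sphere 0 1) \<times> code_box) \<subseteq> ball 0 1 \<times> cball 0 1"
        by (auto intro!: order_trans[OF norm_rescale_decode])
    qed
  qed (auto intro: measurable_encode encode_in_box)
  thus ?thesis by (simp add: rescale_decode_encode)
qed

lemma ball_kernel_continuous:
  "continuous_on (ball 0 1 \<times> sphere 0 1) (\<lambda>z. ball_kernel (fst z) (snd z))"
  "continuous_on (ball 0 1 \<times> sphere 0 1) (\<lambda>z. kernel_grad (fst z) (snd z))"
  "continuous_on (ball 0 1 \<times> sphere 0 1) (\<lambda>z. kernel_hess v (fst z) (snd z))"
proof -
  show "continuous_on (ball 0 1 \<times> sphere 0 1) (\<lambda>z. ball_kernel (fst z) (snd z))"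
    unfolding ball_kernel_def by (intro continuous_on_GM_integral continuous_on_pk continuous_intros) auto
  show "continuous_on (ball 0 1 \<times> sphere 0 1) (\<lambda>z. kernel_grad (fst z) (snd z))"
    unfolding kernel_grad_def vec_integral_def mult_1
    by (intro continuous_on_sum continuous_on_scaleR continuous_on_const
         continuous_on_GM_integral[where F="\<lambda>x q. pk_grad lam x q \<bullet> _"] continuous_on_inner pk_continuous_sections)
  show "continuous_on (ball 0 1 \<times> sphere 0 1) (\<lambda>z. kernel_hess v (fst z) (snd z))"
    unfolding kernel_hess_def vec_integral_def mult_1
    by (intro continuous_on_sum continuous_on_scaleR continuous_on_const
         continuous_on_GM_integral[where F="\<lambda>x q. pk_hess lam v x q \<bullet> _"] continuous_on_inner pk_continuous_sections)
qed

text \<open>The continuous extension of \<open>k \<beta> \<langle>\<nabla>P(x), \<beta>\<rangle> / \<langle>\<beta>, x\<rangle>\<close> to the hyperplane orthogonal to \<open>\<beta>\<close>.\<close>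

definition kernel_quot :: "'a \<Rightarrow> 'a \<Rightarrow> 'a \<Rightarrow> real" where
  "kernel_quot \<beta> x y = (LINT t|GM. - 2 * k \<beta> * pk_dist x (rescale R t y) powr (- lam)
     - 2 * lam * k \<beta> * (1 - x \<bullet> x) * pk_dist x (rescale R t y) powr (- lam - 1)
     + 2 * lam * (lam + 1) * (1 - x \<bullet> x) * pairing \<beta> y y * ((1 - (t \<beta>)\<^sup>2) * pk_dist x (rescale R t y) powr (- lam - 2)))"

lemma integrable_GM_encode:
  assumes "continuous_on code_box F" shows "integrable GM (\<lambda>t. F (encode t) :: real)"
  using integrable_compact_param[OF compact_code_box assms measurable_encode encode_in_box, of "\<lambda>_. 1"] by simp

lemma continuous_on_decode [continuous_intros]:
  "continuous_on S f \<Longrightarrow> continuous_on S (\<lambda>z. decode (f z) \<beta>)"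
  unfolding decode_def divide_inverse by (intro continuous_intros)

lemma pk_dist_rescale_upd:
  assumes "\<beta> \<in> R"
  shows "pk_dist x (rescale R (t(\<beta> := s)) y) = pk_dist x (rescale R t y) - 2 * (s - t \<beta>) * pairing \<beta> x y"
  unfolding pk_dist_def rescale_upd[OF assms]
  by (simp add: inner_add_right pairing_def inner_commute[of x \<beta>] distrib_left mult_ac)

context
  fixes x y :: 'a assumes x: "x \<in> ball 0 1" and y: "y \<in> sphere 0 1"
begin

lemma pk_dist_GM_pos: "t \<in> space GM \<Longrightarrow> 0 < pk_dist x (rescale R t y)"
  using x y order_trans[OF norm_rescale_GM, of t y 1] by (intro pk_dist_pos) auto

lemma integrable_pk_dist: "integrable GM (\<lambda>t. pk_dist x (rescale R t y) powr e)"
proof -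
  have "continuous_on code_box (\<lambda>\<tau>. pk_dist x (rescale R (decode \<tau>) y) powr e)"
    using x y norm_rescale_decode[of _ y] by (intro continuous_on_pk continuous_intros) auto
  from integrable_GM_encode[OF this] show ?thesis by (simp add: rescale_decode_encode)
qed

lemma integrable_pk_dist_poly:
  assumes b: "\<beta> \<in> R" and f: "continuous_on UNIV f"
  shows "integrable GM (\<lambda>t. f (t \<beta>) * pk_dist x (rescale R t y) powr e)"
proof -
  have "continuous_on code_box (\<lambda>\<tau>. f (decode \<tau> \<beta>) * pk_dist x (rescale R (decode \<tau>) y) powr e)"
    using x y norm_rescale_decode[of _ y]
    by (intro continuous_on_mult continuous_on_pk continuous_on_rescale_decode continuous_on_id continuous_on_const
          continuous_on_compose2[OF f continuous_on_decode]) auto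
  from integrable_GM_encode[OF this] show ?thesis by (simp add: rescale_decode_encode decode_encode[OF b])
qed

lemma bounded_pk_dist: "\<exists>B. \<forall>t\<in>space GM. \<bar>pk_dist x (rescale R t y) powr e\<bar> \<le> B"
proof -
  have c: "continuous_on (cball 0 1) (\<lambda>q. pk_dist x q powr e)"
    using x by (intro continuous_on_pk continuous_intros) auto
  have "bounded ((\<lambda>q. pk_dist x q powr e) ` cball 0 1)"
    by (intro compact_imp_bounded compact_continuous_image c compact_cball)
  then obtain B where B: "\<forall>v\<in>(\<lambda>q. pk_dist x q powr e) ` cball 0 1. norm v \<le> B" unfolding bounded_iff by blast
  have "\<bar>pk_dist x (rescale R t y) powr e\<bar> \<le> B" if "t \<in> space GM" for t
  proof -
    have "rescale R t y \<in> cball 0 1" using norm_rescale_GM[OF that, of y] y by simp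
    thus ?thesis using B by (metis imageI real_norm_def)
  qed
  thus ?thesis by blast
qed

text \<open>A is affine in each parameter with slope -2 times the pairing of x and y, so integrating
  the power -\<lambda> - 1 by parts produces that pairing and the power -\<lambda> - 2.\<close>

lemma pk_dist_ibp:
  assumes b: "\<beta> \<in> R"
  shows "k \<beta> * (LINT t|GM. t \<beta> * pk_dist x (rescale R t y) powr (- lam - 1)) =
    (lam + 1) * pairing \<beta> x y * (LINT t|GM. (1 - (t \<beta>)\<^sup>2) * pk_dist x (rescale R t y) powr (- lam - 2))"
proof -
  obtain B1 where B1: "\<forall>t\<in>space GM. \<bar>pk_dist x (rescale R t y) powr (- lam - 1)\<bar> \<le> B1" using bounded_pk_dist by blast
  obtain B2 where B2: "\<forall>t\<in>space GM. \<bar>pk_dist x (rescale R t y) powr (- lam - 2)\<bar> \<le> B2" using bounded_pk_dist by blast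
  have "(LINT t|GM. (1 - (t \<beta>)\<^sup>2) * (2 * (lam + 1) * pairing \<beta> x y * pk_dist x (rescale R t y) powr (- lam - 2)))
    = 2 * k \<beta> * (LINT t|GM. t \<beta> * pk_dist x (rescale R t y) powr (- lam - 1))"
  proof (rule GM_integration_by_parts[OF b])
    fix t and s :: real assume t: "t \<in> space GM" and s: "s \<in> {-1..1}"
    have "t(\<beta> := s) \<in> space GM" using t s b by (auto simp: space_PiM PiE_def Pi_def extensional_def)
    hence pos: "0 < pk_dist x (rescale R (t(\<beta> := s)) y)" by (rule pk_dist_GM_pos)
    have D: "((\<lambda>s. pk_dist x (rescale R (t(\<beta> := s)) y)) has_real_derivative - 2 * pairing \<beta> x y) (at s within {-1..1})"
      unfolding pk_dist_rescale_upd[OF b] by (auto intro!: derivative_eq_intros)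
    have e: "- lam - 1 - 1 = - lam - 2" by simp
    from DERIV_chain2[OF has_real_derivative_powr[OF pos, of "- lam - 1"] D]
    show "((\<lambda>s. pk_dist x (rescale R (t(\<beta> := s)) y) powr (- lam - 1)) has_real_derivative
      2 * (lam + 1) * pairing \<beta> x y * pk_dist x (rescale R (t(\<beta> := s)) y) powr (- lam - 2)) (at s within {-1..1})"
      unfolding e by (rule DERIV_cong) (simp add: algebra_simps)
  next
    fix t assume t: "t \<in> space GM"
    show "\<bar>pk_dist x (rescale R t y) powr (- lam - 1)\<bar> \<le> B1" using B1 t by blast
    have "\<bar>2 * (lam + 1) * pairing \<beta> x y\<bar> * \<bar>pk_dist x (rescale R t y) powr (- lam - 2)\<bar> \<le> \<bar>2 * (lam + 1) * pairing \<beta> x y\<bar> * B2"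
      using B2 t by (intro mult_left_mono) auto
    thus "\<bar>2 * (lam + 1) * pairing \<beta> x y * pk_dist x (rescale R t y) powr (- lam - 2)\<bar> \<le> \<bar>2 * (lam + 1) * pairing \<beta> x y\<bar> * B2"
      by (simp add: abs_mult)
  qed (use integrable_pk_dist in \<open>auto intro!: borel_measurable_times borel_measurable_integrable\<close>)
  note e1 = this
  define I1 where "I1 = (LINT t|GM. t \<beta> * pk_dist x (rescale R t y) powr (- lam - 1))"
  define I2 where "I2 = (LINT t|GM. (1 - (t \<beta>)\<^sup>2) * pk_dist x (rescale R t y) powr (- lam - 2))"
  have e2: "(LINT t|GM. (1 - (t \<beta>)\<^sup>2) * (2 * (lam + 1) * pairing \<beta> x y * pk_dist x (rescale R t y) powr (- lam - 2))) = 2 * (lam + 1) * pairing \<beta> x y * I2"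
    unfolding I2_def integral_mult_right_zero[symmetric] by (intro Bochner_Integration.integral_cong refl) (simp only: mult_ac)
  from trans[OF e2[symmetric] e1[folded I1_def]] have "2 * ((lam + 1) * pairing \<beta> x y * I2) = 2 * (k \<beta> * I1)"
    by (simp only: mult.assoc)
  thus ?thesis unfolding I1_def I2_def by linarith
qed

lemma kernel_quot_eq:
  assumes b: "\<beta> \<in> R"
  shows "kernel_quot \<beta> x y = - 2 * k \<beta> * (LINT t|GM. pk_dist x (rescale R t y) powr (- lam))
     - 2 * lam * k \<beta> * (1 - x \<bullet> x) * (LINT t|GM. pk_dist x (rescale R t y) powr (- lam - 1))
     + 2 * lam * (lam + 1) * (1 - x \<bullet> x) * pairing \<beta> y y * (LINT t|GM. (1 - (t \<beta>)\<^sup>2) * pk_dist x (rescale R t y) powr (- lam - 2))"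
proof -
  have i: "integrable GM (\<lambda>t. (1 - (t \<beta>)\<^sup>2) * pk_dist x (rescale R t y) powr (- lam - 2))"
    by (rule integrable_pk_dist_poly[OF b, where f="\<lambda>s. 1 - s\<^sup>2"]) (intro continuous_intros)
  show ?thesis unfolding kernel_quot_def using i integrable_pk_dist by simp
qed

lemma kernel_grad_inner: "kernel_grad x y \<bullet> v = (LINT t|GM. pk_grad lam x (rescale R t y) \<bullet> v)"
  and kernel_hess_inner: "kernel_hess u x y \<bullet> v = (LINT t|GM. pk_hess lam u x (rescale R t y) \<bullet> v)"
proof -
  interpret compact_parameter GM "\<lambda>_. 1" "\<lambda>t. rescale R t y" "cball 0 1"
    using y by (intro compact_parameter_rescale) auto
  show "kernel_grad x y \<bullet> v = (LINT t|GM. pk_grad lam x (rescale R t y) \<bullet> v)"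
    unfolding kernel_grad_def vec_integral_inner[OF pk_continuous_sections(1) x] by simp
  show "kernel_hess u x y \<bullet> v = (LINT t|GM. pk_hess lam u x (rescale R t y) \<bullet> v)"
    unfolding kernel_hess_def vec_integral_inner[OF pk_continuous_sections(2) x] by simp
qed

lemma integrable_pk_hess: "integrable GM (\<lambda>t. pk_hess lam u x (rescale R t y) \<bullet> v)"
proof -
  interpret compact_parameter GM "\<lambda>_. 1" "\<lambda>t. rescale R t y" "cball 0 1"
    using y by (intro compact_parameter_rescale) auto
  show ?thesis using integrable_section[OF pk_continuous_sections(2) x] by simp
qed

text \<open>In the derivative along \<beta> all terms carry the factor \<beta> \<bullet> x except
  the one that stems from the rescaled y. Integration by parts turns that one into a multiple of the
  pairing of x and y, which contains the missing factor.\<close>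

lemma kernel_grad_root:
  assumes b: "\<beta> \<in> R" shows "k \<beta> * (kernel_grad x y \<bullet> \<beta>) = (\<beta> \<bullet> x) * kernel_quot \<beta> x y"
proof -
  let ?a = "\<lambda>t. pk_dist x (rescale R t y) powr (- lam)"
  let ?b = "\<lambda>t. pk_dist x (rescale R t y) powr (- lam - 1)"
  have ib: "integrable GM (\<lambda>t. t \<beta> * ?b t)"
    by (rule integrable_pk_dist_poly[OF b, where f="\<lambda>s. s"]) (intro continuous_intros)
  have "pk_grad lam x (rescale R t y) \<bullet> \<beta> = (- 2 * (\<beta> \<bullet> x)) * ?a t - (2 * lam * (1 - x \<bullet> x) * (\<beta> \<bullet> x)) * ?b t + (2 * lam * (1 - x \<bullet> x) * (\<beta> \<bullet> y)) * (t \<beta> * ?b t)" for t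
    using inner_rescale_root[OF b, of t y]
    by (simp add: pk_grad_def inner_diff_left inner_commute[of _ \<beta>] algebra_simps)
  hence PGeq: "kernel_grad x y \<bullet> \<beta> = (- 2 * (\<beta> \<bullet> x)) * (LINT t|GM. ?a t) - (2 * lam * (1 - x \<bullet> x) * (\<beta> \<bullet> x)) * (LINT t|GM. ?b t) + (2 * lam * (1 - x \<bullet> x) * (\<beta> \<bullet> y)) * (LINT t|GM. t \<beta> * ?b t)"
    unfolding kernel_grad_inner using ib integrable_pk_dist by simp
  have ar: "k \<beta> * ((- 2 * bx) * A - (2 * lam * X * bx) * B + (2 * lam * X * v) * T) =
     bx * (- 2 * k \<beta> * A - 2 * lam * k \<beta> * X * B) + (2 * lam * X * v) * (k \<beta> * T)" for bx A B T X v
    by (simp add: algebra_simps)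
  have ar2: "bx * (- 2 * k \<beta> * A - 2 * lam * k \<beta> * X * B) + (2 * lam * X * v) * ((lam + 1) * (bx * v / n) * C) =
     bx * (- 2 * k \<beta> * A - 2 * lam * k \<beta> * X * B + 2 * lam * (lam + 1) * X * (v * v / n) * C)" for bx A B X v n C
    by (simp add: algebra_simps add_divide_distrib)
  show ?thesis unfolding PGeq ar pk_dist_ibp[OF b] kernel_quot_eq[OF b] pairing_def ar2 ..
qed

text \<open>On the hyperplane A does not depend on the parameter of \<beta>, so
  \<open>pk_dist_ibp\<close> degenerates. Integrating t times a power of A by parts instead relates
  the second moment of t in the Hessian to the factor 1 - t^2.\<close>

lemma kernel_hess_root:
  assumes b: "\<beta> \<in> R" and 0: "\<beta> \<bullet> x = 0" shows "k \<beta> * ((kernel_hess \<beta> x y \<bullet> \<beta>) / (norm \<beta>)\<^sup>2) = kernel_quot \<beta> x y"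
proof -
  let ?a = "\<lambda>t. pk_dist x (rescale R t y) powr (- lam)"
  let ?b = "\<lambda>t. pk_dist x (rescale R t y) powr (- lam - 1)"
  let ?c = "\<lambda>t. pk_dist x (rescale R t y) powr (- lam - 2)"
  have bb: "\<beta> \<bullet> \<beta> > 0" using root_nonzero[OF b] by simp
  have ic: "integrable GM (\<lambda>t. (t \<beta>)\<^sup>2 * ?c t)"
    by (rule integrable_pk_dist_poly[OF b, where f="\<lambda>s. s\<^sup>2"]) (intro continuous_intros)
  obtain B where B: "\<forall>t\<in>space GM. \<bar>?c t\<bar> \<le> B" using bounded_pk_dist by blast
  have inv: "pk_dist x (rescale R (t(\<beta> := s)) y) = pk_dist x (rescale R t y)" for t s
    using 0 by (simp add: pk_dist_rescale_upd[OF b] pairing_def)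
  have ibp: "(LINT t|GM. (1 - (t \<beta>)\<^sup>2) * ?c t) = 2 * k \<beta> * (LINT t|GM. t \<beta> * (t \<beta> * ?c t))"
  proof (rule GM_integration_by_parts[OF b])
    fix t and s :: real
    show "((\<lambda>s. (t(\<beta> := s)) \<beta> * pk_dist x (rescale R (t(\<beta> := s)) y) powr (- lam - 2)) has_real_derivative
      pk_dist x (rescale R (t(\<beta> := s)) y) powr (- lam - 2)) (at s within {-1..1})"
      unfolding inv by (auto intro!: derivative_eq_intros)
  next
    fix t assume t: "t \<in> space GM"
    show "\<bar>?c t\<bar> \<le> B" using B t by blast
    have "\<bar>t \<beta>\<bar> \<le> 1" using space_GM[OF t b] by auto
    hence "\<bar>t \<beta>\<bar> * \<bar>?c t\<bar> \<le> 1 * B" using B t by (intro mult_mono) auto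
    thus "\<bar>t \<beta> * ?c t\<bar> \<le> 1 * B" by (simp add: abs_mult)
  qed (use integrable_pk_dist measurable_GM_coord[OF b] in \<open>auto intro!: borel_measurable_times borel_measurable_integrable\<close>)
  have "pk_hess lam \<beta> x (rescale R t y) \<bullet> \<beta> = (- 2 * (\<beta> \<bullet> \<beta>)) * ?a t - (2 * lam * (1 - x \<bullet> x) * (\<beta> \<bullet> \<beta>)) * ?b t
      + (4 * lam * (lam + 1) * (1 - x \<bullet> x) * (\<beta> \<bullet> y)\<^sup>2) * ((t \<beta>)\<^sup>2 * ?c t)" for t
  proof -
    have r: "\<beta> \<bullet> rescale R t y = t \<beta> * (\<beta> \<bullet> y)" by (rule inner_rescale_root[OF b])
    show ?thesis
      unfolding pk_hess_def inner_add_left inner_diff_left inner_scaleR_left inner_diff_right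
        inner_commute[of x \<beta>] inner_commute[of "rescale R t y" \<beta>] r 0
      by (simp add: power2_eq_square algebra_simps)
  qed
  hence PHeq: "kernel_hess \<beta> x y \<bullet> \<beta> = (- 2 * (\<beta> \<bullet> \<beta>)) * (LINT t|GM. ?a t) - (2 * lam * (1 - x \<bullet> x) * (\<beta> \<bullet> \<beta>)) * (LINT t|GM. ?b t)
      + (4 * lam * (lam + 1) * (1 - x \<bullet> x) * (\<beta> \<bullet> y)\<^sup>2) * (LINT t|GM. (t \<beta>)\<^sup>2 * ?c t)"
    unfolding kernel_hess_inner using ic integrable_pk_dist by simp
  have ar: "k \<beta> * (((- 2 * n) * A - (2 * lam * X * n) * B + (4 * lam * (lam + 1) * X * v\<^sup>2) * C) / n) =
    - 2 * k \<beta> * A - 2 * lam * k \<beta> * X * B + 2 * lam * (lam + 1) * X * (v * v / n) * (2 * k \<beta> * C)" if "n > 0" for n A B C X v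
    using that by (simp add: field_simps power2_eq_square)
  have "k \<beta> * ((kernel_hess \<beta> x y \<bullet> \<beta>) / (norm \<beta>)\<^sup>2) = - 2 * k \<beta> * (LINT t|GM. ?a t) - 2 * lam * k \<beta> * (1 - x \<bullet> x) * (LINT t|GM. ?b t)
      + 2 * lam * (lam + 1) * (1 - x \<bullet> x) * pairing \<beta> y y * (2 * k \<beta> * (LINT t|GM. (t \<beta>)\<^sup>2 * ?c t))"
    unfolding PHeq power2_norm_eq_inner pairing_def by (rule ar[OF bb])
  also have "2 * k \<beta> * (LINT t|GM. (t \<beta>)\<^sup>2 * ?c t) = (LINT t|GM. (1 - (t \<beta>)\<^sup>2) * ?c t)"
    unfolding ibp by (simp add: power2_eq_square mult.assoc)
  finally show ?thesis unfolding kernel_quot_eq[OF b] .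
qed

lemma trace_pk_hess:
  "(\<Sum>b\<in>Basis. pk_hess l b x q \<bullet> b) = - 2 * real DIM('a) * pk_dist x q powr (- l)
     + 8 * l * pk_dist x q powr (- l - 1) * (x \<bullet> (x - q))
     + (1 - x \<bullet> x) * (4 * l * (l + 1) * pk_dist x q powr (- l - 2) * ((x - q) \<bullet> (x - q)) - 2 * l * real DIM('a) * pk_dist x q powr (- l - 1))"
proof -
  define a where "a = pk_dist x q powr (- l)"
  define b where "b = pk_dist x q powr (- l - 1)"
  define c where "c = pk_dist x q powr (- l - 2)"
  define z where "z = x - q"
  have 1: "(\<Sum>e\<in>Basis. (x \<bullet> e) * (z \<bullet> e)) = x \<bullet> z" "(\<Sum>e\<in>Basis. (z \<bullet> e) * (z \<bullet> e)) = z \<bullet> z"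
    by (simp_all only: euclidean_inner[symmetric])
  have "(\<Sum>e\<in>Basis. pk_hess l e x q \<bullet> e) = (\<Sum>e\<in>Basis. - 2 * a + 8 * l * b * ((x \<bullet> e) * (z \<bullet> e)) + (1 - x \<bullet> x) * (4 * l * (l + 1) * c * ((z \<bullet> e) * (z \<bullet> e)) - 2 * l * b))"
  proof (rule sum.cong[OF refl])
    fix e :: 'a assume "e \<in> Basis"
    thus "pk_hess l e x q \<bullet> e = - 2 * a + 8 * l * b * ((x \<bullet> e) * (z \<bullet> e)) + (1 - x \<bullet> x) * (4 * l * (l + 1) * c * ((z \<bullet> e) * (z \<bullet> e)) - 2 * l * b)"
      unfolding pk_hess_def a_def[symmetric] b_def[symmetric] c_def[symmetric] z_def[symmetric] inner_commute[of e]
      by (simp add: inner_add_left inner_diff_left inner_same_Basis algebra_simps)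
  qed
  also have "\<dots> = - 2 * real DIM('a) * a + 8 * l * b * (x \<bullet> z) + (1 - x \<bullet> x) * (4 * l * (l + 1) * c * (z \<bullet> z) - 2 * l * real DIM('a) * b)"
    by (simp only: sum.distrib sum_subtractf sum_distrib_left[symmetric] sum_constant 1) (simp add: algebra_simps)
  finally show ?thesis by (simp add: a_def b_def c_def z_def)
qed

text \<open>Once the radial quotients have been rewritten by \<open>kernel_quot\<close>, the
  singularities are gone and the combined integrand vanishes for each t.\<close>

lemma ball_kernel_harmonic: "radial_symbol R k x (kernel_grad x y) (\<lambda>v. kernel_hess v x y) = 0"
proof -
  let ?a = "\<lambda>t. pk_dist x (rescale R t y) powr (- lam)"
  let ?b = "\<lambda>t. pk_dist x (rescale R t y) powr (- lam - 1)"
  let ?c = "\<lambda>t. pk_dist x (rescale R t y) powr (- lam - 2)"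
  let ?r = "\<lambda>\<beta> t. - 2 * k \<beta> * ?a t - 2 * lam * k \<beta> * (1 - x \<bullet> x) * ?b t + 2 * lam * (lam + 1) * (1 - x \<bullet> x) * pairing \<beta> y y * ((1 - (t \<beta>)\<^sup>2) * ?c t)"
  have root: "k \<beta> * (if \<beta> \<bullet> x = 0 then (kernel_hess \<beta> x y \<bullet> \<beta>) / (norm \<beta>)\<^sup>2 else (kernel_grad x y \<bullet> \<beta>) / (\<beta> \<bullet> x)) = (LINT t|GM. ?r \<beta> t)" if "\<beta> \<in> R" for \<beta>
    unfolding kernel_quot_def[symmetric] using kernel_grad_root[OF that] kernel_hess_root[OF that] by (auto simp: field_simps)
  have ri: "integrable GM (?r \<beta>)" if "\<beta> \<in> R" for \<beta>
  proof -
    have "integrable GM (\<lambda>t. (1 - (t \<beta>)\<^sup>2) * ?c t)"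
      by (rule integrable_pk_dist_poly[OF that, where f="\<lambda>s. 1 - s\<^sup>2"]) (intro continuous_intros)
    thus ?thesis using integrable_pk_dist by simp
  qed
  have s1: "(\<Sum>b\<in>Basis. LINT t|GM. pk_hess lam b x (rescale R t y) \<bullet> b) = (LINT t|GM. (\<Sum>b\<in>Basis. pk_hess lam b x (rescale R t y) \<bullet> b))"
    by (rule Bochner_Integration.integral_sum[symmetric]) (rule integrable_pk_hess)
  have s2: "(\<Sum>\<beta>\<in>R. LINT t|GM. ?r \<beta> t) = (LINT t|GM. (\<Sum>\<beta>\<in>R. ?r \<beta> t))"
    by (rule Bochner_Integration.integral_sum[symmetric]) (rule ri)
  have s0: "(\<Sum>b\<in>Basis. kernel_hess b x y \<bullet> b) = (LINT t|GM. (\<Sum>b\<in>Basis. pk_hess lam b x (rescale R t y) \<bullet> b))"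
    unfolding kernel_hess_inner by (rule s1)
  have rs: "(\<Sum>\<beta>\<in>R. k \<beta> * (if \<beta> \<bullet> x = 0 then (kernel_hess \<beta> x y \<bullet> \<beta>) / (norm \<beta>)\<^sup>2 else (kernel_grad x y \<bullet> \<beta>) / (\<beta> \<bullet> x))) = (\<Sum>\<beta>\<in>R. LINT t|GM. ?r \<beta> t)"
    by (rule sum.cong[OF refl root])
  have "radial_symbol R k x (kernel_grad x y) (\<lambda>v. kernel_hess v x y) = (LINT t|GM. (\<Sum>b\<in>Basis. pk_hess lam b x (rescale R t y) \<bullet> b)) + (LINT t|GM. 2 * (\<Sum>\<beta>\<in>R. ?r \<beta> t))"
    unfolding radial_symbol_def s0 rs s2 integral_mult_right_zero ..
  also have "\<dots> = (LINT t|GM. (\<Sum>b\<in>Basis. pk_hess lam b x (rescale R t y) \<bullet> b) + 2 * (\<Sum>\<beta>\<in>R. ?r \<beta> t))"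
    by (rule Bochner_Integration.integral_add[symmetric])
       (intro Bochner_Integration.integrable_sum integrable_mult_right integrable_pk_hess ri; assumption)+
  also have "\<dots> = (LINT t|GM. 0)"
  proof (rule Bochner_Integration.integral_cong[OF refl])
    fix t assume t: "t \<in> space GM"
    define q where "q = rescale R t y"
    define A where "A = pk_dist x q"
    define c where "c = A powr (- lam - 2)"
    define S where "S = (\<Sum>\<beta>\<in>R. (1 - (t \<beta>)\<^sup>2) * pairing \<beta> y y)"
    define g where "g = dunkl_gamma R k"
    define X where "X = x \<bullet> x"
    have A: "A > 0" unfolding A_def q_def by (rule pk_dist_GM_pos[OF t])
    have pb: "A powr (- lam - 1) = A * c" and pa: "A powr (- lam) = A * A * c"
      using A by (simp_all add: c_def powr_diff power2_eq_square powr_minus field_simps)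
    \<comment> \<open>This is where the value of \<lambda> enters.\<close>
    have d: "real DIM('a) = 2 * lam - 2 * g" by (simp add: lam_def g_def)
    have xq: "x \<bullet> (x - q) = (A - 1 + X) / 2" by (simp add: A_def pk_dist_def X_def inner_diff_right)
    \<comment> \<open>The length lost by rescaling y is S, the same sum that occurs in the radial
      terms.\<close>
    have "q \<bullet> q = 1 - S"
      using norm_rescale_sq[of t y] y by (simp add: q_def S_def power2_norm_eq_inner[symmetric])
    hence xq2: "(x - q) \<bullet> (x - q) = A - S"
      by (simp add: A_def pk_dist_def inner_diff_left inner_diff_right inner_commute)
    have f1: "(\<Sum>\<beta>\<in>R. ?r \<beta> t) = - 2 * g * (A * A * c) - 2 * lam * g * (1 - X) * (A * c) + 2 * lam * (lam + 1) * (1 - X) * c * S"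
      unfolding q_def[symmetric] A_def[symmetric] X_def[symmetric] pa pb c_def[symmetric] S_def g_def dunkl_gamma_def
      by (simp add: sum.distrib sum_subtractf sum_distrib_left sum_distrib_right sum_negf mult_ac)
    have f2: "(\<Sum>b\<in>Basis. pk_hess lam b x q \<bullet> b) = - 2 * (2 * lam - 2 * g) * (A * A * c) + 8 * lam * (A * c) * ((A - 1 + X) / 2)
      + (1 - X) * (4 * lam * (lam + 1) * c * (A - S) - 2 * lam * (2 * lam - 2 * g) * (A * c))"
      unfolding trace_pk_hess A_def[symmetric] X_def[symmetric] xq xq2 d pa pb c_def[symmetric] ..
    \<comment> \<open>With \<lambda> and \<gamma> in place of d, the coefficients of A^2 c, of (1 -
      X) A c and of (1 - X) c S cancel separately.\<close>
    show "(\<Sum>b\<in>Basis. pk_hess lam b x (rescale R t y) \<bullet> b) + 2 * (\<Sum>\<beta>\<in>R. ?r \<beta> t) = 0"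
      unfolding f1 f2[unfolded q_def] by (simp add: field_simps)
  qed
  finally show ?thesis by simp
qed

end

lemma kernel_quot_continuous:
  assumes y: "y \<in> sphere 0 1" and b: "\<beta> \<in> R" shows "continuous_on (ball 0 1) (\<lambda>x. kernel_quot \<beta> x y)"
proof -
  have "continuous_on (ball 0 1) (\<lambda>x. LINT t|GM. 1 * (- 2 * k \<beta> * pk_dist x (rescale R (decode (encode t)) y) powr (- lam)
     - 2 * lam * k \<beta> * (1 - x \<bullet> x) * pk_dist x (rescale R (decode (encode t)) y) powr (- lam - 1)
     + 2 * lam * (lam + 1) * (1 - x \<bullet> x) * pairing \<beta> y y * ((1 - (decode (encode t) \<beta>)\<^sup>2) * pk_dist x (rescale R (decode (encode t)) y) powr (- lam - 2))))"
  proof (rule continuous_on_param_integral[OF compact_code_box, where q=encode and F="\<lambda>x \<tau>. - 2 * k \<beta> * pk_dist x (rescale R (decode \<tau>) y) powr (- lam)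
     - 2 * lam * k \<beta> * (1 - x \<bullet> x) * pk_dist x (rescale R (decode \<tau>) y) powr (- lam - 1)
     + 2 * lam * (lam + 1) * (1 - x \<bullet> x) * pairing \<beta> y y * ((1 - (decode \<tau> \<beta>)\<^sup>2) * pk_dist x (rescale R (decode \<tau>) y) powr (- lam - 2))"])
    have c: "continuous_on (ball 0 1 \<times> code_box) (\<lambda>z. pk_dist (fst z) (rescale R (decode (snd z)) y) powr e)" for e
      using y norm_rescale_decode[of _ y]
      by (intro continuous_on_pk continuous_on_rescale_decode continuous_on_fst continuous_on_snd continuous_on_id continuous_on_const) auto
    show "continuous_on (ball 0 1 \<times> code_box) (\<lambda>z. - 2 * k \<beta> * pk_dist (fst z) (rescale R (decode (snd z)) y) powr (- lam)
     - 2 * lam * k \<beta> * (1 - fst z \<bullet> fst z) * pk_dist (fst z) (rescale R (decode (snd z)) y) powr (- lam - 1)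
     + 2 * lam * (lam + 1) * (1 - fst z \<bullet> fst z) * pairing \<beta> y y * ((1 - (decode (snd z) \<beta>)\<^sup>2) * pk_dist (fst z) (rescale R (decode (snd z)) y) powr (- lam - 2)))"
      by (intro continuous_on_add continuous_on_diff continuous_on_mult continuous_on_const c continuous_on_inner
            continuous_on_fst continuous_on_snd continuous_on_id continuous_on_power continuous_on_decode)
  qed (auto intro: measurable_encode encode_in_box)
  thus ?thesis by (simp add: kernel_quot_def rescale_decode_encode decode_encode[OF b])
qed

section \<open>Symmetry and invariance of the kernel\<close>

text \<open>For unit vectors both sides depend on x and y only through the scalar product with a
  rescaled vector, and rescalings are self-adjoint. This lets spherical integrals in the second
  argument be computed as spherical means in the first.\<close>

lemma ball_kernel_symmetric: "norm x = 1 \<Longrightarrow> norm y = 1 \<Longrightarrow> ball_kernel (r *\<^sub>R x) y = ball_kernel (r *\<^sub>R y) x"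
proof -
  assume "norm x = 1" "norm y = 1"
  hence "x \<bullet> x = 1" "y \<bullet> y = 1" by (simp_all add: dot_square_norm)
  moreover have "x \<bullet> rescale R t y = y \<bullet> rescale R t x" for t
    using rescale_inner_commute[of t x y] by (simp add: inner_commute)
  ultimately show ?thesis by (simp add: ball_kernel_def pk_fun_def pk_dist_def)
qed

lemma ball_kernel_reflection_right:
  assumes x: "x \<in> ball 0 1" and y: "norm y \<le> 1" and w: "w \<in> reflection_group R"
  shows "ball_kernel x (w y) = ball_kernel x y"
proof -
  have c: "continuous_on (cball 0 1) (pk_fun lam x)" using x by (intro continuous_on_pk continuous_intros) auto
  have "bounded (pk_fun lam x ` cball 0 1)" by (intro compact_imp_bounded compact_continuous_image c compact_cball)
  then obtain B where "\<forall>v\<in>pk_fun lam x ` cball 0 1. norm v \<le> B" unfolding bounded_iff by blast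
  hence B: "\<bar>pk_fun lam x z\<bar> \<le> B" if "norm z \<le> norm y" for z using that y by auto
  show ?thesis unfolding ball_kernel_def
    by (rule integral_GM_reflection_group[OF w _ B]) (simp add: pk_fun_def[abs_def] pk_dist_def[abs_def])
qed

text \<open>An element of W commutes with rescalings, is self-adjoint and preserves norms, so it can
  be moved to the second argument.\<close>

lemma ball_kernel_reflection_left:
  assumes x: "x \<in> ball 0 1" and y: "norm y \<le> 1" and w: "w \<in> reflection_group R"
  shows "ball_kernel (w x) y = ball_kernel x y"
proof -
  obtain F where F: "w = rescale R (\<lambda>\<beta>. if \<beta> \<in> F then -1 else 1)" using reflection_group_rescale[OF w] by blast
  have "w x \<bullet> rescale R t y = x \<bullet> rescale R t (w y)" for t
    unfolding F rescale_inner_commute rescale_rescale by (simp add: mult.commute)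
  moreover have "w x \<bullet> w x = x \<bullet> x" using norm_reflection_group[OF w, of x] by (simp add: dot_square_norm)
  ultimately have "ball_kernel (w x) y = ball_kernel x (w y)" by (simp add: ball_kernel_def pk_fun_def pk_dist_def)
  thus ?thesis using ball_kernel_reflection_right[OF assms] by simp
qed

end

section \<open>The mean value property\<close>

text \<open>The integral of \<phi>(p + s v) over p does not depend on s by translation invariance,
  and its derivative at s = 0 is the integral of the directional derivative. This is the only form
  of the divergence theorem that enters.\<close>

lemma integral_directional_derivative_zero:
  fixes \<phi> :: "'a::euclidean_space \<Rightarrow> real"
  assumes der: "\<And>x. (\<phi> has_derivative (\<lambda>h. D x \<bullet> h)) (at x)" and D: "continuous_on UNIV D"
    and supp: "\<And>x. x \<notin> ball 0 1 \<Longrightarrow> \<phi> x = 0" "\<And>x. x \<notin> ball 0 1 \<Longrightarrow> D x = 0"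
  shows "(LINT x|lborel. D x \<bullet> v) = 0"
proof -
  \<comment> \<open>Contains the support of every translate with |s| < 1, so that the parameter set
    is compact and does not depend on s.\<close>
  define K where "K = cball (0::'a) (1 + norm v)"
  define M where "M = restrict_space lborel K"
  have K: "compact K" by (simp add: K_def)
  have cphi: "continuous_on UNIV \<phi>"
    using der by (intro continuous_at_imp_continuous_on ballI) (rule has_derivative_continuous)
  have w: "integrable M (\<lambda>_. 1 :: real)"
    unfolding M_def using borel_integrable_compact[OF K, of "\<lambda>_. 1 :: real"]
    by (subst integrable_restrict_space) (auto simp: K_def)
  have q: "(\<lambda>p. p) \<in> borel_measurable M" "\<And>p. p \<in> space M \<Longrightarrow> p \<in> K"
    unfolding M_def by (auto simp: space_restrict_space intro: measurable_restrict_space1)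
  have "((\<lambda>s. LINT p|M. 1 * \<phi> (p + s *\<^sub>R v)) has_derivative (\<lambda>h. LINT p|M. 1 * ((D (p + 0 *\<^sub>R v) \<bullet> v) \<bullet> h))) (at (0::real))"
  proof (rule has_derivative_param_integral[where U="{-1<..<1}" and K=K and q="\<lambda>p. p" and F="\<lambda>s p. \<phi> (p + s *\<^sub>R v)" and G="\<lambda>s p. D (p + s *\<^sub>R v) \<bullet> v"])
    show "continuous_on ({-1<..<1} \<times> K) (\<lambda>z. D (snd z + fst z *\<^sub>R v) \<bullet> v)"
      by (intro continuous_intros continuous_on_compose2[OF D]) auto
    fix s :: real and p
    have "((\<lambda>s. p + s *\<^sub>R v) has_derivative (\<lambda>h. h *\<^sub>R v)) (at s)" by (auto intro!: derivative_eq_intros)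
    from has_derivative_compose[OF this der]
    show "((\<lambda>s. \<phi> (p + s *\<^sub>R v)) has_derivative (\<lambda>h. (D (p + s *\<^sub>R v) \<bullet> v) \<bullet> h)) (at s)"
      by (rule has_derivative_eq_rhs) (auto simp: mult.commute)
    show "continuous_on K (\<lambda>p. \<phi> (p + s *\<^sub>R v))"
      by (intro continuous_intros continuous_on_compose2[OF cphi]) auto
  qed (use K q w in auto)
  moreover have "(LINT p|M. 1 * \<phi> (p + s *\<^sub>R v)) = (LINT p|lborel. \<phi> p)" if s: "s \<in> {-1<..<1}" for s
  proof -
    have "(LINT p|M. 1 * \<phi> (p + s *\<^sub>R v)) = (LINT p|lborel. indicator K p *\<^sub>R \<phi> (p + s *\<^sub>R v))"
      unfolding M_def by (subst integral_restrict_space) (auto simp: K_def)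
    also have "\<dots> = (LINT p|lborel. \<phi> (s *\<^sub>R v + p))"
    proof (rule Bochner_Integration.integral_cong[OF refl])
      fix p
      show "indicator K p *\<^sub>R \<phi> (p + s *\<^sub>R v) = \<phi> (s *\<^sub>R v + p)"
      proof (cases "p \<in> K")
        case False
        have "norm p \<le> norm (s *\<^sub>R v + p) + norm (s *\<^sub>R v)" by (metis add_diff_cancel_left' norm_triangle_ineq4 add.commute)
        moreover have "norm (s *\<^sub>R v) \<le> 1 * norm v" unfolding norm_scaleR using s by (intro mult_right_mono) auto
        ultimately have "s *\<^sub>R v + p \<notin> ball 0 1" using False by (simp add: K_def)
        thus ?thesis using supp(1) False by simp
      qed (simp add: add.commute)
    qed
    also have "\<dots> = (LINT p|distr lborel borel ((+) (s *\<^sub>R v)). \<phi> p)"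
      using borel_measurable_continuous_onI[OF cphi] by (subst integral_distr) auto
    also have "\<dots> = (LINT p|lborel. \<phi> p)" by (simp add: lborel_distr_plus)
    finally show ?thesis .
  qed
  ultimately have "((\<lambda>s. LINT p|lborel. \<phi> p) has_derivative (\<lambda>h. LINT p|M. 1 * ((D (p + 0 *\<^sub>R v) \<bullet> v) \<bullet> h))) (at (0::real))"
    using has_derivative_transform_within_open[of _ _ 0 UNIV "{-1<..<1}"] by (smt (verit) greaterThanLessThan_iff open_greaterThanLessThan)
  hence "(\<lambda>h. LINT p|M. 1 * ((D (p + 0 *\<^sub>R v) \<bullet> v) \<bullet> h)) = (\<lambda>h. 0)"
    by (rule has_derivative_unique) (rule has_derivative_const)
  from fun_cong[OF this, of 1] have "(LINT p|M. D p \<bullet> v) = 0" by simp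
  also have "(LINT p|M. D p \<bullet> v) = (LINT p|lborel. indicator K p *\<^sub>R (D p \<bullet> v))"
    unfolding M_def by (subst integral_restrict_space) (auto simp: K_def)
  also have "\<dots> = (LINT p|lborel. D p \<bullet> v)"
  proof (rule Bochner_Integration.integral_cong[OF refl])
    fix p
    have "p \<notin> ball 0 1" if "p \<notin> K"
    proof -
      have "1 + norm v < norm p" using that by (simp add: K_def)
      hence "1 \<le> norm p" using norm_ge_zero[of v] by linarith
      thus ?thesis by simp
    qed
    thus "indicator K p *\<^sub>R (D p \<bullet> v) = D p \<bullet> v" using supp(2) by (cases "p \<in> K") auto
  qed
  finally show ?thesis .
qed

lemma zero_has_derivative_outside:
  assumes "\<And>y. y \<in> V \<Longrightarrow> f y = 0" "open V" "x \<in> V" shows "(f has_derivative (\<lambda>h. 0)) (at x)"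
  by (rule has_derivative_transform_within_open[of "\<lambda>_. 0", OF has_derivative_const assms(2,3)]) (simp add: assms(1))

context orth_roots
begin

text \<open>The weight \<open>\<omega>\<^sub>k\<close> is regularized because it need not be differentiable on the root hyperplanes.\<close>

definition reg_weight :: "real \<Rightarrow> 'a \<Rightarrow> real" where
  "reg_weight \<epsilon> x = exp (\<Sum>\<beta>\<in>R. k \<beta> * ln ((\<beta> \<bullet> x)\<^sup>2 + \<epsilon>))"

text \<open>The gradient of the logarithm of \<open>reg_weight\<close>.\<close>

definition reg_grad :: "real \<Rightarrow> 'a \<Rightarrow> 'a" where
  "reg_grad \<epsilon> x = (\<Sum>\<beta>\<in>R. (2 * k \<beta> * (\<beta> \<bullet> x) / ((\<beta> \<bullet> x)\<^sup>2 + \<epsilon>)) *\<^sub>R \<beta>)"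

lemma has_derivative_reg_weight:
  assumes "\<epsilon> > 0" shows "(reg_weight \<epsilon> has_derivative (\<lambda>h. (reg_weight \<epsilon> x *\<^sub>R reg_grad \<epsilon> x) \<bullet> h)) (at x)"
proof -
  have "((\<lambda>x. k \<beta> * ln ((\<beta> \<bullet> x)\<^sup>2 + \<epsilon>)) has_derivative (\<lambda>h. (2 * k \<beta> * (\<beta> \<bullet> x) / ((\<beta> \<bullet> x)\<^sup>2 + \<epsilon>)) * (\<beta> \<bullet> h))) (at x)" for \<beta>
  proof -
    have pos: "(\<beta> \<bullet> x)\<^sup>2 + \<epsilon> > 0" using assms by (intro add_nonneg_pos) auto
    have "((\<lambda>x. (\<beta> \<bullet> x)\<^sup>2 + \<epsilon>) has_derivative (\<lambda>h. 2 * (\<beta> \<bullet> x) * (\<beta> \<bullet> h))) (at x)"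
      by (auto intro!: derivative_eq_intros)
    from has_derivative_mult_right[OF DERIV_compose_FDERIV[OF DERIV_ln_divide[OF pos] this], of "k \<beta>"]
    show ?thesis by (rule has_derivative_eq_rhs) (auto simp: fun_eq_iff)
  qed
  hence "((\<lambda>x. \<Sum>\<beta>\<in>R. k \<beta> * ln ((\<beta> \<bullet> x)\<^sup>2 + \<epsilon>)) has_derivative (\<lambda>h. \<Sum>\<beta>\<in>R. (2 * k \<beta> * (\<beta> \<bullet> x) / ((\<beta> \<bullet> x)\<^sup>2 + \<epsilon>)) * (\<beta> \<bullet> h))) (at x)"
    by (intro has_derivative_sum)
  from DERIV_compose_FDERIV[OF DERIV_exp this] show ?thesis
    unfolding reg_weight_def
    by (rule has_derivative_eq_rhs) (auto simp: fun_eq_iff reg_grad_def inner_sum_left mult.commute)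
qed

lemma continuous_on_reg:
  assumes "\<epsilon> > 0" shows "continuous_on S (reg_weight \<epsilon>)" "continuous_on S (reg_grad \<epsilon>)"
proof -
  have "(\<beta> \<bullet> x)\<^sup>2 + \<epsilon> \<noteq> 0" for \<beta> x :: 'a using assms by (metis add_nonneg_pos less_irrefl zero_le_power2)
  thus "continuous_on S (reg_weight \<epsilon>)" "continuous_on S (reg_grad \<epsilon>)"
    unfolding reg_weight_def[abs_def] reg_grad_def[abs_def] by (intro continuous_intros; simp)+
qed

lemma reg_weight_bounds:
  assumes e: "0 < \<epsilon>" "\<epsilon> \<le> 1" and x: "norm x \<le> 1"
  shows "0 \<le> reg_weight \<epsilon> x" "reg_weight \<epsilon> x \<le> exp (\<Sum>\<beta>\<in>R. k \<beta> * ln ((norm \<beta>)\<^sup>2 + 1))"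
proof -
  show "0 \<le> reg_weight \<epsilon> x" by (simp add: reg_weight_def)
  have "k \<beta> * ln ((\<beta> \<bullet> x)\<^sup>2 + \<epsilon>) \<le> k \<beta> * ln ((norm \<beta>)\<^sup>2 + 1)" if b: "\<beta> \<in> R" for \<beta>
  proof -
    have "\<bar>\<beta> \<bullet> x\<bar> \<le> norm \<beta> * norm x" by (rule Cauchy_Schwarz_ineq2)
    also have "\<dots> \<le> norm \<beta> * 1" using x by (intro mult_left_mono) auto
    finally have "(\<beta> \<bullet> x)\<^sup>2 \<le> (norm \<beta>)\<^sup>2" by (simp add: abs_le_square_iff[symmetric])
    hence "ln ((\<beta> \<bullet> x)\<^sup>2 + \<epsilon>) \<le> ln ((norm \<beta>)\<^sup>2 + 1)" using e by (intro ln_mono add_mono add_nonneg_pos) auto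
    thus ?thesis using k_nonneg[OF b] by (intro mult_left_mono)
  qed
  thus "reg_weight \<epsilon> x \<le> exp (\<Sum>\<beta>\<in>R. k \<beta> * ln ((norm \<beta>)\<^sup>2 + 1))"
    unfolding reg_weight_def by (simp add: sum_mono)
qed

lemma reg_weight_tendsto:
  assumes "\<And>\<beta>. \<beta> \<in> R \<Longrightarrow> \<beta> \<bullet> x \<noteq> 0" "\<epsilon> \<longlonglongrightarrow> 0"
  shows "(\<lambda>n. reg_weight (\<epsilon> n) x) \<longlonglongrightarrow> dunkl_weight R k x"
proof -
  have "(\<lambda>n. reg_weight (\<epsilon> n) x) \<longlonglongrightarrow> exp (\<Sum>\<beta>\<in>R. k \<beta> * ln ((\<beta> \<bullet> x)\<^sup>2 + 0))"
    unfolding reg_weight_def using assms by (intro tendsto_intros) auto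
  also have "exp (\<Sum>\<beta>\<in>R. k \<beta> * ln ((\<beta> \<bullet> x)\<^sup>2 + 0)) = (\<Prod>\<beta>\<in>R. exp (k \<beta> * ln ((\<beta> \<bullet> x)\<^sup>2)))" by (simp add: exp_sum)
  also have "\<dots> = dunkl_weight R k x"
    unfolding dunkl_weight_def
  proof (rule prod.cong[OF refl])
    fix \<beta> assume "\<beta> \<in> R"
    hence "\<beta> \<bullet> x \<noteq> 0" by (rule assms(1))
    moreover have "ln ((\<beta> \<bullet> x)\<^sup>2) = 2 * ln \<bar>\<beta> \<bullet> x\<bar>" using \<open>\<beta> \<bullet> x \<noteq> 0\<close> by (metis power2_abs ln_realpow of_nat_numeral zero_less_abs_iff)
    ultimately show "exp (k \<beta> * ln ((\<beta> \<bullet> x)\<^sup>2)) = \<bar>\<beta> \<bullet> x\<bar> powr (2 * k \<beta>)" by (simp add: powr_def)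
  qed
  finally show ?thesis .
qed

text \<open>The divergence theorem is applied to the regularized weight times \<zeta>(|x|^2) times
  g. The relation \<open>root\<close> makes the scalar product of g with the logarithmic gradient
  bounded near the hyperplanes, \<open>harm\<close> removes the trace of the Hessian, and the
  regularization error tends to 0 off the hyperplanes under a fixed bound.\<close>

lemma green_identity:
  fixes g :: "'a \<Rightarrow> 'a" and H :: "'a \<Rightarrow> 'a \<Rightarrow> 'a" and \<rho> :: "'a \<Rightarrow> 'a \<Rightarrow> real" and \<zeta> \<zeta>' :: "real \<Rightarrow> real"
  assumes gD: "\<And>x v. x \<in> ball 0 1 \<Longrightarrow> ((\<lambda>x. g x \<bullet> v) has_derivative (\<lambda>h. H v x \<bullet> h)) (at x)"
    and cg: "continuous_on (ball 0 1) g"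
    and cH: "\<And>v. continuous_on (ball 0 1) (H v)"
    and cr: "\<And>\<beta>. \<beta> \<in> R \<Longrightarrow> continuous_on (ball 0 1) (\<rho> \<beta>)"
    and root: "\<And>\<beta> x. \<beta> \<in> R \<Longrightarrow> x \<in> ball 0 1 \<Longrightarrow> k \<beta> * (g x \<bullet> \<beta>) = (\<beta> \<bullet> x) * \<rho> \<beta> x"
    and harm: "\<And>x. x \<in> ball 0 1 \<Longrightarrow> (\<Sum>b\<in>Basis. H b x \<bullet> b) + 2 * (\<Sum>\<beta>\<in>R. \<rho> \<beta> x) = 0"
    and \<zeta>: "\<And>s. 0 \<le> s \<Longrightarrow> s < 1 \<Longrightarrow> (\<zeta> has_real_derivative \<zeta>' s) (at s)" and c\<zeta>': "continuous_on {0..<1} \<zeta>'"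
    and c: "0 < c" "c < 1" "\<And>s. c \<le> s \<Longrightarrow> s < 1 \<Longrightarrow> \<zeta> s = 0" "\<And>s. c \<le> s \<Longrightarrow> s < 1 \<Longrightarrow> \<zeta>' s = 0"
  defines "X \<equiv> (\<lambda>x. indicator (ball 0 1) x * (dunkl_weight R k x * (2 * \<zeta>' (x \<bullet> x) * (g x \<bullet> x))))"
  shows "integrable lborel X" "(LINT x|lborel. X x) = 0"
proof -
  define \<epsilon> where "\<epsilon> n = 1 / real (Suc n)" for n
  have \<epsilon>: "0 < \<epsilon> n" "\<epsilon> n \<le> 1" for n by (auto simp: \<epsilon>_def)
  have \<epsilon>0: "\<epsilon> \<longlonglongrightarrow> 0" unfolding \<epsilon>_def using LIMSEQ_inverse_real_of_nat by (simp add: inverse_eq_divide)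
  \<comment> \<open>On the overlap of this open set with the ball the cut-off vanishes, so a field
    defined on the ball extends by 0 to a differentiable one on the whole space.\<close>
  define V where "V = {x :: 'a. x \<bullet> x > c}"
  have V: "open V" unfolding V_def by (intro open_Collect_less continuous_intros)
  have in01: "0 \<le> x \<bullet> x \<and> x \<bullet> x < 1" if "x \<in> ball 0 1" for x :: 'a
    using that by (simp add: dot_square_norm abs_square_less_1)
  have UV: "ball 0 1 \<union> V = UNIV"
  proof -
    have "x \<in> V" if "x \<notin> ball 0 1" for x
    proof -
      have "1 \<le> norm x" using that by simp
      hence "1 \<le> (norm x)\<^sup>2" by (simp add: one_le_power)
      thus ?thesis using c by (simp add: V_def dot_square_norm)
    qed
    thus ?thesis by blast
  qed
  have c\<zeta>: "continuous_on {0..<1} \<zeta>"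
    using \<zeta> by (intro continuous_at_imp_continuous_on ballI) (auto intro: DERIV_isCont)
  have cz: "continuous_on (ball 0 1) (\<lambda>x::'a. \<zeta> (x \<bullet> x))" "continuous_on (ball 0 1) (\<lambda>x::'a. \<zeta>' (x \<bullet> x))"
    using in01 by (auto intro!: continuous_on_compose2[OF c\<zeta>] continuous_on_compose2[OF c\<zeta>'] continuous_intros)
  have \<zeta>V: "\<zeta> (x \<bullet> x) = 0" "\<zeta>' (x \<bullet> x) = 0" if "x \<in> V" "x \<in> ball 0 1" for x
    using c that in01[of x] by (auto simp: V_def)
  define \<phi> where "\<phi> n b x = (if x \<in> ball 0 1 then reg_weight (\<epsilon> n) x * (\<zeta> (x \<bullet> x) * (g x \<bullet> b)) else 0)" for n b x
  define D where "D n b x = (if x \<in> ball 0 1 then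
     (\<zeta> (x \<bullet> x) * (g x \<bullet> b)) *\<^sub>R (reg_weight (\<epsilon> n) x *\<^sub>R reg_grad (\<epsilon> n) x) +
     reg_weight (\<epsilon> n) x *\<^sub>R ((2 * \<zeta>' (x \<bullet> x) * (g x \<bullet> b)) *\<^sub>R x + \<zeta> (x \<bullet> x) *\<^sub>R H b x) else 0)" for n b x
  have DV: "D n b x = 0" "\<phi> n b x = 0" if "x \<in> V" for n b x using \<zeta>V[OF that] by (auto simp: D_def \<phi>_def)
  have cD: "continuous_on UNIV (D n b)" for n b
    unfolding UV[symmetric]
  proof (rule continuous_on_open_Un[OF open_ball V])
    have "continuous_on (ball 0 1) (\<lambda>x. (\<zeta> (x \<bullet> x) * (g x \<bullet> b)) *\<^sub>R (reg_weight (\<epsilon> n) x *\<^sub>R reg_grad (\<epsilon> n) x) +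
     reg_weight (\<epsilon> n) x *\<^sub>R ((2 * \<zeta>' (x \<bullet> x) * (g x \<bullet> b)) *\<^sub>R x + \<zeta> (x \<bullet> x) *\<^sub>R H b x))"
      by (intro continuous_on_add continuous_on_scaleR continuous_on_mult continuous_on_const continuous_on_id continuous_on_inner
           continuous_on_reg \<epsilon> cz cg cH)
    thus "continuous_on (ball 0 1) (D n b)" by (rule continuous_on_eq) (simp add: D_def)
    show "continuous_on V (D n b)" using DV by (rule_tac continuous_on_eq[OF continuous_on_const[of V 0]]) simp
  qed
  have derD: "(\<phi> n b has_derivative (\<lambda>h. D n b x \<bullet> h)) (at x)" for n b x
  proof (cases "x \<in> ball 0 1")
    case True
    have "((\<lambda>x. x \<bullet> x) has_derivative (\<lambda>h. 2 * (x \<bullet> h))) (at x)"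
      by (auto intro!: derivative_eq_intros simp: inner_commute)
    moreover have "(\<zeta> has_real_derivative \<zeta>' (x \<bullet> x)) (at (x \<bullet> x))" using in01[OF True] by (intro \<zeta>) auto
    ultimately have z: "((\<lambda>x. \<zeta> (x \<bullet> x)) has_derivative (\<lambda>h. 2 * (x \<bullet> h) * \<zeta>' (x \<bullet> x))) (at x)"
      by (rule DERIV_compose_FDERIV[rotated])
    have "((\<lambda>x. reg_weight (\<epsilon> n) x * (\<zeta> (x \<bullet> x) * (g x \<bullet> b))) has_derivative (\<lambda>h. D n b x \<bullet> h)) (at x)"
      by (rule has_derivative_eq_rhs[OF has_derivative_mult[OF has_derivative_reg_weight[OF \<epsilon>(1)] has_derivative_mult[OF z gD[OF True]]]])
         (use True in \<open>simp add: fun_eq_iff D_def inner_add_left algebra_simps\<close>)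
    thus ?thesis by (rule has_derivative_transform_within_open[OF _ open_ball True]) (simp add: \<phi>_def)
  next
    case False
    hence x: "x \<in> V" using UV by blast
    show ?thesis using zero_has_derivative_outside[of V "\<phi> n b", OF DV(2) V x] DV(1)[OF x] by simp
  qed
  have zero: "(LINT x|lborel. D n b x \<bullet> b) = 0" for n b
    by (rule integral_directional_derivative_zero[OF derD cD]) (auto simp: \<phi>_def D_def)
  have intD: "integrable lborel (\<lambda>x. D n b x \<bullet> b)" for n b
  proof -
    have "integrable lborel (\<lambda>x. indicator (cball 0 1) x *\<^sub>R (D n b x \<bullet> b))"
      by (intro borel_integrable_compact continuous_intros continuous_on_subset[OF cD]) auto
    also have "(\<lambda>x. indicator (cball 0 1) x *\<^sub>R (D n b x \<bullet> b)) = (\<lambda>x. D n b x \<bullet> b)"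
      by (auto simp: fun_eq_iff indicator_def D_def)
    finally show ?thesis .
  qed
  define T where "T n x = (\<Sum>b\<in>Basis. D n b x \<bullet> b)" for n x
  have T0: "(LINT x|lborel. T n x) = 0" for n
    unfolding T_def by (subst Bochner_Integration.integral_sum) (auto intro: intD simp: zero)
  have Tm: "T n \<in> borel_measurable lborel" for n
    unfolding T_def using intD by (intro borel_measurable_sum borel_measurable_integrable)
  \<comment> \<open>The bracket that multiplies \<rho> is the quotient minus 1, that is
    -\<epsilon>/((\<beta> \<bullet> x)^2 + \<epsilon>): bounded by 1 in absolute value and
    convergent to 0 off the hyperplane.\<close>
  have Teq: "T n x = indicator (ball 0 1) x * (reg_weight (\<epsilon> n) x * (2 * \<zeta>' (x \<bullet> x) * (g x \<bullet> x)
      + 2 * \<zeta> (x \<bullet> x) * (\<Sum>\<beta>\<in>R. \<rho> \<beta> x * ((\<beta> \<bullet> x)\<^sup>2 / ((\<beta> \<bullet> x)\<^sup>2 + \<epsilon> n) - 1))))" for n x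
  proof (cases "x \<in> ball 0 1")
    case True
    let ?W = "reg_weight (\<epsilon> n) x" and ?z = "\<zeta> (x \<bullet> x)" and ?z' = "\<zeta>' (x \<bullet> x)" and ?r = "reg_grad (\<epsilon> n) x"
    have "T n x = (\<Sum>b\<in>Basis. (?z * ?W) * ((g x \<bullet> b) * (?r \<bullet> b)) + (?W * (2 * ?z')) * ((g x \<bullet> b) * (x \<bullet> b)) + (?W * ?z) * (H b x \<bullet> b))"
      unfolding T_def using True by (intro sum.cong) (simp_all add: D_def inner_add_left algebra_simps)
    also have "\<dots> = (?z * ?W) * (g x \<bullet> ?r) + (?W * (2 * ?z')) * (g x \<bullet> x) + (?W * ?z) * (\<Sum>b\<in>Basis. H b x \<bullet> b)"
      by (simp only: sum.distrib sum_distrib_left[symmetric] euclidean_inner[symmetric])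
    also have "(\<Sum>b\<in>Basis. H b x \<bullet> b) = - 2 * (\<Sum>\<beta>\<in>R. \<rho> \<beta> x)" using harm[OF True] by simp
    also have "g x \<bullet> ?r = (\<Sum>\<beta>\<in>R. 2 * (\<rho> \<beta> x * ((\<beta> \<bullet> x)\<^sup>2 / ((\<beta> \<bullet> x)\<^sup>2 + \<epsilon> n))))"
      unfolding reg_grad_def inner_sum_right
    proof (rule sum.cong[OF refl])
      fix \<beta> assume b: "\<beta> \<in> R"
      have "g x \<bullet> (2 * k \<beta> * (\<beta> \<bullet> x) / ((\<beta> \<bullet> x)\<^sup>2 + \<epsilon> n)) *\<^sub>R \<beta> = 2 * ((\<beta> \<bullet> x) * (k \<beta> * (g x \<bullet> \<beta>)) / ((\<beta> \<bullet> x)\<^sup>2 + \<epsilon> n))" by simp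
      also have "\<dots> = 2 * (\<rho> \<beta> x * ((\<beta> \<bullet> x)\<^sup>2 / ((\<beta> \<bullet> x)\<^sup>2 + \<epsilon> n)))"
        unfolding root[OF b True] by (simp add: power2_eq_square)
      finally show "g x \<bullet> (2 * k \<beta> * (\<beta> \<bullet> x) / ((\<beta> \<bullet> x)\<^sup>2 + \<epsilon> n)) *\<^sub>R \<beta> = 2 * (\<rho> \<beta> x * ((\<beta> \<bullet> x)\<^sup>2 / ((\<beta> \<bullet> x)\<^sup>2 + \<epsilon> n)))" .
    qed
    also have "(\<Sum>\<beta>\<in>R. 2 * (\<rho> \<beta> x * ((\<beta> \<bullet> x)\<^sup>2 / ((\<beta> \<bullet> x)\<^sup>2 + \<epsilon> n)))) = 2 * (\<Sum>\<beta>\<in>R. \<rho> \<beta> x * ((\<beta> \<bullet> x)\<^sup>2 / ((\<beta> \<bullet> x)\<^sup>2 + \<epsilon> n) - 1)) + 2 * (\<Sum>\<beta>\<in>R. \<rho> \<beta> x)"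
      by (simp add: right_diff_distrib sum_subtractf sum_distrib_left)
    finally show ?thesis using True by (simp add: algebra_simps)
  qed (auto simp: T_def D_def)
  \<comment> \<open>The support of the cut-off. It is compact in the open ball, where continuity
    yields bounds even though g need not be bounded up to the sphere.\<close>
  define C where "C = cball (0::'a) (sqrt c)"
  have sc: "sqrt c < 1" using c by simp
  have Cb: "C \<subseteq> ball 0 1"
  proof
    fix x :: 'a assume "x \<in> C"
    hence "norm x \<le> sqrt c" by (simp add: C_def)
    with sc have "norm x < 1" by linarith
    thus "x \<in> ball 0 1" by simp
  qed
  have C_iff: "x \<in> C \<longleftrightarrow> x \<bullet> x \<le> c" for x using c by (simp add: C_def norm_eq_sqrt_inner)
  have bd: "\<exists>B. \<forall>x\<in>C. \<bar>f x\<bar> \<le> B" if "continuous_on (ball 0 1) f" for f :: "'a \<Rightarrow> real"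
  proof -
    have "bounded (f ` C)" unfolding C_def
      by (intro compact_imp_bounded compact_continuous_image continuous_on_subset[OF that] compact_cball) (use Cb in \<open>simp add: C_def\<close>)
    thus ?thesis by (auto simp: bounded_iff)
  qed
  have c1: "continuous_on (ball 0 1) (\<lambda>x. 2 * \<zeta>' (x \<bullet> x) * (g x \<bullet> x))"
    by (intro continuous_intros cz cg)
  obtain B1 where B1: "\<forall>x\<in>C. \<bar>2 * \<zeta>' (x \<bullet> x) * (g x \<bullet> x)\<bar> \<le> B1" using bd[OF c1] by blast
  have c2: "continuous_on (ball 0 1) (\<lambda>x. 2 * \<bar>\<zeta> (x \<bullet> x)\<bar> * (\<Sum>\<beta>\<in>R. \<bar>\<rho> \<beta> x\<bar>))"
    by (intro continuous_intros cz cr)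
  obtain B2 where B2: "\<forall>x\<in>C. \<bar>2 * \<bar>\<zeta> (x \<bullet> x)\<bar> * (\<Sum>\<beta>\<in>R. \<bar>\<rho> \<beta> x\<bar>)\<bar> \<le> B2" using bd[OF c2] by blast
  define B where "B = exp (\<Sum>\<beta>\<in>R. k \<beta> * ln ((norm \<beta>)\<^sup>2 + 1))"
  have bound: "norm (T n x) \<le> B * (B1 + B2) * indicator C x" for n x
  proof (cases "x \<in> C")
    case False
    have "T n x = 0"
    proof (cases "x \<in> ball 0 1")
      case True
      hence "\<zeta> (x \<bullet> x) = 0" "\<zeta>' (x \<bullet> x) = 0" using \<zeta>V[of x] False by (auto simp: C_iff V_def)
      thus ?thesis by (simp add: Teq)
    qed (simp add: Teq)
    thus ?thesis using False by simp
  next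
    case True
    hence xb: "x \<in> ball 0 1" using Cb by blast
    have "\<bar>\<rho> \<beta> x * ((\<beta> \<bullet> x)\<^sup>2 / ((\<beta> \<bullet> x)\<^sup>2 + \<epsilon> n) - 1)\<bar> \<le> \<bar>\<rho> \<beta> x\<bar> * 1" for \<beta>
    proof -
      have p: "(\<beta> \<bullet> x)\<^sup>2 + \<epsilon> n > 0" using \<epsilon>(1)[of n] by (intro add_nonneg_pos) auto
      have "0 \<le> (\<beta> \<bullet> x)\<^sup>2 / ((\<beta> \<bullet> x)\<^sup>2 + \<epsilon> n)" using p by simp
      moreover have "(\<beta> \<bullet> x)\<^sup>2 / ((\<beta> \<bullet> x)\<^sup>2 + \<epsilon> n) \<le> 1" using p \<epsilon>(1)[of n] by simp
      ultimately have "\<bar>(\<beta> \<bullet> x)\<^sup>2 / ((\<beta> \<bullet> x)\<^sup>2 + \<epsilon> n) - 1\<bar> \<le> 1" by linarith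
      thus ?thesis unfolding abs_mult by (intro mult_left_mono) auto
    qed
    hence "\<bar>\<Sum>\<beta>\<in>R. \<rho> \<beta> x * ((\<beta> \<bullet> x)\<^sup>2 / ((\<beta> \<bullet> x)\<^sup>2 + \<epsilon> n) - 1)\<bar> \<le> (\<Sum>\<beta>\<in>R. \<bar>\<rho> \<beta> x\<bar>)"
      by (intro order_trans[OF sum_abs] sum_mono) simp
    hence "\<bar>2 * \<zeta> (x \<bullet> x) * (\<Sum>\<beta>\<in>R. \<rho> \<beta> x * ((\<beta> \<bullet> x)\<^sup>2 / ((\<beta> \<bullet> x)\<^sup>2 + \<epsilon> n) - 1))\<bar> \<le> 2 * \<bar>\<zeta> (x \<bullet> x)\<bar> * (\<Sum>\<beta>\<in>R. \<bar>\<rho> \<beta> x\<bar>)"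
      unfolding abs_mult by (intro mult_mono) auto
    also have "\<dots> \<le> B2" using B2 True by (meson abs_le_D1)
    finally have s2: "\<bar>2 * \<zeta> (x \<bullet> x) * (\<Sum>\<beta>\<in>R. \<rho> \<beta> x * ((\<beta> \<bullet> x)\<^sup>2 / ((\<beta> \<bullet> x)\<^sup>2 + \<epsilon> n) - 1))\<bar> \<le> B2" .
    have s1: "\<bar>2 * \<zeta>' (x \<bullet> x) * (g x \<bullet> x)\<bar> \<le> B1" using B1 True by blast
    have "\<bar>T n x\<bar> \<le> B * (B1 + B2)"
      unfolding Teq using xb reg_weight_bounds[OF \<epsilon>, of x] s1 s2
      by (simp add: abs_mult) (intro mult_mono order_trans[OF abs_triangle_ineq] add_mono, auto simp: B_def abs_mult)
    thus ?thesis using True by simp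
  qed
  have Cint: "integrable lborel (\<lambda>x. B * (B1 + B2) * indicator C x)"
    using borel_integrable_compact[of C "\<lambda>_. B * (B1 + B2)"] by (simp add: C_def mult.commute)
  have lim: "AE x in lborel. (\<lambda>n. T n x) \<longlonglongrightarrow> X x"
    using AE_roots_nonzero
  proof eventually_elim
    fix x :: 'a assume nz: "\<forall>\<beta>\<in>R. \<beta> \<bullet> x \<noteq> 0"
    have "(\<lambda>n. T n x) \<longlonglongrightarrow> indicator (ball 0 1) x * (dunkl_weight R k x * (2 * \<zeta>' (x \<bullet> x) * (g x \<bullet> x)
      + 2 * \<zeta> (x \<bullet> x) * (\<Sum>\<beta>\<in>R. \<rho> \<beta> x * ((\<beta> \<bullet> x)\<^sup>2 / ((\<beta> \<bullet> x)\<^sup>2 + 0) - 1))))"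
      unfolding Teq using nz by (intro tendsto_intros reg_weight_tendsto \<epsilon>0) auto
    also have "(\<Sum>\<beta>\<in>R. \<rho> \<beta> x * ((\<beta> \<bullet> x)\<^sup>2 / ((\<beta> \<bullet> x)\<^sup>2 + 0) - 1)) = 0" using nz by (intro sum.neutral) auto
    finally show "(\<lambda>n. T n x) \<longlonglongrightarrow> X x" by (simp add: X_def)
  qed
  have Xm: "X \<in> borel_measurable lborel"
  proof -
    have "(\<lambda>x. indicator (ball 0 1) x *\<^sub>R (2 * \<zeta>' (x \<bullet> x) * (g x \<bullet> x))) \<in> borel_measurable borel"
      by (intro borel_measurable_continuous_on_indicator continuous_intros cz cg) auto
    hence "(\<lambda>x. dunkl_weight R k x * (indicator (ball 0 1) x *\<^sub>R (2 * \<zeta>' (x \<bullet> x) * (g x \<bullet> x)))) \<in> borel_measurable borel"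
      by (intro borel_measurable_times dunkl_weight_measurable)
    thus ?thesis by (simp add: X_def mult_ac)
  qed
  show "integrable lborel X"
    by (rule integrable_dominated_convergence[OF Xm Tm Cint lim]) (use bound in auto)
  have "(\<lambda>n. LINT x|lborel. T n x) \<longlonglongrightarrow> (LINT x|lborel. X x)"
    by (rule integral_dominated_convergence[OF Xm Tm Cint lim]) (use bound in auto)
  thus "(LINT x|lborel. X x) = 0" unfolding T0 by (simp add: LIMSEQ_const_iff)
qed

section \<open>Spherical means of the kernel\<close>

text \<open>The means are considered for radii in (-1, 1) so that the radius 0 is an interior point
  and no one-sided derivative occurs.\<close>

lemma sphere_integral_derivative:
  assumes y: "y \<in> sphere 0 1"
  defines "B \<equiv> (\<lambda>r. LINT q|sphere_measure. dunkl_weight R k q * (kernel_grad (r *\<^sub>R q) y \<bullet> q))"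
  shows "\<And>r. r \<in> {-1<..<1} \<Longrightarrow>
      ((\<lambda>r. LINT q|sphere_measure. dunkl_weight R k q * ball_kernel (r *\<^sub>R q) y) has_real_derivative B r) (at r)"
    "continuous_on {-1<..<1} B"
proof -
  note w = integrable_sphere_weight
  have q: "(\<lambda>q. q) \<in> borel_measurable sphere_measure" "\<And>q. q \<in> space sphere_measure \<Longrightarrow> q \<in> sphere (0::'a) 1"
    using measurable_sphere_ident by auto
  have in_ball: "r *\<^sub>R q \<in> ball 0 1" if "r \<in> {-1<..<1}" "q \<in> sphere 0 1" for r and q :: 'a using that by auto
  have cG: "continuous_on ({-1<..<1} \<times> sphere 0 1) (\<lambda>z. kernel_grad (fst z *\<^sub>R snd z) y \<bullet> snd z)"
    by (intro continuous_on_inner continuous_on_compose2[OF ball_kernel_continuous(2), of _ "\<lambda>z. (fst z *\<^sub>R snd z, y)", simplified] continuous_intros)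
       (use y in_ball in \<open>auto\<close>)
  show "continuous_on {-1<..<1} B"
    unfolding B_def by (rule continuous_on_param_integral[OF compact_sphere cG q w])
  fix r :: real assume r: "r \<in> {-1<..<1}"
  have D: "((\<lambda>r. ball_kernel (r *\<^sub>R q) y) has_derivative (\<lambda>h. (kernel_grad (r *\<^sub>R q) y \<bullet> q) \<bullet> h)) (at r)" if "r \<in> {-1<..<1}" "q \<in> sphere 0 1" for r q
  proof -
    have 1: "((\<lambda>r. r *\<^sub>R q) has_derivative (\<lambda>h. h *\<^sub>R q)) (at r)" by (auto intro!: derivative_eq_intros)
    have 2: "((\<lambda>x. ball_kernel x y) has_derivative (\<lambda>h. kernel_grad (r *\<^sub>R q) y \<bullet> h)) (at (r *\<^sub>R q))"
      using y by (intro ball_kernel_derivatives(1) in_ball that) auto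
    show ?thesis by (rule has_derivative_eq_rhs[OF has_derivative_compose[OF 1 2]]) (auto simp: mult.commute)
  qed
  have cF: "continuous_on (sphere 0 1) (\<lambda>q. ball_kernel (r *\<^sub>R q) y)" if "r \<in> {-1<..<1}" for r
    by (intro continuous_on_compose2[OF ball_kernel_continuous(1), of _ "\<lambda>q. (r *\<^sub>R q, y)", simplified] continuous_intros)
       (use y in_ball[OF that] in \<open>auto\<close>)
  have "((\<lambda>r. LINT q|sphere_measure. dunkl_weight R k q * ball_kernel (r *\<^sub>R q) y) has_derivative
     (\<lambda>h. LINT q|sphere_measure. dunkl_weight R k q * ((kernel_grad (r *\<^sub>R q) y \<bullet> q) \<bullet> h))) (at r)"
    by (rule has_derivative_param_integral[OF open_greaterThanLessThan compact_sphere cG D cF q w r])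
  moreover have "(\<lambda>h. LINT q|sphere_measure. dunkl_weight R k q * ((kernel_grad (r *\<^sub>R q) y \<bullet> q) \<bullet> h)) = (*) (B r)"
    unfolding B_def by (simp add: fun_eq_iff mult.assoc[symmetric])
  ultimately show "((\<lambda>r. LINT q|sphere_measure. dunkl_weight R k q * ball_kernel (r *\<^sub>R q) y) has_real_derivative B r) (at r)"
    by (simp add: has_field_derivative_def)
qed

text \<open>The test function \<open>\<zeta>'(r\<^sup>2) = B(r) (c - r\<^sup>2)\<^sub>+\<close> turns the Green identity into
  \<open>\<integral> r\<^sup>d\<^sup>+\<^sup>2\<^sup>\<gamma> B(r)\<^sup>2 (c - r\<^sup>2)\<^sub>+ dr = 0\<close>.\<close>

lemma sphere_flux_zero:
  assumes y: "y \<in> sphere 0 1" and r: "0 < r" "r < 1"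
  shows "(LINT q|sphere_measure. dunkl_weight R k q * (kernel_grad (r *\<^sub>R q) y \<bullet> q)) = 0"
proof -
  define B where "B r = (LINT q|sphere_measure. dunkl_weight R k q * (kernel_grad (r *\<^sub>R q) y \<bullet> q))" for r
  have cB: "continuous_on {-1<..<1} B" unfolding B_def by (rule sphere_integral_derivative(2)[OF y])
  \<comment> \<open>A radius strictly between r and 1 keeps the cut-off positive at r and its
    support inside the ball.\<close>
  obtain s where s: "r < s" "s < 1" using r dense by blast
  define c where "c = s\<^sup>2"
  have s0: "0 < s" using r s by simp
  have c: "0 < c" "c < 1" using s s0 by (auto simp: c_def abs_square_less_1)
  have sqrt_c: "sqrt c = s" using s0 by (simp add: c_def)
  \<comment> \<open>Clamping the argument to [0, c] keeps the square root inside the interval where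
    B is continuous and makes the test function continuous on the whole line.\<close>
  define \<zeta>' where "\<zeta>' t = B (sqrt (min (max t 0) c)) * max 0 (c - t)" for t
  have sq: "sqrt (min (max t 0) c) \<in> {-1<..<1}" for t
  proof -
    have "0 \<le> sqrt (min (max t 0) c)" using c by simp
    moreover have "sqrt (min (max t 0) c) \<le> sqrt c" by (intro real_sqrt_le_mono) simp
    ultimately have "-1 < sqrt (min (max t 0) c)" "sqrt (min (max t 0) c) < 1" using s unfolding sqrt_c by linarith+
    thus ?thesis unfolding greaterThanLessThan_iff by (rule conjI)
  qed
  have c\<zeta>': "continuous_on A \<zeta>'" for A
    unfolding \<zeta>'_def by (intro continuous_intros continuous_on_compose2[OF cB]) (use sq in auto)
  \<comment> \<open>The larger interval makes every point of [0, 1) interior, so the derivative is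
    two-sided; subtracting the value at c makes the primitive vanish beyond c.\<close>
  obtain g where g: "\<And>t. t \<in> {-1..2} \<Longrightarrow> (g has_vector_derivative \<zeta>' t) (at t within {-1..2})"
    using antiderivative_continuous[OF c\<zeta>'[of "{-1..2}"]] by blast
  define \<zeta> where "\<zeta> t = g t - g c" for t
  have \<zeta>: "(\<zeta> has_real_derivative \<zeta>' t) (at t)" if "0 \<le> t" "t < 1" for t
  proof -
    have "(g has_vector_derivative \<zeta>' t) (at t)"
      using g[of t] that by (simp add: at_within_Icc_at)
    thus ?thesis unfolding \<zeta>_def has_real_derivative_iff_has_vector_derivative
      by (auto intro!: derivative_eq_intros)
  qed
  have \<zeta>'0: "\<zeta>' t = 0" if "c \<le> t" for t using that by (simp add: \<zeta>'_def)
  have \<zeta>0: "\<zeta> t = 0" if "c \<le> t" "t < 1" for t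
  proof (cases "t = c")
    case False
    hence "c < t" using that by simp
    moreover have "(\<zeta> has_real_derivative \<zeta>' x) (at x)" if "c \<le> x" "x \<le> t" for x
      using that \<open>t < 1\<close> c by (intro \<zeta>) auto
    ultimately obtain z where "c < z" "\<zeta> t - \<zeta> c = (t - c) * \<zeta>' z" using MVT2[of c t \<zeta> \<zeta>'] by blast
    thus ?thesis using \<zeta>'0[of z] by (simp add: \<zeta>_def)
  qed (simp add: \<zeta>_def)
  have yle: "norm y \<le> 1" using y by simp
  have cont: "continuous_on (ball 0 1) (\<lambda>x. kernel_grad x y)"
    by (rule continuous_on_compose2[OF ball_kernel_continuous(2), of _ "\<lambda>x. (x, y)", simplified]) (use y in \<open>auto intro!: continuous_intros\<close>)
  have root: "k \<beta> * (kernel_grad x y \<bullet> \<beta>) = (\<beta> \<bullet> x) * kernel_quot \<beta> x y" if "\<beta> \<in> R" "x \<in> ball 0 1" for \<beta> x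
    using kernel_grad_root that y by blast
  have harm: "(\<Sum>b\<in>Basis. kernel_hess b x y \<bullet> b) + 2 * (\<Sum>\<beta>\<in>R. kernel_quot \<beta> x y) = 0" if x: "x \<in> ball 0 1" for x
  proof -
    have "k \<beta> * (if \<beta> \<bullet> x = 0 then (kernel_hess \<beta> x y \<bullet> \<beta>) / (norm \<beta>)\<^sup>2 else (kernel_grad x y \<bullet> \<beta>) / (\<beta> \<bullet> x)) = kernel_quot \<beta> x y" if b: "\<beta> \<in> R" for \<beta>
      using kernel_hess_root[OF x y b] root[OF b x] by (auto simp: field_simps)
    thus ?thesis using ball_kernel_harmonic[OF x y] by (simp add: radial_symbol_def)
  qed
  define X where "X x = indicator (ball 0 1) x * (dunkl_weight R k x * (2 * \<zeta>' (x \<bullet> x) * (kernel_grad x y \<bullet> x)))" for x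
  note green = green_identity[where g="\<lambda>x. kernel_grad x y" and H="\<lambda>v x. kernel_hess v x y" and \<rho>="\<lambda>\<beta> x. kernel_quot \<beta> x y" and \<zeta>=\<zeta> and \<zeta>'=\<zeta>' and c=c,
    OF ball_kernel_derivatives(2)[OF yle] cont ball_kernel_derivatives(3)[OF yle] kernel_quot_continuous[OF y] root harm \<zeta> c\<zeta>' c \<zeta>0 \<zeta>'0, folded X_def]
  have Xint: "integrable lborel X" "(LINT x|lborel. X x) = 0" using green by (auto simp: X_def[abs_def])
  define Y where "Y r = (indicator {0<..} r * r ^ (DIM('a) - 1)) * (LINT q|sphere_measure. X (r *\<^sub>R q))" for r :: real
  have Yeq: "Y r = indicator {0<..<s} r * (2 * r ^ DIM('a) * r powr (2 * dunkl_gamma R k) * (c - r\<^sup>2) * (B r)\<^sup>2)" for r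
  proof (cases "r > 0")
    case True
    have "X (r *\<^sub>R q) = (indicator {..<1} r * (2 * r * r powr (2 * dunkl_gamma R k) * \<zeta>' (r\<^sup>2))) * (dunkl_weight R k q * (kernel_grad (r *\<^sub>R q) y \<bullet> q))"
      if "q \<in> sphere 0 1" for q
    proof -
      have "q \<bullet> q = 1" using that by (simp add: dot_square_norm)
      thus ?thesis using that True by (simp add: X_def dunkl_weight_scale indicator_def power2_eq_square)
    qed
    hence "(LINT q|sphere_measure. X (r *\<^sub>R q)) = (LINT q|sphere_measure. (indicator {..<1} r * (2 * r * r powr (2 * dunkl_gamma R k) * \<zeta>' (r\<^sup>2))) * (dunkl_weight R k q * (kernel_grad (r *\<^sub>R q) y \<bullet> q)))"
      by (intro Bochner_Integration.integral_cong refl) simp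
    also have "\<dots> = indicator {..<1} r * (2 * r * r powr (2 * dunkl_gamma R k) * \<zeta>' (r\<^sup>2)) * B r" by (simp add: B_def)
    finally have X: "(LINT q|sphere_measure. X (r *\<^sub>R q)) = indicator {..<1} r * (2 * r * r powr (2 * dunkl_gamma R k) * \<zeta>' (r\<^sup>2)) * B r" .
    show ?thesis
    proof (cases "r < s")
      case True
      have "r\<^sup>2 < c" unfolding c_def using True \<open>r > 0\<close> by (intro power_strict_mono) auto
      hence "\<zeta>' (r\<^sup>2) = B r * (c - r\<^sup>2)" using \<open>r > 0\<close> by (simp add: \<zeta>'_def)
      moreover have "r ^ DIM('a) = r * r ^ (DIM('a) - 1)" by (simp add: power_eq_if)
      ultimately show ?thesis using True \<open>r > 0\<close> s by (simp add: Y_def X power2_eq_square)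
    next
      case False
      hence "c \<le> r\<^sup>2" unfolding c_def using s0 by (intro power_mono) auto
      thus ?thesis using False by (simp add: Y_def X \<zeta>'0)
    qed
  qed (simp add: Y_def)
  have Ynn: "0 \<le> Y r" for r
  proof (cases "r \<in> {0<..<s}")
    case True
    hence "r\<^sup>2 \<le> c" unfolding c_def by (intro power_mono) auto
    thus ?thesis using True unfolding Yeq by (intro mult_nonneg_nonneg) auto
  qed (simp add: Yeq)
  have "integrable lborel Y" "(LINT r|lborel. Y r) = 0"
    using polar_coordinates[OF Xint(1)] Xint(2) by (simp_all add: Y_def[abs_def])
  hence Y0: "AE r in lborel. Y r = 0" using Ynn by (subst (asm) integral_nonneg_eq_0_iff_AE) auto
  \<comment> \<open>B vanishes almost everywhere on (0, s), and this set is open by continuity of B,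
    hence empty.\<close>
  define S where "S = {r \<in> {0<..<s}. B r \<noteq> 0}"
  from Y0 have "AE r in lborel. r \<notin> S"
  proof eventually_elim
    fix r assume Y: "Y r = 0"
    show "r \<notin> S"
    proof
      assume r: "r \<in> S"
      hence "r\<^sup>2 < c" unfolding c_def S_def by (intro power_strict_mono) auto
      thus False using Y r by (auto simp: Yeq S_def)
    qed
  qed
  moreover have "open S"
  proof -
    have "continuous_on {0<..<s} B" by (rule continuous_on_subset[OF cB]) (use s in auto)
    from continuous_open_preimage[OF this _ open_Compl[OF closed_singleton[of 0]]]
    have "open ({0<..<s} \<inter> B -` (- {0}))" by simp
    also have "{0<..<s} \<inter> B -` (- {0}) = S" by (auto simp: S_def)
    finally show ?thesis .
  qed
  ultimately have "S = {}" using open_AE_empty by blast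
  thus ?thesis using r s unfolding S_def B_def by auto
qed

text \<open>The derivative of the mean is the flux, which is zero for positive radii, and at radius
  0 the kernel equals 1.\<close>

lemma sphere_mean_value:
  assumes y: "y \<in> sphere 0 1" and r: "0 \<le> r" "r < 1"
  shows "(LINT q|sphere_measure. dunkl_weight R k q * ball_kernel (r *\<^sub>R q) y) = (LINT q|sphere_measure. dunkl_weight R k q)"
proof -
  define M where "M r = (LINT q|sphere_measure. dunkl_weight R k q * ball_kernel (r *\<^sub>R q) y)" for r
  have D: "(M has_real_derivative (LINT q|sphere_measure. dunkl_weight R k q * (kernel_grad (t *\<^sub>R q) y \<bullet> q))) (at t)" if "t \<in> {-1<..<1}" for t
    unfolding M_def by (rule sphere_integral_derivative(1)[OF y that])
  have "M r = M 0"
  proof (cases "r = 0")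
    case False
    show ?thesis
    proof (rule DERIV_isconst_end[of 0 r M])
      show "0 < r" using r False by simp
      show "continuous_on {0..r} M" using r by (intro continuous_at_imp_continuous_on ballI DERIV_isCont[OF D]) auto
      show "DERIV M t :> 0" if "0 < t" "t < r" for t using D[of t] sphere_flux_zero[OF y, of t] r that by simp
    qed
  qed simp
  also have "M 0 = (LINT q|sphere_measure. dunkl_weight R k q)"
  proof -
    have "ball_kernel 0 y = 1" by (simp add: ball_kernel_def pk_fun_def pk_dist_def GM.prob_space)
    thus ?thesis by (simp add: M_def)
  qed
  finally show ?thesis unfolding M_def .
qed

definition sphere_mass :: real where
  "sphere_mass = (LINT q|sphere_measure. dunkl_weight R k q)"

text \<open>By \<open>ball_kernel_symmetric\<close> the direction of x and the point q change
  places, and the integral becomes a spherical mean. It fixes the normalizing constant of the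
  Poisson kernel.\<close>

lemma integral_ball_kernel:
  assumes x: "x \<in> ball 0 1"
  shows "(LINT q|sphere_measure. ball_kernel x q * dunkl_weight R k q) = sphere_mass"
proof -
  obtain e :: 'a where e: "e \<in> Basis" using nonempty_Basis by blast
  \<comment> \<open>At the origin any unit vector serves as direction.\<close>
  define y where "y = (if x = 0 then e else x /\<^sub>R norm x)"
  have y: "norm y = 1" "x = norm x *\<^sub>R y" using e by (auto simp: y_def)
  have "(LINT q|sphere_measure. ball_kernel x q * dunkl_weight R k q) = (LINT q|sphere_measure. dunkl_weight R k q * ball_kernel (norm x *\<^sub>R q) y)"
  proof (rule Bochner_Integration.integral_cong[OF refl])
    fix q :: 'a assume "q \<in> space sphere_measure"
    hence "norm q = 1" by simp
    from ball_kernel_symmetric[OF y(1) this, of "norm x"] y(2)[symmetric] show "ball_kernel x q * dunkl_weight R k q = dunkl_weight R k q * ball_kernel (norm x *\<^sub>R q) y" by simp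
  qed
  also have "\<dots> = sphere_mass" unfolding sphere_mass_def by (rule sphere_mean_value) (use y x in auto)
  finally show ?thesis .
qed

lemma sphere_mass_pos: "sphere_mass > 0"
  unfolding sphere_mass_def by (rule integral_sphere_weight_pos)

section \<open>The normalized kernel and its boundary behaviour\<close>

definition poisson :: "'a \<Rightarrow> 'a \<Rightarrow> real" where
  "poisson x y = (if x \<in> ball 0 1 \<and> y \<in> sphere 0 1 then ball_kernel x y / sphere_mass else 0)"

lemma sphere_ident:
  "(\<lambda>q. q) \<in> borel_measurable sphere_measure" "\<And>q. q \<in> space sphere_measure \<Longrightarrow> q \<in> sphere (0::'a) 1"
  using measurable_sphere_ident by auto

lemma integrable_weight_continuous:
  assumes "continuous_on (sphere 0 1) f" shows "integrable sphere_measure (\<lambda>q. dunkl_weight R k q * f q)"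
  by (rule integrable_compact_param[OF compact_sphere assms sphere_ident integrable_sphere_weight])

lemma ball_kernel_section_continuous:
  assumes "x \<in> ball 0 1" shows "continuous_on (sphere 0 1) (ball_kernel x)"
  by (rule continuous_on_compose2[OF ball_kernel_continuous(1), of _ "\<lambda>q. (x, q)", simplified]) (use assms in \<open>auto intro!: continuous_intros\<close>)

lemma ball_kernel_nonneg:
  assumes "x \<in> ball 0 1" shows "0 \<le> ball_kernel x q"
proof -
  have "x \<bullet> x \<le> 1" using assms by (simp add: dot_square_norm abs_square_le_1)
  thus ?thesis unfolding ball_kernel_def pk_fun_def by (intro Bochner_Integration.integral_nonneg mult_nonneg_nonneg) auto
qed

text \<open>A is affine in each parameter, so on the box it is minimal at a vertex; vertices are
  sign vectors, that is elements of W, where A is a squared distance. Off a neighbourhood of the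
  whole orbit the kernel is therefore small near the sphere.\<close>

lemma pk_dist_rescale_ge:
  assumes t: "t \<in> space GM" and y: "norm y = 1"
  shows "\<exists>w\<in>reflection_group R. (norm (x - w y))\<^sup>2 \<le> pk_dist x (rescale R t y)"
proof -
  define \<epsilon> :: "'a \<Rightarrow> real" where "\<epsilon> \<beta> = (if 0 \<le> pairing \<beta> y x then 1 else -1)" for \<beta>
  have w: "rescale R \<epsilon> \<in> reflection_group R" by (rule rescale_signs_in_reflection_group) (auto simp: \<epsilon>_def)
  have "(t \<beta> - 1) * pairing \<beta> y x \<le> (\<epsilon> \<beta> - 1) * pairing \<beta> y x" if "\<beta> \<in> R" for \<beta>
  proof (cases "0 \<le> pairing \<beta> y x")
    case True
    thus ?thesis using space_GM[OF t that] by (intro mult_right_mono) (auto simp: \<epsilon>_def)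
  next
    case False
    thus ?thesis using space_GM[OF t that] by (intro mult_right_mono_neg) (auto simp: \<epsilon>_def)
  qed
  hence "rescale R t y \<bullet> x \<le> rescale R \<epsilon> y \<bullet> x" unfolding rescale_inner by (intro add_left_mono sum_mono)
  moreover have "(norm (x - rescale R \<epsilon> y))\<^sup>2 = 1 + x \<bullet> x - 2 * (rescale R \<epsilon> y \<bullet> x)"
    using norm_reflection_group[OF w, of y] y
    by (simp add: power2_norm_eq_inner inner_diff_left inner_diff_right inner_commute[of x "rescale R \<epsilon> y"] dot_square_norm[of "rescale R \<epsilon> y"])
  ultimately have "(norm (x - rescale R \<epsilon> y))\<^sup>2 \<le> pk_dist x (rescale R t y)"
    by (simp add: pk_dist_def inner_commute[of x "rescale R t y"])
  thus ?thesis using w by blast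
qed

lemma ball_kernel_le:
  assumes x: "x \<in> ball 0 1" and y: "norm y = 1" and \<delta>: "0 < \<delta>" "\<And>w. w \<in> reflection_group R \<Longrightarrow> \<delta> \<le> norm (x - w y)"
  shows "ball_kernel x y \<le> (1 - x \<bullet> x) * (\<delta>\<^sup>2) powr (- lam)"
proof -
  have x1: "0 \<le> 1 - x \<bullet> x" using x by (simp add: dot_square_norm abs_square_le_1)
  have b: "pk_dist x (rescale R t y) powr (- lam) \<le> (\<delta>\<^sup>2) powr (- lam)" if t: "t \<in> space GM" for t
  proof -
    obtain w where w: "w \<in> reflection_group R" "(norm (x - w y))\<^sup>2 \<le> pk_dist x (rescale R t y)"
      using pk_dist_rescale_ge[OF t y] by blast
    have "\<delta>\<^sup>2 \<le> (norm (x - w y))\<^sup>2" using \<delta> w by (intro power_mono) auto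
    with w(2) have "\<delta>\<^sup>2 \<le> pk_dist x (rescale R t y)" by linarith
    thus ?thesis using \<delta>(1) lam_pos by (intro powr_mono2') auto
  qed
  have "ball_kernel x y = (1 - x \<bullet> x) * (LINT t|GM. pk_dist x (rescale R t y) powr (- lam))"
    by (simp add: ball_kernel_def pk_fun_def)
  also have "(LINT t|GM. pk_dist x (rescale R t y) powr (- lam)) \<le> (LINT t|GM. (\<delta>\<^sup>2) powr (- lam))"
    by (rule Bochner_Integration.integral_mono) (use integrable_pk_dist[OF x, of y] y b in auto)
  also have "(LINT t|GM. (\<delta>\<^sup>2) powr (- lam)) = (\<delta>\<^sup>2) powr (- lam)" by (simp add: GM.prob_space)
  finally show ?thesis using x1 by (simp add: mult_left_mono)
qed

context
  fixes f :: "'a \<Rightarrow> real" assumes cf: "continuous_on (sphere 0 1) f"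
begin

text \<open>Weight, boundary data and normalization together form the integrable factor of a
  parameter integral over the sphere.\<close>

definition "poisson_density q = dunkl_weight R k q * f q / sphere_mass"

interpretation compact_parameter sphere_measure "poisson_density" "\<lambda>q. q" "sphere 0 1"
proof
  show "integrable sphere_measure (poisson_density)"
    unfolding poisson_density_def[abs_def] using integrable_weight_continuous[OF cf] by simp
qed (use sphere_ident in auto)

lemma poisson_integral_eq:
  "x \<in> ball 0 1 \<Longrightarrow> poisson_integral R k poisson f x = (LINT q|sphere_measure. poisson_density q * ball_kernel x q)"
  unfolding poisson_integral_def
  by (intro Bochner_Integration.integral_cong refl) (simp add: poisson_def poisson_density_def)

lemma poisson_integral_C2:
  shows "C2_on (ball 0 1) (poisson_integral R k poisson f)"
    "\<And>x. x \<in> ball 0 1 \<Longrightarrow> radial_dunkl_laplacian R k (poisson_integral R k poisson f) x = 0"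
proof -
  let ?u = "poisson_integral R k poisson f"
  let ?g = "vec_integral sphere_measure poisson_density (\<lambda>q. q) kernel_grad"
  let ?H = "\<lambda>v. vec_integral sphere_measure poisson_density (\<lambda>q. q) (kernel_hess v)"
  have D: "((\<lambda>x. ball_kernel x q) has_derivative (\<lambda>h. kernel_grad x q \<bullet> h)) (at x)" if "x \<in> ball 0 1" "q \<in> sphere 0 1" for x q
    using that by (intro ball_kernel_derivatives(1)) auto
  have D2: "((\<lambda>x. kernel_grad x q \<bullet> v) has_derivative (\<lambda>h. kernel_hess v x q \<bullet> h)) (at x)" if "x \<in> ball 0 1" "q \<in> sphere 0 1" for x q v
    using that by (intro ball_kernel_derivatives(2)) auto
  note C = C2_on_param_integral[where F=ball_kernel and G=kernel_grad and H=kernel_hess and U="ball 0 1",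
     OF open_ball ball_kernel_section_continuous ball_kernel_continuous(2,3) D D2]
  have uD: "(?u has_derivative (\<lambda>h. ?g x \<bullet> h)) (at x)" if x: "x \<in> ball 0 1" for x
    by (rule has_derivative_transform_within_open[OF _ open_ball x]) (use C(1) x poisson_integral_eq in auto)
  note A = open_ball uD C(2) C(3)
  show "C2_on (ball 0 1) ?u" by (rule C2_onI(1)[OF A])
  fix x :: 'a assume x: "x \<in> ball 0 1"
  have "radial_dunkl_laplacian R k ?u x = radial_symbol R k x (?g x) (\<lambda>v. ?H v x)"
    by (rule radial_dunkl_laplacian_eq[OF open_ball x uD C(2) C(3)])
  also have "\<dots> = (LINT q|sphere_measure. poisson_density q * radial_symbol R k x (kernel_grad x q) (\<lambda>v. kernel_hess v x q))"
    by (rule radial_symbol_integral[OF x ball_kernel_continuous(2,3)])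
  also have "\<dots> = (LINT q|(sphere_measure :: 'a measure). 0)"
    by (intro Bochner_Integration.integral_cong refl) (simp add: ball_kernel_harmonic[OF x])
  finally show "radial_dunkl_laplacian R k ?u x = 0" by simp
qed

text \<open>The kernel has total weighted mass one and is nonnegative, so the constant a can be
  moved under the integral.\<close>

lemma poisson_integral_deviation:
  assumes x: "x \<in> ball 0 1"
  shows "\<bar>poisson_integral R k poisson f x - a\<bar> \<le> (LINT q|sphere_measure. dunkl_weight R k q * (\<bar>f q - a\<bar> * ball_kernel x q)) / sphere_mass"
proof -
  note m = sphere_mass_pos
  note c = ball_kernel_section_continuous[OF x]
  have "sphere_mass * (poisson_integral R k poisson f x - a) = (LINT q|sphere_measure. dunkl_weight R k q * (f q * ball_kernel x q)) - (LINT q|sphere_measure. dunkl_weight R k q * (a * ball_kernel x q))"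
  proof -
    have "(LINT q|sphere_measure. dunkl_weight R k q * (a * ball_kernel x q)) = a * sphere_mass"
      unfolding integral_ball_kernel[OF x, symmetric] Bochner_Integration.integral_mult_right_zero[symmetric]
      by (intro Bochner_Integration.integral_cong refl) (simp only: mult_ac)
    moreover have "sphere_mass * poisson_integral R k poisson f x = (LINT q|sphere_measure. dunkl_weight R k q * (f q * ball_kernel x q))"
      unfolding poisson_integral_eq[OF x] Bochner_Integration.integral_mult_right_zero[symmetric] poisson_density_def
      by (intro Bochner_Integration.integral_cong refl) (use m in simp)
    ultimately show ?thesis by (simp add: right_diff_distrib)
  qed
  also have "\<dots> = (LINT q|sphere_measure. dunkl_weight R k q * ((f q - a) * ball_kernel x q))"
    by (subst Bochner_Integration.integral_diff[symmetric])
       (intro integrable_weight_continuous continuous_intros cf c, intro integrable_weight_continuous continuous_intros cf c,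
        intro Bochner_Integration.integral_cong refl, simp add: algebra_simps)
  finally have "sphere_mass * \<bar>poisson_integral R k poisson f x - a\<bar> = \<bar>LINT q|sphere_measure. dunkl_weight R k q * ((f q - a) * ball_kernel x q)\<bar>"
    using m by (metis abs_mult abs_of_pos)
  also have "\<dots> \<le> (LINT q|sphere_measure. \<bar>dunkl_weight R k q * ((f q - a) * ball_kernel x q)\<bar>)" by (rule integral_abs_bound)
  also have "\<dots> = (LINT q|sphere_measure. dunkl_weight R k q * (\<bar>f q - a\<bar> * ball_kernel x q))"
    by (simp add: abs_mult dunkl_weight_nonneg ball_kernel_nonneg[OF x])
  finally show ?thesis using m by (simp add: pos_le_divide_eq mult.commute)
qed

text \<open>The kernel concentrates at the orbit of z and not at z alone; W-invariance of f makes
  its values near the orbit close to f z.\<close>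

lemma poisson_integral_boundary:
  assumes inv: "invariant_on (reflection_group R) (sphere 0 1) f" and z: "z \<in> sphere 0 1" and e: "0 < e"
  shows "\<exists>\<delta>>0. \<forall>x\<in>ball 0 1. dist x z < \<delta> \<longrightarrow> \<bar>poisson_integral R k poisson f x - f z\<bar> < e"
proof -
  note m = sphere_mass_pos
  obtain \<eta> where \<eta>: "0 < \<eta>" "\<And>q. q \<in> sphere 0 1 \<Longrightarrow> dist q z < \<eta> \<Longrightarrow> dist (f q) (f z) < e / 2"
    using cf z e unfolding continuous_on_iff by (metis half_gt_zero)
  have "bounded (f ` sphere 0 1)" by (intro compact_imp_bounded compact_continuous_image cf compact_sphere)
  then obtain M where "\<forall>v\<in>f ` sphere 0 1. norm v \<le> M" unfolding bounded_iff by blast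
  hence M: "\<bar>f q\<bar> \<le> M" if "q \<in> sphere 0 1" for q using that by auto
  have M0: "0 \<le> M" using M[OF z] by linarith
  define A where "A = ((\<eta> / 2)\<^sup>2) powr (- lam)"
  have A0: "0 \<le> A" by (simp add: A_def)
  \<comment> \<open>1 - |x|^2 is at most 2 \<delta>, so the far part contributes at most 4 \<delta>
    M A, less than e/2; the other bound keeps x within half of \<eta> from z.\<close>
  define \<delta> where "\<delta> = min (\<eta> / 2) (e / (8 * (M * A + 1)))"
  have MA: "0 < M * A + 1" using M0 A0 by (intro add_nonneg_pos) auto
  have \<delta>: "0 < \<delta>" using \<eta>(1) e MA by (simp add: \<delta>_def)
  have "\<bar>poisson_integral R k poisson f x - f z\<bar> < e" if x: "x \<in> ball 0 1" and d: "dist x z < \<delta>" for x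
  proof -
    define s where "s = 1 - x \<bullet> x"
    have nx: "norm x < 1" using x by simp
    have "s = (1 - norm x) * (1 + norm x)" by (simp add: s_def dot_square_norm power2_eq_square algebra_simps)
    also have "\<dots> \<le> (1 - norm x) * 2" using nx by (intro mult_left_mono) auto
    also have "1 - norm x \<le> dist x z" using z norm_triangle_ineq2[of z x] by (simp add: dist_norm norm_minus_commute)
    finally have s: "s \<le> 2 * \<delta>" using d by simp
    have s0: "0 \<le> s" using nx by (simp add: s_def dot_square_norm abs_square_le_1)
    \<comment> \<open>Either some point of the orbit of q is near x, and continuity of f applies to
      that point, or the whole orbit is far and \<open>ball_kernel_le\<close> applies.\<close>
    have bd: "\<bar>f q - f z\<bar> * ball_kernel x q \<le> e / 2 * ball_kernel x q + 2 * M * (s * A)" if q: "q \<in> sphere 0 1" for q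
    proof (cases "\<exists>w\<in>reflection_group R. norm (x - w q) < \<eta> / 2")
      case True
      then obtain w where w: "w \<in> reflection_group R" "norm (x - w q) < \<eta> / 2" by blast
      have wq: "w q \<in> sphere 0 1" using q norm_reflection_group[OF w(1), of q] by simp
      have "dist (w q) z \<le> dist (w q) x + dist x z" by (rule dist_triangle)
      also have "\<dots> < \<eta>" using w(2) d by (simp add: dist_norm norm_minus_commute \<delta>_def)
      finally have "\<bar>f (w q) - f z\<bar> < e / 2" using \<eta>(2)[OF wq] by (simp add: dist_real_def)
      moreover have "f (w q) = f q" using inv w(1) q by (simp add: invariant_on_def)
      ultimately have "\<bar>f q - f z\<bar> * ball_kernel x q \<le> e / 2 * ball_kernel x q" using ball_kernel_nonneg[OF x] by (intro mult_right_mono) auto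
      thus ?thesis using M0 s0 A0 by (intro order_trans[OF _ add_increasing2[OF _ order_refl]]) auto
    next
      case False
      hence "ball_kernel x q \<le> s * A" unfolding s_def A_def using q \<eta>(1) by (intro ball_kernel_le[OF x]) (auto simp: not_less)
      moreover have "\<bar>f q - f z\<bar> \<le> 2 * M" using M[OF q] M[OF z] by linarith
      ultimately have "\<bar>f q - f z\<bar> * ball_kernel x q \<le> 2 * M * (s * A)" using M0 ball_kernel_nonneg[OF x] by (intro mult_mono) auto
      moreover have "0 \<le> e / 2 * ball_kernel x q" using e ball_kernel_nonneg[OF x] by simp
      ultimately show ?thesis by linarith
    qed
    note c = ball_kernel_section_continuous[OF x]
    have "(LINT q|sphere_measure. dunkl_weight R k q * (\<bar>f q - f z\<bar> * ball_kernel x q)) \<le>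
        (LINT q|sphere_measure. dunkl_weight R k q * (e / 2 * ball_kernel x q + 2 * M * (s * A)))"
    proof (rule Bochner_Integration.integral_mono)
      fix q :: 'a assume "q \<in> space sphere_measure"
      hence "q \<in> sphere 0 1" by simp
      thus "dunkl_weight R k q * (\<bar>f q - f z\<bar> * ball_kernel x q) \<le> dunkl_weight R k q * (e / 2 * ball_kernel x q + 2 * M * (s * A))"
        by (intro mult_left_mono bd dunkl_weight_nonneg)
    qed (intro integrable_weight_continuous continuous_intros cf c)+
    also have "\<dots> = (LINT q|sphere_measure. e / 2 * (ball_kernel x q * dunkl_weight R k q) + 2 * M * (s * A) * dunkl_weight R k q)"
      by (intro Bochner_Integration.integral_cong refl) (simp add: algebra_simps)
    also have "\<dots> = e / 2 * sphere_mass + 2 * M * (s * A) * sphere_mass"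
    proof -
      have "integrable sphere_measure (\<lambda>q. ball_kernel x q * dunkl_weight R k q)"
        using integrable_weight_continuous[OF c] by (simp add: mult.commute)
      thus ?thesis using integrable_sphere_weight by (simp add: integral_ball_kernel[OF x] sphere_mass_def[symmetric])
    qed
    finally have "\<bar>poisson_integral R k poisson f x - f z\<bar> \<le> (e / 2 * sphere_mass + 2 * M * (s * A) * sphere_mass) / sphere_mass"
      using m by (intro order_trans[OF poisson_integral_deviation[OF x]] divide_right_mono) auto
    also have "\<dots> = e / 2 + 2 * s * (M * A)" using m by (simp add: field_simps)
    also have "2 * s * (M * A) \<le> 2 * (2 * (e / (8 * (M * A + 1)))) * (M * A)"
      using s M0 A0 by (intro mult_right_mono mult_left_mono) (auto simp: \<delta>_def)
    also have "\<dots> = e / 2 * ((M * A) / (M * A + 1))" using MA by (simp add: field_simps)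
    also have "\<dots> < e / 2 * 1" using MA e by (intro mult_strict_left_mono) auto
    finally show ?thesis by simp
  qed
  thus ?thesis using \<delta> by blast
qed

lemma poisson_integral_continuous:
  assumes inv: "invariant_on (reflection_group R) (sphere 0 1) f"
  shows "continuous_on (cball 0 1) (\<lambda>x. if norm x < 1 then poisson_integral R k poisson f x else f x)"
    (is "continuous_on _ ?v")
  unfolding continuous_on_iff
proof (intro ballI allI impI)
  fix z :: 'a and e :: real assume z: "z \<in> cball 0 1" and e: "0 < e"
  show "\<exists>\<delta>>0. \<forall>x\<in>cball 0 1. dist x z < \<delta> \<longrightarrow> dist (?v x) (?v z) < e"
  proof (cases "norm z < 1")
    case True
    hence zb: "z \<in> ball 0 1" by simp
    have "poisson_integral R k poisson f differentiable at z" using poisson_integral_C2(1) zb unfolding C2_on_def by blast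
    hence "isCont (poisson_integral R k poisson f) z" by (rule differentiable_imp_continuous_within)
    then obtain \<delta> where \<delta>: "0 < \<delta>" "\<And>x. dist x z < \<delta> \<Longrightarrow> dist (poisson_integral R k poisson f x) (poisson_integral R k poisson f z) < e"
      using e unfolding continuous_at_eps_delta by (metis dist_commute)
    have "dist (?v x) (?v z) < e" if "dist x z < min \<delta> (1 - norm z)" for x
    proof -
      have "norm x \<le> norm z + dist x z" using norm_triangle_ineq[of z "x - z"] by (simp add: dist_norm)
      hence "norm x < 1" using that by simp
      thus ?thesis using \<delta>(2)[of x] that True by simp
    qed
    thus ?thesis using \<delta>(1) True by (intro exI[of _ "min \<delta> (1 - norm z)"]) auto
  next
    case False
    hence zs: "z \<in> sphere 0 1" using z by simp
    obtain \<delta> where \<delta>: "0 < \<delta>" "\<And>x. x \<in> ball 0 1 \<Longrightarrow> dist x z < \<delta> \<Longrightarrow> \<bar>poisson_integral R k poisson f x - f z\<bar> < e"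
      using poisson_integral_boundary[OF inv zs e] by blast
    obtain \<eta> where \<eta>: "0 < \<eta>" "\<And>q. q \<in> sphere 0 1 \<Longrightarrow> dist q z < \<eta> \<Longrightarrow> dist (f q) (f z) < e"
      using cf zs e unfolding continuous_on_iff by metis
    have "dist (?v x) (?v z) < e" if "x \<in> cball 0 1" "dist x z < min \<delta> \<eta>" for x
      using \<delta>(2)[of x] \<eta>(2)[of x] that False by (cases "norm x < 1") (auto simp: dist_real_def)
    thus ?thesis using \<delta>(1) \<eta>(1) by (intro exI[of _ "min \<delta> \<eta>"]) auto
  qed
qed

end

lemma reflection_group_ball: "w \<in> reflection_group R \<Longrightarrow> x \<in> ball 0 1 \<Longrightarrow> w x \<in> ball 0 1"
  and reflection_group_sphere: "w \<in> reflection_group R \<Longrightarrow> x \<in> sphere 0 1 \<Longrightarrow> w x \<in> sphere 0 1"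
  using norm_reflection_group[of w x] by auto

lemma is_poisson_kernel_poisson: "is_poisson_kernel_W R k poisson"
  unfolding is_poisson_kernel_W_def Let_def
proof (intro conjI ballI allI impI)
  have "continuous_on (ball 0 1 \<times> sphere 0 1) (\<lambda>z. ball_kernel (fst z) (snd z) / sphere_mass)"
    using sphere_mass_pos by (intro continuous_intros ball_kernel_continuous(1)) auto
  thus "continuous_on (ball 0 1 \<times> sphere 0 1) (\<lambda>(x, y). poisson x y)"
    by (rule continuous_on_eq) (auto simp: poisson_def)
  have left: "poisson (w x) y = poisson x y" if "w \<in> reflection_group R" "x \<in> ball 0 1" "y \<in> sphere 0 1" for w x y
    using that reflection_group_ball[of w x] ball_kernel_reflection_left[of x y w] by (simp add: poisson_def)
  show "invariant_on (reflection_group R) (ball 0 1) (\<lambda>x. poisson x y)" if "y \<in> sphere 0 1" for y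
    using left that by (simp add: invariant_on_def)
  show "invariant_on (reflection_group R) (sphere 0 1) (poisson x)" if "x \<in> ball 0 1" for x
    using that reflection_group_sphere ball_kernel_reflection_right[of x] by (simp add: invariant_on_def poisson_def)
  fix f :: "'a \<Rightarrow> real"
  assume f: "continuous_on (sphere 0 1) f \<and> invariant_on (reflection_group R) (sphere 0 1) f"
  hence cf: "continuous_on (sphere 0 1) f" and inv: "invariant_on (reflection_group R) (sphere 0 1) f" by auto
  show "invariant_on (reflection_group R) (ball 0 1) (poisson_integral R k poisson f)"
    unfolding invariant_on_def poisson_integral_def
    using left by (intro ballI Bochner_Integration.integral_cong refl) simp
  show "C2_on (ball 0 1) (poisson_integral R k poisson f)" by (rule poisson_integral_C2(1)[OF cf])
  show "radial_dunkl_laplacian R k (poisson_integral R k poisson f) x = 0" if "x \<in> ball 0 1" for x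
    by (rule poisson_integral_C2(2)[OF cf that])
  show "continuous_on (cball 0 1) (\<lambda>x. if norm x < 1 then poisson_integral R k poisson f x else f x)"
    by (rule poisson_integral_continuous[OF cf inv])
qed

end

section \<open>Maximum principle and uniqueness of the Poisson kernel\<close>

text \<open>If the second derivative were positive, h' would be positive just to the right of 0, and
  the mean value theorem would give a larger value there.\<close>

lemma not_local_max_of_second_derivative_pos:
  fixes h h' :: "real \<Rightarrow> real"
  assumes r: "0 < r" and h: "\<And>t. \<bar>t\<bar> < r \<Longrightarrow> (h has_real_derivative h' t) (at t)"
    and h'': "(h' has_real_derivative l) (at 0)" and max: "\<And>t. \<bar>t\<bar> < r \<Longrightarrow> h t \<le> h 0"
  shows "h' 0 = 0" "l \<le> 0"
proof -
  show h'0: "h' 0 = 0"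
    by (rule DERIV_local_max[OF h[of 0] r]) (use r max in auto)
  show "l \<le> 0"
  proof (rule ccontr)
    assume "\<not> l \<le> 0"
    then obtain d where d: "0 < d" "\<And>s. 0 < s \<Longrightarrow> s < d \<Longrightarrow> h' 0 < h' (0 + s)"
      using DERIV_pos_inc_right[OF h''] by (auto simp: not_le)
    define t where "t = min d r / 2"
    have t: "0 < t" "t < d" "t < r" using d r by (auto simp: t_def)
    obtain z where z: "0 < z" "z < t" "h t - h 0 = (t - 0) * h' z"
      using MVT2[OF t(1), of h h'] h t by force
    have "0 < h' z" using d(2)[of z] z t h'0 by simp
    hence "0 < (t - 0) * h' z" using t by simp
    thus False using max[of t] z(3) t by simp
  qed
qed

lemma C2_on_line_derivative:
  assumes u: "C2_on S u" and x: "x + t *\<^sub>R v \<in> S"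
  shows "((\<lambda>t. u (x + t *\<^sub>R v)) has_real_derivative dir_deriv v u (x + t *\<^sub>R v)) (at t)"
    "((\<lambda>t. dir_deriv v u (x + t *\<^sub>R v)) has_real_derivative dir_deriv v (dir_deriv v u) (x + t *\<^sub>R v)) (at t)"
proof -
  have l: "((\<lambda>t. x + t *\<^sub>R v) has_derivative (\<lambda>h. h *\<^sub>R v)) (at t)" by (auto intro!: derivative_eq_intros)
  have D: "((\<lambda>t. f (x + t *\<^sub>R v)) has_real_derivative dir_deriv v f (x + t *\<^sub>R v)) (at t)"
    if "f differentiable at (x + t *\<^sub>R v)" for f :: "_ \<Rightarrow> real"
  proof -
    interpret f: linear "frechet_derivative f (at (x + t *\<^sub>R v))" using that by (rule linear_frechet_derivative)
    have "(f has_derivative frechet_derivative f (at (x + t *\<^sub>R v))) (at (x + t *\<^sub>R v))"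
      using that unfolding frechet_derivative_works[symmetric] .
    from has_derivative_compose[OF l this] show ?thesis
      unfolding has_field_derivative_def dir_deriv_def
      by (rule has_derivative_eq_rhs) (simp add: fun_eq_iff f.scale mult.commute)
  qed
  show "((\<lambda>t. u (x + t *\<^sub>R v)) has_real_derivative dir_deriv v u (x + t *\<^sub>R v)) (at t)"
    and "((\<lambda>t. dir_deriv v u (x + t *\<^sub>R v)) has_real_derivative dir_deriv v (dir_deriv v u) (x + t *\<^sub>R v)) (at t)"
    using u x unfolding C2_on_def by (blast intro: D)+
qed

context orth_roots
begin

text \<open>At an interior maximum of \<open>u\<^sub>1 - u\<^sub>2 + \<epsilon> |x|\<^sup>2\<close> the function \<open>\<Delta>\<^sup>W (u\<^sub>1 - u\<^sub>2)\<close> would be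
  at most \<open>- \<epsilon> \<Delta>\<^sup>W |x|\<^sup>2 = - \<epsilon> (2 d + 4 \<gamma>) < 0\<close>.\<close>

lemma radial_harmonic_le:
  assumes u: "C2_on (ball 0 1) u1" "C2_on (ball 0 1) u2"
    and harm: "\<And>x. x \<in> ball 0 1 \<Longrightarrow> radial_dunkl_laplacian R k u1 x = radial_dunkl_laplacian R k u2 x"
    and c: "continuous_on (cball 0 1) v1" "continuous_on (cball 0 1) v2"
    and v: "\<And>x. x \<in> ball 0 1 \<Longrightarrow> v1 x = u1 x" "\<And>x. x \<in> ball 0 1 \<Longrightarrow> v2 x = u2 x"
    and bd: "\<And>x. x \<in> sphere 0 1 \<Longrightarrow> v1 x = v2 x"
    and x: "x \<in> ball 0 1"
  shows "u1 x \<le> u2 x"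
proof (rule ccontr)
  assume "\<not> u1 x \<le> u2 x"
  \<comment> \<open>Half of the gap at x: the perturbed difference is at least 2 \<epsilon> at x but
    equals \<epsilon> on the sphere, so its maximum is interior.\<close>
  define \<epsilon> where "\<epsilon> = (u1 x - u2 x) / 2"
  have \<epsilon>: "0 < \<epsilon>" using \<open>\<not> u1 x \<le> u2 x\<close> by (simp add: \<epsilon>_def)
  define \<phi> where "\<phi> z = v1 z - v2 z + \<epsilon> * (z \<bullet> z)" for z
  have "continuous_on (cball 0 1) \<phi>" unfolding \<phi>_def by (intro continuous_intros c)
  then obtain z where z: "z \<in> cball 0 1" "\<And>p. p \<in> cball 0 1 \<Longrightarrow> \<phi> p \<le> \<phi> z"
    using continuous_attains_sup[of "cball (0::'a) 1" \<phi>] by auto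
  have "2 * \<epsilon> \<le> \<phi> x" using x v \<epsilon> by (simp add: \<phi>_def \<epsilon>_def)
  hence z2: "2 * \<epsilon> \<le> \<phi> z" using z(2)[of x] x by simp
  have zb: "z \<in> ball 0 1"
  proof (rule ccontr)
    assume "z \<notin> ball 0 1"
    hence "norm z = 1" using z(1) by simp
    hence "\<phi> z = \<epsilon>" using bd[of z] by (simp add: \<phi>_def dot_square_norm)
    thus False using z2 \<epsilon> by simp
  qed
  \<comment> \<open>First and second order conditions at the maximum along the line in direction e,
    used both for basis vectors and for roots.\<close>
  have dd: "dir_deriv e u1 z - dir_deriv e u2 z = - 2 * \<epsilon> * (e \<bullet> z)"
    "dir_deriv e (dir_deriv e u1) z - dir_deriv e (dir_deriv e u2) z \<le> - 2 * \<epsilon> * (e \<bullet> e)" for e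
  proof -
    define h where "h t = u1 (z + t *\<^sub>R e) - u2 (z + t *\<^sub>R e) + \<epsilon> * ((z + t *\<^sub>R e) \<bullet> (z + t *\<^sub>R e))" for t
    define h' where "h' t = dir_deriv e u1 (z + t *\<^sub>R e) - dir_deriv e u2 (z + t *\<^sub>R e) + \<epsilon> * (2 * (e \<bullet> z) + 2 * t * (e \<bullet> e))" for t
    \<comment> \<open>Keeps the segment inside the ball; the summand 1 in the denominator covers e =
      0.\<close>
    define r where "r = (1 - norm z) / (norm e + 1)"
    have e1: "0 < norm e + 1" by (intro add_nonneg_pos) auto
    have r: "0 < r" using zb e1 by (simp add: r_def)
    have ins: "z + t *\<^sub>R e \<in> ball 0 1" if "\<bar>t\<bar> < r" for t
    proof -
      have "norm (z + t *\<^sub>R e) \<le> norm z + \<bar>t\<bar> * norm e" using norm_triangle_ineq[of z "t *\<^sub>R e"] by simp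
      also have "\<bar>t\<bar> * norm e \<le> \<bar>t\<bar> * (norm e + 1)" by (intro mult_left_mono) auto
      also have "\<dots> < r * (norm e + 1)" using that e1 by (intro mult_strict_right_mono)
      also have "\<dots> = 1 - norm z" using e1 by (simp add: r_def)
      finally show ?thesis by simp
    qed
    have q: "((\<lambda>t. (z + t *\<^sub>R e) \<bullet> (z + t *\<^sub>R e)) has_real_derivative 2 * (e \<bullet> z) + 2 * t * (e \<bullet> e)) (at t)" for t
      unfolding inner_add_left inner_add_right inner_scaleR_left inner_scaleR_right
      by (auto intro!: derivative_eq_intros simp: inner_commute[of z e])
    have q2: "((\<lambda>t. 2 * (e \<bullet> z) + 2 * t * (e \<bullet> e)) has_real_derivative 2 * (e \<bullet> e)) (at t)" for t
      by (auto intro!: derivative_eq_intros)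
    have A: "(h has_real_derivative h' t) (at t)" if "\<bar>t\<bar> < r" for t
      unfolding h_def h'_def
      by (intro DERIV_add DERIV_diff C2_on_line_derivative(1)[OF u(1) ins[OF that]] C2_on_line_derivative(1)[OF u(2) ins[OF that]] DERIV_cmult q)
    have ins0: "z + 0 *\<^sub>R e \<in> ball 0 1" using zb by simp
    have B: "(h' has_real_derivative dir_deriv e (dir_deriv e u1) (z + 0 *\<^sub>R e) - dir_deriv e (dir_deriv e u2) (z + 0 *\<^sub>R e) + \<epsilon> * (2 * (e \<bullet> e))) (at 0)"
      unfolding h'_def
      by (intro DERIV_add DERIV_diff C2_on_line_derivative(2)[OF u(1) ins0] C2_on_line_derivative(2)[OF u(2) ins0] DERIV_cmult q2)
    have C: "h t \<le> h 0" if "\<bar>t\<bar> < r" for t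
      using z(2)[of "z + t *\<^sub>R e"] ins[OF that] zb by (simp add: \<phi>_def v h_def)
    note m = not_local_max_of_second_derivative_pos[OF r A B C]
    show "dir_deriv e u1 z - dir_deriv e u2 z = - 2 * \<epsilon> * (e \<bullet> z)"
      using m(1) by (simp add: h'_def)
    show "dir_deriv e (dir_deriv e u1) z - dir_deriv e (dir_deriv e u2) z \<le> - 2 * \<epsilon> * (e \<bullet> e)"
      using m(2) by simp
  qed
  have diff: "u1 differentiable at z" "u2 differentiable at z" using u zb unfolding C2_on_def by blast+
  have "laplacian u1 z - laplacian u2 z \<le> (\<Sum>e\<in>(Basis :: 'a set). - 2 * \<epsilon> * (e \<bullet> e))"
    unfolding laplacian_def sum_subtractf[symmetric] by (intro sum_mono dd(2))
  also have "\<dots> = - 2 * \<epsilon> * real DIM('a)" by simp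
  also have "\<dots> < 0" using \<epsilon> by simp
  finally have 1: "laplacian u1 z - laplacian u2 z < 0" .
  \<comment> \<open>On a root hyperplane the second order condition bounds the quotient, off it the
    first order condition gives its exact value.\<close>
  have "radial_quotient \<beta> u1 z - radial_quotient \<beta> u2 z \<le> - 2 * \<epsilon>" if b: "\<beta> \<in> R" for \<beta>
  proof (cases "\<beta> \<bullet> z = 0")
    case True
    have "0 < (norm \<beta>)\<^sup>2" using root_nonzero[OF b] by simp
    thus ?thesis using dd(2)[of \<beta>] True
      by (simp add: radial_quotient_def diff_divide_distrib[symmetric] pos_divide_le_eq power2_norm_eq_inner)
  next
    case False
    have "radial_quotient \<beta> u1 z - radial_quotient \<beta> u2 z = (dir_deriv \<beta> u1 z - dir_deriv \<beta> u2 z) / (\<beta> \<bullet> z)"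
      using False by (simp add: radial_quotient_def grad_inner[OF diff(1)] grad_inner[OF diff(2)] diff_divide_distrib)
    also have "\<dots> = - 2 * \<epsilon>" using False by (simp add: dd(1))
    finally show ?thesis by simp
  qed
  hence "radial_quotient \<beta> u1 z - radial_quotient \<beta> u2 z \<le> 0" if "\<beta> \<in> R" for \<beta>
    using that \<epsilon> by fastforce
  hence "k \<beta> * (radial_quotient \<beta> u1 z - radial_quotient \<beta> u2 z) \<le> 0" if "\<beta> \<in> R" for \<beta>
    using that k_nonneg by (intro mult_nonneg_nonpos) auto
  hence "(\<Sum>\<beta>\<in>R. k \<beta> * (radial_quotient \<beta> u1 z - radial_quotient \<beta> u2 z)) \<le> 0" by (intro sum_nonpos) auto
  hence "(\<Sum>\<beta>\<in>R. k \<beta> * radial_quotient \<beta> u1 z) - (\<Sum>\<beta>\<in>R. k \<beta> * radial_quotient \<beta> u2 z) \<le> 0"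
    by (simp add: right_diff_distrib sum_subtractf)
  thus False using 1 harm[OF zb] unfolding radial_dunkl_laplacian_def by linarith
qed

text \<open>The difference of the two kernels at fixed x is itself admissible boundary data f. Both
  kernels solve the same boundary problem for it, so their integrals at x agree by the maximum
  principle, and subtraction shows that the weighted integral of f^2 is 0.\<close>

lemma poisson_kernel_unique:
  assumes P: "is_poisson_kernel_W R k P" and Q: "is_poisson_kernel_W R k Q"
    and x: "x \<in> ball 0 1" and y: "y \<in> sphere 0 1"
  shows "P x y = Q x y"
proof -
  have sec: "continuous_on (sphere 0 1) (F x)" "invariant_on (reflection_group R) (sphere 0 1) (F x)"
    if F: "is_poisson_kernel_W R k F" for F
  proof -
    have "continuous_on (ball 0 1 \<times> sphere 0 1) (\<lambda>(x, y). F x y)" using F by (simp add: is_poisson_kernel_W_def)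
    moreover have "continuous_on (sphere 0 1) (\<lambda>q. (x, q))" by (intro continuous_intros)
    moreover have "(\<lambda>q. (x, q)) ` sphere 0 1 \<subseteq> ball 0 1 \<times> sphere 0 1" using x by auto
    ultimately have "continuous_on (sphere 0 1) (\<lambda>q. case (x, q) of (x, y) \<Rightarrow> F x y)" by (rule continuous_on_compose2)
    thus "continuous_on (sphere 0 1) (F x)" by simp
    show "invariant_on (reflection_group R) (sphere 0 1) (F x)" using F x unfolding is_poisson_kernel_W_def by blast
  qed
  define f where "f q = P x q - Q x q" for q
  have cf: "continuous_on (sphere 0 1) f" unfolding f_def by (intro continuous_intros sec P Q)
  have inv: "invariant_on (reflection_group R) (sphere 0 1) f"
    using sec(2)[OF P] sec(2)[OF Q] by (simp add: invariant_on_def f_def)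
  have sol: "C2_on (ball 0 1) (poisson_integral R k F f)"
    "\<And>z. z \<in> ball 0 1 \<Longrightarrow> radial_dunkl_laplacian R k (poisson_integral R k F f) z = 0"
    "continuous_on (cball 0 1) (\<lambda>x. if norm x < 1 then poisson_integral R k F f x else f x)"
    if "is_poisson_kernel_W R k F" for F
    using that cf inv unfolding is_poisson_kernel_W_def Let_def by blast+
  have le: "poisson_integral R k F f x \<le> poisson_integral R k G f x"
    if F: "is_poisson_kernel_W R k F" and G: "is_poisson_kernel_W R k G" for F G
    by (rule radial_harmonic_le[OF sol(1)[OF F] sol(1)[OF G] _ sol(3)[OF F] sol(3)[OF G] _ _ _ x])
       (simp_all add: sol(2)[OF F] sol(2)[OF G])
  have eq: "poisson_integral R k P f x = poisson_integral R k Q f x"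
    using le[OF P Q] le[OF Q P] by (rule antisym)
  have int: "integrable sphere_measure (\<lambda>q. F x q * f q * dunkl_weight R k q)" if "is_poisson_kernel_W R k F" for F
  proof -
    have "integrable sphere_measure (\<lambda>q. dunkl_weight R k q * (F x q * f q))"
      by (intro integrable_weight_continuous continuous_intros sec that cf)
    thus ?thesis by (simp add: mult_ac)
  qed
  have "(\<lambda>q. P x q * f q * dunkl_weight R k q - Q x q * f q * dunkl_weight R k q) = (\<lambda>q. (f q)\<^sup>2 * dunkl_weight R k q)"
    by (simp add: fun_eq_iff f_def power2_eq_square algebra_simps)
  hence "integrable sphere_measure (\<lambda>q. (f q)\<^sup>2 * dunkl_weight R k q)" "(LINT q|sphere_measure. (f q)\<^sup>2 * dunkl_weight R k q) = 0"
    using Bochner_Integration.integrable_diff[OF int[OF P] int[OF Q]] Bochner_Integration.integral_diff[OF int[OF P] int[OF Q]] eq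
    by (simp_all add: poisson_integral_def)
  hence "\<forall>q\<in>sphere 0 1. (f q)\<^sup>2 = 0"
    by (intro integral_sphere_weight_zero continuous_intros cf) auto
  thus ?thesis using y by (simp add: f_def)
qed

lemma poisson_kernel_W_eq: "poisson_kernel_W R k = poisson"
  unfolding poisson_kernel_W_def
proof (rule the_equality)
  show "is_poisson_kernel_W R k poisson \<and> (\<forall>x y. (x, y) \<notin> ball 0 1 \<times> sphere 0 1 \<longrightarrow> poisson x y = 0)"
    using is_poisson_kernel_poisson by (auto simp: poisson_def)
  fix P assume P: "is_poisson_kernel_W R k P \<and> (\<forall>x y. (x, y) \<notin> ball 0 1 \<times> sphere 0 1 \<longrightarrow> P x y = 0)"
  show "P = poisson"
  proof (intro ext)
    fix x y
    show "P x y = poisson x y"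
    proof (cases "x \<in> ball 0 1 \<and> y \<in> sphere 0 1")
      case True
      thus ?thesis using P is_poisson_kernel_poisson by (intro poisson_kernel_unique) auto
    next
      case False
      hence "(x, y) \<notin> ball 0 1 \<times> sphere 0 1" by blast
      thus ?thesis using P False unfolding poisson_def by metis
    qed
  qed
qed

section \<open>The two-sided estimate for the Poisson kernel\<close>

text \<open>Brings A into the form treated by \<open>GM_riesz_bounds\<close>, with D = |x - y| and
  the pairings as coefficients.\<close>

lemma pk_dist_rescale:
  assumes "norm y = 1"
  shows "pk_dist x (rescale R t y) = (norm (x - y))\<^sup>2 + 2 * (\<Sum>\<beta>\<in>R. (1 - t \<beta>) * pairing \<beta> x y)"
proof -
  have "(\<Sum>\<beta>\<in>R. (t \<beta> - 1) * pairing \<beta> y x) = - (\<Sum>\<beta>\<in>R. (1 - t \<beta>) * pairing \<beta> x y)"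
    unfolding sum_negf[symmetric] by (intro sum.cong) (auto simp: pairing_commute[of _ y x] algebra_simps)
  hence "x \<bullet> rescale R t y = x \<bullet> y - (\<Sum>\<beta>\<in>R. (1 - t \<beta>) * pairing \<beta> x y)"
    using rescale_inner[of t y x] by (simp add: inner_commute)
  moreover have "(norm (x - y))\<^sup>2 = 1 + x \<bullet> x - 2 * (x \<bullet> y)"
    using assms by (simp add: power2_norm_eq_inner inner_diff_left inner_diff_right inner_commute[of y x] dot_square_norm[of y])
  ultimately show ?thesis by (simp add: pk_dist_def)
qed

text \<open>The kernel is (1 - |x|^2)/\<open>sphere_mass\<close> times the mean bounded in
  \<open>GM_riesz_bounds\<close> at l = \<lambda>. A point of the open ball differs from a point of
  the sphere, so D > 0, and in the closed chamber all pairings are nonnegative.\<close>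

lemma poisson_kernel_two_sided:
  "\<exists>c C. 0 < c \<and> 0 < C \<and>
    (\<forall>x \<in> ball 0 1 \<inter> closure (pos_chamber R). \<forall>y \<in> sphere 0 1 \<inter> closure (pos_chamber R).
       c * ((1 - (norm x)\<^sup>2) /
         (norm (x - y) ^ DIM('a) * (\<Prod>\<beta>\<in>R. norm (x - reflection \<beta> y) powr (2 * k \<beta>))))
         \<le> poisson_kernel_W R k x y \<and>
       poisson_kernel_W R k x y \<le>
       C * ((1 - (norm x)\<^sup>2) /
         (norm (x - y) ^ DIM('a) * (\<Prod>\<beta>\<in>R. norm (x - reflection \<beta> y) powr (2 * k \<beta>)))))"
proof -
  note m = sphere_mass_pos
  have l: "dunkl_gamma R k < lam" and lm: "2 * (lam - dunkl_gamma R k) = real DIM('a)" by (auto simp: lam_def)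
  obtain c C where cC: "0 < c" "0 < C" and b: "\<And>D s. 0 < D \<Longrightarrow> (\<forall>\<beta>\<in>R. 0 \<le> s \<beta>) \<Longrightarrow>
     c * comparison lam D s \<le> (LINT t|GM. (D\<^sup>2 + 2 * (\<Sum>\<beta>\<in>R. (1 - t \<beta>) * s \<beta>)) powr (- lam)) \<and>
     (LINT t|GM. (D\<^sup>2 + 2 * (\<Sum>\<beta>\<in>R. (1 - t \<beta>) * s \<beta>)) powr (- lam)) \<le> C * comparison lam D s"
    using GM_riesz_bounds[OF l] by blast
  show ?thesis
  proof (rule exI[of _ "c / sphere_mass"], rule exI[of _ "C / sphere_mass"], intro conjI ballI)
    show "0 < c / sphere_mass" "0 < C / sphere_mass" using cC m by auto
    fix x y assume x: "x \<in> ball 0 1 \<inter> closure (pos_chamber R)" and y: "y \<in> sphere 0 1 \<inter> closure (pos_chamber R)"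
    let ?P = "norm (x - y) ^ DIM('a) * (\<Prod>\<beta>\<in>R. norm (x - reflection \<beta> y) powr (2 * k \<beta>))"
    let ?I = "LINT t|GM. ((norm (x - y))\<^sup>2 + 2 * (\<Sum>\<beta>\<in>R. (1 - t \<beta>) * pairing \<beta> x y)) powr (- lam)"
    have s: "0 \<le> pairing \<beta> x y" if "\<beta> \<in> R" for \<beta> using closure_chamber_pairing_nonneg x y that by blast
    have ne: "x \<noteq> y" using x y by auto
    have cmp: "comparison lam (norm (x - y)) (\<lambda>\<beta>. pairing \<beta> x y) = 1 / ?P" by (rule comparison_eq[OF s ne lm])
    have n: "0 \<le> (1 - (norm x)\<^sup>2) / sphere_mass" using x m by (simp add: abs_square_le_1)
    have ny: "norm y = 1" using y by simp
    have "poisson_kernel_W R k x y = (1 - (norm x)\<^sup>2) / sphere_mass * ?I"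
      using x y by (simp add: poisson_kernel_W_eq poisson_def ball_kernel_def pk_fun_def pk_dist_rescale[OF ny] dot_square_norm)
    moreover have "(1 - (norm x)\<^sup>2) / sphere_mass * (c * (1 / ?P)) \<le> (1 - (norm x)\<^sup>2) / sphere_mass * ?I"
      "(1 - (norm x)\<^sup>2) / sphere_mass * ?I \<le> (1 - (norm x)\<^sup>2) / sphere_mass * (C * (1 / ?P))"
      using b[of "norm (x - y)" "\<lambda>\<beta>. pairing \<beta> x y"] s ne n unfolding cmp by (intro mult_left_mono; simp)+
    ultimately show "c / sphere_mass * ((1 - (norm x)\<^sup>2) / ?P) \<le> poisson_kernel_W R k x y"
      "poisson_kernel_W R k x y \<le> C / sphere_mass * ((1 - (norm x)\<^sup>2) / ?P)" by (simp_all add: mult_ac)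
  qed
qed

end

theorem theorem2p8:
  fixes J :: nat and \<alpha> :: "nat \<Rightarrow> 'a::euclidean_space"
    and \<Phi> \<Phi>p :: "'a set" and k :: "'a \<Rightarrow> real"
  assumes nonzero: "\<And>i. i \<in> {1..J} \<Longrightarrow> \<alpha> i \<noteq> 0"
    and orth: "\<And>i j. i \<in> {1..J} \<Longrightarrow> j \<in> {1..J} \<Longrightarrow> i \<noteq> j \<Longrightarrow> \<alpha> i \<bullet> \<alpha> j = 0"
    and pos_roots: "\<Phi>p = \<alpha> ` {1..J}"
    and roots: "\<Phi> = \<Phi>p \<union> uminus ` \<Phi>p"
    and k_nonneg: "\<And>\<beta>. \<beta> \<in> \<Phi> \<Longrightarrow> 0 \<le> k \<beta>"
    and k_inv: "\<And>w \<beta>. w \<in> reflection_group \<Phi> \<Longrightarrow> \<beta> \<in> \<Phi> \<Longrightarrow> k (w \<beta>) = k \<beta>"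
  shows "\<exists>C1 C2. 0 < C1 \<and> C1 \<le> C2 \<and>
    (\<forall>x \<in> ball 0 1 \<inter> closure (pos_chamber \<Phi>p). \<forall>y \<in> sphere 0 1 \<inter> closure (pos_chamber \<Phi>p).
       C1 * ((1 - (norm x)\<^sup>2) /
         (norm (x - y) ^ DIM('a) * (\<Prod>\<beta>\<in>\<Phi>p. norm (x - reflection \<beta> y) powr (2 * k \<beta>))))
         \<le> poisson_kernel_W \<Phi>p k x y \<and>
       poisson_kernel_W \<Phi>p k x y \<le>
       C2 * ((1 - (norm x)\<^sup>2) /
         (norm (x - y) ^ DIM('a) * (\<Prod>\<beta>\<in>\<Phi>p. norm (x - reflection \<beta> y) powr (2 * k \<beta>))))) \<and>
    (3 \<le> DIM('a) \<longrightarrow>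
      (\<forall>x \<in> closure (pos_chamber \<Phi>p). \<forall>y \<in> closure (pos_chamber \<Phi>p).
       ennreal C1 * (1 / ennreal
         (norm (x - y) ^ (DIM('a) - 2) * (\<Prod>\<beta>\<in>\<Phi>p. norm (x - reflection \<beta> y) powr (2 * k \<beta>))))
         \<le> newton_kernel_W \<Phi>p k x y \<and>
       newton_kernel_W \<Phi>p k x y \<le>
       ennreal C2 * (1 / ennreal
         (norm (x - y) ^ (DIM('a) - 2) * (\<Prod>\<beta>\<in>\<Phi>p. norm (x - reflection \<beta> y) powr (2 * k \<beta>))))))"
proof -
  interpret orth_roots \<Phi>p k
  proof
    show "finite \<Phi>p" by (simp add: pos_roots)
    show "\<beta> \<noteq> 0" if "\<beta> \<in> \<Phi>p" for \<beta> using nonzero that pos_roots by auto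
    show "\<beta> \<bullet> \<gamma> = 0" if "\<beta> \<in> \<Phi>p" "\<gamma> \<in> \<Phi>p" "\<beta> \<noteq> \<gamma>" for \<beta> \<gamma>
    proof -
      obtain i j where "i \<in> {1..J}" "j \<in> {1..J}" "\<beta> = \<alpha> i" "\<gamma> = \<alpha> j" using \<open>\<beta> \<in> \<Phi>p\<close> \<open>\<gamma> \<in> \<Phi>p\<close> pos_roots by auto
      thus ?thesis using orth[of i j] \<open>\<beta> \<noteq> \<gamma>\<close> by auto
    qed
    show "0 \<le> k \<beta>" if "\<beta> \<in> \<Phi>p" for \<beta> using k_nonneg that roots by blast
  qed
  let ?p = "\<lambda>x y. (1 - (norm x)\<^sup>2) / (norm (x - y) ^ DIM('a) * (\<Prod>\<beta>\<in>\<Phi>p. norm (x - reflection \<beta> y) powr (2 * k \<beta>)))"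
  let ?n = "\<lambda>x y. 1 / ennreal (norm (x - y) ^ (DIM('a) - 2) * (\<Prod>\<beta>\<in>\<Phi>p. norm (x - reflection \<beta> y) powr (2 * k \<beta>)))"
  let ?A = "ball 0 1 \<inter> closure (pos_chamber \<Phi>p)" and ?B = "sphere 0 1 \<inter> closure (pos_chamber \<Phi>p)" and ?C = "closure (pos_chamber \<Phi>p)"
  obtain c C where cC: "0 < c" "0 < C" and P: "\<And>x y. x \<in> ?A \<Longrightarrow> y \<in> ?B \<Longrightarrow>
      c * ?p x y \<le> poisson_kernel_W \<Phi>p k x y \<and> poisson_kernel_W \<Phi>p k x y \<le> C * ?p x y"
    using poisson_kernel_two_sided by blast
  obtain c' C' where cC': "0 < c'" "0 < C'" and N: "\<And>x y. 3 \<le> DIM('a) \<Longrightarrow> x \<in> ?C \<Longrightarrow> y \<in> ?C \<Longrightarrow>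
      ennreal c' * ?n x y \<le> newton_kernel_W \<Phi>p k x y \<and> newton_kernel_W \<Phi>p k x y \<le> ennreal C' * ?n x y"
  proof (cases "3 \<le> DIM('a)")
    case True
    show ?thesis using newton_kernel_two_sided[OF dunkl_const_pos True] that by blast
  \<comment> \<open>Below dimension three the estimate is vacuous and any positive constants
    serve.\<close>
  qed (use that[of 1 1] in auto)
  define C1 where "C1 = min c c'"
  \<comment> \<open>Including C1 in the maximum makes C1 \<le> C2 immediate.\<close>
  define C2 where "C2 = max (max C C') C1"
  have p: "0 \<le> ?p x y" if "x \<in> ?A" for x y
    using that by (intro divide_nonneg_nonneg mult_nonneg_nonneg prod_nonneg) (auto simp: abs_square_le_1)
  show ?thesis
  proof (rule exI[of _ C1], rule exI[of _ C2], intro conjI ballI impI)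
    show "0 < C1" "C1 \<le> C2" using cC cC' by (auto simp: C1_def C2_def)
    fix x y assume xy: "x \<in> ?A" "y \<in> ?B"
    have "C1 * ?p x y \<le> c * ?p x y" "C * ?p x y \<le> C2 * ?p x y"
      by (intro mult_right_mono p[OF xy(1)]; simp add: C1_def C2_def)+
    thus "C1 * ?p x y \<le> poisson_kernel_W \<Phi>p k x y" "poisson_kernel_W \<Phi>p k x y \<le> C2 * ?p x y"
      using P[OF xy] by linarith+
  next
    fix x y assume d: "3 \<le> DIM('a)" and xy: "x \<in> ?C" "y \<in> ?C"
    have "ennreal C1 * ?n x y \<le> ennreal c' * ?n x y" "ennreal C' * ?n x y \<le> ennreal C2 * ?n x y"
      by (intro mult_right_mono ennreal_leI; simp add: C1_def C2_def)+
    thus "ennreal C1 * ?n x y \<le> newton_kernel_W \<Phi>p k x y" "newton_kernel_W \<Phi>p k x y \<le> ennreal C2 * ?n x y"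
      using N[OF d xy] by (meson order_trans)+
  qed
qed

end
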